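(* Let $X$ be a simply connected, locally simply connected, locally path-connected metric space and $D$ a countable dense subset of $X$. Then $\pi_1(E(X,D))$ is isomorphic to a subgroup of the Hawaiian earring group $\pi_1(\mathbb{H},o)$. Moreover, if $X_1,X_2$ are two simply connected, locally simply connected, locally path-connected metric spaces with countable dense subsets $D_1\subseteq X_1$ and $D_2\subseteq X_2$, and $X_1$ and $X_2$ are not homeomorphic, then the groups $\pi_1(E(X_1,D_1))$ and $\pi_1(E(X_2,D_2))$ are not isomorphic.
   Context: Simply connected means path-connected with trivial fundamental group. Locally simply connected means: for every $y\in X$ and every neighborhood $U$ of $y$ there is a neighborhood $V\subseteq U$ of $y$ such that every loop in $V$ is null-homotopic in $U$. Earring space: let $(X,\rho_X)$ be a metric space and $D$ a countable subset, with a fixed enumeration without repetition $d_1,d_2,\dots$ of $D$. Let $\mathbb{S}^1$ be the circle with a metric $\rho_C$ of diameter less than $1$ and a chosen point $o\in\mathbb{S}^1$. For $x=d_n\in D$ put $\rho_x(u,v)=\rho_C(u,v)/n$ on $\mathbb{S}^1$; for $x\notin D$ put $\rho_x(o,o)=0$. $E(X,D)$ is the set $X\times\{o\}\cup D\times\mathbb{S}^1$ with the metric $\rho((x,u),(y,v))=\rho_x(u,v)$ if $x=y\in D$, and $\rho((x,u),(y,v))=\rho_X(x,y)+\rho_x(u,o)+\rho_y(v,o)$ otherwise. This space is path-connected when $X$ is, so the base point is irrelevant up to isomorphism. The Hawaiian earring is $\mathbb{H}=\bigcup_{n\ge1}\{(x,y)\in\mathbb{R}^2:(x+1/n)^2+y^2=1/n^2\}$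 with base point the origin $o=(0,0)$ of $\mathbb{R}^2$. *)

theory Defs
  imports "HOL-Analysis.Analysis" "HOL-Algebra.Group"
begin

section \<open>The fundamental group of an abstract topological space\<close>

text \<open>The library's path operations and \<^term>\<open>homotopic_paths\<close> live on types of class
  \<^class>\<open>topological_space\<close>. The space \<open>E(X,D)\<close> depends on the data \<open>X\<close>, \<open>D\<close> and so cannot be
  a type of that class; the notions below are the counterparts for \<^typ>\<open>'a topology\<close>.
  As usual, only the values of a path on \<open>[0,1]\<close> matter.\<close>

definition loops_at :: "'a topology \<Rightarrow> 'a \<Rightarrow> (real \<Rightarrow> 'a) set" where
  "loops_at T x = {p. pathin T p \<and> p 0 = x \<and> p 1 = x}"

definition loop_homotopy :: "'a topology \<Rightarrow> 'a \<Rightarrow> ((real \<Rightarrow> 'a) \<times> (real \<Rightarrow> 'a)) set" where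
  "loop_homotopy T x =
     {(p, q). homotopic_with (\<lambda>r. r 0 = x \<and> r 1 = x) (top_of_set {0..1}) T p q}"

definition path_concat :: "(real \<Rightarrow> 'a) \<Rightarrow> (real \<Rightarrow> 'a) \<Rightarrow> real \<Rightarrow> 'a" where
  "path_concat p q = (\<lambda>t. if t \<le> 1/2 then p (2 * t) else q (2 * t - 1))"

definition fundamental_group :: "'a topology \<Rightarrow> 'a \<Rightarrow> (real \<Rightarrow> 'a) set monoid" where
  "fundamental_group T x =
     \<lparr>carrier = loops_at T x // loop_homotopy T x,
      mult = (\<lambda>A B. \<Union>p\<in>A. \<Union>q\<in>B. loop_homotopy T x `` {path_concat p q}),
      one = loop_homotopy T x `` {\<lambda>_. x}\<rparr>"

lemma equiv_loop_homotopy: "equiv (loops_at T x) (loop_homotopy T x)"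
proof -
  define P where "P = (\<lambda>r::real \<Rightarrow> 'a. r 0 = x \<and> r 1 = x)"
  have R: "(p, q) \<in> loop_homotopy T x \<longleftrightarrow> homotopic_with P (top_of_set {0..1}) T p q" for p q
    by (simp add: loop_homotopy_def P_def)
  have L: "p \<in> loops_at T x \<longleftrightarrow> continuous_map (top_of_set {0..1}) T p \<and> P p" for p
    by (simp add: loops_at_def pathin_def P_def)
  show ?thesis
  proof (intro equivI)
    show "loop_homotopy T x \<subseteq> loops_at T x \<times> loops_at T x"
      by (clarsimp simp: R L)
        (metis homotopic_with_imp_continuous_maps homotopic_with_imp_property)
    show "refl_on (loops_at T x) (loop_homotopy T x)"
      by (simp add: refl_on_def R L)
    show "sym (loop_homotopy T x)"
      by (rule symI) (simp add: R homotopic_with_symD)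
    show "trans (loop_homotopy T x)"
      by (rule transI) (metis R homotopic_with_trans)
  qed
qed

definition simply_connected_space :: "'a topology \<Rightarrow> bool" where
  "simply_connected_space T \<longleftrightarrow>
     path_connected_space T \<and>
     (\<forall>x \<in> topspace T. carrier (fundamental_group T x) = {\<one>\<^bsub>fundamental_group T x\<^esub>})"

definition null_homotopic_loop :: "'a topology \<Rightarrow> (real \<Rightarrow> 'a) \<Rightarrow> bool" where
  "null_homotopic_loop T p \<longleftrightarrow> (p, \<lambda>_. p 0) \<in> loop_homotopy T (p 0)"

text \<open>A neighborhood of \<open>y\<close> is a set with \<open>y\<close> in its interior; it need not be open.\<close>

definition locally_simply_connected_space :: "'a topology \<Rightarrow> bool" where
  "locally_simply_connected_space T \<longleftrightarrow>
     (\<forall>y \<in> topspace T. \<forall>U \<subseteq> topspace T. y \<in> T interior_of U \<longrightarrow>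
        (\<exists>V \<subseteq> U. y \<in> T interior_of V \<and>
           (\<forall>p. pathin (subtopology T V) p \<and> p 0 = p 1 \<longrightarrow>
              null_homotopic_loop (subtopology T U) p)))"


section \<open>The space \<open>E(X,D)\<close>\<close>

definition circle_metric :: "complex metric \<Rightarrow> bool" where
  "circle_metric C \<longleftrightarrow>
     mspace C = sphere 0 1 \<and>
     mtopology_of C = top_of_set (sphere 0 1) \<and>
     (\<exists>r<1. \<forall>u \<in> mspace C. \<forall>v \<in> mspace C. mdist C u v \<le> r)"

text \<open>Enumerations start at \<open>1\<close>; a finite set is enumerated by an initial segment.\<close>

definition enum_domain :: "'a set \<Rightarrow> nat set" where
  "enum_domain D = (if finite D then {1..card D} else {1..})"

definition enumerates :: "(nat \<Rightarrow> 'a) \<Rightarrow> 'a set \<Rightarrow> bool" where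
  "enumerates d D \<longleftrightarrow> bij_betw d (enum_domain D) D"

definition fibre_dist ::
  "complex metric \<Rightarrow> 'a set \<Rightarrow> (nat \<Rightarrow> 'a) \<Rightarrow> 'a \<Rightarrow> complex \<Rightarrow> complex \<Rightarrow> real" where
  "fibre_dist C D d x u v =
     (if x \<in> D then mdist C u v / real (the_inv_into (enum_domain D) d x) else 0)"

definition earring_dist ::
  "complex metric \<Rightarrow> complex \<Rightarrow> 'a metric \<Rightarrow> 'a set \<Rightarrow> (nat \<Rightarrow> 'a) \<Rightarrow>
     'a \<times> complex \<Rightarrow> 'a \<times> complex \<Rightarrow> real" where
  "earring_dist C c X D d = (\<lambda>(x, u) (y, v).
     if x = y \<and> x \<in> D then fibre_dist C D d x u v
     else mdist X x y + fibre_dist C D d x u c + fibre_dist C D d y v c)"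

definition earring_metric ::
  "complex metric \<Rightarrow> complex \<Rightarrow> 'a metric \<Rightarrow> 'a set \<Rightarrow> (nat \<Rightarrow> 'a) \<Rightarrow> ('a \<times> complex) metric" where
  "earring_metric C c X D d =
     metric (mspace X \<times> {c} \<union> D \<times> mspace C, earring_dist C c X D d)"

abbreviation earring_space ::
  "complex metric \<Rightarrow> complex \<Rightarrow> 'a metric \<Rightarrow> 'a set \<Rightarrow> (nat \<Rightarrow> 'a) \<Rightarrow> ('a \<times> complex) topology" where
  "earring_space C c X D d \<equiv> mtopology_of (earring_metric C c X D d)"

text \<open>The constructor \<^term>\<open>metric\<close> is only meaningful on genuine metric spaces.\<close>

lemma Metric_space_earring:
  assumes c: "c \<in> mspace C" and D: "D \<subseteq> mspace X" and d: "enumerates d D"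
  shows "Metric_space (mspace X \<times> {c} \<union> D \<times> mspace C) (earring_dist C c X D d)"
proof -
  interpret X: Metric_space "mspace X" "mdist X" by simp
  interpret C: Metric_space "mspace C" "mdist C" by simp
  let ?n = "\<lambda>x. real (the_inv_into (enum_domain D) d x)"
  let ?f = "fibre_dist C D d"
  have pos: "?n x > 0" if "x \<in> D" for x
  proof -
    have "the_inv_into (enum_domain D) d x \<in> enum_domain D"
      using d that the_inv_into_into unfolding enumerates_def bij_betw_def by fastforce
    then show ?thesis by (auto simp: enum_domain_def split: if_splits)
  qed
  have f0: "?f x u v \<ge> 0" for x u v
    by (simp add: fibre_dist_def)
  have fcom: "?f x u v = ?f x v u" for x u v
    by (simp add: fibre_dist_def C.commute)
  have fz: "?f x u v = 0 \<longleftrightarrow> u = v" if "x \<in> D" "u \<in> mspace C" "v \<in> mspace C" for x u v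
    using that pos[of x] by (simp add: fibre_dist_def)
  have ftri: "?f x u w \<le> ?f x u v + ?f x v w"
    if "u \<in> mspace C" "v \<in> mspace C" "w \<in> mspace C" for x u v w
    using C.triangle[OF that] pos[of x]
    by (simp add: fibre_dist_def divide_right_mono flip: add_divide_distrib)
  show ?thesis
  proof
    show "0 \<le> earring_dist C c X D d p q" for p q
      by (auto simp: earring_dist_def f0 split: prod.splits)
    show "earring_dist C c X D d p q = earring_dist C c X D d q p" for p q
      by (auto simp: earring_dist_def X.commute fcom split: prod.splits)
  next
    fix p q
    assume p: "p \<in> mspace X \<times> {c} \<union> D \<times> mspace C" and q: "q \<in> mspace X \<times> {c} \<union> D \<times> mspace C"
    obtain x u y v where e: "p = (x, u)" "q = (y, v)" by (metis prod.exhaust)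
    have m: "x \<in> mspace X" "y \<in> mspace X" "u \<in> mspace C" "v \<in> mspace C"
      using p q c D e by auto
    have cc: "x \<notin> D \<Longrightarrow> u = c" "y \<notin> D \<Longrightarrow> v = c" using p q e by auto
    show "earring_dist C c X D d p q = 0 \<longleftrightarrow> p = q"
    proof (cases "x = y")
      case True
      then show ?thesis
        using m cc fz[of x u v] X.zero[of x x] e by (auto simp: earring_dist_def fibre_dist_def)
    next
      case False
      then have "mdist X x y > 0" using m X.mdist_pos_less by auto
      then have "earring_dist C c X D d p q > 0"
        using False f0[of x u c] f0[of y v c] e by (simp add: earring_dist_def)
      then show ?thesis using False e by auto
    qed
  next
    fix p q r
    assume p: "p \<in> mspace X \<times> {c} \<union> D \<times> mspace C" and q: "q \<in> mspace X \<times> {c} \<union> D \<times> mspace C"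
      and r: "r \<in> mspace X \<times> {c} \<union> D \<times> mspace C"
    obtain x u y v z w where e: "p = (x, u)" "q = (y, v)" "r = (z, w)" by (metis prod.exhaust)
    have m: "x \<in> mspace X" "y \<in> mspace X" "z \<in> mspace X"
        "u \<in> mspace C" "v \<in> mspace C" "w \<in> mspace C"
      using p q r c D e by auto
    have h1: "mdist X x z \<le> mdist X x y + mdist X y z" "mdist X x x = 0" "mdist X y y = 0"
      using X.triangle m by auto
    have h2: "?f x u w \<le> ?f x u c + ?f x w c" "?f x u v \<le> ?f x u c + ?f x v c"
        "?f x u c \<le> ?f x u v + ?f x v c" "?f x u w \<le> ?f x u v + ?f x v w"
        "?f y w c \<le> ?f y v w + ?f y v c"
      using ftri[of u c w x] ftri[of u c v x] ftri[of u v c x] ftri[of u v w x] ftri[of w v c y]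
        c m by (simp_all add: fcom)
    have h3: "mdist X x y \<ge> 0" "mdist X y z \<ge> 0" "?f y v c \<ge> 0" "?f x u c \<ge> 0"
        "?f z w c \<ge> 0"
      by (simp_all add: f0)
    show "earring_dist C c X D d p r
        \<le> earring_dist C c X D d p q + earring_dist C c X D d q r"
    proof (cases "x = y \<and> x \<in> D")
      case True
      then show ?thesis using h1 h2 h3 unfolding e earring_dist_def by auto
    next
      case xy: False
      show ?thesis
      proof (cases "y = z \<and> y \<in> D")
        case True
        then show ?thesis using xy h1 h2 h3 unfolding e earring_dist_def by auto
      next
        case yz: False
        have "earring_dist C c X D d p r \<le> mdist X x z + ?f x u c + ?f z w c"
          using h1(1) h2(1) h3 X.nonneg[of x z] unfolding e earring_dist_def prod.case
          by (smt (verit))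
        then show ?thesis using xy yz h1 h3 unfolding e earring_dist_def prod.case by argo
      qed
    qed
  qed
qed


section \<open>The Hawaiian earring\<close>

definition hawaiian_earring :: "(real \<times> real) set" where
  "hawaiian_earring = (\<Union>n\<in>{1::nat..}. {(x, y). (x + 1 / real n)\<^sup>2 + y\<^sup>2 = (1 / real n)\<^sup>2})"

text \<open>The standing hypotheses on a pair \<open>(X, D)\<close>, with a choice \<open>d\<close> of enumeration of \<open>D\<close>.\<close>

definition earring_data :: "'a metric \<Rightarrow> 'a set \<Rightarrow> (nat \<Rightarrow> 'a) \<Rightarrow> bool" where
  "earring_data X D d \<longleftrightarrow>
     simply_connected_space (mtopology_of X) \<and>
     locally_simply_connected_space (mtopology_of X) \<and>
     locally_path_connected_space (mtopology_of X) \<and>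
     D \<subseteq> mspace X \<and> countable D \<and> mtopology_of X closure_of D = mspace X \<and>
     enumerates d D"

end

theory Submission
  imports Defs "HOL-Library.Sublist" "HOL-Algebra.Coset" "HOL-Real_Asymp.Real_Asymp"
begin

text \<open>For a finite set \<open>S\<close> of points of \<open>D\<close>, a loop in \<open>E(X,D)\<close> spells an element of the free group on
  \<open>S\<close>, one letter for each passage through a circle. If all these words are trivial, the loop is null
  homotopic: compactness yields a noncrossing matching of its letters, the chords of the matching
  form a lamination of the square, and the gaps, whose boundaries project to loops in \<open>X\<close>,
  are filled in \<open>X\<close>, by small discs where the loops are small. Collapsing \<open>X\<close> to a
  point preserves the words, so it embeds the fundamental group into that of the Hawaiian earring.

  To recover \<open>X\<close>, consider the sequences of loop classes that shrink to a point \<open>x\<close> of \<open>X\<^sub>1\<close>. Their infinite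
  products exist, so by Higman's argument (exponents growing faster than word lengths) and by
  counting alternations of letters, an isomorphism sends them to sequences that, up to conjugation, concentrate at a
  single point of \<open>X\<^sub>2\<close>. The resulting map \<open>X\<^sub>1 \<rightarrow> X\<^sub>2\<close> is continuous, and the inverse isomorphism gives its inverse.\<close>

text \<open>Classes with infinitely many letters are compared only through their words in the free
  groups on finite sets of circles, which are linked by the retractions deleting letters. The
  lamination can have infinitely many gaps, and continuity of the filling is the difficulty: simple
  connectedness fills each gap, local simple connectedness makes a filling shrink with its boundary,
  and choosing every filling nearly as small as possible lets one choice do both. An isomorphism, on
  the other hand, transports only algebra. The image of a null sequence at x is not known to consist
  of small loops at y; it is only known that its words off a small punctured ball about y are
  eventually trivial. The centre is left out because the circle over it may be large. That the two
  limit maps are mutually inverse therefore rests on a separate fact: a homomorphism that kills all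
  conjugates of small loops at y kills every class that is inactive off a small punctured ball at y.
  A one-point space has no null sequences of nontrivial classes; it is recognised by commutativity
  of its group.\<close>

notation path_concat (infixr "@@" 65)

abbreviation (input) "pi1 \<equiv> fundamental_group"

abbreviation (input) "cont_on S \<equiv> continuous_map (top_of_set S)"

section \<open>Path homotopy\<close>

lemma continuous_map_compose_eu:
 assumes "cont_on S T f" "continuous_on S' g" "g ` S' \<subseteq> S"
 shows "cont_on S' T (\<lambda>x. f (g x))"
proof -
 have "cont_on S' (top_of_set S) g"
  using assms(2,3) by (simp add: continuous_map_in_subtopology image_subset_iff Pi_iff)
 thus ?thesis
  using continuous_map_compose[OF _ assms(1), of "top_of_set S'" g] by (simp add: o_def)
qed

lemma segment_in:
 assumes "u \<in> {0..1}" "s <= (t::real)" shows "s + u * (t - s) \<in> {s..t}"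
proof -
 have "0 <= u * (t - s)" "u * (t - s) <= t - s" using assms by (auto intro!: mult_left_le_one_le)
 thus ?thesis unfolding atLeastAtMost_iff by linarith
qed

definition path_hom :: "'a topology => 'a => 'a => (real => 'a) => (real => 'a) => bool" where
 "path_hom T x y p q \<longleftrightarrow> homotopic_with (\<lambda>r. r 0 = x & r 1 = y) (top_of_set {0..1}) T p q"

definition joins :: "'a topology => 'a => 'a => (real => 'a) => bool" where
 "joins T x y p \<longleftrightarrow> pathin T p & p 0 = x & p 1 = y"

definition rev_path :: "(real => 'a) => real => 'a" where
 "rev_path p = (\<lambda>t. p (1 - t))"

lemma path_hom_iff:
 "path_hom T x y p q \<longleftrightarrow>
  (\<exists>h. cont_on ({0..1::real} \<times> {0..1::real}) T h &
   (\<forall>t\<in>{0..1}. h (0, t) = p t & h (1, t) = q t & h (t, 0) = x & h (t, 1) = y))"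
 unfolding path_hom_def
 by (subst homotopic_with) (auto simp: prod_topology_subtopology_eu)

lemma path_homI:
 assumes "cont_on ({0..1::real} \<times> {0..1::real}) T h"
  "\<And>t. 0 <= t ==> t <= 1 ==> h (0, t) = p t" "\<And>t. 0 <= t ==> t <= 1 ==> h (1, t) = q t"
  "\<And>t. 0 <= t ==> t <= 1 ==> h (t, 0) = x" "\<And>t. 0 <= t ==> t <= 1 ==> h (t, 1) = y"
 shows "path_hom T x y p q"
 unfolding path_hom_iff by (intro exI[of _ h] conjI ballI assms) simp_all

lemma path_hom_refl: "joins T x y p ==> path_hom T x y p p"
 by (simp add: path_hom_def joins_def pathin_def)

lemma path_hom_sym: "path_hom T x y p q ==> path_hom T x y q p"
 unfolding path_hom_def by (rule homotopic_with_symD)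

lemma path_hom_trans [trans]: "path_hom T x y p q ==> path_hom T x y q r ==> path_hom T x y p r"
 unfolding path_hom_def by (rule homotopic_with_trans)

lemma path_hom_imp:
 assumes "path_hom T x y p q"
 shows "joins T x y p" "joins T x y q"
 using homotopic_with_imp_continuous_maps[OF assms[unfolded path_hom_def]]
  homotopic_with_imp_property[OF assms[unfolded path_hom_def]]
 by (auto simp: joins_def pathin_def)

lemma loop_homotopy_iff: "(p, q) \<in> loop_homotopy T x \<longleftrightarrow> path_hom T x x p q"
 by (simp add: loop_homotopy_def path_hom_def)

lemma loops_at_iff: "p \<in> loops_at T x \<longleftrightarrow> joins T x x p"
 by (simp add: loops_at_def joins_def)

lemma joins_in: "joins T x y p ==> x \<in> topspace T & y \<in> topspace T"
 unfolding joins_def pathin_def using continuous_map_image_subset_topspace by fastforce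

lemma joins_topspace:
 "joins T x y p ==> 0 <= t ==> t <= 1 ==> p t \<in> topspace T"
 unfolding joins_def pathin_def using continuous_map_image_subset_topspace by fastforce

lemma joins_const: "x \<in> topspace T ==> joins T x x (\<lambda>_. x)"
 by (simp add: joins_def pathin_def)

lemma joins_compose:
 assumes "joins T x y p" "continuous_on S g" "g ` S \<subseteq> {0..1}"
 shows "cont_on S T (\<lambda>t. p (g t))"
 using assms(1) continuous_map_compose_eu[OF _ assms(2,3), of T p] by (simp add: joins_def pathin_def)

lemma joins_rev:
 assumes "joins T x y p" shows "joins T y x (rev_path p)"
proof -
 have "cont_on {0..1} T (\<lambda>t. p (1 - t))"
  by (rule joins_compose[OF assms]) (auto intro!: continuous_intros)
 thus ?thesis
  using assms by (simp add: joins_def pathin_def rev_path_def)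
qed

lemma joins_concat:
 assumes "joins T x y p" "joins T y z q"
 shows "joins T x z (p @@ q)"
proof -
 have "cont_on {0..1} T (\<lambda>t. if t <= 1/2 then p (2 * t) else q (2 * t - 1))"
 proof (rule continuous_map_cases_le[where p="\<lambda>t. t" and q="\<lambda>t. 1/2"])
  show "continuous_map (subtopology (top_of_set {0..1}) {x \<in> topspace (top_of_set {0..1}). x <= (1/2::real)}) T (\<lambda>t. p (2*t))"
   unfolding subtopology_subtopology
   by (rule joins_compose[OF assms(1)]) (auto intro!: continuous_intros)
  show "continuous_map (subtopology (top_of_set {0..1}) {x \<in> topspace (top_of_set {0..1}). (1/2::real) <= x}) T (\<lambda>t. q (2*t-1))"
   unfolding subtopology_subtopology
   by (rule joins_compose[OF assms(2)]) (auto intro!: continuous_intros)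
  show "p (2 * t) = q (2 * t - 1)" if "t = 1/2" for t
   unfolding that using assms by (simp add: joins_def)
 qed auto
 thus ?thesis
  using assms by (simp add: joins_def pathin_def path_concat_def)
qed

text \<open>The unit interval is convex, so the straight-line homotopy between the two
  parametrisations stays inside it and can be composed with \<open>p\<close>. The group laws reduce
  to this.\<close>

lemma path_hom_reparam:
 assumes "joins T x y p" "continuous_on {0..1} \<phi>" "continuous_on {0..1} \<psi>"
  "\<phi> ` {0..1} \<subseteq> {0..1}" "\<psi> ` {0..1} \<subseteq> {0..1}" "\<phi> 0 = \<psi> 0" "\<phi> 1 = \<psi> 1"
 shows "path_hom T (p (\<phi> 0)) (p (\<phi> 1)) (\<lambda>t. p (\<phi> t)) (\<lambda>t. p (\<psi> t))"
proof (rule path_homI[where h="\<lambda>z. p ((1 - fst z) * \<phi> (snd z) + fst z * \<psi> (snd z))"])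
 have "continuous_on ({0..1} \<times> {0..1}) (\<lambda>z. (1 - fst z) * \<phi> (snd z) + fst z * \<psi> (snd z))"
  using assms by (intro continuous_intros continuous_on_compose2[OF assms(2)] continuous_on_compose2[OF assms(3)]) auto
 moreover have "(1 - s) * \<phi> t + s * \<psi> t \<in> {0..1}" if "s \<in> {0..1}" "t \<in> {0..1}" for s t
 proof -
  have "\<phi> t \<in> {0..1}" "\<psi> t \<in> {0..1}"
   using assms(4,5) that(2) by (meson image_subset_iff)+
  thus ?thesis
   using convexD_alt[OF convex_real_interval(5)[of 0 1], of "\<phi> t" "\<psi> t" s] that(1) by simp
 qed
 ultimately show "cont_on ({0..1} \<times> {0..1}) T (\<lambda>z. p ((1 - fst z) * \<phi> (snd z) + fst z * \<psi> (snd z)))"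
  by (intro joins_compose[OF assms(1)]) auto
qed (use assms in \<open>auto simp: algebra_simps\<close>)

text \<open>Paths are functions on all reals, while formulas for concatenated and reversed paths
  agree only on the unit interval; this passes from equality there to homotopy.\<close>

lemma path_hom_cong:
 assumes "joins T x y p" "\<And>t. 0 <= t ==> t <= 1 ==> p t = q t"
 shows "path_hom T x y p q"
proof -
 have "p 0 = x" "p 1 = y" "q 0 = x" "q 1 = y"
  using assms(1) assms(2)[of 0] assms(2)[of 1] by (auto simp: joins_def)
 thus ?thesis
  using assms unfolding path_hom_def joins_def pathin_def
  by (intro homotopic_with_equal) auto
qed

lemma path_hom_concat:
 assumes "path_hom T x y p p'" "path_hom T y z q q'"
 shows "path_hom T x z (p @@ q) (p' @@ q')"
proof -
 obtain h where h: "cont_on ({0..1::real} \<times> {0..1::real}) T h"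
   "\<forall>t\<in>{0..1}. h (0, t) = p t & h (1, t) = p' t & h (t, 0) = x & h (t, 1) = y"
  using assms(1) unfolding path_hom_iff by blast
 obtain k where k: "cont_on ({0..1::real} \<times> {0..1::real}) T k"
   "\<forall>t\<in>{0..1}. k (0, t) = q t & k (1, t) = q' t & k (t, 0) = y & k (t, 1) = z"
  using assms(2) unfolding path_hom_iff by blast
 have cont: "cont_on ({0..1} \<times> {0..1}) T
   (\<lambda>w. if snd w <= 1/2 then h (fst w, 2 * snd w) else k (fst w, 2 * snd w - 1))"
 proof (rule continuous_map_cases_le[where q="\<lambda>t. 1/2"])
  show "continuous_map (subtopology (top_of_set ({0..1} \<times> {0..1})) {x \<in> topspace (top_of_set ({0..1} \<times> {0..1})). snd x <= (1/2::real)}) T (\<lambda>w. h (fst w, 2 * snd w))"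
   unfolding subtopology_subtopology
   by (intro continuous_map_compose_eu[OF h(1)] continuous_intros) auto
  show "continuous_map (subtopology (top_of_set ({0..1} \<times> {0..1})) {x \<in> topspace (top_of_set ({0..1} \<times> {0..1})). (1/2::real) <= snd x}) T (\<lambda>w. k (fst w, 2 * snd w - 1))"
   unfolding subtopology_subtopology
   by (intro continuous_map_compose_eu[OF k(1)] continuous_intros) auto
  show "cont_on ({0..1} \<times> {0..1}) euclideanreal snd"
   by (auto intro!: continuous_intros)
  show "h (fst w, 2 * snd w) = k (fst w, 2 * snd w - 1)"
   if "w \<in> topspace (top_of_set ({0..1} \<times> {0..1}))" "snd w = 1/2" for w
  proof -
   have "2 * snd w = 1" using that by simp
   thus ?thesis using that(1) h(2) k(2) by auto
  qed
 qed auto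
 show ?thesis
 proof (rule path_homI[OF cont]; simp)
  fix t :: real assume t: "0 <= t" "t <= 1"
  have *: "2 * t \<in> {0..1}" if "t * 2 <= 1" using t that by simp
  have **: "2 * t - 1 \<in> {0..1}" if "\<not> t * 2 <= 1" using t that by simp
  show "(t * 2 <= 1 --> h (0, 2 * t) = (p @@ q) t) & (\<not> t * 2 <= 1 --> k (0, 2 * t - 1) = (p @@ q) t)"
   using bspec[OF h(2) *] bspec[OF k(2) **] by (simp add: path_concat_def)
  show "(t * 2 <= 1 --> h (1, 2 * t) = (p' @@ q') t) & (\<not> t * 2 <= 1 --> k (1, 2 * t - 1) = (p' @@ q') t)"
   using bspec[OF h(2) *] bspec[OF k(2) **] by (simp add: path_concat_def)
  show "h (t, 0) = x" "k (t, 1) = z"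
   using t bspec[OF h(2), of t] bspec[OF k(2), of t] by simp_all
 qed
qed

lemma path_hom_rev:
 assumes "path_hom T x y p q" shows "path_hom T y x (rev_path p) (rev_path q)"
proof -
 obtain h where h: "cont_on ({0..1::real} \<times> {0..1::real}) T h"
   "\<forall>t\<in>{0..1}. h (0, t) = p t & h (1, t) = q t & h (t, 0) = x & h (t, 1) = y"
  using assms(1) unfolding path_hom_iff by blast
 have cont: "cont_on ({0..1} \<times> {0..1}) T (\<lambda>w. h (fst w, 1 - snd w))"
  by (intro continuous_map_compose_eu[OF h(1)] continuous_intros) auto
 show ?thesis
 proof (rule path_homI[OF cont])
  fix t :: real assume t: "0 <= t" "t <= 1"
  hence "1 - t \<in> {0..1}" "t \<in> {0..1}" by auto
  thus "h (fst (0::real, t), 1 - snd (0::real, t)) = rev_path p t" "h (fst (1::real, t), 1 - snd (1::real, t)) = rev_path q t"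
   "h (fst (t, 0::real), 1 - snd (t, 0::real)) = y" "h (fst (t, 1::real), 1 - snd (t, 1::real)) = x"
   using h(2) by (simp_all add: rev_path_def)
 qed
qed

text \<open>Each of the next four homotopies compares two reparametrisations of one path.\<close>

lemma path_hom_assoc:
 assumes "joins T x y p" "joins T y z q" "joins T z w r"
 shows "path_hom T x w ((p @@ q) @@ r) (p @@ (q @@ r))"
proof -
 let ?P = "((p @@ q) @@ r)"
 have P: "joins T x w ?P"
  using assms by (meson joins_concat)
 \<comment> \<open>The reparametrisation has slopes 1/2, 1, 2 on [0,1/2], [1/2,3/4], [3/4,1]. Being
   convex, it is the maximum of its three affine pieces, which makes its continuity
   immediate.\<close>
 let ?\<phi> = "\<lambda>t::real. max (t/2) (max (t - 1/4) (2 * t - 1))"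
 have "path_hom T (?P (?\<phi> 0)) (?P (?\<phi> 1)) (\<lambda>t. ?P (?\<phi> t)) (\<lambda>t. ?P t)"
  by (rule path_hom_reparam[OF P, where \<phi>="?\<phi>" and \<psi>="\<lambda>t. t"]) (auto intro!: continuous_intros simp: le_max_iff_disj)
 moreover have "?P (?\<phi> 0) = x" "?P (?\<phi> 1) = w"
  using assms by (auto simp: path_concat_def joins_def)
 moreover have "path_hom T x w (p @@ (q @@ r)) (\<lambda>t. ?P (?\<phi> t))"
 proof (rule path_hom_cong)
  show "joins T x w (p @@ (q @@ r))"
   using assms by (meson joins_concat)
  fix t :: real assume "0 <= t" "t <= 1"
  consider "t <= 1/2" | "1/2 < t" "t <= 3/4" | "3/4 < t" by linarith
  thus "(p @@ (q @@ r)) t = ?P (?\<phi> t)"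
  proof cases
   case 1
   hence "?\<phi> t = t/2" by (simp add: max_def)
   thus ?thesis using 1 by (simp add: path_concat_def)
  next
   case 2
   hence "?\<phi> t = t - 1/4" by (simp add: max_def)
   thus ?thesis using 2 by (simp add: path_concat_def algebra_simps)
  next
   case 3
   hence "?\<phi> t = 2 * t - 1" by (simp add: max_def)
   thus ?thesis using 3 by (simp add: path_concat_def algebra_simps)
  qed
 qed
 ultimately show ?thesis
  using path_hom_sym path_hom_trans by metis
qed

lemma path_hom_unit_right:
 assumes "joins T x y p"
 shows "path_hom T x y (p @@ (\<lambda>_. y)) p"
proof -
 have "path_hom T (p (min 1 (2*0))) (p (min 1 (2*1))) (\<lambda>t. p (min 1 (2*t))) (\<lambda>t. p t)"
  by (rule path_hom_reparam[OF assms, where \<phi>="\<lambda>t. min 1 (2*t)" and \<psi>="\<lambda>t. t"]) (auto intro!: continuous_intros)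
 hence "path_hom T x y (\<lambda>t. p (min 1 (2*t))) p"
  using assms by (simp add: joins_def)
 moreover have "path_hom T x y (p @@ (\<lambda>_. y)) (\<lambda>t. p (min 1 (2*t)))"
  using assms joins_in[OF assms]
  by (intro path_hom_cong joins_concat joins_const) (auto simp: path_concat_def joins_def)
 ultimately show ?thesis
  by (rule path_hom_trans[rotated])
qed

lemma path_hom_unit_left:
 assumes "joins T x y p"
 shows "path_hom T x y ((\<lambda>_. x) @@ p) p"
proof -
 have "path_hom T (p (max 0 (2*0-1))) (p (max 0 (2*1-1))) (\<lambda>t. p (max 0 (2*t-1))) (\<lambda>t. p t)"
  by (rule path_hom_reparam[OF assms, where \<phi>="\<lambda>t. max 0 (2*t-1)" and \<psi>="\<lambda>t. t"]) (auto intro!: continuous_intros)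
 hence "path_hom T x y (\<lambda>t. p (max 0 (2*t-1))) p"
  using assms by (simp add: joins_def)
 moreover have "path_hom T x y ((\<lambda>_. x) @@ p) (\<lambda>t. p (max 0 (2*t-1)))"
 proof (intro path_hom_cong joins_concat joins_const)
  show "((\<lambda>_. x) @@ p) t = p (max 0 (2*t-1))" if "0 <= t" "t <= 1" for t
   using assms by (cases "t <= 1/2") (auto simp: path_concat_def joins_def)
 qed (use assms joins_in[OF assms] in \<open>auto intro: joins_const\<close>)
 ultimately show ?thesis
  by (rule path_hom_trans[rotated])
qed

lemma path_hom_inv_right:
 assumes "joins T x y p"
 shows "path_hom T x x (p @@ rev_path p) (\<lambda>_. x)"
proof -
 have "path_hom T (p (1 - \<bar>2*0-1\<bar>)) (p (1 - \<bar>2*1-1\<bar>)) (\<lambda>t. p (1 - \<bar>2*t-1\<bar>)) (\<lambda>t. p 0)"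
  by (rule path_hom_reparam[OF assms, where \<phi>="\<lambda>t. 1 - \<bar>2*t-1\<bar>" and \<psi>="\<lambda>_. 0"]) (auto intro!: continuous_intros)
 hence "path_hom T x x (\<lambda>t. p (1 - \<bar>2*t-1\<bar>)) (\<lambda>t. x)"
  using assms by (simp add: joins_def)
 moreover have "path_hom T x x (p @@ rev_path p) (\<lambda>t. p (1 - \<bar>2*t-1\<bar>))"
 proof (intro path_hom_cong joins_concat joins_rev)
  show "(p @@ rev_path p) t = p (1 - \<bar>2*t-1\<bar>)" if "0 <= t" "t <= 1" for t
   by (cases "t <= 1/2") (auto simp: path_concat_def rev_path_def)
 qed (use assms in auto)
 ultimately show ?thesis
  by (rule path_hom_trans[rotated])
qed

lemma rev_rev_path [simp]: "rev_path (rev_path p) = p"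
 by (simp add: rev_path_def)

lemma path_hom_inv_left:
 assumes "joins T x y p"
 shows "path_hom T y y (rev_path p @@ p) (\<lambda>_. y)"
 using path_hom_inv_right[OF joins_rev[OF assms]] by simp

section \<open>The fundamental group\<close>

definition loop_class :: "'a topology => 'a => (real => 'a) => (real => 'a) set" where
 "loop_class T x p = loop_homotopy T x `` {p}"

lemma loop_class_eq_iff:
 assumes "joins T x x p" "joins T x x q"
 shows "loop_class T x p = loop_class T x q \<longleftrightarrow> path_hom T x x p q"
 using eq_equiv_class_iff[OF equiv_loop_homotopy, of p T x q] assms
 by (simp add: loop_class_def loops_at_iff loop_homotopy_iff)

lemma loop_class_eqI: "path_hom T x x p q ==> loop_class T x p = loop_class T x q"
 using loop_class_eq_iff path_hom_imp by metis

lemma loop_class_carrier: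
 "joins T x x p ==> loop_class T x p \<in> carrier (pi1 T x)"
 by (simp add: fundamental_group_def loop_class_def quotientI loops_at_iff)

lemma carrier_pi1E:
 assumes "g \<in> carrier (pi1 T x)"
 obtains p where "joins T x x p" "g = loop_class T x p"
 using assms by (auto simp: fundamental_group_def loop_class_def loops_at_iff elim!: quotientE)

lemma one_pi1: "\<one>\<^bsub>pi1 T x\<^esub> = loop_class T x (\<lambda>_. x)"
 by (simp add: fundamental_group_def loop_class_def)

lemma mult_loop_class:
 assumes "joins T x x p" "joins T x x q"
 shows "loop_class T x p \<otimes>\<^bsub>pi1 T x\<^esub> loop_class T x q = loop_class T x (p @@ q)"
proof -
 have "loop_class T x (p' @@ q') = loop_class T x (p @@ q)"
  if "p' \<in> loop_class T x p" "q' \<in> loop_class T x q" for p' q'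
  using that by (intro loop_class_eqI path_hom_concat[where y=x])
   (auto simp: loop_class_def loop_homotopy_iff path_hom_sym)
 moreover have "p \<in> loop_class T x p" "q \<in> loop_class T x q"
  using assms by (auto simp: loop_class_def loop_homotopy_iff path_hom_refl)
 ultimately have "(\<Union>p'\<in>loop_class T x p. \<Union>q'\<in>loop_class T x q. loop_class T x (p' @@ q'))
   = loop_class T x (p @@ q)"
  by blast
 thus ?thesis
  by (simp add: fundamental_group_def loop_class_def)
qed

lemma group_pi1:
 assumes "x \<in> topspace T"
 shows "group (pi1 T x)"
proof (rule groupI)
 let ?G = "pi1 T x"
 show "g \<otimes>\<^bsub>?G\<^esub> h \<in> carrier ?G" if "g \<in> carrier ?G" "h \<in> carrier ?G" for g h
  using that by (elim carrier_pi1E)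
   (auto simp: mult_loop_class intro!: loop_class_carrier joins_concat)
 show "\<one>\<^bsub>?G\<^esub> \<in> carrier ?G"
  unfolding one_pi1 by (intro loop_class_carrier joins_const assms)
 show "g \<otimes>\<^bsub>?G\<^esub> h \<otimes>\<^bsub>?G\<^esub> k = g \<otimes>\<^bsub>?G\<^esub> (h \<otimes>\<^bsub>?G\<^esub> k)"
  if "g \<in> carrier ?G" "h \<in> carrier ?G" "k \<in> carrier ?G" for g h k
  using that
 proof (elim carrier_pi1E)
  fix p q r assume *: "joins T x x p" "joins T x x q" "joins T x x r"
   and g: "g = loop_class T x p" "h = loop_class T x q" "k = loop_class T x r"
  have "joins T x x (p @@ q)" "joins T x x (q @@ r)"
   using * by (auto intro: joins_concat)
  thus ?thesis
   unfolding g using * by (simp add: mult_loop_class loop_class_eqI[OF path_hom_assoc[OF *]])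
 qed
 show "\<one>\<^bsub>?G\<^esub> \<otimes>\<^bsub>?G\<^esub> g = g" if "g \<in> carrier ?G" for g
  using that
 proof (elim carrier_pi1E)
  fix p assume *: "joins T x x p" "g = loop_class T x p"
  thus ?thesis
   unfolding one_pi1 using assms
   by (simp add: mult_loop_class joins_const loop_class_eqI[OF path_hom_unit_left])
 qed
 show "\<exists>h\<in>carrier ?G. h \<otimes>\<^bsub>?G\<^esub> g = \<one>\<^bsub>?G\<^esub>" if "g \<in> carrier ?G" for g
  using that
 proof (elim carrier_pi1E)
  fix p assume *: "joins T x x p" "g = loop_class T x p"
  hence "loop_class T x (rev_path p) \<otimes>\<^bsub>?G\<^esub> g = \<one>\<^bsub>?G\<^esub>"
   unfolding one_pi1
   by (simp add: mult_loop_class joins_rev loop_class_eqI[OF path_hom_inv_left])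
  thus ?thesis
   using loop_class_carrier[OF joins_rev[OF *(1)]] by blast
 qed
qed

lemma inv_loop_class:
 assumes "joins T x x p"
 shows "inv\<^bsub>pi1 T x\<^esub> (loop_class T x p) = loop_class T x (rev_path p)"
proof -
 interpret group "pi1 T x"
  using joins_in[OF assms] by (simp add: group_pi1)
 have "loop_class T x (rev_path p) \<otimes>\<^bsub>pi1 T x\<^esub> loop_class T x p = \<one>\<^bsub>pi1 T x\<^esub>"
  unfolding one_pi1
  using assms by (simp add: mult_loop_class joins_rev loop_class_eqI[OF path_hom_inv_left])
 thus ?thesis
  by (rule inv_equality) (intro loop_class_carrier joins_rev assms)+
qed

lemma joins_image:
 assumes "continuous_map T T' \<Phi>" "joins T x y p"
 shows "joins T' (\<Phi> x) (\<Phi> y) (\<lambda>t. \<Phi> (p t))"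
 using assms continuous_map_compose[of "top_of_set {0..1}" T p T' \<Phi>]
 by (auto simp: joins_def pathin_def o_def)

lemma path_hom_image:
 assumes "continuous_map T T' \<Phi>" "path_hom T x y p q"
 shows "path_hom T' (\<Phi> x) (\<Phi> y) (\<lambda>t. \<Phi> (p t)) (\<lambda>t. \<Phi> (q t))"
proof -
 obtain h where h: "cont_on ({0..1::real} \<times> {0..1::real}) T h"
   "\<forall>t\<in>{0..1}. h (0, t) = p t & h (1, t) = q t & h (t, 0) = x & h (t, 1) = y"
  using assms(2) unfolding path_hom_iff by blast
 have cont: "cont_on ({0..1} \<times> {0..1}) T' (\<lambda>z. \<Phi> (h z))"
  using continuous_map_compose[OF h(1) assms(1)] by (simp add: o_def)
 show ?thesis
  by (rule path_homI[OF cont]) (use h(2) in simp_all)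
qed

section \<open>Conjugation of loops by paths, induced homomorphisms and change of base point\<close>

definition conj_loop :: "(real => 'a) => (real => 'a) => real => 'a" where
 "conj_loop \<alpha> m = ((\<alpha> @@ m) @@ rev_path \<alpha>)"

lemma joins_conj_loop:
 "joins T x y \<alpha> ==> joins T y y m ==> joins T x x (conj_loop \<alpha> m)"
 unfolding conj_loop_def by (meson joins_concat joins_rev)

lemma path_hom_conj_loop:
 assumes "path_hom T x y \<alpha> \<beta>" "path_hom T y y m m'"
 shows "path_hom T x x (conj_loop \<alpha> m) (conj_loop \<beta> m')"
 unfolding conj_loop_def by (intro path_hom_concat[where y=y] path_hom_rev assms)

lemma path_concat_cancel_right:
 assumes "joins T x y p" "joins T z y q"
 shows "path_hom T x y ((p @@ rev_path q) @@ q) p"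
proof -
 have "path_hom T x y ((p @@ rev_path q) @@ q) (p @@ (rev_path q @@ q))"
  using assms by (meson path_hom_assoc joins_rev)
 also have "path_hom T x y \<dots> (p @@ (\<lambda>_. y))"
  by (intro path_hom_concat[where y=y] path_hom_refl path_hom_inv_left[where x=z] assms)
 also have "path_hom T x y \<dots> p"
  by (rule path_hom_unit_right[OF assms(1)])
 finally show ?thesis .
qed

lemma path_concat_cancel_middle:
 assumes "joins T x y p" "joins T z y q" "joins T y w r"
 shows "path_hom T x w ((p @@ rev_path q) @@ (q @@ r)) (p @@ r)"
proof -
 have "path_hom T x w ((p @@ rev_path q) @@ (q @@ r))
   (((p @@ rev_path q) @@ q) @@ r)"
  using assms by (meson path_hom_sym path_hom_assoc joins_concat joins_rev)
 also have "path_hom T x w \<dots> (p @@ r)"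
  using assms by (intro path_hom_concat[where y=y] path_concat_cancel_right path_hom_refl)
 finally show ?thesis .
qed

lemma conj_loop_mult:
 assumes "joins T x y \<alpha>" "joins T y y m" "joins T y y m'"
 shows "path_hom T x x (conj_loop \<alpha> m @@ conj_loop \<alpha> m') (conj_loop \<alpha> (m @@ m'))"
proof -
 note [intro] = joins_concat joins_rev
 have 1: "path_hom T x x (conj_loop \<alpha> m') (\<alpha> @@ (m' @@ rev_path \<alpha>))"
  unfolding conj_loop_def using assms by (intro path_hom_assoc joins_rev)
 have "path_hom T x x (conj_loop \<alpha> m @@ conj_loop \<alpha> m')
   (((\<alpha> @@ m) @@ rev_path \<alpha>) @@ (\<alpha> @@ (m' @@ rev_path \<alpha>)))"
  using assms by (subst (1) conj_loop_def) (intro path_hom_concat[where y=x] path_hom_refl 1, blast)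
 also have "path_hom T x x \<dots> ((\<alpha> @@ m) @@ (m' @@ rev_path \<alpha>))"
  using assms by (intro path_concat_cancel_middle) blast+
 also have "path_hom T x x \<dots> (((\<alpha> @@ m) @@ m') @@ rev_path \<alpha>)"
  using assms by (intro path_hom_sym[OF path_hom_assoc]) blast+
 also have "path_hom T x x \<dots> ((\<alpha> @@ (m @@ m')) @@ rev_path \<alpha>)"
  using assms by (intro path_hom_concat[where y=y] path_hom_assoc[where y=y] path_hom_refl) blast+
 finally show ?thesis unfolding conj_loop_def .
qed

lemma rev_path_concat:
 assumes "joins T x y p" "joins T y z q"
 shows "path_hom T z x (rev_path (p @@ q)) (rev_path q @@ rev_path p)"
proof (rule path_hom_cong)
 show "rev_path (p @@ q) t = (rev_path q @@ rev_path p) t" if "0 <= t" "t <= 1" for t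
  using assms by (cases "t = 1/2") (auto simp: rev_path_def path_concat_def joins_def field_simps)
qed (use assms in \<open>meson joins_concat joins_rev\<close>)

lemma conj_loop_concat:
 assumes "joins T x y \<alpha>" "joins T y z \<beta>" "joins T z z m"
 shows "path_hom T x x (conj_loop (\<alpha> @@ \<beta>) m) (conj_loop \<alpha> (conj_loop \<beta> m))"
proof -
 note [intro] = joins_concat joins_rev
 have "path_hom T x x (conj_loop (\<alpha> @@ \<beta>) m)
   ((\<alpha> @@ (\<beta> @@ m)) @@ (rev_path \<beta> @@ rev_path \<alpha>))"
  unfolding conj_loop_def using assms
  by (intro path_hom_concat[where y=z] path_hom_assoc[where y=y] rev_path_concat[where y=y])
 also have "path_hom T x x \<dots> (((\<alpha> @@ (\<beta> @@ m)) @@ rev_path \<beta>) @@ rev_path \<alpha>)"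
  using assms by (intro path_hom_sym[OF path_hom_assoc]) blast+
 also have "path_hom T x x \<dots> ((\<alpha> @@ ((\<beta> @@ m) @@ rev_path \<beta>)) @@ rev_path \<alpha>)"
  using assms by (intro path_hom_concat[where y=y] path_hom_assoc path_hom_refl) blast+
 finally show ?thesis unfolding conj_loop_def .
qed

lemma conj_loop_inverse:
 assumes "joins T x y \<alpha>" "joins T x x m"
 shows "path_hom T x x (conj_loop \<alpha> (conj_loop (rev_path \<alpha>) m)) m"
proof -
 note [intro] = joins_concat joins_rev
 have x: "x \<in> topspace T" using joins_in assms by metis
 have "path_hom T x x (conj_loop \<alpha> (conj_loop (rev_path \<alpha>) m)) (conj_loop (\<alpha> @@ rev_path \<alpha>) m)"
  using assms by (intro path_hom_sym[OF conj_loop_concat]) blast+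
 also have "path_hom T x x \<dots> (conj_loop (\<lambda>_. x) m)"
  using assms by (intro path_hom_conj_loop[where y=x] path_hom_inv_right[where y=y] path_hom_refl) blast+
 also have "path_hom T x x \<dots> m"
 proof -
  have r: "rev_path (\<lambda>_. x) = (\<lambda>_. x)" by (simp add: rev_path_def)
  have "path_hom T x x (conj_loop (\<lambda>_. x) m) ((\<lambda>_. x) @@ m)"
   unfolding conj_loop_def r using assms joins_const[OF x]
   by (intro path_hom_unit_right joins_concat)
  thus ?thesis
   using path_hom_trans path_hom_unit_left assms(2) by metis
 qed
 finally show ?thesis .
qed

text \<open>Two paths with the same ends differ by the loop \<open>g\<close> at their start, so the
  choice of the path matters only up to conjugation. Conjugation invariant properties of classes,
  such as activity below, do not see it.\<close>

lemma conj_loop_class_conj: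
 assumes "joins T x y \<alpha>" "joins T x y \<beta>" "joins T y y m"
 defines "g \<equiv> loop_class T x (\<alpha> @@ rev_path \<beta>)"
 shows "loop_class T x (conj_loop \<alpha> m) =
  g \<otimes>\<^bsub>pi1 T x\<^esub> loop_class T x (conj_loop \<beta> m) \<otimes>\<^bsub>pi1 T x\<^esub> inv\<^bsub>pi1 T x\<^esub> g"
proof -
 note [intro] = joins_concat joins_rev joins_conj_loop
 let ?\<gamma> = "(\<alpha> @@ rev_path \<beta>)"
 have \<gamma>: "joins T x x ?\<gamma>" using assms by blast
 have "path_hom T x x (conj_loop ?\<gamma> (conj_loop \<beta> m)) (conj_loop (?\<gamma> @@ \<beta>) m)"
  using assms by (intro path_hom_sym[OF conj_loop_concat]) blast+
 also have "path_hom T x x \<dots> (conj_loop \<alpha> m)"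
  using assms by (intro path_hom_conj_loop path_concat_cancel_right path_hom_refl)
 finally have "loop_class T x (conj_loop \<alpha> m) = loop_class T x (conj_loop ?\<gamma> (conj_loop \<beta> m))"
  using loop_class_eqI by metis
 also have "\<dots> = g \<otimes>\<^bsub>pi1 T x\<^esub> loop_class T x (conj_loop \<beta> m) \<otimes>\<^bsub>pi1 T x\<^esub> inv\<^bsub>pi1 T x\<^esub> g"
  using \<gamma> joins_conj_loop[OF assms(2,3)] joins_rev[OF \<gamma>]
   joins_concat[OF \<gamma> joins_conj_loop[OF assms(2,3)]]
  by (simp add: g_def conj_loop_def[of ?\<gamma>] mult_loop_class inv_loop_class)
 finally show ?thesis .
qed

text \<open>Compatibility with concatenation is asked only up to homotopy, so that the lemma covers
  continuous maps, which respect it exactly, as well as conjugation by a path, which does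
  not.\<close>

lemma hom_loop_classes:
 assumes hom: "\<And>p q. path_hom T x x p q ==> path_hom T' y y (F p) (F q)"
  and mult: "\<And>p q. joins T x x p ==> joins T x x q ==>
   path_hom T' y y (F (p @@ q)) (F p @@ F q)"
 obtains h where "h \<in> hom (pi1 T x) (pi1 T' y)"
  "\<And>p. joins T x x p ==> h (loop_class T x p) = loop_class T' y (F p)"
proof -
 define h where "h g = loop_class T' y (F (SOME p. joins T x x p & g = loop_class T x p))" for g
 have eq: "h (loop_class T x p) = loop_class T' y (F p)" if p: "joins T x x p" for p
 proof -
  have "path_hom T x x (SOME q. joins T x x q & loop_class T x p = loop_class T x q) p"
   using someI[of "\<lambda>q. joins T x x q & loop_class T x p = loop_class T x q" p] p loop_class_eq_iff by metis
  thus ?thesis unfolding h_def by (intro loop_class_eqI hom)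
 qed
 have F: "joins T' y y (F p)" if "joins T x x p" for p
  using path_hom_imp[OF hom[OF path_hom_refl[OF that]]] by blast
 have "h \<in> hom (pi1 T x) (pi1 T' y)"
  by (rule homI) (auto elim!: carrier_pi1E
   simp: eq mult_loop_class joins_concat F loop_class_eqI[OF mult] intro!: loop_class_carrier)
 thus ?thesis using that eq by blast
qed

lemma hom_induced:
 assumes "continuous_map T T' \<Phi>"
 obtains h where "h \<in> hom (pi1 T x) (pi1 T' (\<Phi> x))"
  "\<And>p. joins T x x p ==> h (loop_class T x p) = loop_class T' (\<Phi> x) (\<lambda>t. \<Phi> (p t))"
proof (rule hom_loop_classes[of T x T' "\<Phi> x" "\<lambda>p t. \<Phi> (p t)"])
 have c: "(\<lambda>t. \<Phi> ((p @@ q) t)) = ((\<lambda>t. \<Phi> (p t)) @@ (\<lambda>t. \<Phi> (q t)))" for p q :: "real => 'a"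
  by (auto simp: path_concat_def)
 show "path_hom T' (\<Phi> x) (\<Phi> x) (\<lambda>t. \<Phi> ((p @@ q) t)) ((\<lambda>t. \<Phi> (p t)) @@ (\<lambda>t. \<Phi> (q t)))"
  if "joins T x x p" "joins T x x q" for p q
  unfolding c using that by (intro path_hom_refl joins_concat[where y="\<Phi> x"] joins_image[OF assms])
qed (use path_hom_image[OF assms] in blast)+

lemma iso_change_base:
 assumes \<alpha>: "joins T x y \<alpha>"
 obtains h where "h \<in> iso (pi1 T y) (pi1 T x)"
  "\<And>p. joins T y y p ==> h (loop_class T y p) = loop_class T x (conj_loop \<alpha> p)"
proof -
 have ex: "\<exists>h. h \<in> hom (pi1 T y) (pi1 T x) &
   (\<forall>p. joins T y y p --> h (loop_class T y p) = loop_class T x (conj_loop \<alpha> p))"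
  if "joins T x y \<alpha>" for x y \<alpha>
  by (rule hom_loop_classes[of T y T x "conj_loop \<alpha>"])
   (use path_hom_conj_loop[OF path_hom_refl[OF that]] path_hom_sym[OF conj_loop_mult[OF that]] in blast)+
 obtain h where h: "h \<in> hom (pi1 T y) (pi1 T x)"
   "\<And>p. joins T y y p ==> h (loop_class T y p) = loop_class T x (conj_loop \<alpha> p)"
  using ex[OF \<alpha>] by blast
 obtain k where k: "k \<in> hom (pi1 T x) (pi1 T y)"
   "\<And>p. joins T x x p ==> k (loop_class T x p) = loop_class T y (conj_loop (rev_path \<alpha>) p)"
  using ex[OF joins_rev[OF \<alpha>]] by blast
 \<comment> \<open>The inverse is conjugation by the reversed path.\<close>
 have "bij_betw h (carrier (pi1 T y)) (carrier (pi1 T x))"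
 proof (rule bij_betw_byWitness[where f'=k])
  show "\<forall>g\<in>carrier (pi1 T y). k (h g) = g" "\<forall>g\<in>carrier (pi1 T x). h (k g) = g"
   using joins_rev[OF \<alpha>] \<alpha> loop_class_eqI[OF conj_loop_inverse[OF \<alpha>]]
    loop_class_eqI[OF conj_loop_inverse[OF joins_rev[OF \<alpha>]]]
   by (auto elim!: carrier_pi1E simp: h k joins_conj_loop)
 qed (use h(1) k(1) in \<open>auto simp: hom_def\<close>)
 thus ?thesis using that[of h] h by (simp add: iso_def)
qed

section \<open>Free groups\<close>

fun linv :: "'a \<times> bool => 'a \<times> bool" where "linv (s, b) = (s, \<not> b)"

lemma linv_linv [simp]: "linv (linv x) = x" and fst_linv [simp]: "fst (linv x) = fst x"
 and linv_neq [simp]: "linv x ~= x" "x ~= linv x" and linv_eq_iff [simp]: "linv x = linv y \<longleftrightarrow> x = y"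
 by (cases x; cases y; auto)+

definition reduced :: "('a \<times> bool) list => bool" where
 "reduced w \<longleftrightarrow> successively (\<lambda>x y. y ~= linv x) w"

fun push :: "'a \<times> bool => ('a \<times> bool) list => ('a \<times> bool) list" where
 "push x [] = [x]"
| "push x (y # w) = (if y = linv x then w else x # y # w)"

definition red :: "('a \<times> bool) list => ('a \<times> bool) list" where
 "red w = foldr push w []"

lemma reduced_simps [simp]: "reduced []" "reduced [x]"
 "reduced (x # y # w) \<longleftrightarrow> y ~= linv x & reduced (y # w)"
 by (auto simp: reduced_def)

lemma reduced_ConsD: "reduced (x # w) ==> reduced w"
 by (cases w) auto

lemma reduced_append_iff:
 "reduced (u @ v) \<longleftrightarrow> reduced u & reduced v & (u = [] \<or> v = [] \<or> hd v ~= linv (last u))"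
 by (auto simp: reduced_def successively_append_iff)

lemma reduced_push: "reduced w ==> reduced (push x w)"
 by (cases w) (auto dest: reduced_ConsD)

lemma reduced_foldr_push: "reduced v ==> reduced (foldr push w v)"
 by (induction w) (auto intro: reduced_push)

lemma reduced_red: "reduced (red w)"
 by (simp add: red_def reduced_foldr_push)

lemma red_id: "reduced w ==> red w = w"
proof (induction w)
 case (Cons x w)
 hence "red w = w" using reduced_ConsD by blast
 thus ?case using Cons.prems by (cases w) (auto simp: red_def)
qed (simp add: red_def)

lemma push_push_linv: "reduced w ==> push x (push (linv x) w) = w"
 by (cases w rule: list.exhaust; cases "tl w") auto

text \<open>By \<open>push_push_linv\<close>, pushing a letter permutes the reduced words and
  pushing its inverse undoes this, so the free group acts on reduced words, and a word acts like its
  reduction. This is van der Waerden's argument; it gives associativity without a confluence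
  proof.\<close>

lemma foldr_push_red: "reduced v ==> foldr push (red w) v = foldr push w v"
proof (induction w)
 case (Cons x w)
 show ?case
 proof (cases "\<exists>ys. red w = linv x # ys")
  case True
  then obtain ys where ys: "red w = linv x # ys" by blast
  hence "foldr push w v = push (linv x) (foldr push ys v)"
   using Cons by (metis foldr.simps(2) o_apply)
  thus ?thesis
   using ys Cons.prems push_push_linv[OF reduced_foldr_push, of v x ys]
   by (simp add: red_def)
 next
  case False
  hence "red (x # w) = x # red w"
   by (cases "red w") (auto simp: red_def)
  thus ?thesis using Cons by simp
 qed
qed (simp add: red_def)

lemma red_append: "red (u @ v) = foldr push u (red v)"
 by (simp add: red_def)

lemma red_append_red: "red (red u @ red v) = red (u @ v)"
 by (simp add: red_append foldr_push_red reduced_red red_id)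

lemma red_append_red1: "red (red u @ v) = red (u @ v)" and red_append_red2: "red (u @ red v) = red (u @ v)"
 by (metis red_append_red red_id reduced_red)+

lemma red_cancel: "red (u @ x # linv x # v) = red (u @ v)"
proof -
 have "red (x # linv x # v) = red v"
  using push_push_linv[OF reduced_red, of x v] by (simp add: red_def)
 thus ?thesis by (metis red_append)
qed

typedef 'a fg = "{w :: ('a \<times> bool) list. reduced w}" morphisms rep_fg Abs_fg
 by (rule exI[of _ "[]"]) simp

definition fg_of :: "('a \<times> bool) list => 'a fg" where "fg_of w = Abs_fg (red w)"

definition winv :: "('a \<times> bool) list => ('a \<times> bool) list" where "winv w = map linv (rev w)"

lemma reduced_rep [simp]: "reduced (rep_fg a)"
 using rep_fg by auto

lemma rep_fg_of [simp]: "rep_fg (fg_of w) = red w"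
 by (simp add: fg_of_def Abs_fg_inverse reduced_red)

lemma fg_of_rep [simp]: "fg_of (rep_fg a) = a"
 by (simp add: fg_of_def rep_fg_inverse red_id)

lemma fg_of_eq_iff: "fg_of u = fg_of v \<longleftrightarrow> red u = red v"
 by (metis fg_of_rep rep_fg_of rep_fg_inject)

lemma winv_simps [simp]: "winv [] = []" "winv (x # w) = winv w @ [linv x]"
 "winv (u @ v) = winv v @ winv u" "winv (winv w) = w"
 by (auto simp: winv_def rev_map comp_def)

lemma red_winv: "red (winv w @ w) = []" "red (w @ winv w) = []"
proof -
 have *: "red (w @ winv w) = []" for w :: "('a \<times> bool) list"
 proof (induction w)
  case (Cons x w)
  have "red (x # w @ winv w @ [linv x]) = red ([x] @ red ((w @ winv w)) @ [linv x])"
   by (metis append.assoc append_Cons append_Nil red_append_red1 red_append_red2)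
  also have "\<dots> = []" using Cons by (simp add: red_def)
  finally show ?case by simp
 qed (simp add: red_def)
 show "red (w @ winv w) = []" by (rule *)
 show "red (winv w @ w) = []" using *[of "winv w"] by simp
qed

text \<open>Additive notation for a noncommutative group makes the cancellation rules of
  \<open>group_add\<close> available, here and in the transport along paths, whose values lie in an
  arbitrary such group.\<close>

instantiation fg :: (type) group_add
begin
definition "0 = fg_of []"
definition "a + b = fg_of (rep_fg a @ rep_fg b)"
definition "- a = fg_of (winv (rep_fg a))"
definition "a - b = a + - (b :: 'a fg)"
instance
proof
 fix a b c :: "'a fg"
 show "a + b + c = a + (b + c)"
  by (simp add: plus_fg_def fg_of_eq_iff red_append_red1 red_append_red2)
 show "0 + a = a" "a + 0 = a"
  by (simp_all add: plus_fg_def zero_fg_def) (simp_all add: red_def)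
 show "- a + a = 0"
  by (simp add: plus_fg_def zero_fg_def uminus_fg_def fg_of_eq_iff red_append_red1 red_winv) (simp add: red_def)
 show "a + - b = a - b" by (simp add: minus_fg_def)
qed
end

lemma fg_of_append: "fg_of (u @ v) = fg_of u + fg_of v"
 by (simp add: plus_fg_def fg_of_eq_iff red_append_red)

lemma fg_of_Nil [simp]: "fg_of [] = 0"
 by (simp add: zero_fg_def)

lemma fg_of_Cons: "fg_of (x # w) = fg_of [x] + fg_of w"
 using fg_of_append[of "[x]" w] by simp

lemma fg_of_winv: "fg_of (winv w) = - fg_of w"
 by (metis eq_neg_iff_add_eq_0 fg_of_Nil fg_of_append fg_of_eq_iff red_winv(1) red_id reduced_simps(1))

lemma fg_of_eq_0: "fg_of w = 0 \<longleftrightarrow> red w = []"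
 by (metis fg_of_Nil fg_of_eq_iff red_id reduced_simps(1))

lemma rep_zero [simp]: "rep_fg 0 = []"
 by (metis fg_of_Nil red_id rep_fg_of reduced_simps(1))

lemma rep_eq_Nil [simp]: "rep_fg a = [] \<longleftrightarrow> a = 0"
 by (metis rep_zero rep_fg_inject)

text \<open>The retraction of the free group onto the free factor generated by the letters in
  \<open>A\<close>.\<close>

definition fg_keep :: "'a set => 'a fg => 'a fg" where
 "fg_keep A a = fg_of (filter (\<lambda>x. fst x \<in> A) (rep_fg a))"

text \<open>The two letters of a cancelling pair have the same first component, so the pair is kept
  or deleted as a whole.\<close>

lemma red_filter_red: "red (filter (\<lambda>x. fst x \<in> A) (red w)) = red (filter (\<lambda>x. fst x \<in> A) w)"
proof (induction w)
 case (Cons x w)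
 let ?f = "filter (\<lambda>x. fst x \<in> A)"
 have *: "red (?f (x # red w)) = red (?f (x # w))"
  using Cons red_append[of "[x]"] by simp
 show ?case
 proof (cases "\<exists>ys. red w = linv x # ys")
  case True
  then obtain ys where ys: "red w = linv x # ys" by blast
  hence "red (x # w) = ys" by (simp add: red_def)
  moreover have "red (?f (x # red w)) = red (?f ys)"
   using ys red_cancel[of "[]" x "?f ys"] by auto
  ultimately show ?thesis using * by simp
 next
  case False
  hence "red (x # w) = x # red w"
   by (cases "red w") (auto simp: red_def)
  thus ?thesis using * by simp
 qed
qed (simp add: red_def)

lemma fg_keep_of: "fg_keep A (fg_of w) = fg_of (filter (\<lambda>x. fst x \<in> A) w)"
 by (simp add: fg_keep_def fg_of_eq_iff red_filter_red)

lemma fg_keep_add: "fg_keep A (a + b) = fg_keep A a + fg_keep A b"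
 by (metis fg_keep_of fg_of_append fg_of_rep filter_append)

lemma fg_keep_zero [simp]: "fg_keep A 0 = 0"
 by (simp add: fg_keep_def)

lemma fg_keep_uminus: "fg_keep A (- a) = - fg_keep A a"
 by (metis add.left_inverse fg_keep_add fg_keep_zero minus_unique add.right_inverse)

definition fg_supp :: "'a fg => 'a set" where "fg_supp a = fst ` set (rep_fg a)"

lemma set_red: "set (red w) \<subseteq> set w"
proof (induction w)
 case (Cons x w)
 thus ?case by (cases "red w") (auto simp: red_def)
qed (simp add: red_def)

lemma fg_supp_zero [simp]: "fg_supp 0 = {}"
 by (simp add: fg_supp_def)

lemma fg_supp_add: "fg_supp (a + b) \<subseteq> fg_supp a \<union> fg_supp b"
 using set_red[of "rep_fg a @ rep_fg b"] by (auto simp: fg_supp_def plus_fg_def)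

lemma fg_supp_uminus: "fg_supp (- a) = fg_supp a"
proof -
 have "fg_supp (- a) \<subseteq> fg_supp a" for a :: "'a fg"
  using set_red[of "winv (rep_fg a)"] by (force simp: fg_supp_def uminus_fg_def winv_def)
 from this[of a] this[of "- a"] show ?thesis by auto
qed

lemma fg_keep_id: "fg_supp a \<subseteq> A ==> fg_keep A a = a"
proof -
 assume "fg_supp a \<subseteq> A"
 hence "filter (\<lambda>x. fst x \<in> A) (rep_fg a) = rep_fg a"
  by (auto simp: fg_supp_def filter_id_conv)
 thus ?thesis by (simp add: fg_keep_def)
qed

lemma fg_supp_keep: "fg_supp (fg_keep A a) \<subseteq> A"
 using set_red[of "filter (\<lambda>x. fst x \<in> A) (rep_fg a)"] by (auto simp: fg_supp_def fg_keep_def)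

lemma fg_keep_eq_0: "fg_supp a \<inter> A = {} ==> fg_keep A a = 0"
proof -
 assume "fg_supp a \<inter> A = {}"
 hence "filter (\<lambda>x. fst x \<in> A) (rep_fg a) = []"
  by (auto simp: fg_supp_def filter_empty_conv)
 thus ?thesis by (simp add: fg_keep_def)
qed

lemma fg_supp_of_subset: "fg_supp (fg_of w) \<subseteq> fst ` set w"
 using set_red[of w] by (auto simp: fg_supp_def)

lemma fg_of_single_neq_0 [simp]: "fg_of [x] ~= 0"
 by (simp add: fg_of_eq_0 red_def)

lemma fg_of_single_noncommute:
 "s ~= t ==> fg_of [(s, b)] + fg_of [(t, c)] ~= fg_of [(t, c)] + fg_of [(s, b)]"
 by (simp add: fg_of_append[symmetric] fg_of_eq_iff red_def)

lemma fg_single_commute: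
 assumes "fg_supp a \<subseteq> {s}" "fg_supp b \<subseteq> {s}"
 shows "a + b = b + a"
proof -
 have 0: "fg_of [(s, c)] + fg_of [(s, d)] = fg_of [(s, d)] + fg_of [(s, c)]" for c d
  by (simp add: fg_of_append[symmetric] fg_of_eq_iff red_def)
 have 1: "fg_of [(s, c)] + fg_of w = fg_of w + fg_of [(s, c)]" if "fst ` set w \<subseteq> {s}" for c w
  using that
 proof (induction w)
  case (Cons x w)
  then obtain d where x: "x = (s, d)" by (cases x) auto
  have "fg_of [(s, c)] + fg_of (x # w) = fg_of [(s, c)] + fg_of [(s, d)] + fg_of w"
   by (subst fg_of_Cons) (simp add: x add.assoc)
  also have "\<dots> = fg_of [(s, d)] + (fg_of [(s, c)] + fg_of w)"
   using 0 by (metis add.assoc)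
  also have "\<dots> = fg_of (x # w) + fg_of [(s, c)]"
   using Cons by (subst fg_of_Cons[of x]) (simp add: x add.assoc)
  finally show ?case .
 qed simp
 have 2: "fg_of v + fg_of w = fg_of w + fg_of v" if "fst ` set v \<subseteq> {s}" "fst ` set w \<subseteq> {s}" for v w
  using that(1)
 proof (induction v)
  case (Cons x v)
  then obtain d where x: "x = (s, d)" by (cases x) auto
  have "fg_of (x # v) + fg_of w = fg_of [(s, d)] + (fg_of v + fg_of w)"
   by (subst fg_of_Cons) (simp add: x add.assoc)
  also have "\<dots> = fg_of [(s, d)] + fg_of w + fg_of v" using Cons by (simp add: add.assoc)
  also have "\<dots> = fg_of w + fg_of [(s, d)] + fg_of v" using 1[OF that(2)] by simp
  also have "\<dots> = fg_of w + fg_of (x # v)" by (subst fg_of_Cons[of x]) (simp add: x add.assoc)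
  finally show ?case .
 qed simp
 show ?thesis using 2[of "rep_fg a" "rep_fg b"] assms by (simp add: fg_supp_def)
qed

subsection \<open>Powers\<close>

definition fg_pow :: "nat => 'a fg => 'a fg" where "fg_pow n a = ((+) a ^^ n) 0"

lemma fg_pow_simps [simp]: "fg_pow 0 a = 0" "fg_pow (Suc n) a = a + fg_pow n a"
 by (simp_all add: fg_pow_def)

text \<open>\<open>v\<close> is the cyclically reduced core: reducedness of \<open>v @ v\<close>
  says that its last letter does not cancel against its first, so powers of \<open>v\<close> do not
  cancel either.\<close>

definition cyc_decomp :: "'a fg => ('a \<times> bool) list => ('a \<times> bool) list => bool" where
 "cyc_decomp a u v \<longleftrightarrow> rep_fg a = u @ v @ winv u & v ~= [] & reduced (v @ v)"

lemma reduced_cyc_exists: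
 assumes "reduced w" "w ~= []"
 shows "\<exists>u v. w = u @ v @ winv u & v ~= [] & reduced (v @ v)"
 using assms
proof (induction "length w" arbitrary: w rule: less_induct)
 case less
 show ?case
 proof (cases "reduced (w @ w)")
  case True
  thus ?thesis using less.prems by (intro exI[of _ "[]"] exI[of _ w]) simp
 next
  case False
  \<comment> \<open>Cyclic reducedness fails only because the last letter cancels the first; both
    are stripped. Something remains, since no letter is its own inverse and a letter followed by its
    inverse is not reduced.\<close>
  hence *: "hd w = linv (last w)"
   using less.prems by (auto simp: reduced_append_iff)
  obtain x w1 where w1: "w = x # w1" using less.prems by (cases w) auto
  have "w1 ~= []" using * w1 by auto
  then obtain w' y where w': "w1 = w' @ [y]" by (metis append_butlast_last_id)
  have y: "y = linv x" using * w1 w' by (cases x; cases y) auto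
  have red': "reduced w'" using less.prems w1 w' by (auto simp: reduced_append_iff dest: reduced_ConsD)
  have "w' ~= []" using less.prems w1 w' y by auto
  then obtain u v where "w' = u @ v @ winv u" "v ~= []" "reduced (v @ v)"
   using less.hyps[OF _ red'] w1 w' by auto
  thus ?thesis
   using w1 w' y by (intro exI[of _ "x # u"] exI[of _ v]) simp
 qed
qed

lemma cyc_decomp_exists: "a ~= 0 ==> \<exists>u v. cyc_decomp a u v"
 unfolding cyc_decomp_def using reduced_cyc_exists[of "rep_fg a"] by simp

lemma cyc_decomp_pow:
 assumes "cyc_decomp a u v" "n > 0"
 shows "rep_fg (fg_pow n a) = u @ concat (replicate n v) @ winv u"
proof -
 note d = assms(1)[unfolded cyc_decomp_def]
 have a: "a = fg_of u + fg_of v + - fg_of u"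
  using d fg_of_rep[of a] by (metis add.assoc fg_of_append fg_of_winv)
 have "fg_pow n a = fg_of (u @ concat (replicate n v) @ winv u)" for n
 proof (induction n)
  case 0
  thus ?case by (simp add: fg_of_append fg_of_winv)
 next
  case (Suc n)
  have "fg_pow (Suc n) a = fg_of u + fg_of v + - fg_of u + (fg_of u + (fg_of (concat (replicate n v)) + - fg_of u))"
   using a Suc by (simp add: fg_of_append fg_of_winv)
  also have "\<dots> = fg_of (u @ concat (replicate (Suc n) v) @ winv u)"
   by (simp add: fg_of_append fg_of_winv add.assoc del: add_uminus_conv_diff)
  finally show ?case .
 qed
 moreover have "reduced (u @ concat (replicate n v) @ winv u)"
 proof -
  have r: "reduced (u @ v @ winv u)" using d reduced_rep[of a] by simp
  have *: "reduced (concat (replicate n v)) & concat (replicate n v) ~= [] &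
    hd (concat (replicate n v)) = hd v & last (concat (replicate n v)) = last v"
   using assms(2)
  proof (induction n)
   case (Suc n)
   thus ?case using d by (cases "n = 0") (auto simp: reduced_append_iff)
  qed simp
  thus ?thesis using r d by (auto simp: reduced_append_iff)
 qed
 ultimately show ?thesis by (simp add: red_id)
qed

definition fg_len :: "'a fg => nat" where "fg_len a = length (rep_fg a)"

lemma length_red: "length (red w) <= length w"
proof (induction w)
 case (Cons x w)
 thus ?case by (cases "red w") (auto simp: red_def)
qed (simp add: red_def)

lemma fg_len_add: "fg_len (a + b) <= fg_len a + fg_len b"
 using length_red[of "rep_fg a @ rep_fg b"] by (simp add: fg_len_def plus_fg_def)

lemma fg_len_uminus: "fg_len (- a) = fg_len a"
proof -
 have "fg_len (- a) <= fg_len a" for a :: "'a fg"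
  using length_red[of "winv (rep_fg a)"] by (simp add: fg_len_def uminus_fg_def winv_def)
 from this[of a] this[of "- a"] show ?thesis by auto
qed

text \<open>The power is u v^n u^-1 without cancellation, and (n - 1) (|v| - 1) >= 0. The length of
  \<open>a\<close> is kept on the left so that Higman's recursion makes lengths drop
  strictly.\<close>

lemma fg_len_pow:
 assumes "a ~= 0" "n > 0" shows "fg_len a + n <= fg_len (fg_pow n a) + 1"
proof -
 obtain u v where d: "cyc_decomp a u v" using cyc_decomp_exists[OF assms(1)] by blast
 have l: "length v >= 1" using d by (auto simp: cyc_decomp_def Suc_le_eq)
 have "length (concat (replicate n v)) = n * length v" by (induction n) auto
 moreover have "length v + n <= n * length v + 1"
 proof -
  obtain l' m where "length v = Suc l'" "n = Suc m" using l assms(2) by (metis Suc_le_D not0_implies_Suc not_gr0 One_nat_def)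
  thus ?thesis by (simp add: algebra_simps)
 qed
 ultimately show ?thesis
  using cyc_decomp_pow[OF d assms(2)] d by (simp add: fg_len_def cyc_decomp_def)
qed

text \<open>Higman's argument: exponents growing faster than the lengths of the given
 elements force the solution of the recursive system, and hence the system itself, to be eventually trivial.\<close>

lemma higman_eventually_zero:
 fixes g :: "nat => 'a fg"
 assumes "\<And>k. \<exists>x. \<forall>j. x j = g j + fg_pow (k j) (x (Suc j))"
 shows "\<exists>J. \<forall>j\<ge>J. g j = 0"
proof -
 \<comment> \<open>With exponent |g_j| + 2, \<open>fg_len_pow\<close> gives |x_(j+1)| + |g_j| + 2 <=
   |g_j| + |x_j| + 1 whenever x_(j+1) is nontrivial.\<close>
 obtain x where x: "\<And>j. x j = g j + fg_pow (fg_len (g j) + 2) (x (Suc j))"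
  using assms[of "\<lambda>j. fg_len (g j) + 2"] by blast
 have step: "fg_len (x (Suc j)) + 1 <= fg_len (x j)" if "x (Suc j) ~= 0" for j
 proof -
  have "fg_pow (fg_len (g j) + 2) (x (Suc j)) = - g j + x j"
   using x[of j] by (simp add: add.assoc[symmetric])
  hence "fg_len (fg_pow (fg_len (g j) + 2) (x (Suc j))) <= fg_len (g j) + fg_len (x j)"
   by (metis fg_len_add fg_len_uminus)
  thus ?thesis
   using fg_len_pow[OF that, of "fg_len (g j) + 2"] by linarith
 qed
 have down: "x j ~= 0" if "x (Suc j) ~= 0" for j
  using step[OF that] by (auto simp: fg_len_def)
 have "\<exists>J. x J = 0"
 proof (rule ccontr)
  assume "\<nexists>J. x J = 0"
  hence st: "fg_len (x (Suc j)) + 1 <= fg_len (x j)" for j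
   using step by blast
  have "fg_len (x j) + j <= fg_len (x 0)" for j
  proof (induction j)
   case (Suc j)
   thus ?case using st[of j] by simp
  qed simp
  from this[of "Suc (fg_len (x 0))"] show False by simp
 qed
 then obtain J where J: "x J = 0" by blast
 \<comment> \<open>By \<open>down\<close>, a nontrivial term forces its predecessor to be
   nontrivial, so triviality at \<open>J\<close> propagates to all later terms.\<close>
 have "x j = 0" if "j >= J" for j
  using that J by (induction rule: dec_induct) (use down in auto)
 hence "g j = 0" if "j >= J" for j
 proof -
  have "fg_pow n (0 :: 'a fg) = 0" for n by (induction n) auto
  thus ?thesis using x[of j] \<open>\<And>j. j >= J ==> x j = 0\<close> that by simp
 qed
 thus ?thesis by blast
qed

subsection \<open>Cyclic cores and alternation numbers\<close>

text \<open>Only the letters of the cyclic core are repeated in powers, so only they make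
  alternation numbers grow.\<close>

definition core_supp :: "'a fg => 'a set" where
 "core_supp a = fst ` set (SOME v. \<exists>u. cyc_decomp a u v)"

lemma core_suppE:
 assumes "a ~= 0"
 obtains u v where "cyc_decomp a u v" "core_supp a = fst ` set v"
 using someI_ex[of "\<lambda>v. \<exists>u. cyc_decomp a u v"] cyc_decomp_exists[OF assms]
 unfolding core_supp_def by blast

lemma core_supp_subset: "a ~= 0 ==> core_supp a \<subseteq> fg_supp a"
 by (erule core_suppE) (auto simp: fg_supp_def cyc_decomp_def)

lemma fg_keep_cyc_decomp:
 assumes "cyc_decomp a u v"
 shows "fg_keep A a = fg_keep A (fg_of u) + fg_keep A (fg_of v) - fg_keep A (fg_of u)"
proof -
 have "a = fg_of u + fg_of v + - fg_of u"
  using assms fg_of_rep[of a] unfolding cyc_decomp_def by (metis add.assoc fg_of_append fg_of_winv)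
 thus ?thesis by (metis fg_keep_add fg_keep_uminus diff_conv_add_uminus)
qed

text \<open>The retraction takes a conjugate to a conjugate; a core without letters in
  \<open>A\<close> would be killed, and the element with it.\<close>

lemma core_supp_meets:
 assumes "fg_keep A a ~= 0" shows "core_supp a \<inter> A ~= {}"
proof -
 have "a ~= 0" using assms by auto
 then obtain u v where d: "cyc_decomp a u v" "core_supp a = fst ` set v" by (rule core_suppE)
 have "fg_keep A (fg_of v) ~= 0" using assms fg_keep_cyc_decomp[OF d(1), of A] by auto
 hence "fg_supp (fg_of v) \<inter> A ~= {}" using fg_keep_eq_0 by blast
 thus ?thesis using d fg_supp_of_subset[of v] by auto
qed

text \<open>A core spelled in \<open>A\<close> is fixed by the retraction, and conjugates of a
  nontrivial element are nontrivial.\<close>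

lemma core_supp_not_subset:
 assumes "a ~= 0" "fg_keep A a = 0" shows "\<not> core_supp a \<subseteq> A"
proof
 assume *: "core_supp a \<subseteq> A"
 obtain u v where d: "cyc_decomp a u v" "core_supp a = fst ` set v" using core_suppE[OF assms(1)] .
 have "fg_supp (fg_of v) \<subseteq> A" using * d fg_supp_of_subset[of v] by auto
 hence "fg_keep A (fg_of v) = fg_of v" by (rule fg_keep_id)
 moreover have "fg_of v ~= 0"
  using d by (auto simp: fg_of_eq_0 cyc_decomp_def red_id reduced_append_iff)
 ultimately have "fg_keep A a ~= 0"
  using fg_keep_cyc_decomp[OF d(1), of A]
  by (metis add.right_neutral add_left_imp_eq diff_eq_eq add.left_neutral)
 thus False using assms by simp
qed

text \<open>Counts the switches between letters in \<open>A\<close> and letters in \<open>B\<close>,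
  ignoring all others. The flag records that the last letter counted was in \<open>A\<close>;
  another initial flag changes the count by at most one (\<open>alt_from_state\<close>).\<close>

fun alt_from :: "'a set => 'a set => bool => ('a \<times> bool) list => nat" where
 "alt_from A B b [] = 0"
| "alt_from A B b (x # w) =
  (if fst x \<in> A then of_bool (\<not> b) + alt_from A B True w
   else if fst x \<in> B then of_bool b + alt_from A B False w
   else alt_from A B b w)"

definition fg_alt :: "'a set => 'a set => 'a fg => nat" where
 "fg_alt A B a = alt_from A B True (rep_fg a)"

lemma alt_from_state: "alt_from A B b w <= of_bool (b ~= c) + alt_from A B c w"
 by (induction w arbitrary: b c) (auto split: if_splits)

text \<open>Omitting a letter may change the flag, but the extra switch this can cause is one that
  the omitted letter has already paid for. Hence free reduction, which passes to a subword, creates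
  no switches.\<close>

lemma alt_from_subseq: "subseq v w ==> alt_from A B b v <= alt_from A B b w"
proof (induction v w arbitrary: b rule: list_emb.induct)
 case (list_emb_Cons v w x)
 show ?case
  using list_emb_Cons.IH[of b] list_emb_Cons.IH[of True] list_emb_Cons.IH[of False]
   alt_from_state[of A B b v True] alt_from_state[of A B b v False]
  by (cases b) auto
qed (auto simp: add_mono)

lemma subseq_red: "subseq (red w) w"
proof (induction w)
 case (Cons x w)
 show ?case
 proof (cases "red w")
  case Nil
  thus ?thesis by (simp add: red_def)
 next
  case (Cons y ys)
  thus ?thesis using Cons.IH by (auto simp: red_def dest: subseq_Cons')
 qed
qed (simp add: red_def)

lemma alt_from_append: "alt_from A B b (u @ v) <= alt_from A B b u + 1 + alt_from A B c v"
proof (induction u arbitrary: b)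
 case Nil
 thus ?case using alt_from_state[of A B b v c] by (cases "b = c") auto
qed auto

lemma fg_alt_add: "fg_alt A B (a + b) <= fg_alt A B a + 1 + fg_alt A B b"
 using alt_from_subseq[OF subseq_red, of A B True "rep_fg a @ rep_fg b"]
  alt_from_append[of A B True "rep_fg a" "rep_fg b" True]
 by (simp add: fg_alt_def plus_fg_def)

lemma fg_alt_zero [simp]: "fg_alt A B 0 = 0"
 by (simp add: fg_alt_def)

lemma alt_from_le_1:
 assumes "A \<inter> B = {}" "fst ` set w \<inter> A = {} \<or> fst ` set w \<inter> B = {}"
 shows "alt_from A B b w <= 1"
proof -
 have "fst ` set w \<inter> A = {} ==> alt_from A B b w <= of_bool b" for b
 proof (induction w arbitrary: b)
  case (Cons x w)
  thus ?case using Cons.IH[of True] Cons.IH[of False] by (cases b) auto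
 qed simp
 moreover have "fst ` set w \<inter> B = {} ==> alt_from A B b w <= of_bool (\<not> b)" for b
 proof (induction w arbitrary: b)
  case (Cons x w)
  thus ?case using Cons.IH[of True] Cons.IH[of False] by (cases b) auto
 qed simp
 ultimately show ?thesis using assms(2) by (meson le_trans of_bool_less_eq_one)
qed

lemma fg_alt_le_1:
 assumes "A \<inter> B = {}" "fg_supp a \<inter> A = {} \<or> fg_supp a \<inter> B = {}" shows "fg_alt A B a <= 1"
 using alt_from_le_1[OF assms(1)] assms(2) unfolding fg_alt_def fg_supp_def by blast

text \<open>The core has letters in both sets, so each of its n copies contributes a switch,
  whatever flag it is entered with. The conjugating ends are dropped by passing to a
  subword.\<close>

lemma fg_alt_pow:
 assumes "A \<inter> B = {}" "a ~= 0" "core_supp a \<inter> A ~= {}" "core_supp a \<inter> B ~= {}"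
 shows "n <= fg_alt A B (fg_pow n a)"
proof (cases "n = 0")
 case False
 obtain u v where d: "cyc_decomp a u v" "core_supp a = fst ` set v"
  using core_suppE[OF assms(2)] .
 have app: "1 <= alt_from A B b v & (\<exists>c. alt_from A B b (v @ w) = alt_from A B b v + alt_from A B c w)" for b w
 proof
  have A1: "fst ` set v \<inter> A ~= {} ==> 1 <= alt_from A B False v" for v
   by (induction v) auto
  have B1: "fst ` set v \<inter> B ~= {} ==> 1 <= alt_from A B True v" for v
   using assms(1) by (induction v) auto
  show "1 <= alt_from A B b v"
   using A1 B1 assms(3,4) d(2) by (cases b) auto
  show "\<exists>c. alt_from A B b (v @ w) = alt_from A B b v + alt_from A B c w"
   by (induction v arbitrary: b) auto
 qed
 have "n <= alt_from A B b (concat (replicate n v))" for b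
 proof (induction n arbitrary: b)
  case (Suc n)
  obtain c where "alt_from A B b (v @ concat (replicate n v)) = alt_from A B b v + alt_from A B c (concat (replicate n v))"
   using app by blast
  thus ?case using Suc[of c] app[of b "[]"] by simp
 qed simp
 also have "alt_from A B True (concat (replicate n v)) <= alt_from A B True (rep_fg (fg_pow n a))"
  using False by (intro alt_from_subseq) (simp add: cyc_decomp_pow[OF d(1)] subseq_drop_many list_emb_prefix)
 finally show ?thesis by (simp add: fg_alt_def)
qed simp

subsection \<open>Noncrossing matchings of trivial words\<close>

definition ncmatching :: "'k::linorder set => ('k => 'a \<times> bool) => ('k => 'k) => bool" where
 "ncmatching K lab \<pi> \<longleftrightarrow>
  (\<forall>i\<in>K. \<pi> i \<in> K & \<pi> (\<pi> i) = i & lab (\<pi> i) = linv (lab i)) &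
  (\<forall>i\<in>K. \<forall>k\<in>K. \<not> (i < k & k < \<pi> i & \<pi> i < \<pi> k))"

lemma red_NilE:
 assumes "red w = []" "w ~= []"
 obtains u x v where "w = u @ x # linv x # v"
proof -
 have "\<not> reduced w" using assms red_id by fastforce
 hence "\<exists>u x v. w = u @ x # linv x # v"
 proof (induction w)
  case (Cons y w)
  show ?case
  proof (cases "reduced w")
   case True
   then obtain v where "w = linv y # v" using Cons.prems by (cases w) auto
   thus ?thesis by (intro exI[of _ "[]"]) simp
  next
   case False
   then obtain u x v where "w = u @ x # linv x # v" using Cons.IH by blast
   thus ?thesis by (intro exI[of _ "y # u"]) simp
  qed
 qed simp
 thus ?thesis using that by blast
qed

text \<open>A nonempty word reducing to the empty one contains an adjacent cancelling pair. Its two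
  positions are matched with each other and the rest by induction; no remaining position lies
  between them, so the new chord crosses nothing.\<close>

lemma ncmatching_exists:
 assumes "sorted_wrt (<) js" "red (map lab js) = []"
 shows "\<exists>\<pi>. ncmatching (set js) lab \<pi>"
 using assms
proof (induction "length js" arbitrary: js rule: less_induct)
 case less
 show ?case
 proof (cases "js = []")
  case True
  thus ?thesis by (auto simp: ncmatching_def)
 next
  case False
  then obtain u x v where "map lab js = u @ x # linv x # v"
   using red_NilE[OF less.prems(2)] by (metis map_is_Nil_conv)
  then obtain us i j vs where js: "js = us @ i # j # vs" "u = map lab us" "v = map lab vs" "lab i = x" "lab j = linv x"
   by (auto simp: map_eq_append_conv map_eq_Cons_conv)
  have "red (map lab (us @ vs)) = []" using less.prems(2) red_cancel[of u x v] js by simp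
  moreover have "sorted_wrt (<) (us @ vs)" using less.prems(1) js by (auto simp: sorted_wrt_append)
  ultimately obtain \<pi> where \<pi>: "ncmatching (set (us @ vs)) lab \<pi>"
   using less.hyps[of "us @ vs"] js by auto
  have ij: "i < j" "i \<notin> set (us @ vs)" "j \<notin> set (us @ vs)" and
   btw: "\<And>k. k \<in> set (us @ vs) ==> k < i \<or> j < k"
   using less.prems(1) js by (auto simp: sorted_wrt_append)
  let ?\<pi> = "\<pi>(i := j, j := i)"
  have "ncmatching (set js) lab ?\<pi>"
   unfolding ncmatching_def
  proof (intro conjI ballI)
   fix k assume "k \<in> set js"
   then consider "k = i" | "k = j" | "k \<in> set (us @ vs)" "k ~= i" "k ~= j" using js ij by auto
   note cs = this
   have K: "\<pi> k ~= i & \<pi> k ~= j & \<pi> k \<in> set (us @ vs)" if "k \<in> set (us @ vs)" for k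
    using \<pi> ij that by (auto simp: ncmatching_def)
   show "?\<pi> k \<in> set js" using cs by cases (use K js in auto)
   show "?\<pi> (?\<pi> k) = k" using cs by cases (use K \<pi> ij in \<open>auto simp: ncmatching_def\<close>)
   show "lab (?\<pi> k) = linv (lab k)" using cs by cases (use \<pi> ij js in \<open>auto simp: ncmatching_def\<close>)
   fix l assume "l \<in> set js"
   then consider "l = i" | "l = j" | "l \<in> set (us @ vs)" "l ~= i" "l ~= j" using js ij by auto
   note ls = this
   show "\<not> (k < l & l < ?\<pi> k & ?\<pi> k < ?\<pi> l)"
    using cs
   proof cases
    case 1
    show ?thesis using ls by cases (use 1 ij btw[of l] in auto)
   next
    case 2
    show ?thesis using ls by cases (use 2 ij btw[of l] in auto)
   next
    case 3
    show ?thesis using ls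
    proof cases
     case 1
     thus ?thesis using 3 ij btw[of "\<pi> k"] K[of k] by auto
    next
     case 2
     thus ?thesis using 3 ij btw[of "\<pi> k"] K[of k] by auto
    next
     case l: 3
     have "k \<in> set (us @ vs)" "l \<in> set (us @ vs)" using 3 l by auto
     hence "\<not> (k < l & l < \<pi> k & \<pi> k < \<pi> l)" using \<pi> unfolding ncmatching_def by blast
     thus ?thesis using 3 l by simp
    qed
   qed
  qed
  thus ?thesis by blast
 qed
qed

section \<open>Transport along a path\<close>

text \<open>\<open>g\<close> integrates \<open>\<kappa>\<close> along \<open>f\<close>: its
  increments are prescribed locally, as for a path lifted to a covering space. \<open>ctrans\<close>
  is the total increment, which is the same for all lifts by \<open>clift_unique\<close>.\<close>

definition clift :: "('t => 't => 'g::group_add) => (real => 't) => real => real => (real => 'g) => bool" where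
 "clift \<kappa> f a b g \<longleftrightarrow> (\<forall>t\<in>{a..b}. \<exists>\<delta>>0. \<forall>s\<in>{a..b}. \<forall>s'\<in>{a..b}.
   \<bar>s - t\<bar> < \<delta> & \<bar>s' - t\<bar> < \<delta> --> g s' = g s + \<kappa> (f s) (f s'))"

definition ctrans :: "('t => 't => 'g::group_add) => (real => 't) => real => real => 'g" where
 "ctrans \<kappa> f a b = (let g = SOME g. clift \<kappa> f a b g in - g a + g b)"

lemma cliftE:
 assumes "clift \<kappa> f a b g" "t \<in> {a..b}"
 obtains \<delta> where "\<delta> > 0" "\<And>s s'. s \<in> {a..b} ==> s' \<in> {a..b} ==> \<bar>s - t\<bar> < \<delta> ==> \<bar>s' - t\<bar> < \<delta> ==> g s' = g s + \<kappa> (f s) (f s')"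
 using assms unfolding clift_def by meson

lemma clift_subinterval: "clift \<kappa> f a b g ==> a <= a' ==> b' <= b ==> clift \<kappa> f a' b' g"
 unfolding clift_def by (meson atLeastAtMost_iff order_trans)

text \<open>Near each time the increments of both lifts are given by \<open>\<kappa>\<close>. The
  bisection principle \<open>Bolzano\<close> carries this over to the whole interval; it replaces
  explicit subdivisions here and below.\<close>

lemma clift_unique:
 assumes g: "clift \<kappa> f a b g" and h: "clift \<kappa> f a b h" and "a <= b"
 shows "- g a + g b = - h a + h b"
proof -
 have "a <= a & b <= b --> - g a + g b = - h a + h b"
  using assms(3)
 proof (rule Bolzano[where P="\<lambda>x y. a <= x & y <= b --> - g x + g y = - h x + h y"])
  fix x y z :: real
  assume *: "a <= x & y <= b --> - g x + g y = - h x + h y" "a <= y & z <= b --> - g y + g z = - h y + h z"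
   "x <= y" "y <= z"
  show "a <= x & z <= b --> - g x + g z = - h x + h z"
  proof
   assume "a <= x & z <= b"
   hence "- g x + g y = - h x + h y" "- g y + g z = - h y + h z" using * by auto
   hence "(- g x + g y) + (- g y + g z) = (- h x + h y) + (- h y + h z)" by simp
   thus "- g x + g z = - h x + h z" by (simp add: add.assoc)
  qed
 next
  fix t assume "a <= t" "t <= b"
  hence t: "t \<in> {a..b}" by simp
  obtain d where d: "d > 0" "\<And>s s'. s \<in> {a..b} ==> s' \<in> {a..b} ==> \<bar>s - t\<bar> < d ==> \<bar>s' - t\<bar> < d ==> g s' = g s + \<kappa> (f s) (f s')"
   using cliftE[OF g t] by blast
  obtain e where e: "e > 0" "\<And>s s'. s \<in> {a..b} ==> s' \<in> {a..b} ==> \<bar>s - t\<bar> < e ==> \<bar>s' - t\<bar> < e ==> h s' = h s + \<kappa> (f s) (f s')"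
   using cliftE[OF h t] by blast
  show "\<exists>d>0. \<forall>x y. x <= t & t <= y & y - x < d --> (a <= x & y <= b --> - g x + g y = - h x + h y)"
  proof (intro exI[of _ "min d e"] conjI allI impI)
   fix x y assume "x <= t & t <= y & y - x < min d e" "a <= x & y <= b"
   hence "g y = g x + \<kappa> (f x) (f y)" "h y = h x + \<kappa> (f x) (f y)"
    by (intro d(2) e(2); simp)+
   thus "- g x + g y = - h x + h y" by (simp add: add.assoc[symmetric])
  qed (use d e in auto)
 qed
 thus ?thesis by simp
qed

lemma ctrans_eq:
 assumes "clift \<kappa> f a b g" "a <= b" shows "ctrans \<kappa> f a b = - g a + g b"
proof -
 have "clift \<kappa> f a b (SOME g. clift \<kappa> f a b g)" by (rule someI[of "clift \<kappa> f a b", OF assms(1)])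
 thus ?thesis unfolding ctrans_def Let_def using clift_unique assms by blast
qed

lemma ctrans_cong:
 assumes "\<And>t. a <= t ==> t <= b ==> f t = f' t"
 shows "ctrans \<kappa> f a b = ctrans \<kappa> f' a b"
proof -
 have imp: "clift \<kappa> f' a b g" if g: "clift \<kappa> f a b g" and eq: "\<And>t. t \<in> {a..b} ==> f t = f' t" for f f' :: "real => 'a" and g
  unfolding clift_def
 proof
  fix t assume "t \<in> {a..b}"
  then obtain d where d: "d > 0" "\<And>s s'. s \<in> {a..b} ==> s' \<in> {a..b} ==> \<bar>s - t\<bar> < d ==> \<bar>s' - t\<bar> < d ==> g s' = g s + \<kappa> (f s) (f s')"
   using cliftE[OF g] by blast
  show "\<exists>\<delta>>0. \<forall>s\<in>{a..b}. \<forall>s'\<in>{a..b}. \<bar>s - t\<bar> < \<delta> & \<bar>s' - t\<bar> < \<delta> --> g s' = g s + \<kappa> (f' s) (f' s')"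
  proof (intro exI[of _ d] conjI ballI impI)
   fix s s' assume "s \<in> {a..b}" "s' \<in> {a..b}" "\<bar>s - t\<bar> < d & \<bar>s' - t\<bar> < d"
   thus "g s' = g s + \<kappa> (f' s) (f' s')" using d(2)[of s s'] eq[of s] eq[of s'] by simp
  qed (rule d(1))
 qed
 have "clift \<kappa> f a b g = clift \<kappa> f' a b g" for g
  using imp[of f g f'] imp[of f' g f] assms by auto
 thus ?thesis by (simp add: ctrans_def)
qed

lemma ctrans_zero:
 assumes "\<And>s s'. s \<in> {a..b} ==> s' \<in> {a..b} ==> \<kappa> (f s) (f s') = 0" "a <= b"
 shows "ctrans \<kappa> f a b = 0"
proof -
 have "clift \<kappa> f a b (\<lambda>_. 0)" unfolding clift_def using assms(1) by (auto intro!: exI[of _ 1])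
 thus ?thesis using ctrans_eq assms(2) by fastforce
qed

text \<open>A Cech 1-cocycle written as a function of two points, additive only inside the members
  of an open cover. That suffices for a transport that is additive under concatenation and invariant
  under homotopy.\<close>

locale cocycle =
 fixes T :: "'t topology" and \<U> :: "'t set set" and \<kappa> :: "'t => 't => 'g::group_add"
 assumes open_cover: "V \<in> \<U> ==> openin T V" and covers: "topspace T \<subseteq> \<Union>\<U>"
  and coc: "V \<in> \<U> ==> P \<in> V ==> Q \<in> V ==> R \<in> V ==> \<kappa> P Q + \<kappa> Q R = \<kappa> P R"
begin

lemma refl0: "V \<in> \<U> ==> P \<in> V ==> \<kappa> P P = 0"
 using coc[of V P P P] add_left_imp_eq[of "\<kappa> P P" "\<kappa> P P" 0] by simp

lemma refl0_topspace: "P \<in> topspace T ==> \<kappa> P P = 0"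
 using covers refl0 by blast

lemma local_piece:
 assumes "cont_on S T f" "z \<in> S"
 obtains V d where "V \<in> \<U>" "d > 0" "\<And>w. w \<in> S ==> dist w z < d ==> f w \<in> V"
proof -
 have "f z \<in> topspace T"
  using assms continuous_map_image_subset_topspace by fastforce
 then obtain V where V: "V \<in> \<U>" "f z \<in> V" using covers by blast
 hence "openin (top_of_set S) {x \<in> S. f x \<in> V}"
  using openin_continuous_map_preimage[OF assms(1) open_cover] by simp
 moreover have "z \<in> {x \<in> S. f x \<in> V}" using V assms by simp
 ultimately obtain d where "d > 0" "\<forall>w\<in>S. dist w z < d --> w \<in> {x \<in> S. f x \<in> V}"
  unfolding openin_euclidean_subtopology_iff by blast
 thus ?thesis using that V by blast
qed

lemma clift_local:
 assumes "V \<in> \<U>" "\<And>t. t \<in> {a..b} ==> f t \<in> V" "a <= b"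
 shows "clift \<kappa> f a b (\<lambda>t. \<kappa> (f a) (f t))"
 unfolding clift_def using coc[OF assms(1)] assms(2,3) by (auto intro!: exI[of _ 1])

lemma ctrans_local:
 assumes "V \<in> \<U>" "\<And>t. t \<in> {a..b} ==> f t \<in> V" "a <= b"
 shows "ctrans \<kappa> f a b = \<kappa> (f a) (f b)"
 using ctrans_eq[OF clift_local[OF assms] assms(3)] refl0[OF assms(1), of "f a"] assms(2,3) by simp

lemma clift_join:
 assumes f: "cont_on {a..c} T f" and "a <= b" "b <= c"
  and g: "clift \<kappa> f a b g" and h: "clift \<kappa> f b c h"
 shows "clift \<kappa> f a c (\<lambda>t. if t <= b then g t else g b - h b + h t)"
  (is "clift \<kappa> f a c ?k")
 unfolding clift_def
proof
 fix t assume t: "t \<in> {a..c}"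
 consider "t < b" | "t = b" | "t > b" by linarith
 thus "\<exists>\<delta>>0. \<forall>s\<in>{a..c}. \<forall>s'\<in>{a..c}. \<bar>s - t\<bar> < \<delta> & \<bar>s' - t\<bar> < \<delta> --> ?k s' = ?k s + \<kappa> (f s) (f s')"
 proof cases
  case 1
  then obtain d where d: "d > 0" "\<And>s s'. s \<in> {a..b} ==> s' \<in> {a..b} ==> \<bar>s - t\<bar> < d ==> \<bar>s' - t\<bar> < d ==> g s' = g s + \<kappa> (f s) (f s')"
   using cliftE[OF g, of t] t by auto
  show ?thesis
   by (rule exI[of _ "min d (b - t)"]) (use 1 d in auto)
 next
  case 3
  then obtain d where d: "d > 0" "\<And>s s'. s \<in> {b..c} ==> s' \<in> {b..c} ==> \<bar>s - t\<bar> < d ==> \<bar>s' - t\<bar> < d ==> h s' = h s + \<kappa> (f s) (f s')"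
   using cliftE[OF h, of t] t by auto
  show ?thesis
   by (rule exI[of _ "min d (t - b)"]) (use 3 d in \<open>auto simp: add.assoc\<close>)
 next
  case 2
  obtain d where d: "d > 0" "\<And>s s'. s \<in> {a..b} ==> s' \<in> {a..b} ==> \<bar>s - t\<bar> < d ==> \<bar>s' - t\<bar> < d ==> g s' = g s + \<kappa> (f s) (f s')"
   using cliftE[OF g, of t] 2 assms by auto
  obtain e where e: "e > 0" "\<And>s s'. s \<in> {b..c} ==> s' \<in> {b..c} ==> \<bar>s - t\<bar> < e ==> \<bar>s' - t\<bar> < e ==> h s' = h s + \<kappa> (f s) (f s')"
   using cliftE[OF h, of t] 2 assms by auto
  \<comment> \<open>At the junction both one-sided pieces are compared with the value at
    \<open>b\<close>. One member of the cover contains all nearby points, and additivity inside it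
    combines the two increments.\<close>
  obtain V r where V: "V \<in> \<U>" "r > 0" "\<And>w. w \<in> {a..c} ==> dist w t < r ==> f w \<in> V"
   using local_piece[OF f t] by blast
  show ?thesis
  proof (rule exI[of _ "min r (min d e)"], intro conjI ballI impI)
   show "min r (min d e) > 0" using d e V by auto
   fix s s' assume s: "s \<in> {a..c}" "s' \<in> {a..c}" "\<bar>s - t\<bar> < min r (min d e) & \<bar>s' - t\<bar> < min r (min d e)"
   hence inV: "f s \<in> V" "f s' \<in> V" "f b \<in> V"
    using V(3) 2 t V(2) by (auto simp: dist_real_def)
   have st: "?k b = g b" by simp
   have one: "?k u = g b + \<kappa> (f b) (f u)" if "u \<in> {a..c}" "\<bar>u - t\<bar> < min r (min d e)" for u
   proof (cases "u <= b")
    case True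
    thus ?thesis using d(2)[of b u] d(1) that 2 assms by auto
   next
    case False
    thus ?thesis using e(2)[of b u] e(1) that 2 assms by (auto simp: add.assoc[symmetric])
   qed
   have "?k s' = g b + \<kappa> (f b) (f s')" "?k s = g b + \<kappa> (f b) (f s)" using one s by auto
   thus "?k s' = ?k s + \<kappa> (f s) (f s')"
    using coc[OF V(1) inV(3,1,2)] by (simp add: add.assoc)
  qed
 qed
qed

lemma clift_exists:
 assumes f: "cont_on {a..b} T f" and "a <= b"
 shows "\<exists>g. clift \<kappa> f a b g"
proof -
 have "a <= a & b <= b --> (\<exists>g. clift \<kappa> f a b g)"
  using assms(2)
 proof (rule Bolzano[where P="\<lambda>x y. a <= x & y <= b --> (\<exists>g. clift \<kappa> f x y g)"])
  fix x y z :: real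
  assume *: "a <= x & y <= b --> (\<exists>g. clift \<kappa> f x y g)" "a <= y & z <= b --> (\<exists>g. clift \<kappa> f y z g)"
   "x <= y" "y <= z"
  show "a <= x & z <= b --> (\<exists>g. clift \<kappa> f x z g)"
  proof
   assume "a <= x & z <= b"
   moreover from this obtain g h where "clift \<kappa> f x y g" "clift \<kappa> f y z h" using * by auto
   ultimately show "\<exists>g. clift \<kappa> f x z g"
    using clift_join[of x z f y g h] continuous_map_from_subtopology_mono[OF f, of "{x..z}"] *(3,4) by auto
  qed
 next
  fix t assume "a <= t" "t <= b"
  then obtain V r where V: "V \<in> \<U>" "r > 0" "\<And>w. w \<in> {a..b} ==> dist w t < r ==> f w \<in> V"
   using local_piece[OF f, of t] by auto
  show "\<exists>d>0. \<forall>x y. x <= t & t <= y & y - x < d --> (a <= x & y <= b --> (\<exists>g. clift \<kappa> f x y g))"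
  proof (intro exI[of _ r] conjI allI impI)
   fix x y assume "x <= t & t <= y & y - x < r" "a <= x & y <= b"
   thus "\<exists>g. clift \<kappa> f x y g"
    by (intro exI[of _ "\<lambda>t. \<kappa> (f x) (f t)"] clift_local[OF V(1)] V(3)) (auto simp: dist_real_def)
  qed (use V in auto)
 qed
 thus ?thesis by simp
qed

lemma ctrans_join:
 assumes f: "cont_on {a..c} T f" and "a <= b" "b <= c"
 shows "ctrans \<kappa> f a c = ctrans \<kappa> f a b + ctrans \<kappa> f b c"
proof -
 obtain g where g: "clift \<kappa> f a c g" using clift_exists[OF f] assms by auto
 have "clift \<kappa> f a b g" "clift \<kappa> f b c g" using clift_subinterval[OF g] assms by auto
 thus ?thesis using g assms by (simp add: ctrans_eq add.assoc)
qed

lemma ctrans_reparam: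
 assumes f: "cont_on {a..b} T f" and "a <= b" "a' <= b'"
  and \<phi>: "continuous_on {a'..b'} \<phi>" "\<phi> ` {a'..b'} \<subseteq> {a..b}" "\<phi> a' = a" "\<phi> b' = b"
 shows "ctrans \<kappa> (\<lambda>t. f (\<phi> t)) a' b' = ctrans \<kappa> f a b"
proof -
 obtain g where g: "clift \<kappa> f a b g" using clift_exists[OF f] assms by auto
 have "clift \<kappa> (\<lambda>t. f (\<phi> t)) a' b' (\<lambda>t. g (\<phi> t))"
  unfolding clift_def
 proof
  fix t assume t: "t \<in> {a'..b'}"
  hence "\<phi> t \<in> {a..b}" using \<phi> by blast
  then obtain d where d: "d > 0" "\<And>s s'. s \<in> {a..b} ==> s' \<in> {a..b} ==> \<bar>s - \<phi> t\<bar> < d ==> \<bar>s' - \<phi> t\<bar> < d ==> g s' = g s + \<kappa> (f s) (f s')"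
   using cliftE[OF g] by blast
  obtain e where e: "e > 0" "\<And>s. s \<in> {a'..b'} ==> dist s t < e ==> dist (\<phi> s) (\<phi> t) < d"
   using \<phi>(1) t d(1) unfolding continuous_on_iff by metis
  have \<phi>m: "\<phi> s \<in> {a..b}" if "s \<in> {a'..b'}" for s using \<phi>(2) that by blast
  show "\<exists>\<delta>>0. \<forall>s\<in>{a'..b'}. \<forall>s'\<in>{a'..b'}. \<bar>s - t\<bar> < \<delta> & \<bar>s' - t\<bar> < \<delta> -->
    g (\<phi> s') = g (\<phi> s) + \<kappa> (f (\<phi> s)) (f (\<phi> s'))"
  proof (intro exI[of _ e] conjI ballI impI)
   fix s s' assume "s \<in> {a'..b'}" "s' \<in> {a'..b'}" "\<bar>s - t\<bar> < e & \<bar>s' - t\<bar> < e"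
   thus "g (\<phi> s') = g (\<phi> s) + \<kappa> (f (\<phi> s)) (f (\<phi> s'))"
    using e(2)[of s] e(2)[of s'] \<phi>m by (intro d(2)) (auto simp: dist_real_def)
  qed (rule e(1))
 qed
 thus ?thesis using assms g by (simp add: ctrans_eq)
qed

text \<open>The transport is a finite sum of local values of \<open>\<kappa>\<close>. This is
  applied to the elements of a free group with support in a given set.\<close>

lemma ctrans_mem:
 assumes f: "cont_on {a..b} T f" and "a <= b"
  and H: "\<And>s s'. s \<in> {a..b} ==> s' \<in> {a..b} ==> \<kappa> (f s) (f s') \<in> H"
  "\<And>x y. x \<in> H ==> y \<in> H ==> x + y \<in> H"
 shows "ctrans \<kappa> f a b \<in> H"
proof -
 have "a <= a & b <= b --> ctrans \<kappa> f a b \<in> H"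
  using assms(2)
 proof (rule Bolzano[where P="\<lambda>x y. a <= x & y <= b --> ctrans \<kappa> f x y \<in> H"])
  fix x y z :: real
  assume *: "a <= x & y <= b --> ctrans \<kappa> f x y \<in> H" "a <= y & z <= b --> ctrans \<kappa> f y z \<in> H"
   "x <= y" "y <= z"
  thus "a <= x & z <= b --> ctrans \<kappa> f x z \<in> H"
   using ctrans_join[of x z f y] continuous_map_from_subtopology_mono[OF f, of "{x..z}"] H(2) by auto
 next
  fix t assume "a <= t" "t <= b"
  then obtain V r where V: "V \<in> \<U>" "r > 0" "\<And>w. w \<in> {a..b} ==> dist w t < r ==> f w \<in> V"
   using local_piece[OF f, of t] by auto
  show "\<exists>d>0. \<forall>x y. x <= t & t <= y & y - x < d --> (a <= x & y <= b --> ctrans \<kappa> f x y \<in> H)"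
  proof (intro exI[of _ r] conjI allI impI)
   fix x y assume xy: "x <= t & t <= y & y - x < r" "a <= x & y <= b"
   have "ctrans \<kappa> f x y = \<kappa> (f x) (f y)"
    using xy by (intro ctrans_local[OF V(1)] V(3)) (auto simp: dist_real_def)
   thus "ctrans \<kappa> f x y \<in> H" using H(1)[of x y] xy by simp
  qed (use V in auto)
 qed
 thus ?thesis by simp
qed

lemma continuous_map_slice:
 assumes h: "cont_on (A \<times> B) T h" and "s \<in> A" "C \<subseteq> B"
 shows "cont_on C T (\<lambda>t. h (s, t))"
 by (rule continuous_map_compose_eu[OF h]) (use assms in \<open>auto intro!: continuous_intros\<close>)

text \<open>Changing s at the first end and then following the path equals following the path and
  then changing s at the other end. On a small rectangle inside a member of the cover this is
  additivity; rectangles are glued along their common sides, with \<open>d\<close> becoming the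
  minimum.\<close>

lemma ctrans_homotopy_step:
 fixes h :: "real \<times> real => 't"
 assumes h: "cont_on ({0..1} \<times> {0..1}) T h" and s0: "s0 \<in> {0..1}"
 shows "\<exists>d>0. \<forall>s\<in>{0..1}. \<bar>s - s0\<bar> < d -->
  \<kappa> (h (s0, 0)) (h (s, 0)) + ctrans \<kappa> (\<lambda>t. h (s, t)) 0 1 = ctrans \<kappa> (\<lambda>t. h (s0, t)) 0 1 + \<kappa> (h (s0, 1)) (h (s, 1))"
proof -
 define Q where "Q x y d \<longleftrightarrow> (\<forall>s\<in>{0..1}. \<bar>s - s0\<bar> < d -->
  \<kappa> (h (s0, x)) (h (s, x)) + ctrans \<kappa> (\<lambda>t. h (s, t)) x y = ctrans \<kappa> (\<lambda>t. h (s0, t)) x y + \<kappa> (h (s0, y)) (h (s, y)))" for x y d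
 have "0 <= (0::real) & 1 <= (1::real) --> (\<exists>d>0. Q 0 1 d)"
 proof (rule Bolzano[where P="\<lambda>x y. 0 <= x & y <= 1 --> (\<exists>d>0. Q x y d)"])
  fix x y z :: real
  assume *: "0 <= x & y <= 1 --> (\<exists>d>0. Q x y d)" "0 <= y & z <= 1 --> (\<exists>d>0. Q y z d)" "x <= y" "y <= z"
  show "0 <= x & z <= 1 --> (\<exists>d>0. Q x z d)"
  proof
   assume xz: "0 <= x & z <= 1"
   then obtain d e where de: "d > 0" "Q x y d" "e > 0" "Q y z e" using * by auto
   have join: "ctrans \<kappa> (\<lambda>t. h (s, t)) x z = ctrans \<kappa> (\<lambda>t. h (s, t)) x y + ctrans \<kappa> (\<lambda>t. h (s, t)) y z"
    if "s \<in> {0..1}" for s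
    using xz *(3,4) by (intro ctrans_join continuous_map_slice[OF h that]) auto
   have "Q x z (min d e)"
    unfolding Q_def
   proof (intro ballI impI)
    fix s assume s: "s \<in> {0..1}" "\<bar>s - s0\<bar> < min d e"
    let ?k = "\<lambda>t. \<kappa> (h (s0, t)) (h (s, t))" and ?\<tau> = "\<lambda>s x y. ctrans \<kappa> (\<lambda>t. h (s, t)) x y"
    have 1: "?k x + ?\<tau> s x y = ?\<tau> s0 x y + ?k y" "?k y + ?\<tau> s y z = ?\<tau> s0 y z + ?k z"
     using de(2,4) s unfolding Q_def by auto
    have "?k x + ?\<tau> s x z = (?k x + ?\<tau> s x y) + ?\<tau> s y z" using join[OF s(1)] by (simp add: add.assoc)
    also have "\<dots> = ?\<tau> s0 x y + (?k y + ?\<tau> s y z)" using 1 by (simp add: add.assoc)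
    also have "\<dots> = ?\<tau> s0 x z + ?k z" using 1 join[OF s0] by (simp add: add.assoc)
    finally show "?k x + ?\<tau> s x z = ?\<tau> s0 x z + ?k z" .
   qed
   thus "\<exists>d>0. Q x z d" using de by (intro exI[of _ "min d e"]) auto
  qed
 next
  fix t :: real assume t: "0 <= t" "t <= 1"
  obtain V r where V: "V \<in> \<U>" "r > 0" "\<And>w. w \<in> {0..1} \<times> {0..1} ==> dist w (s0, t) < r ==> h w \<in> V"
   using local_piece[OF h, of "(s0, t)"] s0 t by auto
  have inV: "h (s, x) \<in> V" if "s \<in> {0..1}" "x \<in> {0..1}" "\<bar>s - s0\<bar> < r/2" "\<bar>x - t\<bar> < r/2" for s x
  proof (rule V(3))
   have "dist (s, x) (s0, t) <= dist s s0 + dist x t"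
    by (simp add: dist_Pair_Pair sqrt_sum_squares_le_sum)
   thus "dist (s, x) (s0, t) < r" using that by (simp add: dist_real_def)
  qed (use that in auto)
  show "\<exists>d>0. \<forall>x y. x <= t & t <= y & y - x < d --> (0 <= x & y <= 1 --> (\<exists>d>0. Q x y d))"
  proof (intro exI[of _ "r/2"] conjI allI impI)
   fix x y assume xy: "x <= t & t <= y & y - x < r/2" "0 <= x & y <= 1"
   have tr: "ctrans \<kappa> (\<lambda>t. h (s, t)) x y = \<kappa> (h (s, x)) (h (s, y))" if "s \<in> {0..1}" "\<bar>s - s0\<bar> < r/2" for s
   proof (intro ctrans_local[OF V(1)])
    fix u assume "u \<in> {x..y}"
    hence "\<bar>u - t\<bar> < r/2" "u \<in> {0..1}"
     using xy by (auto simp: abs_if)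
    thus "h (s, u) \<in> V" using inV that by blast
   qed (use xy in auto)
   show "Q x y (r/2)"
    unfolding Q_def
   proof (intro ballI impI)
     fix s assume s: "s \<in> {0..1}" "\<bar>s - s0\<bar> < r/2"
     have "h (s, x) \<in> V" "h (s, y) \<in> V" "h (s0, x) \<in> V" "h (s0, y) \<in> V"
      using s s0 xy V(2) by (auto intro!: inV)
     thus "\<kappa> (h (s0, x)) (h (s, x)) + ctrans \<kappa> (\<lambda>t. h (s, t)) x y = ctrans \<kappa> (\<lambda>t. h (s0, t)) x y + \<kappa> (h (s0, y)) (h (s, y))"
      using tr[OF s] tr[OF s0] V(2) by (simp add: coc[OF V(1)])
   qed
  qed (use V in auto)
 qed simp
 thus ?thesis unfolding Q_def by simp
qed

lemma ctrans_path_hom: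
 assumes "path_hom T x y p q"
 shows "ctrans \<kappa> p 0 1 = ctrans \<kappa> q 0 1"
proof -
 obtain h where h: "cont_on ({0..1::real} \<times> {0..1::real}) T h"
   "\<forall>t\<in>{0..1}. h (0, t) = p t & h (1, t) = q t & h (t, 0) = x & h (t, 1) = y"
  using assms(1) unfolding path_hom_iff by blast
 have xy: "\<kappa> x x = 0" "\<kappa> y y = 0"
  using joins_in path_hom_imp[OF assms] refl0_topspace by metis+
 let ?\<tau> = "\<lambda>s. ctrans \<kappa> (\<lambda>t. h (s, t)) 0 1"
 have "0 <= (0::real) & 1 <= (1::real) --> ?\<tau> 0 = ?\<tau> 1"
 proof (rule Bolzano[where P="\<lambda>x y. 0 <= x & y <= 1 --> ?\<tau> x = ?\<tau> y"])
  fix s :: real assume s: "0 <= s" "s <= 1"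
  then obtain d where d: "d > 0" "\<And>s'. s' \<in> {0..1} ==> \<bar>s' - s\<bar> < d ==>
   \<kappa> (h (s, 0)) (h (s', 0)) + ?\<tau> s' = ?\<tau> s + \<kappa> (h (s, 1)) (h (s', 1))"
   using ctrans_homotopy_step[OF h(1), of s] by auto
  have ends: "h (u, 0) = x" "h (u, 1) = y" if "u \<in> {0..1}" for u
   using h(2) that by auto
  have eq: "?\<tau> s' = ?\<tau> s" if "s' \<in> {0..1}" "\<bar>s' - s\<bar> < d" for s'
   using d(2)[OF that] ends[OF that(1)] ends[of s] s xy by simp
  show "\<exists>d>0. \<forall>x y. x <= s & s <= y & y - x < d --> (0 <= x & y <= 1 --> ?\<tau> x = ?\<tau> y)"
  proof (intro exI[of _ d] conjI allI impI)
   fix x y assume "x <= s & s <= y & y - x < d" "0 <= x & y <= 1"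
   thus "?\<tau> x = ?\<tau> y" using eq[of x] eq[of y] by simp
  qed (rule d(1))
 qed auto
 moreover have "?\<tau> 0 = ctrans \<kappa> p 0 1" "?\<tau> 1 = ctrans \<kappa> q 0 1"
  using h(2) by (auto intro!: ctrans_cong)
 ultimately show ?thesis by simp
qed

lemma ctrans_concat:
 assumes p: "joins T x y p" and q: "joins T y z q"
 shows "ctrans \<kappa> (p @@ q) 0 1 = ctrans \<kappa> p 0 1 + ctrans \<kappa> q 0 1"
proof -
 have "ctrans \<kappa> (p @@ q) 0 1 = ctrans \<kappa> (p @@ q) 0 (1/2) + ctrans \<kappa> (p @@ q) (1/2) 1"
  using joins_concat[OF p q] by (intro ctrans_join) (auto simp: joins_def pathin_def)
 also have "ctrans \<kappa> (p @@ q) 0 (1/2) = ctrans \<kappa> (\<lambda>t. p (2 * t)) 0 (1/2)"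
  by (rule ctrans_cong) (auto simp: path_concat_def)
 also have "\<dots> = ctrans \<kappa> p 0 1"
  using p by (intro ctrans_reparam) (auto simp: joins_def pathin_def intro!: continuous_intros)
 also have "ctrans \<kappa> (p @@ q) (1/2) 1 = ctrans \<kappa> (\<lambda>t. q (2 * t - 1)) (1/2) 1"
 proof (rule ctrans_cong)
  fix t :: real assume "1/2 <= t" "t <= 1"
  thus "(p @@ q) t = q (2 * t - 1)"
  proof (cases "t = 1/2")
   case True
   show ?thesis unfolding True using p q by (simp add: path_concat_def joins_def)
  qed (simp add: path_concat_def)
 qed
 also have "\<dots> = ctrans \<kappa> q 0 1"
  using q by (intro ctrans_reparam) (auto simp: joins_def pathin_def intro!: continuous_intros)
 finally show ?thesis .
qed

lemma ctrans_const: "x \<in> topspace T ==> ctrans \<kappa> (\<lambda>_. x) a b = 0" if "a <= b"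
 using that by (intro ctrans_zero) (auto simp: refl0_topspace)

lemma ctrans_rev:
 assumes p: "joins T x y p"
 shows "ctrans \<kappa> (rev_path p) 0 1 = - ctrans \<kappa> p 0 1"
proof -
 have "ctrans \<kappa> p 0 1 + ctrans \<kappa> (rev_path p) 0 1 = ctrans \<kappa> (\<lambda>_. x) 0 1"
  using ctrans_path_hom[OF path_hom_inv_right[OF p]] ctrans_concat[OF p joins_rev[OF p]] by simp
 also have "\<dots> = 0" using joins_in[OF p] by (intro ctrans_const) auto
 finally show ?thesis by (metis minus_unique)
qed

lemma ctrans_conj_loop:
 assumes "joins T x y \<alpha>" "joins T y y m"
 shows "ctrans \<kappa> (conj_loop \<alpha> m) 0 1 = ctrans \<kappa> \<alpha> 0 1 + ctrans \<kappa> m 0 1 - ctrans \<kappa> \<alpha> 0 1"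
 using ctrans_concat[OF joins_concat[OF assms] joins_rev[OF assms(1)]]
  ctrans_concat[OF assms] ctrans_rev[OF assms(1)]
 by (simp add: conj_loop_def)

end

subsection \<open>Words read off from circle-valued maps\<close>

text \<open>At each point at most one coordinate differs from 1, as in spaces whose circles meet
  only in base points. Stated abstractly so that words in E(X,D) and in the Hawaiian earring arise
  from one construction.\<close>

definition circle_system :: "'t topology => 's set => ('s => 't => complex) => bool" where
 "circle_system T S q \<longleftrightarrow>
  (\<forall>s\<in>S. continuous_map T (top_of_set (sphere 0 1)) (q s)) &
  (\<forall>P\<in>topspace T. \<forall>s\<in>S. \<forall>s'\<in>S. q s P ~= 1 & q s' P ~= 1 --> s = s')"

text \<open>Both points lie in the left half of circle \<open>s\<close> and on different sides of
  -1, the antipode of the base value 1; the point -1 itself counts as upper. A counterclockwise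
  passage starts in the upper half, so the side of the first point gives the sign of the
  letter.\<close>

definition crosses :: "'s set => ('s => 't => complex) => 's => 't => 't => bool" where
 "crosses S q s P Q \<longleftrightarrow> s \<in> S & Re (q s P) < 0 & Re (q s Q) < 0 & (0 <= Im (q s P)) ~= (0 <= Im (q s Q))"

text \<open>Two nearby points contribute a letter when they lie on different sides of the antipode of
 the base point of a circle.\<close>

definition cross_letter :: "'s set => ('s => 't => complex) => 't => 't => 's fg" where
 "cross_letter S q P Q = (if \<exists>!s. crosses S q s P Q
   then let s = THE s. crosses S q s P Q in fg_of [(s, 0 <= Im (q s P))] else 0)"

definition word_along :: "'s set => ('s => 't => complex) => (real => 't) => real => real => 's fg" where
 "word_along S q = ctrans (cross_letter S q)"

lemma cross_letter_0: "(\<And>s. \<not> crosses S q s P Q) ==> cross_letter S q P Q = 0"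
 by (auto simp: cross_letter_def)

lemma circle_system_norm: "circle_system T S q ==> P \<in> topspace T ==> s \<in> S ==> norm (q s P) = 1"
 unfolding circle_system_def using continuous_map_image_subset_topspace by fastforce

lemma circle_system_subset: "circle_system T S q ==> S' \<subseteq> S ==> circle_system T S' q"
 unfolding circle_system_def by (meson subsetD)

lemma circle_system_unique:
 "circle_system T S q ==> P \<in> topspace T ==> s \<in> S ==> s' \<in> S ==> q s P ~= 1 ==> q s' P ~= 1 ==> s = s'"
 unfolding circle_system_def by meson

lemma crossesD:
 "crosses S q s P Q ==> s \<in> S" "crosses S q s P Q ==> q s P ~= 1" "crosses S q s P Q ==> q s Q ~= 1"
 by (auto simp: crosses_def)

lemma crosses_unique:
 "circle_system T S q ==> P \<in> topspace T ==> crosses S q s P Q ==> crosses S q s' P Q' ==> s = s'"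
 by (rule circle_system_unique) (auto dest: crossesD)

lemma cross_letter_eq:
 assumes "circle_system T S q" "P \<in> topspace T" "crosses S q s P Q"
 shows "cross_letter S q P Q = fg_of [(s, 0 <= Im (q s P))]"
proof -
 have "s' = s" if "crosses S q s' P Q" for s'
  by (rule crosses_unique[OF assms(1,2) that assms(3)])
 hence "\<exists>!s. crosses S q s P Q" "(THE s. crosses S q s P Q) = s" using assms(3) by blast+
 thus ?thesis by (simp add: cross_letter_def)
qed

lemma cross_letter_cases:
 assumes "circle_system T S q" "P \<in> topspace T"
 obtains "\<And>s. \<not> crosses S q s P Q" "cross_letter S q P Q = 0" |
  s where "crosses S q s P Q" "cross_letter S q P Q = fg_of [(s, 0 <= Im (q s P))]"
 using cross_letter_eq[OF assms] cross_letter_0 by metis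

lemma fg_keep_cross_letter:
 assumes "circle_system T S q" "P \<in> topspace T"
 shows "fg_keep A (cross_letter S q P Q) = cross_letter (S \<inter> A) q P Q"
proof (rule cross_letter_cases[OF assms, of Q])
 assume *: "\<And>s. \<not> crosses S q s P Q" "cross_letter S q P Q = 0"
 hence "cross_letter (S \<inter> A) q P Q = 0"
  by (intro cross_letter_0) (auto simp: crosses_def)
 thus ?thesis using * by simp
next
 fix s assume *: "crosses S q s P Q" "cross_letter S q P Q = fg_of [(s, 0 <= Im (q s P))]"
 show ?thesis
 proof (cases "s \<in> A")
  case True
  hence "crosses (S \<inter> A) q s P Q" using *(1) by (simp add: crosses_def)
  hence "cross_letter (S \<inter> A) q P Q = fg_of [(s, 0 <= Im (q s P))]"
   using cross_letter_eq[OF circle_system_subset[OF assms(1)] assms(2)] by blast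
  thus ?thesis using * True by (simp add: fg_keep_of)
 next
  case False
  have "\<not> crosses (S \<inter> A) q s' P Q" for s'
  proof
   assume "crosses (S \<inter> A) q s' P Q"
   hence "s' \<in> A" "crosses S q s' P Q" by (auto simp: crosses_def)
   moreover from this have "s = s'"
    using crosses_unique[OF assms(1,2) *(1)] by simp
   ultimately show False using False by simp
  qed
  thus ?thesis using * False by (simp add: fg_keep_of cross_letter_0)
 qed
qed

text \<open>Letters arise only inside a left half circle; in the other members of the cover no two
  points are separated by an antipode. The first member is open because \<open>S\<close> is
  finite.\<close>

definition circle_cover :: "'t topology => 's set => ('s => 't => complex) => 't set set" where
 "circle_cover T S q = insert {P \<in> topspace T. \<forall>s\<in>S. 0 < Re (q s P)}
   ((\<lambda>s. {P \<in> topspace T. Re (q s P) < 0}) ` S \<union> (\<lambda>s. {P \<in> topspace T. 0 < Im (q s P)}) ` S \<union>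
   (\<lambda>s. {P \<in> topspace T. Im (q s P) < 0}) ` S)"

lemma cocycle_cross_letter:
 assumes sys: "circle_system T S q" and fin: "finite S"
 shows "cocycle T (circle_cover T S q) (cross_letter S q)"
proof
 have cont: "continuous_map T euclidean (q s)" if "s \<in> S" for s
  using sys that by (auto simp: circle_system_def continuous_map_in_subtopology)
 have Re: "continuous_map T euclideanreal (\<lambda>P. Re (q s P))" and Im: "continuous_map T euclideanreal (\<lambda>P. Im (q s P))"
  if "s \<in> S" for s
  using continuous_map_compose[OF cont[OF that], of euclideanreal Re]
   continuous_map_compose[OF cont[OF that], of euclideanreal Im]
  by (auto simp: o_def linear_continuous_on[OF bounded_linear_Re] linear_continuous_on[OF bounded_linear_Im])
 have op: "openin T {P \<in> topspace T. f P \<in> U}" if "continuous_map T euclideanreal f" "open U" for f U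
  using openin_continuous_map_preimage[OF that(1)] that(2) by auto
 show "openin T V" if V: "V \<in> circle_cover T S q" for V
 proof -
  have "openin T {P \<in> topspace T. \<forall>s\<in>S. 0 < Re (q s P)}"
  proof (cases "S = {}")
   case False
   have "{P \<in> topspace T. \<forall>s\<in>S. 0 < Re (q s P)} = (\<Inter>s\<in>S. {P \<in> topspace T. Re (q s P) \<in> {0<..}})"
    using False by auto
   also have "openin T \<dots>"
    using False fin op[OF Re, of _ "{0<..}"] by (intro openin_INT2) auto
   finally show ?thesis .
  qed simp
  moreover have "openin T {P \<in> topspace T. Re (q s P) < 0}" "openin T {P \<in> topspace T. 0 < Im (q s P)}"
   "openin T {P \<in> topspace T. Im (q s P) < 0}" if "s \<in> S" for s
   using op[OF Re[OF that], of "{..<0}"] op[OF Im[OF that], of "{0<..}"] op[OF Im[OF that], of "{..<0}"] by auto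
  ultimately show ?thesis using V by (auto simp: circle_cover_def)
 qed
 show "topspace T \<subseteq> \<Union> (circle_cover T S q)"
 proof
  fix P assume P: "P \<in> topspace T"
  show "P \<in> \<Union> (circle_cover T S q)"
  proof (cases "\<forall>s\<in>S. 0 < Re (q s P)")
   case True
   thus ?thesis using P by (auto simp: circle_cover_def)
  next
   case False
   then obtain s where s: "s \<in> S" "Re (q s P) <= 0" by force
   have "Re (q s P) < 0 \<or> 0 < Im (q s P) \<or> Im (q s P) < 0"
   proof (rule ccontr)
    assume "\<not> ?thesis"
    hence "q s P = 0" using s by (auto simp: complex_eq_iff)
    thus False using circle_system_norm[OF sys P s(1)] by simp
   qed
   moreover have "{P \<in> topspace T. Re (q s P) < 0} \<in> circle_cover T S q"
    "{P \<in> topspace T. 0 < Im (q s P)} \<in> circle_cover T S q"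
    "{P \<in> topspace T. Im (q s P) < 0} \<in> circle_cover T S q"
    using s(1) by (auto simp: circle_cover_def)
   ultimately show ?thesis using P by (elim disjE) (rule UnionI, assumption, simp)+
  qed
 qed
 fix V P Q R assume V: "V \<in> circle_cover T S q" and PQR: "P \<in> V" "Q \<in> V" "R \<in> V"
 have top: "P \<in> topspace T" "Q \<in> topspace T" "R \<in> topspace T"
  using V PQR by (auto simp: circle_cover_def)
 show "cross_letter S q P Q + cross_letter S q Q R = cross_letter S q P R"
 proof (cases "\<exists>s\<in>S. V = {P \<in> topspace T. Re (q s P) < 0}")
  case True
  then obtain s where s: "s \<in> S" "V = {P \<in> topspace T. Re (q s P) < 0}" by blast
  \<comment> \<open>On the left half of circle \<open>s\<close> no other circle can be crossed, and
    the letter depends only on the sides of the two points. Additivity becomes the cancellation of a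
    letter with its inverse.\<close>
  have *: "cross_letter S q A B = (if (0 <= Im (q s A)) ~= (0 <= Im (q s B)) then fg_of [(s, 0 <= Im (q s A))] else 0)"
   if "A \<in> V" "B \<in> V" for A B
  proof -
   have neg: "Re (q s A) < 0" "Re (q s B) < 0" "A \<in> topspace T" using that s by auto
   have u: "s' = s" if "crosses S q s' A B" for s'
   proof -
    have "q s A ~= 1" "q s' A ~= 1" "s' \<in> S" using neg that by (auto simp: crosses_def)
    thus ?thesis using circle_system_unique[OF sys neg(3) _ s(1)] by blast
   qed
   show ?thesis
   proof (cases "(0 <= Im (q s A)) ~= (0 <= Im (q s B))")
    case True
    hence "crosses S q s A B" using neg s by (simp add: crosses_def)
    thus ?thesis using cross_letter_eq[OF sys neg(3)] True by auto
   next
    case False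
    hence "\<not> crosses S q s' A B" for s' using u by (auto simp: crosses_def)
    thus ?thesis using False by (simp add: cross_letter_0)
   qed
  qed
  have c: "fg_of [(s, b)] + fg_of [(s, \<not> b)] = 0" for b
   using red_cancel[of "[]" "(s, b)" "[]"] by (simp add: fg_of_append[symmetric] fg_of_eq_0 red_def)
  show ?thesis
   using c[of True] c[of False] by (auto simp: *[OF PQR(1,2)] *[OF PQR(2,3)] *[OF PQR(1,3)])
 next
  case False
  have "\<not> crosses S q s A B" if "A \<in> V" "B \<in> V" for A B s
  proof
   assume c: "crosses S q s A B"
   from V False consider "V = {P \<in> topspace T. \<forall>s\<in>S. 0 < Re (q s P)}"
    | s' where "s' \<in> S" "V = {P \<in> topspace T. 0 < Im (q s' P)}"
    | s' where "s' \<in> S" "V = {P \<in> topspace T. Im (q s' P) < 0}"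
    unfolding circle_cover_def by blast
   thus False
   proof cases
    case 1
    thus ?thesis using c that by (auto simp: crosses_def)
   next
    case 2
    hence "q s' A ~= 1" "q s A ~= 1" "A \<in> topspace T" "s \<in> S" using that c by (auto simp: crosses_def)
    hence "s = s'" using circle_system_unique[OF sys] 2 by blast
    thus ?thesis using c that 2 by (auto simp: crosses_def)
   next
    case 3
    hence "q s' A ~= 1" "q s A ~= 1" "A \<in> topspace T" "s \<in> S" using that c by (auto simp: crosses_def)
    hence "s = s'" using circle_system_unique[OF sys] 3 by blast
    thus ?thesis using c that 3 by (auto simp: crosses_def)
   qed
  qed
  thus ?thesis using PQR by (simp add: cross_letter_0)
 qed
qed

text \<open>The retraction applied to a lift is a lift for the smaller set of circles. So the words
  for different finite sets are compatible.\<close>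

lemma word_along_keep:
 assumes sys: "circle_system T S q" and fin: "finite S"
  and f: "cont_on {a..b} T f" "a <= b"
 shows "fg_keep A (word_along S q f a b) = word_along (S \<inter> A) q f a b"
proof -
 interpret cocycle T "circle_cover T S q" "cross_letter S q" by (rule cocycle_cross_letter[OF sys fin])
 obtain g where g: "clift (cross_letter S q) f a b g" using clift_exists[OF f] by blast
 have top: "f t \<in> topspace T" if "t \<in> {a..b}" for t
  using f(1) that continuous_map_image_subset_topspace by fastforce
 have "clift (cross_letter (S \<inter> A) q) f a b (\<lambda>t. fg_keep A (g t))"
  unfolding clift_def
 proof
  fix t assume "t \<in> {a..b}"
  then obtain d where d: "d > 0" "\<And>s s'. s \<in> {a..b} ==> s' \<in> {a..b} ==> \<bar>s - t\<bar> < d ==> \<bar>s' - t\<bar> < d ==> g s' = g s + cross_letter S q (f s) (f s')"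
   using cliftE[OF g] by blast
  thus "\<exists>\<delta>>0. \<forall>s\<in>{a..b}. \<forall>s'\<in>{a..b}. \<bar>s - t\<bar> < \<delta> & \<bar>s' - t\<bar> < \<delta> -->
    fg_keep A (g s') = fg_keep A (g s) + cross_letter (S \<inter> A) q (f s) (f s')"
   by (intro exI[of _ d]) (metis fg_keep_add fg_keep_cross_letter[OF sys top])
 qed
 thus ?thesis
  unfolding word_along_def using g f(2) by (simp add: ctrans_eq fg_keep_add fg_keep_uminus)
qed

lemma word_along_avoid:
 assumes sys: "circle_system T S q" and fin: "finite S"
  and f: "cont_on {a..b} T f" "a <= b"
  and A: "\<And>t s. t \<in> {a..b} ==> s \<in> S \<inter> A ==> q s (f t) = 1"
 shows "fg_supp (word_along S q f a b) \<subseteq> S - A"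
proof -
 interpret cocycle T "circle_cover T S q" "cross_letter S q" by (rule cocycle_cross_letter[OF sys fin])
 have "word_along S q f a b \<in> {x. fg_supp x \<subseteq> S - A}"
  unfolding word_along_def
 proof (rule ctrans_mem[OF f])
  fix t t' assume t: "t \<in> {a..b}" "t' \<in> {a..b}"
  hence top: "f t \<in> topspace T"
   using f(1) continuous_map_image_subset_topspace by fastforce
  show "cross_letter S q (f t) (f t') \<in> {x. fg_supp x \<subseteq> S - A}"
  proof (rule cross_letter_cases[OF sys top, of "f t'"])
   fix s assume *: "crosses S q s (f t) (f t')" "cross_letter S q (f t) (f t') = fg_of [(s, 0 <= Im (q s (f t)))]"
   hence "s \<in> S - A" using A[OF t(1), of s] by (auto simp: crosses_def)
   thus ?thesis using fg_supp_of_subset[of "[(s, 0 <= Im (q s (f t)))]"] * by auto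
  qed auto
 next
  fix x y assume "x \<in> {x. fg_supp x \<subseteq> S - A}" "y \<in> {x. fg_supp x \<subseteq> S - A}"
  thus "x + y \<in> {x. fg_supp x \<subseteq> S - A}" using fg_supp_add[of x y] by auto
 qed
 thus ?thesis by simp
qed

lemma word_along_trivial:
 assumes "circle_system T S q" "finite S" "cont_on {a..b} T f" "a <= b"
  and "\<And>t s. t \<in> {a..b} ==> s \<in> S ==> q s (f t) = 1"
 shows "word_along S q f a b = 0"
proof -
 have "fg_supp (word_along S q f a b) \<subseteq> S - S"
  by (rule word_along_avoid[OF assms(1-4)]) (use assms(5) in auto)
 thus ?thesis by (auto simp: fg_supp_def)
qed

lemma word_along_circle:
 assumes sys: "circle_system T S q" and fin: "finite S" and s: "s \<in> S"
  and f: "cont_on {a..b} T f" "a < b"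
  and eq: "\<And>t. t \<in> {a..b} ==> q s (f t) = cis ((if \<epsilon> then 1 else -1) * (2 * pi * (t - a) / (b - a)))"
  and others: "\<And>t s'. t \<in> {a..b} ==> s' \<in> S ==> s' ~= s ==> q s' (f t) = 1"
 shows "word_along S q f a b = fg_of [(s, \<epsilon>)]"
proof -
 interpret cocycle T "circle_cover T S q" "cross_letter S q" by (rule cocycle_cross_letter[OF sys fin])
 \<comment> \<open>These times correspond to the angles 3/4 pi and 5/4 pi: the piece between them
   runs through -1 inside the open left half-plane, and the two outer pieces stay off the
   antipode.\<close>
 define c d where "c = a + 3/8 * (b - a)" and "d = a + 5/8 * (b - a)"
 have abcd: "a < c" "c < d" "d < b" using f(2) by (auto simp: c_def d_def field_simps)
 have top: "f t \<in> topspace T" if "t \<in> {a..b}" for t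
  using f(1) that continuous_map_image_subset_topspace by fastforce
 define \<theta> where "\<theta> t = 2 * pi * (t - a) / (b - a)" for t
 have q: "Re (q s (f t)) = cos (\<theta> t)" "Im (q s (f t)) = (if \<epsilon> then 1 else -1) * sin (\<theta> t)" if "t \<in> {a..b}" for t
  using eq[OF that] by (auto simp: \<theta>_def)
 have \<theta>: "\<theta> a = 0" "\<theta> b = 2 * pi" "\<theta> c = 3/4 * pi" "\<theta> d = 5/4 * pi"
  using f(2) by (simp_all add: \<theta>_def c_def d_def divide_simps)
 have mono: "\<theta> t <= \<theta> t'" if "t <= t'" for t t'
  using that f(2) unfolding \<theta>_def by (intro divide_right_mono mult_left_mono) auto
 have only: "s' = s" if "crosses S q s' (f t) P" "t \<in> {a..b}" for s' t P
  using others[OF that(2), of s'] that(1) by (auto simp: crosses_def)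
 have split: "word_along S q f a b = word_along S q f a c + (word_along S q f c d + word_along S q f d b)"
  unfolding word_along_def
  using ctrans_join[OF f(1), of c] ctrans_join[of c b f d] abcd continuous_map_from_subtopology_mono[OF f(1), of "{c..b}"]
  by simp
 have zero: "word_along S q f x y = 0" if xy: "a <= x" "x <= y" "y <= b" and
  sg: "(\<forall>t\<in>{x..y}. 0 <= cos (\<theta> t) \<or> 0 < sin (\<theta> t)) \<or> (\<forall>t\<in>{x..y}. 0 <= cos (\<theta> t) \<or> sin (\<theta> t) < 0)" for x y
 proof -
  have "cross_letter S q (f t) (f t') = 0" if t: "t \<in> {x..y}" "t' \<in> {x..y}" for t t'
  proof (rule cross_letter_0)
   fix s'
   have tt: "t \<in> {a..b}" "t' \<in> {a..b}" using t xy by auto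
   have "\<not> crosses S q s (f t) (f t')"
   proof -
    have "((0 <= cos (\<theta> t) \<or> 0 < sin (\<theta> t)) & (0 <= cos (\<theta> t') \<or> 0 < sin (\<theta> t'))) \<or>
      ((0 <= cos (\<theta> t) \<or> sin (\<theta> t) < 0) & (0 <= cos (\<theta> t') \<or> sin (\<theta> t') < 0))"
     using sg t by meson
    thus ?thesis unfolding crosses_def q[OF tt(1)] q[OF tt(2)] by (cases \<epsilon>) auto
   qed
   thus "\<not> crosses S q s' (f t) (f t')" using only[of s' t "f t'"] tt by auto
  qed
  thus ?thesis unfolding word_along_def using xy by (intro ctrans_zero) auto
 qed
 have "word_along S q f a c = 0"
 proof (rule zero)
  have "0 <= cos (\<theta> t) \<or> 0 < sin (\<theta> t)" if "t \<in> {a..c}" for t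
  proof (cases "\<theta> t = 0")
   case False
   have "0 <= \<theta> t" "\<theta> t <= 3/4 * pi" using mono[of a t] mono[of t c] \<theta> that by auto
   hence "0 < \<theta> t" "\<theta> t < pi" using False pi_gt_zero by linarith+
   thus ?thesis using sin_gt_zero by blast
  qed simp
  thus "(\<forall>t\<in>{a..c}. 0 <= cos (\<theta> t) \<or> 0 < sin (\<theta> t)) \<or> (\<forall>t\<in>{a..c}. 0 <= cos (\<theta> t) \<or> sin (\<theta> t) < 0)" by blast
 qed (use abcd in auto)
 moreover have "word_along S q f d b = 0"
 proof (rule zero)
  have "0 <= cos (\<theta> t) \<or> sin (\<theta> t) < 0" if "t \<in> {d..b}" for t
  proof (cases "\<theta> t = 2 * pi")
   case False
   have "5/4 * pi <= \<theta> t" "\<theta> t <= 2 * pi" using mono[of d t] mono[of t b] \<theta> that by auto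
   hence "pi < \<theta> t" "\<theta> t < 2 * pi" using False pi_gt_zero by linarith+
   thus ?thesis using sin_lt_zero by blast
  qed simp
  thus "(\<forall>t\<in>{d..b}. 0 <= cos (\<theta> t) \<or> 0 < sin (\<theta> t)) \<or> (\<forall>t\<in>{d..b}. 0 <= cos (\<theta> t) \<or> sin (\<theta> t) < 0)" by blast
 qed (use abcd in auto)
 moreover have "word_along S q f c d = fg_of [(s, \<epsilon>)]"
 proof -
  have neg: "Re (q s (f t)) < 0" if "t \<in> {c..d}" for t
  proof -
   have "3/4 * pi <= \<theta> t" "\<theta> t <= 5/4 * pi" using mono[of c t] mono[of t d] \<theta> that by auto
   hence "0 < cos (\<theta> t - pi)" by (intro cos_gt_zero_pi) (use pi_gt_zero in linarith)+
   thus ?thesis using q(1)[of t] that abcd by (simp add: cos_diff)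
  qed
  have "word_along S q f c d = cross_letter S q (f c) (f d)"
   unfolding word_along_def
  proof (rule ctrans_local)
   show "{P \<in> topspace T. Re (q s P) < 0} \<in> circle_cover T S q" using s by (auto simp: circle_cover_def)
   show "f t \<in> {P \<in> topspace T. Re (q s P) < 0}" if "t \<in> {c..d}" for t
    using neg[OF that] top[of t] that abcd by auto
  qed (use abcd in auto)
  moreover have sn: "0 < sin (\<theta> c)" "sin (\<theta> d) < 0"
   unfolding \<theta> by (intro sin_gt_zero sin_lt_zero; use pi_gt_zero in linarith)+
  have "crosses S q s (f c) (f d)"
   using s neg[of c] neg[of d] abcd sn unfolding crosses_def by (auto simp: q)
  hence "cross_letter S q (f c) (f d) = fg_of [(s, \<epsilon>)]"
   using cross_letter_eq[OF sys top, of c s "f d"] abcd sn by (auto simp: q)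
  ultimately show ?thesis by simp
 qed
 ultimately show ?thesis using split by simp
qed

section \<open>Null homotopies from laminations\<close>

context Metric_space
begin

lemma continuous_map_eu_metric:
 fixes S :: "'b::metric_space set"
 shows "cont_on S mtopology f \<longleftrightarrow>
  (\<forall>x\<in>S. f x \<in> M & (\<forall>\<epsilon>>0. \<exists>\<delta>>0. \<forall>w\<in>S. dist w x < \<delta> --> f w \<in> M & d (f x) (f w) < \<epsilon>))" (is "?l = ?r")
proof
 assume l: ?l
 show ?r
 proof (intro ballI conjI allI impI)
  fix x assume x: "x \<in> S"
  show xM: "f x \<in> M" using l x continuous_map_image_subset_topspace by fastforce
  fix \<epsilon> :: real assume "\<epsilon> > 0"
  have "openin (top_of_set S) {w \<in> topspace (top_of_set S). f w \<in> mball (f x) \<epsilon>}"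
   by (rule openin_continuous_map_preimage[OF l]) simp
  moreover have "x \<in> {w \<in> topspace (top_of_set S). f w \<in> mball (f x) \<epsilon>}" using x xM \<open>\<epsilon> > 0\<close> by simp
  ultimately obtain \<delta> where "\<delta> > 0" "\<forall>w\<in>S. dist w x < \<delta> --> w \<in> {w \<in> topspace (top_of_set S). f w \<in> mball (f x) \<epsilon>}"
   unfolding openin_euclidean_subtopology_iff by blast
  thus "\<exists>\<delta>>0. \<forall>w\<in>S. dist w x < \<delta> --> f w \<in> M & d (f x) (f w) < \<epsilon>" by auto
 qed
next
 assume r: ?r
 show ?l
  unfolding continuous_map_to_metric
 proof (intro ballI allI impI)
  fix x \<epsilon> assume "x \<in> topspace (top_of_set S)" "(\<epsilon>::real) > 0"
  hence x: "x \<in> S" and "\<epsilon> > 0" by simp_all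
  hence "f x \<in> M & (\<exists>\<delta>>0. \<forall>w\<in>S. dist w x < \<delta> --> f w \<in> M & d (f x) (f w) < \<epsilon>)"
   using r by meson
  then obtain \<delta> where *: "x \<in> S" "f x \<in> M" "\<delta> > 0" "\<forall>w\<in>S. dist w x < \<delta> --> f w \<in> M & d (f x) (f w) < \<epsilon>"
   using x by blast
  show "\<exists>U. openin (top_of_set S) U & x \<in> U & (\<forall>y\<in>U. f y \<in> mball (f x) \<epsilon>)"
   by (rule exI[of _ "S \<inter> ball x \<delta>"]) (use * in \<open>auto simp: dist_commute\<close>)
 qed
qed

text \<open>One good index per sequence is enough, because a discontinuity produces a sequence all
  of whose terms are bad. This spares the passage to subsequences in applications.\<close>

lemma continuous_map_eu_seqI:
 fixes S :: "'b::metric_space set"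
 assumes "\<And>x. x \<in> S ==> f x \<in> M"
  and "\<And>x s \<epsilon>. x \<in> S ==> (\<And>k. s k \<in> S) ==> s \<longlonglongrightarrow> x ==> \<epsilon> > 0 ==> \<exists>k. d (f x) (f (s k)) < \<epsilon>"
 shows "cont_on S mtopology f"
 unfolding continuous_map_eu_metric
proof (intro ballI conjI allI impI)
 fix x \<epsilon> assume x: "x \<in> S" and e: "(\<epsilon>::real) > 0"
 show "\<exists>\<delta>>0. \<forall>w\<in>S. dist w x < \<delta> --> f w \<in> M & d (f x) (f w) < \<epsilon>"
 proof (rule ccontr)
  assume "\<not> ?thesis"
  hence "\<forall>\<delta>>0. \<exists>w\<in>S. dist w x < \<delta> & \<not> d (f x) (f w) < \<epsilon>" using assms(1) by blast
  hence "\<forall>k. \<exists>w. w \<in> S & dist w x < 1 / Suc k & \<not> d (f x) (f w) < \<epsilon>"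
   by (metis of_nat_0_less_iff zero_less_Suc zero_less_divide_1_iff)
  then obtain s where s: "\<And>k. s k \<in> S" "\<And>k. dist (s k) x < 1 / Suc k" "\<And>k. \<not> d (f x) (f (s k)) < \<epsilon>"
   by metis
  have "(\<lambda>k. dist (s k) x) \<longlonglongrightarrow> 0"
   by (rule real_tendsto_sandwich[OF _ _ tendsto_const lim_1_over_n[THEN LIMSEQ_Suc]])
    (use s(2) in \<open>auto simp: less_imp_le eventually_sequentially\<close>)
  hence "s \<longlonglongrightarrow> x" by (rule iffD2[OF tendsto_dist_iff])
  thus False using assms(2)[of x s, OF x s(1) _ e] s(3) by blast
 qed
qed (use assms in auto)

lemma continuous_map_eu_tendsto:
 fixes S :: "'b::metric_space set"
 assumes "cont_on S mtopology f" "x \<in> S" "\<And>k. s k \<in> S" "s \<longlonglongrightarrow> x"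
 shows "(\<lambda>k. d (f (s k)) (f x)) \<longlonglongrightarrow> 0"
proof (rule LIMSEQ_I)
 fix r :: real assume "r > 0"
 then obtain \<delta> where \<delta>: "\<delta> > 0" "\<forall>w\<in>S. dist w x < \<delta> --> d (f x) (f w) < r"
  using assms(1,2) unfolding continuous_map_eu_metric by meson
 then obtain K where "\<forall>k\<ge>K. dist (s k) x < \<delta>" using assms(4) unfolding lim_sequentially by blast
 thus "\<exists>K. \<forall>k\<ge>K. norm (d (f (s k)) (f x) - 0) < r"
  using \<delta> assms(3) by (intro exI[of _ K]) (simp add: commute[of "f x"])
qed

definition null_hom_on :: "real => real => (real => 'a) => (real \<times> real => 'a) => bool" where
 "null_hom_on u v p h \<longleftrightarrow> cont_on ({0..1} \<times> {u..v}) mtopology h &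
  (\<forall>t\<in>{u..v}. h (0, t) = p t & h (1, t) = p u) & (\<forall>s\<in>{0..1}. h (s, u) = p u & h (s, v) = p u)"

text \<open>The height \<open>\<sigma>\<close> of the filling at \<open>(x, y)\<close> is governed by the distance to the set of pairs
 bounding an interval on which the loop is constant, so that the filling is constant over such intervals.\<close>

lemma triangle_filling:
 assumes uv: "u < v" and h: "null_hom_on u v p h" and p: "cont_on {u..v} mtopology p"
 obtains H where "cont_on {(x, y). u <= x & x <= y & y <= v} mtopology H"
  "\<And>y. u <= y ==> y <= v ==> H (u, y) = p u" "\<And>x. u <= x ==> x <= v ==> H (x, v) = p u"
  "\<And>x y. u <= x ==> x <= y ==> y <= v ==> (\<And>t. t \<in> {x..y} ==> p t = p x) ==> H (x, y) = p x"
  "\<And>x y. u <= x ==> x <= y ==> y <= v ==> H (x, y) \<in> h ` ({0..1} \<times> {u..v})"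
proof -
 define D where "D = {(x, y). u <= x & x <= y & y <= v}"
 have D_iff [simp]: "z \<in> D \<longleftrightarrow> u <= fst z & fst z <= snd z & snd z <= v" for z
  by (auto simp: D_def)
 define N where "N = {z \<in> D. \<forall>t\<in>{fst z..snd z}. p t = p (fst z)}"
 have ND: "p t = p (fst z)" if "z \<in> N" "t \<in> {fst z..snd z}" for z t
  using that unfolding N_def by blast
 have hu: "\<And>t. t \<in> {u..v} ==> h (0, t) = p t" "\<And>t. t \<in> {u..v} ==> h (1, t) = p u"
  "\<And>s. s \<in> {0..1} ==> h (s, u) = p u" "\<And>s. s \<in> {0..1} ==> h (s, v) = p u"
  using h unfolding null_hom_on_def by blast+
 have pM: "p t \<in> M" if "t \<in> {u..v}" for t
  using p that unfolding continuous_map_eu_metric by blast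
 have lv: "p v = p u" using hu(1)[of v] hu(4)[of 0] uv by simp
 have Dc: "closed D"
  unfolding D_def by (simp add: case_prod_unfold) (intro closed_Collect_conj closed_Collect_le continuous_intros)
 have "closed N"
  unfolding closed_sequential_limits
 proof (intro allI impI, elim conjE)
  fix z and l :: "real \<times> real" assume z: "\<forall>n. z n \<in> N" and lim: "z \<longlonglongrightarrow> l"
  have lD: "l \<in> D" by (rule closed_sequentially[OF Dc _ lim]) (use z in \<open>simp add: N_def\<close>)
  have "p t = p (fst l)" if t: "t \<in> {fst l..snd l}" for t
  proof -
   let ?x = "\<lambda>n. fst (z n)" and ?s = "\<lambda>n. max (fst (z n)) (min t (snd (z n)))"
   have zn: "u <= fst (z n)" "fst (z n) <= snd (z n)" "snd (z n) <= v" for n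
    using z by (auto simp: N_def)
   have "?s \<longlonglongrightarrow> max (fst l) (min t (snd l))" by (intro tendsto_intros lim)
   hence s: "?s \<longlonglongrightarrow> t" using t by (simp add: max_def min_def split: if_splits)
   have x: "?x \<longlonglongrightarrow> fst l" by (intro tendsto_intros lim)
   have sin: "?s n \<in> {fst (z n)..snd (z n)}" for n using zn[of n] by auto
   have "(\<lambda>n. d (p (?s n)) (p t)) \<longlonglongrightarrow> 0"
    using lD t zn sin by (intro continuous_map_eu_tendsto[OF p _ _ s]) (auto, (meson order_trans max.cobounded1)+)
   moreover have "(\<lambda>n. d (p (?x n)) (p (fst l))) \<longlonglongrightarrow> 0"
    using lD zn by (intro continuous_map_eu_tendsto[OF p _ _ x]) (auto intro: order_trans)
   moreover have "p (?s n) = p (?x n)" for n using z sin[of n] unfolding N_def by blast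
   ultimately have "(\<lambda>n. d (p (?x n)) (p t) + d (p (?x n)) (p (fst l))) \<longlonglongrightarrow> 0 + 0"
    by (intro tendsto_add) simp_all
   hence lim0: "(\<lambda>n. d (p (?x n)) (p t) + d (p (?x n)) (p (fst l))) \<longlonglongrightarrow> 0" by simp
   have tM: "p t \<in> M" "p (fst l) \<in> M" "p (?x n) \<in> M" for n
    using pM[of t] pM[of "fst l"] pM[of "?x n"] t lD zn[of n] by auto
   have "d (p t) (p (fst l)) <= d (p (?x n)) (p t) + d (p (?x n)) (p (fst l))" for n
    using triangle[of "p t" "p (?x n)" "p (fst l)"] tM commute[of "p t"] by simp
   hence "d (p t) (p (fst l)) <= 0"
    using LIMSEQ_le_const[OF lim0] by blast
   thus ?thesis using tM nonneg[of "p t" "p (fst l)"] zero by (metis order_antisym)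
  qed
  thus "l \<in> N" using lD unfolding N_def by blast
 qed
 moreover have "(u, u) \<in> N" using uv by (auto simp: N_def)
 ultimately have zN: "infdist z N = 0 \<longleftrightarrow> z \<in> N" for z
  using in_closed_iff_infdist_zero[of N z] by blast
 define \<delta> where "\<delta> z = infdist z N" for z
 show ?thesis
 proof (cases "(u, v) \<in> N")
  case True
  have c: "p t = p u" if "t \<in> {u..v}" for t using ND[OF True, of t] that by simp
  have M: "p u \<in> M" using pM uv by simp
  show ?thesis
  proof (rule that[of "\<lambda>_. p u"])
   show "p u = p x" if "u <= x" "x <= y" "y <= v" for x y
    using c[of x] that by simp
   show "p u \<in> h ` ({0..1} \<times> {u..v})"
    by (rule image_eqI[of _ h "(0,u)"]) (use hu(3)[of 0] uv in simp_all)
   show "cont_on {(x, y). u <= x & x <= y & y <= v} mtopology (\<lambda>_. p u)"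
    using M by simp
  qed (rule refl)+
 next
  case False
  define D0 where "D0 = \<delta> (u, v)"
  have D0: "D0 > 0" using False zN[of "(u,v)"] infdist_nonneg[of "(u,v)" N] by (simp add: D0_def \<delta>_def)
  \<comment> \<open>\<sigma> vanishes on \<open>N\<close>, where the filling must have the values of
    \<open>p\<close>, and reaches 1 at distance \<open>D0 / 2\<close>, where \<open>h\<close> is
    constant; the constant then extends the filling over the corner (u, v).\<close>
  define \<sigma> where "\<sigma> z = min 1 (2 * \<delta> z / D0)" for z
  \<comment> \<open>A point of [x, y] that equals u for x = u and, away from that leg, v for y = v,
    so both legs of the triangle go to the ends of the loop. The weight degenerates only at the
    corner (u, v), which lies in the constant region.\<close>
  define \<tau> where "\<tau> z = fst z + (snd z - fst z) * ((fst z - u) / ((fst z - u) + (v - snd z)))" for z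
  define H where "H z = (if \<delta> z <= D0 / 2 then h (\<sigma> z, \<tau> z) else p u)" for z
  have d0: "\<delta> z >= 0" for z by (simp add: \<delta>_def infdist_nonneg)
  have \<sigma>: "\<sigma> z \<in> {0..1}" for z using d0[of z] D0 by (simp add: \<sigma>_def)
  have \<tau>: "\<tau> z \<in> {fst z..snd z}" if "z \<in> D" for z
  proof -
   have "0 <= (fst z - u) / ((fst z - u) + (v - snd z))" "(fst z - u) / ((fst z - u) + (v - snd z)) <= 1"
    using that by (auto simp: divide_le_eq_1)
   thus ?thesis
    unfolding \<tau>_def using that mult_left_mono[of "(fst z - u) / ((fst z - u) + (v - snd z))" 1 "snd z - fst z"] by auto
  qed
  have cont: "cont_on D mtopology H"
   unfolding H_def
  proof (rule continuous_map_cases_le[where p=\<delta> and q="\<lambda>_. D0/2"])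
   show "cont_on D euclideanreal \<delta>"
    unfolding \<delta>_def by (auto intro!: continuous_intros)
   show "continuous_map (subtopology (top_of_set D) {x \<in> topspace (top_of_set D). \<delta> x <= D0 / 2}) mtopology (\<lambda>z. h (\<sigma> z, \<tau> z))"
    unfolding subtopology_subtopology
   proof (rule continuous_map_compose_eu[where g="\<lambda>z. (\<sigma> z, \<tau> z)"])
    show "cont_on ({0..1} \<times> {u..v}) mtopology h" using h by (simp add: null_hom_on_def)
    have nz: "(fst z - u) + (v - snd z) ~= 0" if "z \<in> D" "\<delta> z <= D0/2" for z
    proof
     assume "(fst z - u) + (v - snd z) = 0"
     hence "z = (u, v)" using that(1) by (cases z) auto
     thus False using that(2) D0 by (simp add: D0_def)
    qed
    show "continuous_on (D \<inter> {x \<in> topspace (top_of_set D). \<delta> x <= D0 / 2}) (\<lambda>z. (\<sigma> z, \<tau> z))"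
     unfolding \<sigma>_def \<tau>_def \<delta>_def
     by (intro continuous_intros) (use D0 nz in \<open>auto simp: \<delta>_def\<close>)
    show "(\<lambda>z. (\<sigma> z, \<tau> z)) ` (D \<inter> {x \<in> topspace (top_of_set D). \<delta> x <= D0 / 2}) \<subseteq> {0..1} \<times> {u..v}"
     using \<sigma> \<tau> by fastforce
   qed
   show "continuous_map (subtopology (top_of_set D) {x \<in> topspace (top_of_set D). D0 / 2 <= \<delta> x}) mtopology (\<lambda>z. p u)"
    using pM[of u] uv by simp
   show "h (\<sigma> z, \<tau> z) = p u" if "z \<in> topspace (top_of_set D)" "\<delta> z = D0 / 2" for z
   proof -
    have "\<sigma> z = 1" using that(2) D0 by (simp add: \<sigma>_def)
    moreover have "\<tau> z \<in> {u..v}" using \<tau>[of z] that(1) by auto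
    ultimately show ?thesis using hu(2) by simp
   qed
  qed simp
  show ?thesis
  proof (rule that[of H])
   show "cont_on {(x, y). u <= x & x <= y & y <= v} mtopology H"
    using cont by (simp add: D_def)
   show "H (u, y) = p u" if "u <= y" "y <= v" for y
   proof -
    have "\<tau> (u, y) = u" by (simp add: \<tau>_def)
    thus ?thesis using hu(3)[OF \<sigma>] by (simp add: H_def)
   qed
   show "H (x, v) = p u" if "u <= x" "x <= v" for x
   proof (cases "x = u")
    case True
    hence "\<tau> (x, v) = u" by (simp add: \<tau>_def)
    thus ?thesis using hu(3)[OF \<sigma>] by (simp add: H_def)
   next
    case False
    hence "\<tau> (x, v) = v" by (simp add: \<tau>_def)
    thus ?thesis using hu(4)[OF \<sigma>] by (simp add: H_def)
   qed
   show "H (x, y) = p x" if "u <= x" "x <= y" "y <= v" "\<And>t. t \<in> {x..y} ==> p t = p x" for x y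
   proof -
    have "(x, y) \<in> D" using that(1-3) by simp
    moreover have "\<forall>t\<in>{fst (x, y)..snd (x, y)}. p t = p (fst (x, y))"
     unfolding fst_conv snd_conv using that(4) by blast
    ultimately have "(x, y) \<in> N" unfolding N_def by blast
    hence d: "\<delta> (x, y) = 0" using zN by (simp add: \<delta>_def)
    have "\<tau> (x, y) \<in> {x..y}" using \<tau>[of "(x,y)"] that(1-3) by simp
    hence "p (\<tau> (x, y)) = p x" "\<tau> (x, y) \<in> {u..v}" using that(4)[of "\<tau> (x, y)"] that(1-3) by simp_all
    thus ?thesis using d D0 hu(1)[of "\<tau> (x, y)"] by (simp add: H_def \<sigma>_def)
   qed
   show "H (x, y) \<in> h ` ({0..1} \<times> {u..v})" if "u <= x" "x <= y" "y <= v" for x y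
   proof -
    have "\<tau> (x, y) \<in> {u..v}" using \<tau>[of "(x,y)"] that by auto
    moreover have "p u = h (1, u)" using hu(3)[of 1] by simp
    ultimately show ?thesis unfolding H_def using \<sigma>[of "(x,y)"] uv by auto
   qed
  qed
 qed
qed

end

section \<open>Laminations of the interval and their gaps\<close>

locale lamination = Metric_space M d for M :: "'a set" and d +
 fixes f :: "real => 'a" and L :: "(real \<times> real) set"
 assumes cont_f: "cont_on {0..1} mtopology f"
  and L_bounds: "(u, v) \<in> L ==> 0 <= u & u <= v & v <= 1"
  and L_closed: "closed L" and L_top: "(0, 1) \<in> L"
  and L_eq: "(u, v) \<in> L ==> f u = f v"
  and L_diag: "0 <= t ==> t <= 1 ==> (t, t) \<in> L"
  and L_noncrossing: "(u, v) \<in> L ==> (u', v') \<in> L ==> u < u' ==> u' < v ==> v' <= v"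
begin

definition encl :: "real \<times> real => real => real => bool" where
 "encl c x y \<longleftrightarrow> fst c <= x & y <= snd c"

definition len :: "real \<times> real => real" where "len c = snd c - fst c"

definition Sub :: "real \<times> real => (real \<times> real) set" where
 "Sub c = {e \<in> L. encl c (fst e) (snd e) & e ~= c}"

text \<open>Geometrically, \<open>c\<close> bounds a complementary region of the lamination from
  above: the chords below it do not accumulate at it.\<close>

definition gap :: "real \<times> real => bool" where
 "gap c \<longleftrightarrow> c \<in> L & fst c < snd c & c \<notin> closure (Sub c)"

text \<open>The lower sides of the gap. A chord is discarded only if another one exceeds it strictly
  at both ends: what remains is a closed condition, so \<open>Maxi c\<close> is compact, and chords
  sharing an end carry the same value of \<open>f\<close> anyway.\<close>

definition Maxi :: "real \<times> real => (real \<times> real) set" where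
 "Maxi c = {e \<in> Sub c. \<forall>e'\<in>Sub c. fst e <= fst e' \<or> snd e' <= snd e}"

text \<open>Shortest rather than minimal under inclusion, so that existence is the attainment of a
  minimum on a compact set.\<close>

definition chord :: "real => real => real \<times> real" where
 "chord x y = (SOME c. c \<in> L & encl c x y & (\<forall>e\<in>L. encl e x y --> len c <= len e))"

text \<open>The boundary loop of the gap, parametrised by the interval under \<open>c\<close> and
  constant across each lower side.\<close>

definition edge :: "real \<times> real => real => 'a" where
 "edge c t = f (fst (SOME e. e \<in> Maxi c & encl e t t))"

lemma L_bounds': "c \<in> L ==> 0 <= fst c & fst c <= snd c & snd c <= 1"
 using L_bounds[of "fst c" "snd c"] by simp

lemma L_fst: "c \<in> L ==> 0 <= fst c & fst c <= 1"
 using L_bounds'[of c] by auto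

lemma L_eq': "c \<in> L ==> f (fst c) = f (snd c)"
 using L_eq[of "fst c" "snd c"] by simp

lemma L_nc: "c \<in> L ==> e \<in> L ==> fst c < fst e ==> fst e < snd c ==> snd e <= snd c"
 using L_noncrossing[of "fst c" "snd c" "fst e" "snd e"] by simp

lemma compact_L: "compact L"
proof -
 have "L \<subseteq> cbox (0, 0) (1, 1)"
  using L_bounds by (fastforce simp: cbox_Pair_eq)
 hence "bounded L" using bounded_cbox bounded_subset by blast
 thus ?thesis using L_closed compact_eq_bounded_closed by blast
qed

lemma fM: "0 <= t ==> t <= 1 ==> f t \<in> M"
 using cont_f unfolding continuous_map_eu_metric by simp

lemma longest:
 assumes "compact K" "K ~= {}"
 shows "\<exists>c\<in>K. \<forall>e\<in>K. len e <= len c" "\<exists>c\<in>K. \<forall>e\<in>K. len c <= len e"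
proof -
 have "continuous_on K len" unfolding len_def by (intro continuous_intros)
 thus "\<exists>c\<in>K. \<forall>e\<in>K. len e <= len c" "\<exists>c\<in>K. \<forall>e\<in>K. len c <= len e"
  using continuous_attains_sup[OF assms] continuous_attains_inf[OF assms] by blast+
qed

lemma closed_encl: "closed {e. encl e x y}" "closed {e. encl c (fst e) (snd e)}"
 unfolding encl_def by (intro closed_Collect_conj closed_Collect_le continuous_intros)+

lemma chord:
 assumes "0 <= x" "x <= y" "y <= 1"
 shows "chord x y \<in> L" "encl (chord x y) x y" "\<And>e. e \<in> L ==> encl e x y ==> len (chord x y) <= len e"
proof -
 have "compact (L \<inter> {e. encl e x y})" by (rule compact_Int_closed[OF compact_L closed_encl(1)])
 moreover have "(0, 1) \<in> L \<inter> {e. encl e x y}" using L_top assms by (simp add: encl_def)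
 ultimately obtain c where "c \<in> L \<inter> {e. encl e x y}" "\<forall>e\<in>L \<inter> {e. encl e x y}. len c <= len e"
  using longest(2)[of "L \<inter> {e. encl e x y}"] by blast
 hence "\<exists>c. c \<in> L & encl c x y & (\<forall>e\<in>L. encl e x y --> len c <= len e)" by blast
 from someI_ex[OF this] show "chord x y \<in> L" "encl (chord x y) x y"
  "\<And>e. e \<in> L ==> encl e x y ==> len (chord x y) <= len e"
  unfolding chord_def[symmetric] by blast+
qed

lemma Sub_L: "e \<in> Sub c ==> e \<in> L" "e \<in> Sub c ==> encl c (fst e) (snd e)" "e \<in> Sub c ==> e ~= c"
 by (auto simp: Sub_def)

lemma len_Sub: "e \<in> Sub c ==> len e < len c"
proof -
 assume e: "e \<in> Sub c"
 hence "fst c <= fst e" "snd e <= snd c" "fst e ~= fst c \<or> snd e ~= snd c"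
  by (auto simp: Sub_def encl_def prod_eq_iff)
 thus ?thesis by (auto simp: len_def)
qed

text \<open>Chords below \<open>c\<close> can accumulate only at chords below \<open>c\<close> or at
  \<open>c\<close> itself, and the gap condition excludes the latter.\<close>

lemma compact_Sub: assumes "gap c" shows "compact (Sub c)"
proof -
 let ?K = "L \<inter> {e. encl c (fst e) (snd e)}"
 have K: "closed ?K" using L_closed closed_encl by blast
 have "closure (Sub c) \<subseteq> ?K" by (rule closure_minimal[OF _ K]) (auto simp: Sub_def)
 moreover have "c \<notin> closure (Sub c)" using assms by (simp add: gap_def)
 ultimately have "closure (Sub c) \<subseteq> Sub c" by (auto simp: Sub_def)
 hence "closed (Sub c)" by (simp add: closure_subset_eq)
 moreover have "Sub c \<subseteq> L" by (auto simp: Sub_def)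
 ultimately show ?thesis using compact_L by (metis compact_Int_closed inf.absorb_iff2 inf_commute)
qed

lemma compact_Maxi: assumes "gap c" shows "compact (Maxi c)"
proof -
 have "closed {e. fst e <= fst e' \<or> snd e' <= snd e}" for e' :: "real \<times> real"
  by (intro closed_Collect_disj closed_Collect_le continuous_intros)
 hence "closed (\<Inter>e'\<in>Sub c. {e. fst e <= fst e' \<or> snd e' <= snd e})" by (intro closed_INT) blast
 hence "compact (Sub c \<inter> (\<Inter>e'\<in>Sub c. {e. fst e <= fst e' \<or> snd e' <= snd e}))"
  using compact_Sub[OF assms] by (rule compact_Int_closed[rotated])
 moreover have "Maxi c = Sub c \<inter> (\<Inter>e'\<in>Sub c. {e. fst e <= fst e' \<or> snd e' <= snd e})"
  by (auto simp: Maxi_def)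
 ultimately show ?thesis by simp
qed

lemma Maxi_cover:
 assumes "gap c" "e \<in> Sub c" "encl e x y"
 obtains m where "m \<in> Maxi c" "encl m x y"
proof -
 have "compact (Sub c \<inter> {e. encl e x y})" by (rule compact_Int_closed[OF compact_Sub[OF assms(1)] closed_encl(1)])
 moreover have "e \<in> Sub c \<inter> {e. encl e x y}" using assms by simp
 ultimately obtain m where m: "m \<in> Sub c" "encl m x y" "\<And>e. e \<in> Sub c ==> encl e x y ==> len e <= len m"
  using longest(1)[of "Sub c \<inter> {e. encl e x y}"] by blast
 have "fst m <= fst e' \<or> snd e' <= snd m" if "e' \<in> Sub c" for e'
 proof (rule ccontr)
  assume "\<not> ?thesis"
  hence "fst e' < fst m" "snd m < snd e'" by auto
  moreover from this have "encl e' x y" using m(2) by (auto simp: encl_def)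
  ultimately show False using m(3)[OF that] by (simp add: len_def)
 qed
 thus ?thesis using that[of m] m(1,2) unfolding Maxi_def by blast
qed

text \<open>By noncrossing and maximality, two maximal chords over the same point share an end or
  meet end to end, and \<open>f\<close> agrees at the two ends of a chord.\<close>

lemma Maxi_single:
 assumes "e \<in> Maxi c" "e' \<in> Maxi c" "encl e t t" "encl e' t t"
 shows "f (fst e) = f (fst e')"
proof -
 have *: "f (fst e) = f (fst e')" if e: "e \<in> Maxi c" "e' \<in> Maxi c" "encl e t t" "encl e' t t" and lt: "fst e <= fst e'" for e e'
 proof -
  have L: "e \<in> L" "e' \<in> L" using e by (auto simp: Maxi_def Sub_def)
  consider "fst e = fst e'" | "fst e < fst e'" "fst e' < snd e" | "fst e' = snd e"
   using lt e(3,4) by (force simp: encl_def)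
  thus ?thesis
  proof cases
   case 2
   hence "snd e' <= snd e" using L_nc L by blast
   moreover have "fst e' <= fst e \<or> snd e <= snd e'" using e(1,2) unfolding Maxi_def by blast
   ultimately have "snd e = snd e'" using 2 by auto
   thus ?thesis using L_eq'[OF L(1)] L_eq'[OF L(2)] by simp
  next
   case 3
   thus ?thesis using L_eq'[OF L(1)] by simp
  qed simp
 qed
 show ?thesis
 proof (cases "fst e <= fst e'")
  case True
  show ?thesis by (rule *[OF assms True])
 next
  case False
  hence "fst e' <= fst e" by simp
  thus ?thesis by (rule *[OF assms(2,1,4,3), symmetric])
 qed
qed

lemma diag_Sub: "gap c ==> fst c <= t ==> t <= snd c ==> (t, t) \<in> Sub c"
 using L_bounds'[of c] L_diag[of t] by (auto simp: Sub_def encl_def gap_def)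

lemma edge_eq:
 assumes "m \<in> Maxi c" "encl m t t"
 shows "edge c t = f (fst m)"
proof -
 have "(SOME e. e \<in> Maxi c & encl e t t) \<in> Maxi c & encl (SOME e. e \<in> Maxi c & encl e t t) t t"
  using assms by (intro someI[of "\<lambda>e. e \<in> Maxi c & encl e t t"]) simp
 thus ?thesis unfolding edge_def using Maxi_single assms by blast
qed

lemma edgeE:
 assumes "gap c" "fst c <= t" "t <= snd c"
 obtains m where "m \<in> Maxi c" "encl m t t" "edge c t = f (fst m)"
 using Maxi_cover[OF assms(1) diag_Sub[OF assms], of t t] edge_eq by (auto simp: encl_def)

lemma Maxi_L: "m \<in> Maxi c ==> m \<in> L" "m \<in> Maxi c ==> m \<in> Sub c"
 by (auto simp: Maxi_def Sub_def)

lemma edge_M: assumes "gap c" "fst c <= t" "t <= snd c" shows "edge c t \<in> M"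
proof -
 obtain m where m: "m \<in> Maxi c" "edge c t = f (fst m)" using edgeE[OF assms] by blast
 show ?thesis unfolding m(2) using L_fst[OF Maxi_L(1)[OF m(1)]] by (intro fM) auto
qed

lemma edge_ends:
 assumes "gap c" shows "edge c (fst c) = f (fst c)" "edge c (snd c) = f (fst c)"
proof -
 have c: "c \<in> L" "fst c < snd c" using assms by (auto simp: gap_def)
 obtain m where m: "m \<in> Maxi c" "encl m (fst c) (fst c)" "edge c (fst c) = f (fst m)"
  using edgeE[OF assms, of "fst c"] c by auto
 hence "fst m = fst c" using Sub_L(2)[OF Maxi_L(2)[OF m(1)]] by (auto simp: encl_def)
 thus "edge c (fst c) = f (fst c)" using m by simp
 obtain m where m: "m \<in> Maxi c" "encl m (snd c) (snd c)" "edge c (snd c) = f (fst m)"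
  using edgeE[OF assms, of "snd c"] c by auto
 hence "snd m = snd c" using Sub_L(2)[OF Maxi_L(2)[OF m(1)]] by (auto simp: encl_def)
 thus "edge c (snd c) = f (fst c)" using m L_eq'[OF c(1)] L_eq'[OF Maxi_L(1)[OF m(1)]] by simp
qed

lemma edge_const:
 assumes "m \<in> Maxi c" "fst m <= x" "x <= y" "y <= snd m" "t \<in> {x..y}"
 shows "edge c t = edge c x"
 using edge_eq[OF assms(1), of t] edge_eq[OF assms(1), of x] assms by (simp add: encl_def)

lemma f_tendsto:
 assumes "\<And>k. 0 <= s k & s k <= 1" "s \<longlonglongrightarrow> t"
 shows "(\<lambda>k. d (f (s k)) (f t)) \<longlonglongrightarrow> 0"
proof -
 have "0 <= t" "t <= 1" using assms by (auto intro: LIMSEQ_le_const LIMSEQ_le_const2)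
 thus ?thesis using assms by (intro continuous_map_eu_tendsto[OF cont_f]) auto
qed

text \<open>Maximal chords over times tending to t subconverge, by compactness, to a maximal chord
  over t, and \<open>f\<close> is continuous along their left ends.\<close>

lemma edge_cont:
 assumes "gap c"
 shows "cont_on {fst c..snd c} mtopology (edge c)"
proof (rule continuous_map_eu_seqI)
 show "edge c t \<in> M" if "t \<in> {fst c..snd c}" for t using edge_M[OF assms] that by simp
 fix t s and \<epsilon> :: real
 assume t: "t \<in> {fst c..snd c}" and s: "\<And>k. s k \<in> {fst c..snd c}" "s \<longlonglongrightarrow> t" and \<epsilon>: "\<epsilon> > 0"
 have "\<forall>k. \<exists>m. m \<in> Maxi c & encl m (s k) (s k)" using edgeE[OF assms] s(1) by (metis atLeastAtMost_iff)
 then obtain m where m: "\<And>k. m k \<in> Maxi c" "\<And>k. encl (m k) (s k) (s k)" by metis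
 obtain e r where e: "e \<in> Maxi c" "strict_mono (r :: nat => nat)" "(m \<circ> r) \<longlonglongrightarrow> e"
  using compact_Maxi[OF assms] m(1) unfolding compact_def by metis
 have sr: "(\<lambda>k. s (r k)) \<longlonglongrightarrow> t" using LIMSEQ_subseq_LIMSEQ[OF s(2) e(2)] by (simp add: o_def)
 have m1: "(\<lambda>k. fst (m (r k))) \<longlonglongrightarrow> fst e" and m2: "(\<lambda>k. snd (m (r k))) \<longlonglongrightarrow> snd e"
  using tendsto_fst[OF e(3)] tendsto_snd[OF e(3)] by (simp_all add: o_def)
 have "fst e <= t" by (rule LIMSEQ_le[OF m1 sr]) (use m(2) in \<open>auto simp: encl_def\<close>)
 moreover have "t <= snd e" by (rule LIMSEQ_le[OF sr m2]) (use m(2) in \<open>auto simp: encl_def\<close>)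
 ultimately have "edge c t = f (fst e)" using edge_eq[OF e(1)] by (simp add: encl_def)
 moreover have "(\<lambda>k. d (f (fst (m (r k)))) (f (fst e))) \<longlonglongrightarrow> 0"
  by (rule f_tendsto[OF _ m1]) (rule L_fst[OF Maxi_L(1)[OF m(1)]])
 hence "\<exists>K. \<forall>k\<ge>K. norm (d (f (fst (m (r k)))) (f (fst e)) - 0) < \<epsilon>" using \<epsilon> LIMSEQ_D by blast
 then obtain k where "d (f (fst (m (r k)))) (f (fst e)) < \<epsilon>" by auto
 moreover have "edge c (s (r k)) = f (fst (m (r k)))" using edge_eq m by blast
 ultimately show "\<exists>k. d (edge c t) (edge c (s k)) < \<epsilon>" by (metis commute)
qed

text \<open>If the shortest chord over [x, y] extended beyond it on both sides and were a limit of
  chords below it, one of those would still cover [x, y] and be shorter.\<close>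

lemma chord_not_gap:
 assumes xy: "0 <= x" "x <= y" "y <= 1" and "\<not> gap (chord x y)"
 shows "x = fst (chord x y) \<or> y = snd (chord x y)"
proof (rule ccontr)
 let ?c = "chord x y"
 assume neg: "\<not> ?thesis"
 hence lt: "fst ?c < x" "y < snd ?c" using chord(2)[OF xy] by (auto simp: encl_def)
 hence "?c \<in> closure (Sub ?c)" using assms(4) chord(1)[OF xy] xy by (auto simp: gap_def)
 then obtain e where e: "e \<in> Sub ?c" "dist e ?c < min (x - fst ?c) (snd ?c - y)"
  using lt unfolding closure_approachable by (metis diff_gt_0_iff_gt min_less_iff_conj)
 have "\<bar>fst e - fst ?c\<bar> <= dist e ?c" "\<bar>snd e - snd ?c\<bar> <= dist e ?c"
  using dist_fst_le[of e ?c] dist_snd_le[of e ?c] by (auto simp: dist_real_def)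
 hence "encl e x y" using e(2) by (auto simp: encl_def)
 thus False using chord(3)[OF xy Sub_L(1)[OF e(1)]] len_Sub[OF e(1)] by simp
qed

end

text \<open>Chord-wise fillings \<open>H\<close> whose images shrink to points along any sequence of chords on which the boundary loops do.\<close>

locale lamination_filling = lamination M d f L for M :: "'a set" and d f L +
 fixes H :: "real \<times> real => real \<times> real => 'a"
 assumes H_cont: "c \<in> L ==> cont_on {(x, y). fst c <= x & x <= y & y <= snd c} mtopology (H c)"
  and H_left: "c \<in> L ==> fst c <= y ==> y <= snd c ==> H c (fst c, y) = f (fst c)"
  and H_right: "c \<in> L ==> fst c <= x ==> x <= snd c ==> H c (x, snd c) = f (fst c)"
  and H_const: "gap c ==> fst c <= x ==> x <= y ==> y <= snd c ==>
   (\<And>t. t \<in> {x..y} ==> edge c t = edge c x) ==> H c (x, y) = edge c x"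
  and H_small: "0 <= z ==> z <= 1 ==> \<epsilon> > 0 ==> \<exists>\<delta>>0. \<forall>c x y. gap c & d (f (fst c)) (f z) < \<delta> &
   (\<forall>t\<in>{fst c..snd c}. d (edge c t) (f z) < \<delta>) & fst c <= x & x <= y & y <= snd c --> d (H c (x, y)) (f z) < \<epsilon>"
begin

text \<open>A point (x, y) of the triangle is read as an interval; the shortest chord over it
  decides which of the fillings is used. The filled triangle has \<open>f\<close> on its
  diagonal.\<close>

definition \<Phi> :: "real \<times> real => 'a" where "\<Phi> z = H (chord (fst z) (snd z)) z"

text \<open>By noncrossing the shortest chord over [x, y] has the same end as \<open>e\<close> on
  the side where [x, y] touches it, unless x = y is an end of both. In each case the filling is
  constant on that side.\<close>

lemma \<Phi>_on_chord:
 assumes e: "e \<in> L" "encl e x y" and xy: "0 <= x" "x <= y" "y <= 1" and on: "x = fst e \<or> y = snd e"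
 shows "\<Phi> (x, y) = f (fst e)"
proof -
 let ?c = "chord x y"
 note c = chord(1,2)[OF xy] chord(3)[OF xy e]
 note le = c(2)[unfolded encl_def] e(2)[unfolded encl_def] c(3)[unfolded len_def]
 have fc: "f (fst ?c) = f (snd ?c)" "f (fst e) = f (snd e)" using L_eq' c e by auto
 have left: "\<Phi> (x, y) = f (fst ?c)" if "x = fst ?c"
  using H_left[OF c(1), of y] that le xy unfolding \<Phi>_def by (metis fst_conv order_trans snd_conv)
 have right: "\<Phi> (x, y) = f (fst ?c)" if "y = snd ?c"
  using H_right[OF c(1), of x] that le xy unfolding \<Phi>_def by (metis fst_conv order_trans snd_conv)
 show ?thesis
 proof (cases "x = fst e")
  case True
  show ?thesis
  proof (cases "fst ?c = x")
   case False
   hence "fst ?c < fst e" "snd ?c < snd e" using le True by auto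
   hence "snd ?c <= fst e" using L_nc[OF c(1) e(1)] by force
   hence "snd ?c = x" "x = y" using le True xy by auto
   thus ?thesis using right fc True by simp
  qed (use left True in simp)
 next
  case False
  hence y: "y = snd e" using on by simp
  show ?thesis
  proof (cases "snd ?c = y")
   case False
   hence "fst e < fst ?c" "snd e < snd ?c" using le y by auto
   hence "snd e <= fst ?c" using L_nc[OF e(1) c(1)] by force
   hence "fst ?c = x" "x = y" using le y xy by auto
   thus ?thesis using left fc y by simp
  qed (use right fc y in simp)
 qed
qed

lemma nested:
 assumes "c \<in> L" "e \<in> L" "encl c a b" "encl e a b" "fst c < a" "fst e < a" "a <= b" "b < snd c" "b < snd e"
 shows "encl c (fst e) (snd e) \<or> encl e (fst c) (snd c)"
proof (cases "fst c < fst e")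
 case True
 hence "snd e <= snd c" using L_nc[OF assms(1,2)] assms by auto
 thus ?thesis using True by (simp add: encl_def)
next
 case False
 show ?thesis
 proof (cases "fst e < fst c")
  case True
  hence "snd c <= snd e" using L_nc[OF assms(2,1)] assms by auto
  thus ?thesis using True by (simp add: encl_def)
 next
  case False
  thus ?thesis using \<open>\<not> fst c < fst e\<close> by (auto simp: encl_def)
 qed
qed

lemma nested_eq: "encl c (fst e) (snd e) \<or> encl e (fst c) (snd c) ==> len c = len e ==> c = e"
 by (auto simp: encl_def len_def prod_eq_iff)

text \<open>Along a subsequence the map is the continuous \<open>H c0\<close>. The point is that
  \<open>H c0\<close> also gives the value at the limit, whose own shortest chord may be smaller:
  the limit then lies on a side of the gap under \<open>c0\<close>, and \<open>H_const\<close>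
  identifies the values.\<close>

lemma \<Phi>_cont_same:
 assumes c0: "c0 \<in> L" and z: "0 <= x" "x <= y" "y <= 1"
  and s: "\<And>k::nat. 0 <= X k & X k <= Y k & Y k <= 1" "X \<longlonglongrightarrow> x" "Y \<longlonglongrightarrow> y"
  and inf: "\<exists>\<^sub>\<infinity>k. chord (X k) (Y k) = c0" and \<epsilon>: "\<epsilon> > 0"
 shows "\<exists>k. d (\<Phi> (x, y)) (\<Phi> (X k, Y k)) < \<epsilon>"
proof -
 define r where "r = enumerate {k. chord (X k) (Y k) = c0}"
 have r: "strict_mono r" "\<And>k. chord (X (r k)) (Y (r k)) = c0"
  using inf strict_mono_enumerate[of "{k. chord (X k) (Y k) = c0}"] enumerate_in_set[of "{k. chord (X k) (Y k) = c0}"]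
  unfolding r_def INFM_iff_infinite by auto
 have Xr: "(\<lambda>k. X (r k)) \<longlonglongrightarrow> x" and Yr: "(\<lambda>k. Y (r k)) \<longlonglongrightarrow> y"
  using LIMSEQ_subseq_LIMSEQ[OF s(2) r(1)] LIMSEQ_subseq_LIMSEQ[OF s(3) r(1)] by (simp_all add: o_def)
 have en: "encl c0 (X (r k)) (Y (r k))" "\<And>e. e \<in> L ==> encl e (X (r k)) (Y (r k)) ==> len c0 <= len e" for k
  using chord(2,3)[of "X (r k)" "Y (r k)"] s(1) r(2) by metis+
 have c0e: "fst c0 <= x" "y <= snd c0"
  using LIMSEQ_le_const[OF Xr, of "fst c0"] LIMSEQ_le_const2[OF Yr, of "snd c0"] en(1) by (auto simp: encl_def)
 let ?D = "{(x, y). fst c0 <= x & x <= y & y <= snd c0}"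
 have "(\<lambda>k. (X (r k), Y (r k))) \<longlonglongrightarrow> (x, y)" by (intro tendsto_Pair Xr Yr)
 hence "(\<lambda>k. d (H c0 (X (r k), Y (r k))) (H c0 (x, y))) \<longlonglongrightarrow> 0"
  using c0e z s(1) en(1) by (intro continuous_map_eu_tendsto[OF H_cont[OF c0]]) (auto simp: encl_def)
 hence "\<exists>K. \<forall>k\<ge>K. norm (d (H c0 (X (r k), Y (r k))) (H c0 (x, y)) - 0) < \<epsilon>" using \<epsilon> LIMSEQ_D by blast
 then obtain k where k: "d (H c0 (X (r k), Y (r k))) (H c0 (x, y)) < \<epsilon>" by auto
 have "\<Phi> (X (r k), Y (r k)) = H c0 (X (r k), Y (r k))" using r(2)[of k] by (simp add: \<Phi>_def)
 moreover have "\<Phi> (x, y) = H c0 (x, y)"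
 proof (cases "chord x y = c0")
  case True
  thus ?thesis by (simp add: \<Phi>_def)
 next
  case ne: False
  show ?thesis
  proof (cases "x = fst c0 \<or> y = snd c0")
   case True
   hence "\<Phi> (x, y) = f (fst c0)" using \<Phi>_on_chord[OF c0 _ z] c0e by (simp add: encl_def)
   also have "\<dots> = H c0 (x, y)"
    using True H_left[OF c0, of y] H_right[OF c0, of x] c0e z by auto
   finally show ?thesis .
  next
   case False
   hence lt: "fst c0 < x" "y < snd c0" using c0e by auto
   have ev: "\<forall>\<^sub>F k in sequentially. fst c0 < X (r k) & Y (r k) < snd c0"
    using order_tendstoD(1)[OF Xr lt(1)] order_tendstoD(2)[OF Yr lt(2)] by eventually_elim auto
   then obtain k0 where "fst c0 < X (r k0)" "Y (r k0) < snd c0" unfolding eventually_sequentially by blast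
   hence g: "gap c0" using chord_not_gap[of "X (r k0)" "Y (r k0)"] s(1)[of "r k0"] r(2)[of k0] by force
   note e' = chord[OF z]
   have "encl c0 (fst (chord x y)) (snd (chord x y))"
   proof -
    have l: "len (chord x y) <= len c0" using e'(3)[OF c0] c0e by (simp add: encl_def)
    have le: "fst (chord x y) <= x" "y <= snd (chord x y)" using e'(2) by (auto simp: encl_def)
    have "fst c0 <= fst (chord x y)"
    proof (rule ccontr)
     assume "\<not> ?thesis"
     hence "snd c0 <= snd (chord x y)" using L_nc[OF e'(1) c0] lt le z by auto
     thus False using l \<open>\<not> fst c0 <= fst (chord x y)\<close> by (simp add: len_def)
    qed
    moreover have "snd (chord x y) <= snd c0"
    proof (rule ccontr)
     assume a: "\<not> ?thesis"
     hence "fst c0 < fst (chord x y)" using l by (simp add: len_def)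
     thus False using L_nc[OF c0 e'(1)] lt le z a by auto
    qed
    ultimately show ?thesis by (simp add: encl_def)
   qed
   hence "chord x y \<in> Sub c0" using e'(1) ne by (simp add: Sub_def)
   then obtain m where m: "m \<in> Maxi c0" "encl m x y" using Maxi_cover[OF g] e'(2) by blast
   have H: "H c0 (x, y) = f (fst m)"
   proof -
    have "H c0 (x, y) = edge c0 x"
    proof (rule H_const[OF g c0e(1) z(2) c0e(2)])
     show "edge c0 t = edge c0 x" if "t \<in> {x..y}" for t
      by (rule edge_const[OF m(1) _ z(2) _ that]) (use m(2) in \<open>simp_all add: encl_def\<close>)
    qed
    thus ?thesis using edge_eq[OF m(1), of x] m(2) z by (simp add: encl_def)
   qed
   \<comment> \<open>A maximal chord extending beyond the limit on both sides would cover terms of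
     the sequence and be shorter than their shortest chord \<open>c0\<close>.\<close>
   have "x = fst m \<or> y = snd m"
   proof (rule ccontr)
    assume "\<not> ?thesis"
    hence "fst m < x" "y < snd m" using m(2) by (auto simp: encl_def)
    hence "\<forall>\<^sub>F k in sequentially. fst m < X (r k) & Y (r k) < snd m"
     using order_tendstoD(1)[OF Xr] order_tendstoD(2)[OF Yr] by (simp add: eventually_conj_iff)
    then obtain k1 where "fst m < X (r k1)" "Y (r k1) < snd m" unfolding eventually_sequentially by blast
    hence "len c0 <= len m" using en(2)[OF Maxi_L(1)[OF m(1)], of k1] by (simp add: encl_def)
    thus False using len_Sub[OF Maxi_L(2)[OF m(1)]] by simp
   qed
   hence "\<Phi> (x, y) = f (fst m)" using \<Phi>_on_chord[OF Maxi_L(1)[OF m(1)] m(2) z] by blast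
   thus ?thesis using H by simp
  qed
 qed
 ultimately have "d (\<Phi> (x, y)) (\<Phi> (X (r k), Y (r k))) < \<epsilon>"
  using k commute[of "H c0 (x, y)"] by simp
 thus ?thesis by blast
qed

text \<open>Otherwise maximal chords m_k of the gaps under c_k, with values of \<open>f\<close> away
  from that of \<open>e\<close>, subconverge to a chord strictly inside \<open>e\<close> at both
  ends. Far out the chords c_j are nested and lie strictly outside every m_k, so two different ones
  would contradict the maximality of some m_k; hence the sequence would become constant.\<close>

lemma edge_shrinks:
 assumes e: "e \<in> L" and c: "\<And>k. c k \<in> L" "c \<longlonglongrightarrow> e" and dist: "\<And>c0. \<forall>\<^sub>F k in sequentially. c k ~= c0" and \<delta>: "\<delta> > 0"
 shows "\<forall>\<^sub>F k in sequentially. gap (c k) --> (\<forall>t\<in>{fst (c k)..snd (c k)}. d (edge (c k) t) (f (fst e)) < \<delta>)"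
proof (rule ccontr)
 let ?P = "\<lambda>k. gap (c k) & (\<exists>t\<in>{fst (c k)..snd (c k)}. \<not> d (edge (c k) t) (f (fst e)) < \<delta>)"
 assume "\<not> ?thesis"
 hence "\<exists>\<^sub>F k in sequentially. \<not> (gap (c k) --> (\<forall>t\<in>{fst (c k)..snd (c k)}. d (edge (c k) t) (f (fst e)) < \<delta>))"
  by (simp only: not_eventually not_not)
 hence "\<exists>\<^sub>F k in sequentially. ?P k" by (rule frequently_elim1) blast
 hence inf: "\<exists>\<^sub>\<infinity>k. ?P k" by (simp only: cofinite_eq_sequentially)
 define r where "r = enumerate {k. ?P k}"
 have r: "strict_mono r" "\<And>k. ?P (r k)"
  using inf strict_mono_enumerate[of "{k. ?P k}"] enumerate_in_set[of "{k. ?P k}"]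
  unfolding r_def INFM_iff_infinite by auto
 have "\<forall>k. \<exists>m. m \<in> Maxi (c (r k)) & \<not> d (f (fst m)) (f (fst e)) < \<delta>"
  using r(2) edgeE by (metis atLeastAtMost_iff)
 then obtain m where m: "\<And>k. m k \<in> Maxi (c (r k))" "\<And>k. \<not> d (f (fst (m k))) (f (fst e)) < \<delta>" by metis
 have mL: "m k \<in> L" for k using Maxi_L(1)[OF m(1)] .
 obtain a q where a: "a \<in> L" "strict_mono (q :: nat => nat)" "(m \<circ> q) \<longlonglongrightarrow> a"
  using compact_L mL unfolding compact_def by metis
 define C where "C = (\<lambda>k. c (r (q k)))"
 have Clim: "C \<longlonglongrightarrow> e"
  using LIMSEQ_subseq_LIMSEQ[OF LIMSEQ_subseq_LIMSEQ[OF c(2) r(1)] a(2)] by (simp add: C_def o_def)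
 have C1: "(\<lambda>k. fst (C k)) \<longlonglongrightarrow> fst e" and C2: "(\<lambda>k. snd (C k)) \<longlonglongrightarrow> snd e"
  using tendsto_fst[OF Clim] tendsto_snd[OF Clim] by simp_all
 have m1: "(\<lambda>k. fst (m (q k))) \<longlonglongrightarrow> fst a" and m2: "(\<lambda>k. snd (m (q k))) \<longlonglongrightarrow> snd a"
  using tendsto_fst[OF a(3)] tendsto_snd[OF a(3)] by (simp_all add: o_def)
 have sub: "fst (C k) <= fst (m (q k))" "snd (m (q k)) <= snd (C k)" for k
  using Sub_L(2)[OF Maxi_L(2)[OF m(1)[of "q k"]]] by (auto simp: encl_def C_def)
 have ae: "fst e <= fst a" "snd a <= snd e"
  using LIMSEQ_le[OF C1 m1] LIMSEQ_le[OF m2 C2] sub by auto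
 have "\<delta> <= d (f (fst a)) (f (fst e))"
 proof -
  have "(\<lambda>k. d (f (fst (m (q k)))) (f (fst a))) \<longlonglongrightarrow> 0"
   by (rule f_tendsto[OF _ m1]) (rule L_fst[OF mL])
  hence "(\<lambda>k. d (f (fst (m (q k)))) (f (fst a)) + d (f (fst a)) (f (fst e))) \<longlonglongrightarrow> 0 + d (f (fst a)) (f (fst e))"
   by (intro tendsto_intros)
  moreover have "\<delta> <= d (f (fst (m (q k)))) (f (fst a)) + d (f (fst a)) (f (fst e))" for k
   using m(2)[of "q k"] triangle[OF fM fM fM, of "fst (m (q k))" "fst a" "fst e"]
    L_bounds'[OF mL[of "q k"]] L_bounds'[OF a(1)] L_bounds'[OF e] by linarith
  ultimately show ?thesis using LIMSEQ_le_const by fastforce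
 qed
 hence "f (fst a) ~= f (fst e)" using \<delta> fM L_bounds'[OF e] by (metis linorder_not_le mdist_zero order_trans)
 hence ne: "fst a ~= fst e" "snd a ~= snd e" "fst a <= snd a"
  using L_eq'[OF a(1)] L_eq'[OF e] L_bounds'[OF a(1)] by auto
 hence lt: "fst e < fst a" "snd a < snd e" using ae by auto
 define p where "p = (fst e + fst a) / 2"
 define p' where "p' = (snd e + snd a) / 2"
 have p: "fst e < p" "p < fst a" "snd a < p'" "p' < snd e" using lt by (auto simp: p_def p'_def)
 have "\<forall>\<^sub>F k in sequentially. fst (C k) < p & p' < snd (C k) & p < fst (m (q k)) & snd (m (q k)) < p'"
  using order_tendstoD(2)[OF C1 p(1)] order_tendstoD(1)[OF C2 p(4)] order_tendstoD(1)[OF m1 p(2)] order_tendstoD(2)[OF m2 p(3)]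
  by eventually_elim auto
 then obtain K where K: "\<And>k. k >= K ==> fst (C k) < p & p' < snd (C k) & p < fst (m (q k)) & snd (m (q k)) < p'"
  unfolding eventually_sequentially by blast
 have CL: "C k \<in> L" for k using c(1) by (simp add: C_def)
 have notsub: "C j \<notin> Sub (C k)" if "j >= K" "k >= K" for j k
 proof
  assume "C j \<in> Sub (C k)"
  hence "fst (m (q k)) <= fst (C j) \<or> snd (C j) <= snd (m (q k))"
   using m(1)[of "q k"] by (auto simp: Maxi_def C_def)
  thus False using K[OF that(1)] K[OF that(2)] by auto
 qed
 have same: "C j = C K" if "j >= K" for j
 proof (rule ccontr)
  assume ne: "C j ~= C K"
  have "encl (C j) (fst (C K)) (snd (C K)) \<or> encl (C K) (fst (C j)) (snd (C j))"
   using K[OF that] K[of K] p lt ne(1) \<open>fst a <= snd a\<close>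
   by (intro nested[of _ _ p p'] CL) (auto simp: encl_def)
  thus False using notsub[OF that, of K] notsub[OF _ that, of K] ne CL by (auto simp: Sub_def)
 qed
 have "strict_mono (r \<circ> q)" using r(1) a(2) by (rule strict_mono_o)
 moreover obtain N where N: "\<And>k. k >= N ==> c k ~= C K" using dist[of "C K"] unfolding eventually_sequentially by blast
 ultimately have "(r \<circ> q) (max N K) >= N" by (metis max.cobounded1 order_trans strict_mono_imp_increasing)
 thus False using N same[of "max N K"] by (simp add: C_def)
qed

lemma \<Phi>_cont_distinct:
 assumes z: "0 <= x" "x <= y" "y <= 1" and e: "e \<in> L"
  and s: "\<And>k::nat. 0 <= X k & X k <= Y k & Y k <= 1" "X \<longlonglongrightarrow> x" "Y \<longlonglongrightarrow> y"
  and lim: "(\<lambda>k. chord (X k) (Y k)) \<longlonglongrightarrow> e"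
  and dist: "\<And>c0. \<forall>\<^sub>F k in sequentially. chord (X k) (Y k) ~= c0" and \<epsilon>: "\<epsilon> > 0"
 shows "\<exists>k. d (\<Phi> (x, y)) (\<Phi> (X k, Y k)) < \<epsilon>"
proof -
 define c where "c = (\<lambda>k. chord (X k) (Y k))"
 have cL: "c k \<in> L" "encl (c k) (X k) (Y k)" "\<And>e. e \<in> L ==> encl e (X k) (Y k) ==> len (c k) <= len e" for k
  using chord[of "X k" "Y k"] s(1)[of k] by (auto simp: c_def)
 have clim: "c \<longlonglongrightarrow> e" using lim by (simp add: c_def)
 have C1: "(\<lambda>k. fst (c k)) \<longlonglongrightarrow> fst e" and C2: "(\<lambda>k. snd (c k)) \<longlonglongrightarrow> snd e"
  using tendsto_fst[OF clim] tendsto_snd[OF clim] by simp_all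
 have ee: "fst e <= x" "y <= snd e"
  using LIMSEQ_le[OF C1 s(2)] LIMSEQ_le[OF s(3) C2] cL(2) by (auto simp: encl_def)
 \<comment> \<open>If the limit point were strictly inside \<open>e\<close>, the late chords would
   all cover each other's intervals, so all would have the same minimal length, that of
   \<open>e\<close>; being nested with \<open>e\<close>, they would equal it, against
   \<open>dist\<close>.\<close>
 have on: "x = fst e \<or> y = snd e"
 proof (rule ccontr)
  assume "\<not> ?thesis"
  hence lt: "fst e < x" "y < snd e" using ee by auto
  define p where "p = (fst e + x) / 2"
  define p' where "p' = (snd e + y) / 2"
  have p: "fst e < p" "p < x" "y < p'" "p' < snd e" using lt by (auto simp: p_def p'_def)
  have "\<forall>\<^sub>F k in sequentially. fst (c k) < p & p' < snd (c k) & p < X k & Y k < p'"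
   using order_tendstoD(2)[OF C1 p(1)] order_tendstoD(1)[OF C2 p(4)] order_tendstoD(1)[OF s(2) p(2)] order_tendstoD(2)[OF s(3) p(3)]
   by eventually_elim auto
  then obtain K where K: "\<And>k. k >= K ==> fst (c k) < p & p' < snd (c k) & p < X k & Y k < p'"
   unfolding eventually_sequentially by blast
  have le: "len (c k) <= len (c j)" if "k >= K" "j >= K" for j k
   using K[OF that(1)] K[OF that(2)] by (intro cL) (auto simp: encl_def)
  have "(\<lambda>k. len (c k)) \<longlonglongrightarrow> len e" unfolding len_def by (intro tendsto_intros C1 C2)
  moreover have "\<forall>\<^sub>F k in sequentially. len (c k) = len (c K)"
   unfolding eventually_sequentially using le by (intro exI[of _ K]) (auto intro: antisym)
  ultimately have leq: "len e = len (c K)" by (metis tendsto_eventually LIMSEQ_unique)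
  have "c k = e" if "k >= K" for k
  proof (rule nested_eq)
   show "len (c k) = len e" using leq le[OF that order_refl] le[OF order_refl that] by simp
   show "encl (c k) (fst e) (snd e) \<or> encl e (fst (c k)) (snd (c k))"
    using K[OF that] p z(2) by (intro nested[of _ _ p p'] cL e) (auto simp: encl_def)
  qed
  moreover obtain N where "\<And>k. k >= N ==> c k ~= e" using dist[of e] unfolding eventually_sequentially c_def by blast
  ultimately show False by (metis nle_le)
 qed
 have \<Phi>z: "\<Phi> (x, y) = f (fst e)" using \<Phi>_on_chord[OF e _ z on] ee by (simp add: encl_def)
 obtain \<delta> where \<delta>: "\<delta> > 0" "\<And>c x y. gap c ==> d (f (fst c)) (f (fst e)) < \<delta> ==>
   (\<forall>t\<in>{fst c..snd c}. d (edge c t) (f (fst e)) < \<delta>) ==> fst c <= x ==> x <= y ==> y <= snd c ==> d (H c (x, y)) (f (fst e)) < \<epsilon>"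
  using H_small[of "fst e" \<epsilon>] L_bounds'[OF e] \<epsilon> by (metis order_trans)
 have "\<forall>\<^sub>F k in sequentially. gap (c k) --> (\<forall>t\<in>{fst (c k)..snd (c k)}. d (edge (c k) t) (f (fst e)) < \<delta>)"
  by (rule edge_shrinks[OF e cL(1) clim _ \<delta>(1)]) (use dist in \<open>simp add: c_def\<close>)
 moreover have "(\<lambda>k. d (f (fst (c k))) (f (fst e))) \<longlonglongrightarrow> 0"
  by (rule f_tendsto[OF _ C1]) (rule L_fst[OF cL(1)])
 hence "\<forall>\<^sub>F k in sequentially. d (f (fst (c k))) (f (fst e)) < min \<delta> \<epsilon>"
  using order_tendstoD(2)[of _ 0 sequentially "min \<delta> \<epsilon>"] \<delta>(1) \<epsilon> by simp
 ultimately have "\<forall>\<^sub>F k in sequentially. (gap (c k) --> (\<forall>t\<in>{fst (c k)..snd (c k)}. d (edge (c k) t) (f (fst e)) < \<delta>)) &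
   d (f (fst (c k))) (f (fst e)) < min \<delta> \<epsilon>" by (rule eventually_conj)
 then obtain k where k: "gap (c k) --> (\<forall>t\<in>{fst (c k)..snd (c k)}. d (edge (c k) t) (f (fst e)) < \<delta>)"
   "d (f (fst (c k))) (f (fst e)) < min \<delta> \<epsilon>"
  unfolding eventually_sequentially by blast
 have "d (\<Phi> (X k, Y k)) (f (fst e)) < \<epsilon>"
 proof (cases "gap (c k)")
  case True
  thus ?thesis using \<delta>(2)[OF True, of "X k" "Y k"] k s(1)[of k] cL(2)[of k] by (simp add: \<Phi>_def c_def encl_def)
 next
  case False
  hence "X k = fst (c k) \<or> Y k = snd (c k)" using chord_not_gap[of "X k" "Y k"] s(1)[of k] by (simp add: c_def)
  hence "\<Phi> (X k, Y k) = f (fst (c k))" using \<Phi>_on_chord[OF cL(1,2)] s(1)[of k] by blast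
  thus ?thesis using k by simp
 qed
 hence "d (\<Phi> (x, y)) (\<Phi> (X k, Y k)) < \<epsilon>" using \<Phi>z commute[of "f (fst e)"] by simp
 thus ?thesis by blast
qed

text \<open>By compactness of \<open>L\<close> the shortest chords along a sequence may be assumed
  to converge. Either one chord occurs infinitely often, or every chord drops out
  eventually.\<close>

theorem \<Phi>_cont: "cont_on {(x, y). 0 <= x & x <= y & y <= 1} mtopology \<Phi>"
proof (rule continuous_map_eu_seqI)
 fix z assume "z \<in> {(x, y). 0 <= x & x <= y & (y::real) <= 1}"
 hence z: "0 <= fst z" "fst z <= snd z" "snd z <= 1" by auto
 have "z \<in> {(x, y). fst (chord (fst z) (snd z)) <= x & x <= y & y <= snd (chord (fst z) (snd z))}"
  using chord(2)[OF z] z by (auto simp: encl_def)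
 thus "\<Phi> z \<in> M"
  using H_cont[OF chord(1)[OF z]] unfolding \<Phi>_def continuous_map_eu_metric by blast
next
 fix z s and \<epsilon> :: real
 assume z: "z \<in> {(x, y). 0 <= x & x <= y & (y::real) <= 1}" and
  s: "\<And>k::nat. s k \<in> {(x, y). 0 <= x & x <= y & (y::real) <= 1}" "s \<longlonglongrightarrow> z" and \<epsilon>: "\<epsilon> > 0"
 have z': "0 <= fst z" "fst z <= snd z" "snd z <= 1" using z by auto
 have s': "0 <= fst (s k) & fst (s k) <= snd (s k) & snd (s k) <= 1" for k using s(1)[of k] by auto
 define cc where "cc = (\<lambda>k. chord (fst (s k)) (snd (s k)))"
 have "cc k \<in> L" for k unfolding cc_def using chord(1) s'[of k] by blast
 then obtain e r where e: "e \<in> L" "strict_mono (r :: nat => nat)" "(cc \<circ> r) \<longlonglongrightarrow> e"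
  using compact_L unfolding compact_def by metis
 define X Y where "X = (\<lambda>k. fst (s (r k)))" and "Y = (\<lambda>k. snd (s (r k)))"
 have sr: "(\<lambda>k. s (r k)) \<longlonglongrightarrow> z" using LIMSEQ_subseq_LIMSEQ[OF s(2) e(2)] by (simp add: o_def)
 have XY: "X \<longlonglongrightarrow> fst z" "Y \<longlonglongrightarrow> snd z" "\<And>k. 0 <= X k & X k <= Y k & Y k <= 1"
  using tendsto_fst[OF sr] tendsto_snd[OF sr] s' by (auto simp: X_def Y_def)
 have lim: "(\<lambda>k. chord (X k) (Y k)) \<longlonglongrightarrow> e" using e(3) by (simp add: X_def Y_def cc_def o_def)
 have "\<exists>k. d (\<Phi> (fst z, snd z)) (\<Phi> (X k, Y k)) < \<epsilon>"
 proof (cases "\<exists>c0. \<exists>\<^sub>\<infinity>k. chord (X k) (Y k) = c0")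
  case True
  then obtain c0 where c0: "\<exists>\<^sub>\<infinity>k. chord (X k) (Y k) = c0" by blast
  then obtain k where "chord (X k) (Y k) = c0" by (auto dest: frequently_ex)
  hence "c0 \<in> L" using chord(1) XY(3)[of k] by blast
  thus ?thesis using \<Phi>_cont_same[OF _ z' XY(3,1,2) c0 \<epsilon>] by blast
 next
  case False
  hence "\<forall>\<^sub>F k in sequentially. chord (X k) (Y k) ~= c0" for c0
   unfolding cofinite_eq_sequentially[symmetric] frequently_def by blast
  thus ?thesis using \<Phi>_cont_distinct[OF z' e(1) XY(3,1,2) lim _ \<epsilon>] by blast
 qed
 thus "\<exists>k. d (\<Phi> z) (\<Phi> (s k)) < \<epsilon>" by (auto simp: X_def Y_def)
qed

text \<open>Segments parallel to the diagonal shrink to the corner (0, 1). The filling is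
  \<open>f\<close> on the diagonal and constant on the two legs, because (0, 1) is a chord.\<close>

lemma null_homotopic: "path_hom mtopology (f 0) (f 0) f (\<lambda>_. f 0)"
proof (rule path_homI[where h="\<lambda>z. \<Phi> ((1 - fst z) * snd z, (1 - fst z) * snd z + fst z)"])
 have 1: "(1 - s) * t + s <= 1" if "0 <= s" "s <= 1" "0 <= t" "t <= 1" for s t :: real
  using mult_left_mono[of t 1 "1 - s"] that by simp
 show "cont_on ({0..1} \<times> {0..1}) mtopology (\<lambda>z. \<Phi> ((1 - fst z) * snd z, (1 - fst z) * snd z + fst z))"
  by (rule continuous_map_compose_eu[OF \<Phi>_cont]) (use 1 in \<open>auto intro!: continuous_intros\<close>)
 have d: "\<Phi> (t, t) = f t" if "0 <= t" "t <= 1" for t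
  using \<Phi>_on_chord[OF L_diag[OF that], of t t] that by (simp add: encl_def)
 have a: "\<Phi> (0, t) = f 0" "\<Phi> (t, 1) = f 0" if "0 <= t" "t <= 1" for t
  using \<Phi>_on_chord[OF L_top, of 0 t] \<Phi>_on_chord[OF L_top, of t 1] that by (simp_all add: encl_def)
 fix t :: real assume t: "0 <= t" "t <= 1"
 show "\<Phi> ((1 - fst (0, t)) * snd (0, t), (1 - fst (0, t)) * snd (0, t) + fst (0, t)) = f t" using d[OF t] by simp
 show "\<Phi> ((1 - fst (1, t)) * snd (1, t), (1 - fst (1, t)) * snd (1, t) + fst (1, t)) = f 0" using a(1)[of 1] by simp
 show "\<Phi> ((1 - fst (t, 0)) * snd (t, 0), (1 - fst (t, 0)) * snd (t, 0) + fst (t, 0)) = f 0" using a(1)[OF t] by simp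
 show "\<Phi> ((1 - fst (t, 1)) * snd (t, 1), (1 - fst (t, 1)) * snd (t, 1) + fst (t, 1)) = f 0" using a(2)[of "1 - t"] t by simp
qed

end

section \<open>The topology of \<open>E(X,D)\<close>\<close>

lemma mdist_self: "x \<in> mspace m ==> mdist m x x = 0"
 by simp

lemma continuous_map_mdist_ball:
 assumes "continuous_map Z (mtopology_of m) g" "z0 \<in> topspace Z" "\<epsilon> > 0"
 shows "\<exists>U. openin Z U & z0 \<in> U & (\<forall>z\<in>U. mdist m (g z0) (g z) < \<epsilon>)"
proof -
 interpret Metric_space "mspace m" "mdist m" by simp
 have "continuous_map Z mtopology g" using assms(1) by (simp add: mtopology_of_def)
 hence "\<exists>U. openin Z U & z0 \<in> U & (\<forall>z\<in>U. g z \<in> mball (g z0) \<epsilon>)"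
  using assms(2,3) unfolding continuous_map_to_metric by blast
 thus ?thesis by (metis in_mball)
qed

locale earring =
 fixes C :: "complex metric" and c :: complex and X :: "'a metric" and D :: "'a set" and d :: "nat => 'a"
 assumes circle: "circle_metric C" and c_sphere: "c \<in> sphere 0 1"
  and D_sub: "D \<subseteq> mspace X" and enum: "enumerates d D"
begin

abbreviation "E \<equiv> earring_space C c X D d"
abbreviation "EM \<equiv> mspace X \<times> {c} \<union> D \<times> sphere 0 1"
abbreviation "ed \<equiv> earring_dist C c X D d"

definition q :: "'a => 'a \<times> complex => complex" where
 "q s P = (if fst P = s then snd P / c else 1)"

definition idx :: "'a => nat" where "idx x = the_inv_into (enum_domain D) d x"

lemma mspace_C: "mspace C = sphere 0 1"
 using circle by (simp add: circle_metric_def)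

lemma c_nz [simp]: "c ~= 0" and norm_c [simp]: "norm c = 1"
 using c_sphere by auto

sublocale ES: Metric_space EM ed
 using Metric_space_earring[of c C D X d] c_sphere D_sub enum by (simp add: mspace_C)

sublocale XM: Metric_space "mspace X" "mdist X"
 by simp

lemma E_eq: "E = ES.mtopology"
 by (simp add: earring_metric_def mspace_C mtopology_of_def ES.mspace_metric ES.mdist_metric)

lemma topspace_E: "topspace E = EM"
 by (simp add: E_eq)

lemma idx: assumes "x \<in> D" shows "idx x \<in> enum_domain D" "d (idx x) = x" "idx x >= 1"
proof -
 have b: "bij_betw d (enum_domain D) D" using enum by (simp add: enumerates_def)
 thus 1: "idx x \<in> enum_domain D"
  unfolding idx_def using assms the_inv_into_into[of d "enum_domain D" x "enum_domain D"] by (auto simp: bij_betw_def)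
 show "d (idx x) = x"
  unfolding idx_def using b assms by (auto simp: bij_betw_def intro!: f_the_inv_into_f)
 show "idx x >= 1" using 1 by (auto simp: enum_domain_def split: if_splits)
qed

lemma idx_inj: "x \<in> D ==> y \<in> D ==> idx x = idx y ==> x = y"
 using idx(2) by metis

lemma finite_idx_le: "finite {s \<in> D. idx s <= N}"
 by (rule inj_on_finite[of idx _ "{..N}"]) (use idx_inj in \<open>auto simp: inj_on_def\<close>)

lemma ed_same: "x \<in> D ==> ed (x, u) (x, v) = mdist C u v / real (idx x)"
 by (simp add: earring_dist_def fibre_dist_def idx_def)

lemma ed_base: "x \<in> mspace X ==> y \<in> mspace X ==> ed (x, c) (y, c) = mdist X x y"
 using c_sphere by (auto simp: earring_dist_def fibre_dist_def mspace_C mdist_self)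

lemma ed_fibre: "x \<in> mspace X ==> ed (x, u) (x, c) = fibre_dist C D d x u c"
 using c_sphere by (auto simp: earring_dist_def fibre_dist_def mspace_C mdist_self)

lemma fibre_dist_nonneg: "0 <= fibre_dist C D d x u v"
 by (simp add: fibre_dist_def)

lemma fibre_dist_le: "u \<in> sphere 0 1 ==> v \<in> sphere 0 1 ==> x \<in> D ==> fibre_dist C D d x u v <= 1 / real (idx x)"
proof -
 assume a: "u \<in> sphere 0 1" "v \<in> sphere 0 1" "x \<in> D"
 hence "mdist C u v <= 1" using circle by (force simp: circle_metric_def)
 thus ?thesis using a by (simp add: fibre_dist_def idx_def divide_right_mono)
qed

lemma EM_fst: "P \<in> EM ==> fst P \<in> mspace X"
 using D_sub by auto

lemma EM_snd: "P \<in> EM ==> snd P \<in> sphere 0 1"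
 using c_sphere by auto

lemma EM_iff: "P \<in> EM \<longleftrightarrow> fst P \<in> mspace X & snd P \<in> sphere 0 1 & (snd P ~= c --> fst P \<in> D)"
 using D_sub c_sphere by (cases P) auto

lemma mdist_fst_le: assumes "P \<in> EM" "Q \<in> EM" shows "mdist X (fst P) (fst Q) <= ed P Q"
proof -
 have m: "fst P \<in> mspace X" "fst Q \<in> mspace X" using EM_fst assms by blast+
 obtain x u y v where PQ: "P = (x, u)" "Q = (y, v)" by (cases P; cases Q) auto
 have "fibre_dist C D d x u c >= 0" "fibre_dist C D d y v c >= 0" "fibre_dist C D d x u v >= 0"
  using fibre_dist_nonneg by auto
 thus ?thesis using m by (auto simp: PQ earring_dist_def mdist_self)
qed

text \<open>The rotation by \<open>c\<close> in \<open>q\<close> need not be an isometry of the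
  given circle metric, so distance bounds are stated for the unrotated coordinate.\<close>

definition circ :: "'a => 'a \<times> complex => complex" where "circ s P = (if fst P = s then snd P else c)"

lemma q_circ: "q s P = circ s P / c"
 by (simp add: q_def circ_def)

lemma circ_sphere: "P \<in> EM ==> circ s P \<in> sphere 0 1"
 using EM_snd c_sphere by (simp add: circ_def)

lemma mdist_circ_le:
 assumes "s \<in> D" "P \<in> EM" "Q \<in> EM"
 shows "mdist C (circ s P) (circ s Q) <= real (idx s) * ed P Q"
proof -
 have n: "real (idx s) > 0" using idx(3)[OF assms(1)] by simp
 have mul: "mdist C u v = real (idx s) * fibre_dist C D d s u v" for u v
  using n assms(1) by (simp add: fibre_dist_def idx_def)
 have X: "fst P \<in> mspace X" "fst Q \<in> mspace X" using assms EM_fst by blast+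
 obtain x u y v where PQ: "P = (x, u)" "Q = (y, v)" by (cases P; cases Q) auto
 have c0: "mdist C c c = 0" using c_sphere by (simp add: mspace_C mdist_self)
 have nn: "mdist X x y >= 0" "fibre_dist C D d x u c >= 0" "fibre_dist C D d y v c >= 0"
  using fibre_dist_nonneg by auto
 have "fibre_dist C D d s (circ s P) (circ s Q) <= ed P Q"
 proof (cases "x = s")
  case xs: True
  show ?thesis
  proof (cases "y = s")
   case True
   thus ?thesis using xs assms(1) by (simp add: PQ circ_def earring_dist_def)
  next
   case False
   thus ?thesis using xs nn by (simp add: PQ circ_def earring_dist_def)
  qed
 next
  case xs: False
  show ?thesis
  proof (cases "y = s")
   case True
   hence "fibre_dist C D d s c v = fibre_dist C D d y v c"
    by (simp add: fibre_dist_def mdist_commute)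
   thus ?thesis using xs True nn by (simp add: PQ circ_def earring_dist_def)
  next
   case False
   thus ?thesis using xs c0 ES.nonneg[of P Q] by (simp add: PQ circ_def fibre_dist_def)
  qed
 qed
 thus ?thesis using n by (simp add: mul)
qed

lemma continuous_fst: "continuous_map E (mtopology_of X) fst"
proof -
 have "continuous_map ES.mtopology (Metric_space.mtopology (mspace X) (mdist X)) fst"
  unfolding ES.metric_continuous_map[OF Metric_space_mspace_mdist]
 proof (intro conjI ballI allI impI)
  show "fst ` EM \<subseteq> mspace X" using EM_fst by blast
  fix P and \<epsilon> :: real assume P: "P \<in> EM" and \<epsilon>: "\<epsilon> > 0"
  show "\<exists>\<delta>>0. \<forall>Q. Q \<in> EM & ed P Q < \<delta> --> mdist X (fst P) (fst Q) < \<epsilon>"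
   using mdist_fst_le[OF P] \<epsilon> by (intro exI[of _ \<epsilon>]) (blast intro: le_less_trans)
 qed
 thus ?thesis unfolding E_eq by (simp add: mtopology_of_def)
qed

lemma continuous_circ: assumes "s \<in> D" shows "continuous_map E (top_of_set (sphere 0 1)) (circ s)"
proof -
 have "continuous_map ES.mtopology (Metric_space.mtopology (mspace C) (mdist C)) (circ s)"
  unfolding ES.metric_continuous_map[OF Metric_space_mspace_mdist]
 proof (intro conjI ballI allI impI)
  show "circ s ` EM \<subseteq> mspace C" using circ_sphere unfolding mspace_C by blast
  fix P and \<epsilon> :: real assume P: "P \<in> EM" and \<epsilon>: "\<epsilon> > 0"
  have n: "real (idx s) > 0" using idx(3)[OF assms(1)] by simp
  show "\<exists>\<delta>>0. \<forall>Q. Q \<in> EM & ed P Q < \<delta> --> mdist C (circ s P) (circ s Q) < \<epsilon>"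
  proof (intro exI[of _ "\<epsilon> / real (idx s)"] conjI allI impI)
   fix Q assume "Q \<in> EM & ed P Q < \<epsilon> / real (idx s)"
   thus "mdist C (circ s P) (circ s Q) < \<epsilon>"
    using mdist_circ_le[OF assms P, of Q] n by (simp add: field_simps)
  qed (use n \<epsilon> in simp)
 qed
 hence "continuous_map E (mtopology_of C) (circ s)"
  unfolding E_eq by (simp add: mtopology_of_def)
 thus ?thesis using circle by (simp add: circle_metric_def)
qed

lemma rot_cont: "cont_on (sphere 0 1) (top_of_set (sphere 0 1)) (\<lambda>u. u / c)"
 "cont_on (sphere 0 1) (top_of_set (sphere 0 1)) (\<lambda>u. c * u)"
 by (auto simp: continuous_map_in_subtopology norm_divide norm_mult intro!: continuous_intros)

lemma continuous_q: assumes "s \<in> D" shows "continuous_map E (top_of_set (sphere 0 1)) (q s)"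
 using continuous_map_compose[OF continuous_circ[OF assms] rot_cont(1)] by (simp add: q_circ[abs_def] o_def)

lemma q_neq_1: "q s P ~= 1 ==> fst P = s & snd P ~= c"
 by (auto simp: q_def split: if_splits)

lemma q_base [simp]: "q s (x, c) = 1"
 by (simp add: q_def)

lemma circle_system_E: "S \<subseteq> D ==> circle_system E S q"
 unfolding circle_system_def using continuous_q q_neq_1 by blast

text \<open>The topology of \<open>E\<close> is initial for the projection to \<open>X\<close> and the circle coordinates, because
 all but finitely many circles are uniformly small.\<close>

lemma continuous_into_E:
 assumes EMg: "\<And>z. z \<in> topspace Z ==> g z \<in> EM"
  and fst: "continuous_map Z (mtopology_of X) (\<lambda>z. fst (g z))"
  and circ: "\<And>s. s \<in> D ==> continuous_map Z (top_of_set (sphere 0 1)) (\<lambda>z. q s (g z))"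
 shows "continuous_map Z E g"
 unfolding E_eq ES.continuous_map_to_metric
proof (intro ballI allI impI)
 fix z0 \<epsilon> assume z0: "z0 \<in> topspace Z" and \<epsilon>: "(\<epsilon>::real) > 0"
 define P where "P = g z0"
 have P: "P \<in> EM" using EMg z0 by (simp add: P_def)
 obtain N :: nat where N: "N > 0" "1 / real N < \<epsilon> / 3"
  using \<epsilon> reals_Archimedean2[of "3 / \<epsilon>"] by (metis divide_pos_pos field_lbound_gt_zero mult.commute nat_approx_posE of_nat_0_less_iff zero_less_Suc zero_less_numeral)
 define F where "F = {s \<in> D. idx s <= N}"
 have finF: "finite F" unfolding F_def by (rule finite_idx_le)
 have circ': "continuous_map Z (mtopology_of C) (\<lambda>z. circ s (g z))" if "s \<in> D" for s
 proof -
  have "continuous_map Z (top_of_set (sphere 0 1)) (\<lambda>z. c * q s (g z))"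
   using continuous_map_compose[OF circ[OF that] rot_cont(2)] by (simp add: o_def)
  thus ?thesis using circle by (simp add: circle_metric_def q_circ)
 qed
 have opC: "\<exists>U. openin Z U & z0 \<in> U & (\<forall>z\<in>U. mdist C (circ s P) (circ s (g z)) < \<epsilon> / 3)" if "s \<in> D" for s
  using continuous_map_mdist_ball[OF circ'[OF that] z0, of "\<epsilon> / 3"] \<epsilon> by (simp add: P_def)
 then obtain U where U: "\<And>s. s \<in> D ==> openin Z (U s) & z0 \<in> U s & (\<forall>z\<in>U s. mdist C (circ s P) (circ s (g z)) < \<epsilon> / 3)"
  by metis
 obtain V where V: "openin Z V" "z0 \<in> V" "\<And>z. z \<in> V ==> mdist X (fst P) (fst (g z)) < \<epsilon> / 3"
  using continuous_map_mdist_ball[OF fst z0, of "\<epsilon> / 3"] \<epsilon> unfolding P_def by auto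
 let ?W = "V \<inter> (\<Inter>s\<in>F. U s) \<inter> topspace Z"
 have opW: "openin Z ?W"
 proof (cases "F = {}")
  case False
  thus ?thesis using U V(1) finF by (intro openin_Int openin_INT2) (auto simp: F_def)
 qed (use V in auto)
 \<comment> \<open>In the finitely many circles of \<open>F\<close> the coordinate controls the
   distance, since dividing by the index only shrinks it; every other circle has diameter at most
   1/N < \<epsilon>/3.\<close>
 have fib: "fibre_dist C D d x u v < \<epsilon> / 3"
  if "u \<in> sphere 0 1" "v \<in> sphere 0 1" "x \<in> F ==> mdist C u v < \<epsilon> / 3" for x u v
 proof (cases "x \<in> F")
  case True
  hence "x \<in> D" "real (idx x) >= 1" using idx(3) by (auto simp: F_def)
  hence "fibre_dist C D d x u v <= mdist C u v"
   using mult_left_mono[of 1 "real (idx x)" "mdist C u v"] by (auto simp: fibre_dist_def idx_def divide_le_eq)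
  thus ?thesis using that True by simp
 next
  case False
  show ?thesis
  proof (cases "x \<in> D")
   case True
   hence "real N < real (idx x)" using False by (simp add: F_def)
   hence "1 / real (idx x) <= 1 / real N" using N(1) by (intro divide_left_mono) auto
   thus ?thesis using fibre_dist_le[OF that(1,2) True] N by linarith
  qed (use \<epsilon> in \<open>simp add: fibre_dist_def\<close>)
 qed
 have "g z \<in> ES.mball P \<epsilon>" if z: "z \<in> ?W" for z
 proof -
  have zZ: "z \<in> topspace Z" and gz: "g z \<in> EM" using z EMg by auto
  have CF: "mdist C (circ s P) (circ s (g z)) < \<epsilon> / 3" if "s \<in> F" for s
   using U[of s] that z by (auto simp: F_def)
  obtain x u y v where xy: "P = (x, u)" "g z = (y, v)" by (cases P; cases "g z") auto
  have sp: "u \<in> sphere 0 1" "v \<in> sphere 0 1" using EM_snd[OF P] EM_snd[OF gz] xy by auto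
  have "ed P (g z) < \<epsilon>"
  proof (cases "x = y & x \<in> D")
   case True
   hence "ed P (g z) = fibre_dist C D d x u v" by (auto simp: xy earring_dist_def)
   also have "\<dots> < \<epsilon> / 3"
    by (rule fib[OF sp]) (use CF[of x] True xy in \<open>simp add: circ_def\<close>)
   finally show ?thesis using \<epsilon> by simp
  next
   case False
   have "fibre_dist C D d x u c < \<epsilon> / 3"
   proof (rule fib[OF sp(1) c_sphere])
    assume "x \<in> F"
    thus "mdist C u c < \<epsilon> / 3" using CF[of x] False xy by (auto simp: circ_def F_def)
   qed
   moreover have "fibre_dist C D d y v c < \<epsilon> / 3"
   proof (rule fib[OF sp(2) c_sphere])
    assume "y \<in> F"
    thus "mdist C v c < \<epsilon> / 3" using CF[of y] False xy mdist_commute[of C v c] by (auto simp: circ_def F_def)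
   qed
   moreover have "mdist X x y < \<epsilon> / 3" using V(3)[of z] z xy by simp
   moreover have "ed P (g z) = mdist X x y + fibre_dist C D d x u c + fibre_dist C D d y v c"
    using False by (auto simp: xy earring_dist_def)
   ultimately show ?thesis by simp
  qed
  thus ?thesis using P gz by (simp add: ES.in_mball del: Un_iff)
 qed
 thus "\<exists>U. openin Z U & z0 \<in> U & (\<forall>y\<in>U. g y \<in> ES.mball (g z0) \<epsilon>)"
  using opW V(2) U z0 unfolding P_def by (intro exI[of _ ?W]) (auto simp: F_def simp del: ES.in_mball)
qed

definition collapse :: "'a set => 'a \<times> complex => 'a \<times> complex" where
 "collapse A P = (fst P, if fst P \<in> A then snd P else c)"

lemma continuous_collapse: "continuous_map E E (collapse A)"
proof (rule continuous_into_E)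
 show "collapse A P \<in> EM" if "P \<in> topspace E" for P
  using that EM_iff[of P] EM_iff[of "collapse A P"] c_sphere unfolding topspace_E by (auto simp: collapse_def)
 show "continuous_map E (mtopology_of X) (\<lambda>P. fst (collapse A P))"
  using continuous_fst by (simp add: collapse_def)
 fix s assume s: "s \<in> D"
 have "(\<lambda>P. q s (collapse A P)) = (if s \<in> A then q s else (\<lambda>_. 1))"
  by (auto simp: q_def collapse_def)
 thus "continuous_map E (top_of_set (sphere 0 1)) (\<lambda>P. q s (collapse A P))"
  using continuous_q[OF s] by simp
qed

lemma word_along_collapse: "word_along S q (\<lambda>t. collapse A (f t)) a b = word_along (S \<inter> A) q f a b"
proof -
 have cr: "crosses S q s (collapse A P) (collapse A Q) = crosses (S \<inter> A) q s P Q" for s P Q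
  by (auto simp: crosses_def collapse_def q_def)
 have im: "s \<in> A ==> q s (collapse A P) = q s P" for s P
  by (simp add: q_def collapse_def)
 have "cross_letter S q (collapse A P) (collapse A Q) = cross_letter (S \<inter> A) q P Q" for P Q
 proof (cases "\<exists>!s. crosses (S \<inter> A) q s P Q")
  case True
  hence "(THE s. crosses (S \<inter> A) q s P Q) \<in> A"
   using theI'[OF True] by (simp add: crosses_def)
  thus ?thesis using True by (simp add: cross_letter_def cr im Let_def)
 qed (simp add: cross_letter_def cr)
 thus ?thesis
  by (simp add: word_along_def ctrans_def clift_def)
qed

lemma base_in_EM: "x \<in> mspace X ==> (x, c) \<in> EM"
 by simp

lemma path_in_circle:
 assumes "s \<in> D" "continuous_on {0..1} \<theta>"
 shows "joins E (s, c * cis (\<theta> 0)) (s, c * cis (\<theta> 1)) (\<lambda>t. (s, c * cis (\<theta> t)))"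
proof -
 have "cont_on {0..1} E (\<lambda>t. (s, c * cis (\<theta> t)))"
 proof (rule continuous_into_E)
  show "cont_on {0..1} (top_of_set (sphere 0 1)) (\<lambda>t. q s' (s, c * cis (\<theta> t)))" for s'
   using assms(2) by (cases "s' = s") (auto simp: q_def continuous_map_in_subtopology intro!: continuous_intros)
 qed (use assms D_sub in \<open>auto simp: norm_mult\<close>)
 thus ?thesis by (simp add: joins_def pathin_def)
qed

lemma continuous_base: "continuous_map (mtopology_of X) E (\<lambda>x. (x, c))"
 by (rule continuous_into_E) simp_all

end

section \<open>Standard form of loops\<close>

definition arc_on :: "(real => real) => (real => real) => real => real => bool" where
 "arc_on \<theta> \<theta>' a b \<longleftrightarrow> a < b & \<theta> a \<in> \<int> & \<theta> b \<in> \<int> & (\<forall>t. a < t & t < b --> \<theta> t \<notin> \<int>) &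
  (\<exists>\<epsilon>. \<forall>t\<in>{a..b}. \<theta>' t = \<theta> a + (if \<epsilon> then 1 else -1) * ((t - a) / (b - a)))"

lemma arc_on_cong: "arc_on \<theta> \<theta>' a b ==> (\<And>t. a <= t ==> t <= b ==> \<theta>'' t = \<theta>' t) ==> arc_on \<theta> \<theta>'' a b"
 by (simp add: arc_on_def)

text \<open>\<open>\<theta>\<close> is a real lift of one circle coordinate, integers standing for
  the base point. The straightened lift turns once, linearly, over each of the finitely many
  intervals in \<open>J\<close> and is integer valued elsewhere; excursions that return to where
  they started disappear.\<close>

definition straight :: "(real => real) => real => real => (real \<times> real) set => (real => real) => bool" where
 "straight \<theta> \<alpha> \<beta> J \<theta>' \<longleftrightarrow> finite J & continuous_on {\<alpha>..\<beta>} \<theta>' &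
  (\<forall>t\<in>{\<alpha>..\<beta>}. \<theta> t \<in> \<int> --> \<theta>' t = \<theta> t) &
  (\<forall>a b. (a, b) \<in> J --> \<alpha> <= a & b <= \<beta> & arc_on \<theta> \<theta>' a b) &
  (\<forall>t\<in>{\<alpha>..\<beta>}. (\<forall>a b. (a, b) \<in> J --> \<not> (a < t & t < b)) --> \<theta>' t \<in> \<int>)"

lemma straight_join:
 assumes 1: "straight \<theta> \<alpha> \<beta> J1 \<theta>1" and 2: "straight \<theta> \<beta> \<gamma> J2 \<theta>2" and le: "\<alpha> <= \<beta>" "\<beta> <= \<gamma>" and Z: "\<theta> \<beta> \<in> \<int>"
 shows "straight \<theta> \<alpha> \<gamma> (J1 \<union> J2) (\<lambda>t. if t <= \<beta> then \<theta>1 t else \<theta>2 t)" (is "straight _ _ _ _ ?\<theta>")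
proof -
 have \<beta>: "\<theta>1 \<beta> = \<theta> \<beta>" "\<theta>2 \<beta> = \<theta> \<beta>" using 1 2 le Z by (auto simp: straight_def)
 have eq1: "?\<theta> t = \<theta>1 t" if "t <= \<beta>" for t using that by simp
 have eq2: "?\<theta> t = \<theta>2 t" if "t >= \<beta>" for t using that \<beta> by (cases "t = \<beta>") auto
 have "continuous_on ({\<alpha>..\<beta>} \<union> {\<beta>..\<gamma>}) ?\<theta>"
 proof (rule continuous_on_closed_Un)
  show "continuous_on {\<alpha>..\<beta>} ?\<theta>"
  proof (rule continuous_on_eq)
   show "continuous_on {\<alpha>..\<beta>} \<theta>1" using 1 by (simp add: straight_def)
  qed simp
  show "continuous_on {\<beta>..\<gamma>} ?\<theta>"
  proof (rule continuous_on_eq)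
   show "continuous_on {\<beta>..\<gamma>} \<theta>2" using 2 by (simp add: straight_def)
   show "\<theta>2 t = ?\<theta> t" if "t \<in> {\<beta>..\<gamma>}" for t
    using eq2[of t, symmetric] that unfolding atLeastAtMost_iff by blast
  qed
 qed auto
 hence cont: "continuous_on {\<alpha>..\<gamma>} ?\<theta>" using le by (simp add: ivl_disj_un_two_touch(4))
 show ?thesis
  unfolding straight_def
 proof (intro conjI allI ballI impI)
  show "finite (J1 \<union> J2)" using 1 2 by (simp add: straight_def)
  show "continuous_on {\<alpha>..\<gamma>} ?\<theta>" by (rule cont)
  fix t assume t: "t \<in> {\<alpha>..\<gamma>}"
  show "?\<theta> t = \<theta> t" if "\<theta> t \<in> \<int>"
   using 1 2 t that by (cases "t <= \<beta>") (auto simp: straight_def)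
  show "?\<theta> t \<in> \<int>" if *: "\<forall>a b. (a, b) \<in> J1 \<union> J2 --> \<not> (a < t & t < b)"
  proof (cases "t <= \<beta>")
   case True
   hence "\<theta>1 t \<in> \<int>" using 1 t * unfolding straight_def by (metis UnI1 atLeastAtMost_iff)
   thus ?thesis using True by simp
  next
   case False
   hence "\<beta> <= t" by simp
   hence "\<theta>2 t \<in> \<int>" using 2 t * unfolding straight_def by (metis UnI2 atLeastAtMost_iff)
   thus ?thesis using False by simp
  qed
 next
  fix a b assume "(a, b) \<in> J1 \<union> J2"
  hence "\<alpha> <= a & b <= \<gamma> & arc_on \<theta> ?\<theta> a b"
  proof
   assume "(a, b) \<in> J1"
   hence *: "\<alpha> <= a" "b <= \<beta>" "arc_on \<theta> \<theta>1 a b" using 1 by (auto simp: straight_def)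
   thus ?thesis using arc_on_cong[OF *(3), of ?\<theta>] le by auto
  next
   assume "(a, b) \<in> J2"
   hence *: "\<beta> <= a" "b <= \<gamma>" "arc_on \<theta> \<theta>2 a b" using 2 by (auto simp: straight_def)
   have "arc_on \<theta> ?\<theta> a b" by (rule arc_on_cong[OF *(3)]) (use eq2 *(1) in \<open>meson order_trans\<close>)
   thus ?thesis using * le by auto
  qed
  thus "\<alpha> <= a" "b <= \<gamma>" "arc_on \<theta> ?\<theta> a b" by blast+
 qed
qed

lemma straight_const:
 assumes "\<theta> \<alpha> \<in> \<int>" "\<And>t. t \<in> {\<alpha>..\<beta>} ==> \<theta> t \<in> \<int> ==> \<theta> t = \<theta> \<alpha>"
 shows "straight \<theta> \<alpha> \<beta> {} (\<lambda>_. \<theta> \<alpha>)"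
 unfolding straight_def
proof (intro conjI ballI impI)
 show "\<theta> \<alpha> = \<theta> t" if "t \<in> {\<alpha>..\<beta>}" "\<theta> t \<in> \<int>" for t
  using assms(2)[OF that] by simp
qed (use assms(1) in simp_all)

lemma straight_elem:
 assumes cont: "continuous_on {\<alpha>..\<beta>} \<theta>" and "\<alpha> < \<beta>" "\<theta> \<alpha> \<in> \<int>" "\<theta> \<beta> \<in> \<int>" and no: "\<And>t. \<alpha> < t ==> t < \<beta> ==> \<theta> t \<notin> \<int>"
 shows "\<exists>J \<theta>'. straight \<theta> \<alpha> \<beta> J \<theta>'"
proof (cases "\<theta> \<alpha> = \<theta> \<beta>")
 case True
 have "straight \<theta> \<alpha> \<beta> {} (\<lambda>_. \<theta> \<alpha>)"
 proof (rule straight_const)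
  show "\<theta> \<alpha> \<in> \<int>" by (rule assms(3))
  fix t assume t: "t \<in> {\<alpha>..\<beta>}" "\<theta> t \<in> \<int>"
  hence "t = \<alpha> \<or> t = \<beta>" using no[of t] by (auto simp: less_eq_real_def)
  thus "\<theta> t = \<theta> \<alpha>" using True by auto
 qed
 thus ?thesis by blast
next
 case False
 obtain m n where mn: "\<theta> \<alpha> = of_int m" "\<theta> \<beta> = of_int n" using assms(3,4) by (auto elim!: Ints_cases)
 \<comment> \<open>The lift attains the integer next to its initial value in the direction of its
   final value. Interior times are excluded, so this integer is the final value and the excursion is
   a single turn.\<close>
 have "\<exists>t. \<alpha> <= t & t <= \<beta> & \<theta> t = of_int (m + sgn (n - m))"
 proof (cases "m < n")
  case True
  thus ?thesis using assms(2) cont mn by (intro IVT') auto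
 next
  case False
  hence "sgn (n - m) = -1" using \<open>\<theta> \<alpha> ~= \<theta> \<beta>\<close> mn by auto
  thus ?thesis using False assms(2) cont mn \<open>\<theta> \<alpha> ~= \<theta> \<beta>\<close> by (intro IVT2') auto
 qed
 then obtain t where t: "\<alpha> <= t" "t <= \<beta>" "\<theta> t = of_int (m + sgn (n - m))" by blast
 hence "t = \<alpha> \<or> t = \<beta>" using no[of t] Ints_of_int by (metis less_eq_real_def)
 moreover have mn': "m ~= n" using False mn by auto
 ultimately have "n = m + sgn (n - m)" using mn t(3) by (auto simp: sgn_if split: if_splits)
 hence nm: "n = m + 1 \<or> n = m - 1" using mn' by (auto simp: sgn_if split: if_splits)
 define \<epsilon> where "\<epsilon> = (n = m + 1)"
 have \<epsilon>: "\<theta> \<beta> = \<theta> \<alpha> + (if \<epsilon> then 1 else -1)" using nm mn by (auto simp: \<epsilon>_def)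
 let ?\<theta> = "\<lambda>t. \<theta> \<alpha> + (if \<epsilon> then 1 else -1) * ((t - \<alpha>) / (\<beta> - \<alpha>))"
 have "straight \<theta> \<alpha> \<beta> {(\<alpha>, \<beta>)} ?\<theta>"
  unfolding straight_def
 proof (intro conjI allI ballI impI)
  have ends: "?\<theta> \<alpha> = \<theta> \<alpha>" "?\<theta> \<beta> = \<theta> \<beta>" using \<epsilon> assms(2) by auto
  fix t assume t: "t \<in> {\<alpha>..\<beta>}"
  show "?\<theta> t = \<theta> t" if "\<theta> t \<in> \<int>"
  proof -
   have "t = \<alpha> \<or> t = \<beta>" using no[of t] t that by (auto simp: less_eq_real_def)
   thus ?thesis using ends by (elim disjE) simp_all
  qed
  show "?\<theta> t \<in> \<int>" if "\<forall>a b. (a, b) \<in> {(\<alpha>, \<beta>)} --> \<not> (a < t & t < b)"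
  proof -
   have "t = \<alpha> \<or> t = \<beta>" using t that by auto
   thus ?thesis using ends assms(3,4) by (elim disjE) (simp_all only:)
  qed
 next
  show "continuous_on {\<alpha>..\<beta>} ?\<theta>" using assms(2) by (intro continuous_intros) auto
  fix a b assume "(a, b) \<in> {(\<alpha>, \<beta>)}"
  hence ab: "a = \<alpha>" "b = \<beta>" by auto
  show "arc_on \<theta> ?\<theta> a b" unfolding ab arc_on_def using assms by blast
 qed (use assms in auto)
 thus ?thesis by blast
qed

text \<open>On a short interval the lift varies by less than 1 and meets at most one integer, so it
  can be made constant. Bisection runs over all subintervals with integer end values, because only
  these can be joined.\<close>

lemma straight_exists:
 assumes cont: "continuous_on {0..1} \<theta>" and Z: "\<theta> 0 \<in> \<int>" "\<theta> 1 \<in> \<int>"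
 shows "\<exists>J \<theta>'. straight \<theta> 0 1 J \<theta>'"
proof -
 let ?G = "\<lambda>\<alpha> \<beta>. \<exists>J \<theta>'. straight \<theta> \<alpha> \<beta> J \<theta>'"
 let ?P = "\<lambda>x y. \<forall>\<alpha> \<beta>. 0 <= \<alpha> & x <= \<alpha> & \<alpha> <= \<beta> & \<beta> <= y & \<beta> <= 1 & \<theta> \<alpha> \<in> \<int> & \<theta> \<beta> \<in> \<int> --> ?G \<alpha> \<beta>"
 have clo: "compact {t \<in> {x..y}. \<theta> t \<in> \<int>}" if "0 <= x" "y <= 1" for x y
 proof -
  have c: "continuous_on {x..y} \<theta>" using cont continuous_on_subset that by fastforce
  have "closed ({x..y} \<inter> \<theta> -` \<int>)"
   using continuous_closed_preimage[OF c] closed_Ints by blast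
  moreover have "{x..y} \<inter> \<theta> -` \<int> = {t \<in> {x..y}. \<theta> t \<in> \<int>}" by blast
  ultimately have "closed {t \<in> {x..y}. \<theta> t \<in> \<int>}" by simp
  thus ?thesis by (metis (no_types, lifting) bounded_closed_interval bounded_subset compact_eq_bounded_closed mem_Collect_eq subsetI)
 qed
 have join: "?G \<alpha> \<gamma>" if "?G \<alpha> \<beta>" "?G \<beta> \<gamma>" "\<alpha> <= \<beta>" "\<beta> <= \<gamma>" "\<theta> \<beta> \<in> \<int>" for \<alpha> \<beta> \<gamma>
  using straight_join that by meson
 have "?P 0 1"
 proof (rule Bolzano[where P="?P"])
  fix x y z :: real
  assume xy: "?P x y" and yz: "?P y z" and le: "x <= y" "y <= z"
  show "?P x z"
  proof (intro allI impI, elim conjE)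
   fix \<alpha> \<beta> assume ab: "0 <= \<alpha>" "x <= \<alpha>" "\<alpha> <= \<beta>" "\<beta> <= z" "\<beta> <= 1" "\<theta> \<alpha> \<in> \<int>" "\<theta> \<beta> \<in> \<int>"
   consider "\<beta> <= y" | "y <= \<alpha>" | "\<alpha> < y" "y < \<beta>" by linarith
   thus "?G \<alpha> \<beta>"
   proof cases
    case 1 thus ?thesis using xy ab by blast
   next
    case 2 thus ?thesis using yz ab by blast
   next
    case 3
    \<comment> \<open>The lift need not be an integer at the cut point \<open>y\<close>. The
      interval is cut at the last integer time up to \<open>y\<close> and at the first one from
      \<open>y\<close> on; between them the lift takes no integer value.\<close>
    have "\<alpha> \<in> {t \<in> {\<alpha>..y}. \<theta> t \<in> \<int>}" "\<beta> \<in> {t \<in> {y..\<beta>}. \<theta> t \<in> \<int>}" using ab 3 by auto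
    hence "{t \<in> {\<alpha>..y}. \<theta> t \<in> \<int>} ~= {}" "{t \<in> {y..\<beta>}. \<theta> t \<in> \<int>} ~= {}" by blast+
    then obtain \<beta>1 \<alpha>1 where b1: "\<beta>1 \<in> {\<alpha>..y}" "\<theta> \<beta>1 \<in> \<int>" "\<And>t. t \<in> {\<alpha>..y} ==> \<theta> t \<in> \<int> ==> t <= \<beta>1"
     and a1: "\<alpha>1 \<in> {y..\<beta>}" "\<theta> \<alpha>1 \<in> \<int>" "\<And>t. t \<in> {y..\<beta>} ==> \<theta> t \<in> \<int> ==> \<alpha>1 <= t"
     using compact_attains_sup[OF clo[of \<alpha> y]] compact_attains_inf[OF clo[of y \<beta>]] ab 3 by auto
    have G1: "?G \<alpha> \<beta>1" using xy ab b1 3 by auto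
    have G3: "?G \<alpha>1 \<beta>" using yz ab a1 3 by auto
    have G2: "?G \<beta>1 \<alpha>1"
    proof (cases "\<beta>1 < \<alpha>1")
     case True
     show ?thesis
     proof (rule straight_elem[OF _ True b1(2) a1(2)])
      show "continuous_on {\<beta>1..\<alpha>1} \<theta>" using cont continuous_on_subset b1 a1 ab by fastforce
      fix t assume t: "\<beta>1 < t" "t < \<alpha>1"
      show "\<theta> t \<notin> \<int>"
      proof
       assume "\<theta> t \<in> \<int>"
       thus False using b1(1) b1(3)[of t] a1(1) a1(3)[of t] t by (cases "t <= y") auto
      qed
     qed
    next
     case False
     hence "\<beta>1 = \<alpha>1" using b1(1) a1(1) by auto
     hence "straight \<theta> \<beta>1 \<alpha>1 {} (\<lambda>_. \<theta> \<beta>1)" using b1(2) by (intro straight_const) auto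
     thus ?thesis by blast
    qed
    have le2: "\<alpha> <= \<beta>1" "\<beta>1 <= \<alpha>1" "\<alpha>1 <= \<beta>" using b1(1) a1(1) by auto
    show ?thesis
     by (rule join[OF join[OF G1 G2] G3]) (use le2 b1 a1 in auto)
   qed
  qed
 next
  fix t :: real assume t: "0 <= t" "t <= 1"
  then obtain e where e: "e > 0" "\<And>s. s \<in> {0..1} ==> dist s t < e ==> dist (\<theta> s) (\<theta> t) < 1/2"
   using cont unfolding continuous_on_iff by (metis atLeastAtMost_iff half_gt_zero zero_less_one)
  show "\<exists>d>0. \<forall>x y. x <= t & t <= y & y - x < d --> ?P x y"
  proof (intro exI[of _ e] conjI allI impI)
   fix x y \<alpha> \<beta>
   assume "x <= t & t <= y & y - x < e" "0 <= \<alpha> & x <= \<alpha> & \<alpha> <= \<beta> & \<beta> <= y & \<beta> <= 1 & \<theta> \<alpha> \<in> \<int> & \<theta> \<beta> \<in> \<int>"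
   hence *: "x <= t" "t <= y" "y - x < e" "0 <= \<alpha>" "x <= \<alpha>" "\<alpha> <= \<beta>" "\<beta> <= y" "\<beta> <= 1" "\<theta> \<alpha> \<in> \<int>" "\<theta> \<beta> \<in> \<int>"
    by blast+
   have "straight \<theta> \<alpha> \<beta> {} (\<lambda>_. \<theta> \<alpha>)"
   proof (rule straight_const)
    show "\<theta> \<alpha> \<in> \<int>" by (rule *(9))
    fix s assume s: "s \<in> {\<alpha>..\<beta>}" "\<theta> s \<in> \<int>"
    have "s \<in> {0..1}" "\<alpha> \<in> {0..1}" "dist s t < e" "dist \<alpha> t < e"
     using * s by (auto simp: dist_real_def abs_if)
    hence "dist (\<theta> s) (\<theta> t) < 1/2" "dist (\<theta> \<alpha>) (\<theta> t) < 1/2"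
     using e(2) by blast+
    hence "\<bar>\<theta> s - \<theta> \<alpha>\<bar> < 1" unfolding dist_real_def by linarith
    thus "\<theta> s = \<theta> \<alpha>" using s(2) *(9) by (metis Ints_cases Ints_diff Ints_nonzero_abs_less1 eq_iff_diff_eq_0)
   qed
   thus "?G \<alpha> \<beta>" by blast
  qed (rule e(1))
 qed simp
 thus ?thesis using Z by simp
qed

lemma circle_lift:
 assumes "continuous_on {0..1::real} g" "\<And>t. t \<in> {0..1} ==> norm (g t :: complex) = 1"
 obtains \<theta> where "continuous_on {0..1} \<theta>" "\<And>t. t \<in> {0..1} ==> g t = cis (2 * pi * \<theta> t)"
proof -
 have "g t ~= 0" if "t \<in> {0..1}" for t using assms(2)[OF that] by auto
 then obtain h where h: "continuous_on {0..1} h" "\<And>t. t \<in> {0..1} ==> g t = exp (h t)"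
  using continuous_logarithm_on_contractible[of "{0..1::real}" g] assms(1) convex_imp_contractible[of "{0..1::real}"]
  by (metis convex_real_interval(5))
 show ?thesis
 proof
  show "continuous_on {0..1} (\<lambda>t. Im (h t) / (2 * pi))" by (intro continuous_intros h) simp
  fix t :: real assume t: "t \<in> {0..1}"
  have "exp (Re (h t)) = 1" using assms(2)[OF t] h(2)[OF t] by (simp add: norm_exp_eq_Re)
  hence "Re (h t) = 0" by simp
  thus "g t = cis (2 * pi * (Im (h t) / (2 * pi)))" using h(2)[OF t] by (simp add: exp_eq_polar)
 qed
qed

lemma cis_2pi_eq_1: "cis (2 * pi * x) = 1 \<longleftrightarrow> x \<in> \<int>"
proof
 assume "cis (2 * pi * x) = 1"
 hence "cos (2 * pi * x) = 1" by (metis cis.sel(1) one_complex.sel(1))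
 then obtain n :: int where "2 * pi * x = of_int n * 2 * pi" using cos_one_2pi_int by auto
 hence "x = of_int n" by simp
 thus "x \<in> \<int>" by simp
next
 assume "x \<in> \<int>"
 thus "cis (2 * pi * x) = 1" by (elim Ints_cases) (metis cis_multiple_2pi mult.commute mult.assoc Ints_of_int)
qed

text \<open>\<open>K\<close> is the set of starting times of the letters. It may be infinite and
  need not be well ordered, but each circle contributes only finitely many letters.\<close>

locale std_loop = earring C c X D d for C c X and D :: "'a set" and d +
 fixes f :: "real => 'a \<times> complex" and K :: "real set" and rt :: "real => real" and lab :: "real => 'a \<times> bool"
 assumes f_loop: "joins E (f 0) (f 0) f"
  and K: "a \<in> K ==> 0 <= a & a < rt a & rt a <= 1 & fst (lab a) \<in> D"
  and K_disj: "a \<in> K ==> a' \<in> K ==> a < a' ==> rt a <= a'"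
  and f_letter: "a \<in> K ==> a <= t ==> t <= rt a ==>
   f t = (fst (lab a), c * cis ((if snd (lab a) then 1 else -1) * (2 * pi * (t - a) / (rt a - a))))"
  and f_off: "0 <= t ==> t <= 1 ==> (\<And>a. a \<in> K ==> \<not> (a < t & t < rt a)) ==> snd (f t) = c"
  and K_fin: "finite {a \<in> K. fst (lab a) = s}"

context earring
begin

theorem standard_form:
 assumes f: "joins E (x0, c) (x0, c) f"
 obtains f' K rt lab where "path_hom E (x0, c) (x0, c) f f'" "std_loop C c X D d f' K rt lab"
proof -
 have fEM: "f t \<in> EM" if "t \<in> {0..1}" for t
  using joins_topspace[OF f] that by (auto simp: topspace_E[symmetric] simp del: Un_iff)
 have ends: "f 0 = (x0, c)" "f 1 = (x0, c)" using f by (auto simp: joins_def)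
 have cf: "cont_on {0..1} E f" using f by (simp add: joins_def pathin_def)
 have cfst: "cont_on {0..1} (mtopology_of X) (\<lambda>t. fst (f t))"
  using continuous_map_compose[OF cf continuous_fst] by (simp add: o_def)
 have "\<exists>\<theta>. continuous_on {0..1} \<theta> & (\<forall>t\<in>{0..1}. q s (f t) = cis (2 * pi * \<theta> t))" if s: "s \<in> D" for s
 proof -
  have "cont_on {0..1} (top_of_set (sphere 0 1)) (\<lambda>t. q s (f t))"
   using continuous_map_compose[OF cf continuous_q[OF s]] by (simp add: o_def)
  hence "continuous_on {0..1} (\<lambda>t. q s (f t))" "\<And>t. t \<in> {0..1} ==> norm (q s (f t)) = 1"
   by (auto simp: continuous_map_in_subtopology Pi_iff)
  then obtain \<theta> where "continuous_on {0..1} \<theta>" "\<And>t. t \<in> {0..1} ==> q s (f t) = cis (2 * pi * \<theta> t)"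
   using circle_lift[of "\<lambda>t. q s (f t)"] by blast
  thus ?thesis by blast
 qed
 then obtain \<theta> where \<theta>: "\<And>s. s \<in> D ==> continuous_on {0..1} (\<theta> s)"
  "\<And>s t. s \<in> D ==> t \<in> {0..1} ==> q s (f t) = cis (2 * pi * \<theta> s t)"
  by metis
 have Zends: "\<theta> s 0 \<in> \<int>" "\<theta> s 1 \<in> \<int>" if "s \<in> D" for s
  using \<theta>(2)[OF that, of 0] \<theta>(2)[OF that, of 1] ends cis_2pi_eq_1 by auto
 have "\<exists>J \<theta>'. straight (\<theta> s) 0 1 J \<theta>'" if "s \<in> D" for s
  using straight_exists[OF \<theta>(1) Zends] that by blast
 then obtain J \<theta>' where st: "\<And>s. s \<in> D ==> straight (\<theta> s) 0 1 (J s) (\<theta>' s)" by metis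
 have st1: "continuous_on {0..1} (\<theta>' s)" "finite (J s)" if "s \<in> D" for s using st[OF that] by (simp_all add: straight_def)
 have stZ: "\<theta>' s t = \<theta> s t" if "s \<in> D" "t \<in> {0..1}" "\<theta> s t \<in> \<int>" for s t
  using st[OF that(1)] that(2,3) unfolding straight_def by blast
 have stJ: "0 <= a & a < b & b <= 1 & \<theta> s a \<in> \<int> & \<theta> s b \<in> \<int> & (\<forall>t. a < t & t < b --> \<theta> s t \<notin> \<int>) &
   (\<exists>\<epsilon>. \<forall>t\<in>{a..b}. \<theta>' s t = \<theta> s a + (if \<epsilon> then 1 else -1) * ((t - a) / (b - a)))"
  if "s \<in> D" "(a, b) \<in> J s" for s a b
  using st[OF that(1)] that(2) unfolding straight_def arc_on_def by blast
 have stoff: "\<theta>' s t \<in> \<int>" if "s \<in> D" "t \<in> {0..1}" "\<And>a b. (a, b) \<in> J s ==> \<not> (a < t & t < b)" for s t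
  using st[OF that(1)] that(2,3) unfolding straight_def by blast
 have off: "\<theta> s t \<in> \<int>" if "s \<in> D" "t \<in> {0..1}" "fst (f t) ~= s" for s t
  using \<theta>(2)[OF that(1,2)] that(3) cis_2pi_eq_1 by (simp add: q_def)
 define f' where "f' t = (fst (f t), if fst (f t) \<in> D then c * cis (2 * pi * \<theta>' (fst (f t)) t) else c)" for t
 \<comment> \<open>All circles are straightened at once. Off circle \<open>s\<close> its lift is an
   integer and hence unchanged, so one formula describes the coordinate \<open>s\<close> everywhere
   (\<open>qk\<close>); continuity in each coordinate is enough even if infinitely many circles are
   involved.\<close>
 define k where "k z = (fst (f (snd z)), if fst (f (snd z)) \<in> D
   then c * cis (2 * pi * ((1 - fst z) * \<theta> (fst (f (snd z))) (snd z) + fst z * \<theta>' (fst (f (snd z))) (snd z))) else c)" for z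
 have qk: "q s (k z) = cis (2 * pi * ((1 - fst z) * \<theta> s (snd z) + fst z * \<theta>' s (snd z)))"
  if "s \<in> D" "z \<in> {0..1} \<times> {0..1}" for s z
 proof (cases "fst (f (snd z)) = s")
  case True
  thus ?thesis using that by (simp add: q_def k_def)
 next
  case False
  hence Z: "\<theta> s (snd z) \<in> \<int>" using off[OF that(1)] that(2) by auto
  hence "\<theta>' s (snd z) = \<theta> s (snd z)" using stZ[OF that(1)] that(2) by auto
  hence "(1 - fst z) * \<theta> s (snd z) + fst z * \<theta>' s (snd z) = \<theta> s (snd z)" by (simp add: algebra_simps)
  thus ?thesis using Z cis_2pi_eq_1 False by (simp add: q_def k_def)
 qed
 have kE: "cont_on ({0..1} \<times> {0..1}) E k"
 proof (rule continuous_into_E)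
  show "k z \<in> EM" if "z \<in> topspace (top_of_set ({0..1} \<times> {0..1}))" for z
   using that EM_fst[OF fEM[of "snd z"]] EM_iff[of "k z"] by (auto simp: k_def norm_mult simp del: Un_iff)
  show "cont_on ({0..1} \<times> {0..1}) (mtopology_of X) (\<lambda>z. fst (k z))"
   unfolding k_def fst_conv by (rule continuous_map_compose_eu[OF cfst]) (auto intro!: continuous_intros)
  fix s assume s: "s \<in> D"
  have "continuous_on ({0..1} \<times> {0..1}) (\<lambda>z. q s (k z))"
  proof (rule continuous_on_eq)
   show "continuous_on ({0..1} \<times> {0..1}) (\<lambda>z. cis (2 * pi * ((1 - fst z) * \<theta> s (snd z) + fst z * \<theta>' s (snd z))))"
    by (intro continuous_intros continuous_on_compose2[OF \<theta>(1)[OF s]] continuous_on_compose2[OF st1(1)[OF s]]) auto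
  qed (use qk[OF s] in simp)
  thus "cont_on ({0..1} \<times> {0..1}) (top_of_set (sphere 0 1)) (\<lambda>z. q s (k z))"
   using qk[OF s] by (auto simp: continuous_map_in_subtopology Pi_iff)
 qed
 have fdec: "f t = (fst (f t), if fst (f t) \<in> D then c * cis (2 * pi * \<theta> (fst (f t)) t) else c)" if t: "t \<in> {0..1}" for t
 proof (cases "fst (f t) \<in> D")
  case True
  have "snd (f t) = c * q (fst (f t)) (f t)" by (simp add: q_def)
  thus ?thesis using \<theta>(2)[OF True t] True by (simp add: prod_eq_iff)
 next
  case False
  thus ?thesis using fEM[OF t] EM_iff[of "f t"] by (auto simp: prod_eq_iff simp del: Un_iff)
 qed
 have f'ends: "f' 0 = (x0, c)" "f' 1 = (x0, c)"
  using fdec[of 0] fdec[of 1] ends stZ[OF _ _ Zends(1)] stZ[OF _ _ Zends(2)] by (auto simp: f'_def)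
 have hom: "path_hom E (x0, c) (x0, c) f f'"
 proof (rule path_homI[OF kE])
  fix t :: real assume t: "0 <= t" "t <= 1"
  have "k (0, t) = (fst (f t), if fst (f t) \<in> D then c * cis (2 * pi * \<theta> (fst (f t)) t) else c)"
   by (simp add: k_def)
  also have "\<dots> = f t" by (rule fdec[symmetric]) (use t in simp)
  finally show "k (0, t) = f t" .
  show "k (1, t) = f' t" by (simp add: k_def f'_def)
  have "(1 - t) * \<theta> x0 0 + t * \<theta>' x0 0 = \<theta> x0 0" "(1 - t) * \<theta> x0 1 + t * \<theta>' x0 1 = \<theta> x0 1" if "x0 \<in> D"
   using stZ[OF that _ Zends(1)[OF that]] stZ[OF that _ Zends(2)[OF that]] by (simp_all add: algebra_simps)
  thus "k (t, 0) = (x0, c)" "k (t, 1) = (x0, c)"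
   using fdec[of 0] fdec[of 1] ends by (auto simp: k_def)
 qed
 \<comment> \<open>A noninteger lift places the loop on that circle, so simultaneous turns belong to
   the same circle; there they coincide, since their ends are integer times and their interiors
   contain none.\<close>
 have overlap: "s = s' & a = a' & b = b'"
  if J: "s \<in> D" "s' \<in> D" "(a, b) \<in> J s" "(a', b') \<in> J s'" and lt: "a < b'" "a' < b" for s s' a b a' b'
 proof -
  define t where "t = (max a a' + min b b') / 2"
  have t: "a < t" "t < b" "a' < t" "t < b'" using stJ[OF J(1,3)] stJ[OF J(2,4)] lt by (auto simp: t_def max_def min_def)
  have "\<theta> s t \<notin> \<int>" "\<theta> s' t \<notin> \<int>" "0 <= t" "t <= 1" using stJ[OF J(1,3)] stJ[OF J(2,4)] t by auto
  hence "s = s'" using off[OF J(1), of t] off[OF J(2), of t] by auto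
  hence "\<not> a < a'" "\<not> a' < a" "\<not> b < b'" "\<not> b' < b" using stJ[OF J(1,3)] stJ[OF J(2,4)] lt by auto
  thus ?thesis using \<open>s = s'\<close> by simp
 qed
 have disj: "b <= a'" if J: "s \<in> D" "s' \<in> D" "(a, b) \<in> J s" "(a', b') \<in> J s'" "a < a'" for s s' a b a' b'
  using overlap[OF J(1-4)] stJ[OF J(2,4)] J(5) by force
 have uniq: "s = s' & b = b'" if J: "s \<in> D" "s' \<in> D" "(a, b) \<in> J s" "(a, b') \<in> J s'" for s s' a b b'
  using overlap[OF J] stJ[OF J(1,3)] stJ[OF J(2,4)] by blast
 define K where "K = {a. \<exists>s b. s \<in> D & (a, b) \<in> J s}"
 have "\<exists>s b \<epsilon>. s \<in> D & (a, b) \<in> J s & (\<forall>t\<in>{a..b}. \<theta>' s t = \<theta> s a + (if \<epsilon> then 1 else -1) * ((t - a) / (b - a)))"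
  if "a \<in> K" for a
 proof -
  obtain s b where "s \<in> D" "(a, b) \<in> J s" using \<open>a \<in> K\<close> unfolding K_def by blast
  thus ?thesis using stJ by blast
 qed
 then obtain ls rt le where L: "\<And>a. a \<in> K ==> ls a \<in> D" "\<And>a. a \<in> K ==> (a, rt a) \<in> J (ls a)"
  "\<And>a. a \<in> K ==> \<forall>t\<in>{a..rt a}. \<theta>' (ls a) t = \<theta> (ls a) a + (if le a then 1 else -1) * ((t - a) / (rt a - a))"
  by metis
 have fst_on: "fst (f t) = ls a" if a: "a \<in> K" and t: "t \<in> {a..rt a}" for a t
 proof -
  let ?A = "{u \<in> {0..1}. fst (f u) = ls a}"
  have ab: "0 <= a" "a < rt a" "rt a <= 1" and nz: "\<And>t. a < t ==> t < rt a ==> \<theta> (ls a) t \<notin> \<int>"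
   using stJ[OF L(1,2)[OF a]] by auto
  have "closedin (mtopology_of X) {ls a}"
   using L(1)[OF a] D_sub by (auto simp: mtopology_of_def closedin_Hausdorff_sing_eq XM.Hausdorff_space_mtopology)
  hence "closedin (top_of_set {0..1}) ?A" using closedin_continuous_map_preimage[OF cfst, of "{ls a}"] by simp
  hence "closed ?A" by (simp add: closedin_closed_eq)
  moreover have "{a<..<rt a} \<subseteq> ?A"
  proof
   fix u assume u: "u \<in> {a<..<rt a}"
   hence "u \<in> {0..1}" using ab by auto
   thus "u \<in> ?A" using off[OF L(1)[OF a]] nz u by auto
  qed
  ultimately have "closure {a<..<rt a} \<subseteq> ?A" by (rule closure_minimal[rotated])
  thus ?thesis using ab t by auto
 qed
 have "std_loop C c X D d f' K rt (\<lambda>a. (ls a, le a))"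
 proof
  show "joins E (f' 0) (f' 0) f'" using path_hom_imp(2)[OF hom] f'ends by simp
  show "0 <= a & a < rt a & rt a <= 1 & fst (ls a, le a) \<in> D" if "a \<in> K" for a
   using stJ[OF L(1,2)[OF that]] L(1)[OF that] by simp
  show "rt a <= a'" if "a \<in> K" "a' \<in> K" "a < a'" for a a'
   using disj L that by blast
  show "f' t = (fst (ls a, le a), c * cis ((if snd (ls a, le a) then 1 else - 1) * (2 * pi * (t - a) / (rt a - a))))"
   if a: "a \<in> K" "a <= t" "t <= rt a" for a t
  proof -
   have "fst (f t) = ls a" using fst_on[OF a(1)] a by simp
   moreover have "\<theta>' (ls a) t = \<theta> (ls a) a + (if le a then 1 else -1) * ((t - a) / (rt a - a))"
    using L(3)[OF a(1)] a by simp
   moreover have "cis (2 * pi * (\<theta> (ls a) a + y)) = cis (2 * pi * y)" for y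
   proof -
    have "cis (2 * pi * \<theta> (ls a) a) = 1" using stJ[OF L(1,2)[OF a(1)]] cis_2pi_eq_1 by blast
    thus ?thesis by (metis cis_mult distrib_left mult_1)
   qed
   moreover have "2 * pi * ((if le a then 1 else -1) * ((t - a) / (rt a - a))) = (if le a then 1 else -1) * (2 * pi * (t - a) / (rt a - a))"
    by simp
   ultimately show ?thesis using L(1)[OF a(1)] unfolding f'_def fst_conv snd_conv by (simp only: if_True)
  qed
  show "snd (f' t) = c" if t: "0 <= t" "t <= 1" "\<And>a. a \<in> K ==> \<not> (a < t & t < rt a)" for t
  proof (cases "fst (f t) \<in> D")
   case True
   have "\<theta>' (fst (f t)) t \<in> \<int>"
   proof (rule stoff[OF True])
    fix a b assume ab: "(a, b) \<in> J (fst (f t))"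
    hence "a \<in> K" using True by (auto simp: K_def)
    hence "rt a = b" using uniq[OF L(1) True L(2) ab] by blast
    thus "\<not> (a < t & t < b)" using t(3)[OF \<open>a \<in> K\<close>] by simp
   qed (use t in simp)
   thus ?thesis using cis_2pi_eq_1 by (simp add: f'_def)
  qed (simp add: f'_def)
  show "finite {a \<in> K. fst (ls a, le a) = s}" for s
  proof (cases "s \<in> D")
   case True
   have "{a \<in> K. fst (ls a, le a) = s} \<subseteq> fst ` J s" using L(2) by force
   thus ?thesis using st1(2)[OF True] finite_subset by blast
  next
   case False
   hence empty: "{a \<in> K. fst (ls a, le a) = s} = {}" using L(1) by auto
   show ?thesis unfolding empty by (rule finite.emptyI)
  qed
 qed
 thus ?thesis using that hom by blast
qed

end

section \<open>Matchings of infinite words\<close>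

text \<open>Koenig's lemma. \<open>ext n \<rho>\<close> says that \<open>\<rho>\<close> on the n-th
  set extends to a matching of every later set; since that set has finitely many self-maps, the
  pigeonhole principle extends such a \<open>\<rho>\<close> by one stage.\<close>

lemma ncmatching_compactness:
 fixes Kn :: "nat => 'k::linorder set"
 assumes fin: "\<And>n. finite (Kn n)" and mono: "\<And>n. Kn n \<subseteq> Kn (Suc n)" and Kn0: "Kn 0 = {}"
  and ex: "\<And>n. \<exists>\<pi>. ncmatching (Kn n) lab \<pi>"
  and down: "\<And>n m \<pi>. n <= m ==> ncmatching (Kn m) lab \<pi> ==> ncmatching (Kn n) lab \<pi>"
 shows "\<exists>\<pi>. ncmatching (\<Union>n. Kn n) lab \<pi>"
proof -
 define ext where "ext n \<rho> \<longleftrightarrow> (\<forall>m\<ge>n. \<exists>\<pi>. ncmatching (Kn m) lab \<pi> & (\<forall>a\<in>Kn n. \<pi> a = \<rho> a))" for n \<rho>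
 have step: "\<exists>\<rho>'. ext (Suc n) \<rho>' & (\<forall>a\<in>Kn n. \<rho>' a = \<rho> a)" if "ext n \<rho>" for n \<rho>
 proof -
  have "\<forall>m. \<exists>\<pi>. ncmatching (Kn (max m (Suc n))) lab \<pi> & (\<forall>a\<in>Kn n. \<pi> a = \<rho> a)"
   using that by (simp add: ext_def)
  then obtain P where P: "\<And>m. ncmatching (Kn (max m (Suc n))) lab (P m)" "\<And>m a. a \<in> Kn n ==> P m a = \<rho> a"
   by metis
  define R where "R m = restrict (P m) (Kn (Suc n))" for m
  have "R m \<in> PiE (Kn (Suc n)) (\<lambda>_. Kn (Suc n))" for m
   using down[OF _ P(1), of "Suc n" m] by (auto simp: R_def ncmatching_def)
  hence "finite (range R)"
   using finite_PiE[of "Kn (Suc n)" "\<lambda>_. Kn (Suc n)"] fin by (metis finite_subset image_subsetI)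
  then obtain m0 where m0: "infinite {m \<in> UNIV. R m = R m0}"
   using pigeonhole_infinite[of "UNIV :: nat set" R] by auto
  have "ext (Suc n) (P m0)"
   unfolding ext_def
  proof (intro allI impI)
   fix m assume "Suc n <= m"
   obtain m' where m': "m' >= m" "R m' = R m0"
    using m0 unfolding infinite_nat_iff_unbounded_le by blast
   have "P m' a = P m0 a" if "a \<in> Kn (Suc n)" for a
    using m'(2) that unfolding R_def by (metis restrict_apply')
   moreover have "ncmatching (Kn m) lab (P m')" using m'(1) by (intro down[OF _ P(1)[of m']]) simp
   ultimately show "\<exists>\<pi>. ncmatching (Kn m) lab \<pi> & (\<forall>a\<in>Kn (Suc n). \<pi> a = P m0 a)" by blast
  qed
  thus ?thesis using P(2) by blast
 qed
 have "ext 0 id" using ex by (simp add: ext_def Kn0)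
 then obtain \<sigma> where \<sigma>: "\<And>n. ext n (\<sigma> n)" "\<And>n a. a \<in> Kn n ==> \<sigma> (Suc n) a = \<sigma> n a"
  using dependent_nat_choice[of "\<lambda>n \<rho>. ext n \<rho>" "\<lambda>n \<rho> \<rho>'. \<forall>a\<in>Kn n. \<rho>' a = \<rho> a"] step by metis
 have mono': "Kn n \<subseteq> Kn m" if "n <= m" for n m using lift_Suc_mono_le[of Kn] mono that by blast
 have \<sigma>_eq: "\<sigma> m a = \<sigma> n a" if "n <= m" "a \<in> Kn n" for n m a
  using that(1)
 proof (induction rule: dec_induct)
  case (step m)
  have "a \<in> Kn m" using mono'[OF step(1)] that(2) by blast
  from \<sigma>(2)[OF this] step(3) show ?case by (rule trans)
 qed simp
 define \<pi> where "\<pi> a = \<sigma> (LEAST n. a \<in> Kn n) a" for a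
 have \<pi>: "\<pi> a = \<sigma> n a" if "a \<in> Kn n" for a n
  unfolding \<pi>_def using \<sigma>_eq[of "LEAST n. a \<in> Kn n" n a] that by (metis LeastI_ex Least_le)
 have nc: "ncmatching (Kn n) lab \<pi>" for n
 proof -
  obtain \<tau> where \<tau>: "ncmatching (Kn n) lab \<tau>" "\<And>a. a \<in> Kn n ==> \<tau> a = \<sigma> n a"
   using \<sigma>(1)[of n] unfolding ext_def by blast
  hence "\<pi> a = \<tau> a" if "a \<in> Kn n" for a using \<pi> that by simp
  thus ?thesis using \<tau>(1) unfolding ncmatching_def by metis
 qed
 have "ncmatching (\<Union>n. Kn n) lab \<pi>"
  unfolding ncmatching_def
 proof (intro conjI ballI)
  fix i assume "i \<in> (\<Union>n. Kn n)"
  then obtain n where n: "i \<in> Kn n" by blast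
  show "\<pi> i \<in> (\<Union>n. Kn n)" "\<pi> (\<pi> i) = i" "lab (\<pi> i) = linv (lab i)"
   using nc[of n] n unfolding ncmatching_def by blast+
  fix k assume "k \<in> (\<Union>n. Kn n)"
  then obtain m where m: "k \<in> Kn m" by blast
  have "i \<in> Kn (max n m)" "k \<in> Kn (max n m)" using n m mono' by (meson max.cobounded1 max.cobounded2 subsetD)+
  thus "\<not> (i < k & k < \<pi> i & \<pi> i < \<pi> k)" using nc[of "max n m"] unfolding ncmatching_def by blast
 qed
 thus ?thesis by blast
qed

context std_loop
begin

definition KS :: "'a set => real set" where "KS S = {a \<in> K. fst (lab a) \<in> S}"

lemma finite_KS: "finite S ==> finite (KS S)"
proof -
 assume "finite S"
 moreover have "KS S = (\<Union>s\<in>S. {a \<in> K. fst (lab a) = s})" by (auto simp: KS_def)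
 ultimately show ?thesis using K_fin by simp
qed

lemma cont_f: "cont_on {0..1} E f"
 using f_loop by (simp add: joins_def pathin_def)

lemma cont_f_sub: "0 <= a ==> b <= 1 ==> cont_on {a..b} E f"
 using continuous_map_from_subtopology_mono[OF cont_f, of "{a..b}"] by auto

lemma q_letter:
 assumes "a \<in> K" "a <= t" "t <= rt a"
 shows "q (fst (lab a)) (f t) = cis ((if snd (lab a) then 1 else -1) * (2 * pi * (t - a) / (rt a - a)))"
 unfolding f_letter[OF assms] by (simp add: q_def)

lemma snd_f_neq:
 assumes "0 <= t" "t <= 1" "snd (f t) ~= c"
 obtains a where "a \<in> K" "a < t" "t < rt a"
 using f_off[OF assms(1,2)] assms(3) by blast

text \<open>The induction peels off the first letter after time \<open>x\<close>. Up to it, all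
  coordinates in \<open>S\<close> stay at the base value and contribute nothing; the letter itself
  is one full turn.\<close>

lemma word_from:
 assumes S: "finite S" "S \<subseteq> D"
 shows "sorted_wrt (<) js ==> set js = {a \<in> KS S. x <= a} ==> (\<And>a. a \<in> KS S ==> rt a <= x \<or> x <= a) ==>
  0 <= x ==> x <= 1 ==> word_along S q f x 1 = fg_of (map lab js)"
proof (induction js arbitrary: x)
 have sys: "circle_system E S q" by (rule circle_system_E[OF S(2)])
 have triv: "word_along S q f x y = 0" if x: "0 <= x" "x <= y" "y <= 1" and no: "\<And>a. a \<in> KS S ==> rt a <= x \<or> y <= a" for x y
 proof (rule word_along_trivial[OF sys S(1) cont_f_sub])
  fix t s assume t: "t \<in> {x..y}" and s: "s \<in> S"
  show "q s (f t) = 1"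
  proof (rule ccontr)
   assume "q s (f t) ~= 1"
   hence "fst (f t) = s" "snd (f t) ~= c" using q_neq_1 by auto
   then obtain a where a: "a \<in> K" "a < t" "t < rt a" using snd_f_neq[of t] t x by auto
   hence "fst (f t) = fst (lab a)" using f_letter[OF a(1), of t] by simp
   hence "a \<in> KS S" using a s \<open>fst (f t) = s\<close> by (simp add: KS_def)
   thus False using no a t by force
  qed
 qed (use x in auto)
 {
  case Nil
  have "rt a <= x \<or> 1 <= a" if "a \<in> KS S" for a using Nil.prems(2) Nil.prems(3)[OF that] that by auto
  thus ?case using triv[of x 1] Nil.prems by simp
 next
  case (Cons a js)
  have aS: "a \<in> KS S" "x <= a" using Cons.prems(2) by auto
  hence aK: "a \<in> K" "fst (lab a) \<in> S" by (auto simp: KS_def)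
  note Ka = K[OF aK(1)]
  interpret coc: cocycle E "circle_cover E S q" "cross_letter S q" by (rule cocycle_cross_letter[OF sys S(1)])
  have js: "a < b" if "b \<in> set js" for b using Cons.prems(1) that by simp
  have 1: "word_along S q f x a = 0"
  proof (rule triv)
   show "rt b <= x \<or> a <= b" if "b \<in> KS S" for b
    using Cons.prems(3)[OF that] Cons.prems(2) that js by fastforce
  qed (use Cons.prems aS Ka in auto)
  have 2: "word_along S q f a (rt a) = fg_of [lab a]"
  proof -
   have "word_along S q f a (rt a) = fg_of [(fst (lab a), snd (lab a))]"
   proof (rule word_along_circle[OF sys S(1) aK(2)])
    show "q s' (f t) = 1" if "t \<in> {a..rt a}" "s' \<in> S" "s' ~= fst (lab a)" for t s'
     using f_letter[OF aK(1), of t] that by (simp add: q_def)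
   qed (use Ka q_letter[OF aK(1)] cont_f_sub in auto)
   thus ?thesis by simp
  qed
  have 3: "word_along S q f (rt a) 1 = fg_of (map lab js)"
  proof (rule Cons.IH)
   show "sorted_wrt (<) js" using Cons.prems(1) by simp
   show "set js = {b \<in> KS S. rt a <= b}"
   proof
    show "set js \<subseteq> {b \<in> KS S. rt a <= b}"
    proof
     fix b assume b: "b \<in> set js"
     hence "b \<in> KS S" "a < b" using Cons.prems(2) js by auto
     thus "b \<in> {b \<in> KS S. rt a <= b}" using K_disj[OF aK(1), of b] by (simp add: KS_def)
    qed
    show "{b \<in> KS S. rt a <= b} \<subseteq> set js"
    proof
     fix b assume b: "b \<in> {b \<in> KS S. rt a <= b}"
     hence "b \<in> set (a # js)" unfolding Cons.prems(2) using Ka aS by simp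
     moreover have "b ~= a" using b Ka by auto
     ultimately show "b \<in> set js" by simp
    qed
   qed
   show "rt b <= rt a \<or> rt a <= b" if "b \<in> KS S" for b
   proof -
    have bK: "b \<in> K" using that by (simp add: KS_def)
    consider "a < b" | "a = b" | "b < a" by linarith
    thus ?thesis
    proof cases
     case 1 thus ?thesis using K_disj[OF aK(1) bK] by simp
    next
     case 3 thus ?thesis using K_disj[OF bK aK(1)] Ka by auto
    qed simp
   qed
  qed (use Ka in auto)
  have "word_along S q f x 1 = word_along S q f x a + (word_along S q f a (rt a) + word_along S q f (rt a) 1)"
   unfolding word_along_def
   using coc.ctrans_join[OF cont_f_sub, of x 1 a] coc.ctrans_join[OF cont_f_sub, of a 1 "rt a"] Cons.prems Ka aS by simp
  also have "\<dots> = fg_of (map lab (a # js))"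
   using fg_of_Cons[of "lab a" "map lab js"] by (simp add: 1 2 3)
  finally show ?case .
 }
qed

lemma word_std:
 assumes "finite S" "S \<subseteq> D"
 shows "word_along S q f 0 1 = fg_of (map lab (sorted_list_of_set (KS S)))"
proof (rule word_from[OF assms])
 show "sorted_wrt (<) (sorted_list_of_set (KS S))" by simp
 have "0 <= a" if "a \<in> KS S" for a using K[of a] that by (simp add: KS_def)
 thus "set (sorted_list_of_set (KS S)) = {a \<in> KS S. 0 <= a}" "\<And>a. a \<in> KS S ==> rt a <= 0 \<or> 0 <= a"
  using finite_KS[OF assms(1)] by auto
qed auto

text \<open>The stages are the letters on circles of index at most n, finite sets with trivial
  words. Matched letters lie on the same circle, so a matching restricts to earlier stages; stage 0
  is empty because indices start at 1.\<close>

lemma matching_exists: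
 assumes "\<And>S. finite S ==> S \<subseteq> D ==> word_along S q f 0 1 = 0"
 shows "\<exists>\<pi>. ncmatching K lab \<pi>"
proof -
 define S where "S n = {s \<in> D. idx s <= n}" for n
 have finS: "finite (S n)" for n unfolding S_def by (rule finite_idx_le)
 have SD: "S n \<subseteq> D" for n by (auto simp: S_def)
 have "(\<Union>n. KS (S n)) = K" using K by (auto simp: KS_def S_def)
 moreover have "\<exists>\<pi>. ncmatching (\<Union>n. KS (S n)) lab \<pi>"
 proof (rule ncmatching_compactness)
  show "KS (S 0) = {}" using idx(3) by (force simp: KS_def S_def)
  show "\<exists>\<pi>. ncmatching (KS (S n)) lab \<pi>" for n
  proof -
   have "red (map lab (sorted_list_of_set (KS (S n)))) = []"
    using assms[OF finS SD] word_std[OF finS SD] fg_of_eq_0 by metis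
   thus ?thesis
    using ncmatching_exists[of "sorted_list_of_set (KS (S n))" lab] finite_KS[OF finS] by simp
  qed
  show "ncmatching (KS (S n)) lab \<pi>" if "n <= m" "ncmatching (KS (S m)) lab \<pi>" for n m \<pi>
  proof -
   have sub: "KS (S n) \<subseteq> KS (S m)" using that(1) by (auto simp: KS_def S_def)
   have "\<pi> i \<in> KS (S n)" if "i \<in> KS (S n)" for i
    using \<open>ncmatching (KS (S m)) lab \<pi>\<close> that sub unfolding ncmatching_def KS_def by force
   thus ?thesis using that(2) sub unfolding ncmatching_def by (meson subsetD)
  qed
 qed (use finite_KS[OF finS] in \<open>auto simp: KS_def S_def\<close>)
 ultimately show ?thesis by simp
qed

end

section \<open>Loops with trivial words are null homotopic\<close>

locale matched_loop = std_loop C c X D d f K rt lab for C c X and D :: "'a set" and d f K rt lab +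
 fixes \<pi> :: "real => real"
 assumes matching: "ncmatching K lab \<pi>" and f_base: "snd (f 0) = c"
  and sc: "simply_connected_space (mtopology_of X)" and lsc: "locally_simply_connected_space (mtopology_of X)"
begin

text \<open>The affine, orientation reversing map from the letter at \<open>a\<close> onto its
  partner, which runs through the same circle backwards. So \<open>f\<close> has equal values at
  \<open>t\<close> and \<open>\<phi> a t\<close>.\<close>

definition \<phi> :: "real => real => real" where
 "\<phi> a t = rt (\<pi> a) - (t - a) / (rt a - a) * (rt (\<pi> a) - \<pi> a)"

definition leaves :: "(real \<times> real) set" where
 "leaves = {(t, \<phi> a t) | a t. a \<in> K & a < \<pi> a & a <= t & t <= rt a}"

definition L1 :: "(real \<times> real) set" where
 "L1 = leaves \<union> {(0, 1)} \<union> {(t, t) | t. 0 <= t & t <= 1}"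

text \<open>Infinitely many letters can accumulate, so the leaves alone need not form a closed set.
  Limits of leaves are again noncrossing chords with equal values of \<open>f\<close> at their
  ends.\<close>

definition L :: "(real \<times> real) set" where "L = closure L1"

lemma \<pi>: "a \<in> K ==> \<pi> a \<in> K" "a \<in> K ==> \<pi> (\<pi> a) = a" "a \<in> K ==> lab (\<pi> a) = linv (lab a)"
 using matching by (auto simp: ncmatching_def)

lemma \<pi>_noncrossing: "a \<in> K ==> b \<in> K ==> a < b ==> b < \<pi> a ==> \<pi> b < \<pi> a"
proof (rule ccontr)
 assume a: "a \<in> K" "b \<in> K" "a < b" "b < \<pi> a" "\<not> \<pi> b < \<pi> a"
 have "\<pi> b ~= \<pi> a" using \<pi>(2)[OF a(1)] \<pi>(2)[OF a(2)] a(3) by auto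
 thus False using matching a unfolding ncmatching_def by (meson linorder_neqE_linordered_idom)
qed

lemma \<pi>_neq: "a \<in> K ==> \<pi> a ~= a"
 using \<pi>(3)[of a] by (metis linv_neq(1))

lemma \<phi>_affine: "a \<in> K ==> a <= t ==> t <= rt a ==> \<pi> a <= \<phi> a t & \<phi> a t <= rt (\<pi> a)"
proof -
 assume a: "a \<in> K" "a <= t" "t <= rt a"
 have "0 <= (t - a) / (rt a - a)" "(t - a) / (rt a - a) <= 1" using a K[OF a(1)] by auto
 thus ?thesis
  using K[OF \<pi>(1)[OF a(1)]] mult_left_le_one_le[of "rt (\<pi> a) - \<pi> a" "(t - a) / (rt a - a)"]
   mult_nonneg_nonneg[of "(t - a) / (rt a - a)" "rt (\<pi> a) - \<pi> a"]
  unfolding \<phi>_def by linarith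
qed

lemma \<phi>_mono: "a \<in> K ==> t < t' ==> \<phi> a t' < \<phi> a t"
proof -
 assume a: "a \<in> K" "t < t'"
 have "(t - a) / (rt a - a) < (t' - a) / (rt a - a)" using a K[OF a(1)] by (intro divide_strict_right_mono) auto
 from mult_strict_right_mono[OF this, of "rt (\<pi> a) - \<pi> a"]
 show ?thesis using K[OF \<pi>(1)[OF a(1)]] unfolding \<phi>_def by linarith
qed

lemma f_\<phi>: assumes a: "a \<in> K" "a <= t" "t <= rt a" shows "f (\<phi> a t) = f t"
proof -
 note pa = \<pi>(1)[OF a(1)]
 define r where "r = (t - a) / (rt a - a)"
 have r: "(\<phi> a t - \<pi> a) / (rt (\<pi> a) - \<pi> a) = 1 - r"
  using K[OF pa] by (simp add: \<phi>_def r_def field_simps)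
 have "f (\<phi> a t) = (fst (lab (\<pi> a)), c * cis ((if snd (lab (\<pi> a)) then 1 else -1) * (2 * pi * (\<phi> a t - \<pi> a) / (rt (\<pi> a) - \<pi> a))))"
  using f_letter[OF pa] \<phi>_affine[OF a] by simp
 also have "\<dots> = (fst (lab a), c * cis ((if snd (lab a) then -1 else 1) * (2 * pi * (1 - r))))"
  using r \<pi>(3)[OF a(1)] by (cases "lab a") (simp flip: times_divide_eq_right)
 also have "cis ((if snd (lab a) then -1 else 1) * (2 * pi * (1 - r))) = cis ((if snd (lab a) then 1 else -1) * (2 * pi * r))"
  by (cases "snd (lab a)") (simp_all add: cis.ctr complex_eq_iff cos_diff sin_diff algebra_simps)
 also have "(fst (lab a), c * \<dots>) = f t" using f_letter[OF a] by (simp add: r_def)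
 finally show ?thesis .
qed

lemma leavesE: assumes "(u, v) \<in> L1"
 obtains a where "a \<in> K" "a < \<pi> a" "a <= u" "u <= rt a" "v = \<phi> a u" | "u = 0" "v = 1" | "u = v" "0 <= u" "u <= 1"
 using assms by (auto simp: L1_def leaves_def)

lemma leaf_in: "a \<in> K ==> a < \<pi> a ==> a <= t ==> t <= rt a ==> (t, \<phi> a t) \<in> L"
 unfolding L_def using closure_subset[of L1] by (auto simp: L1_def leaves_def)

lemma L1_bounds: "(u, v) \<in> L1 ==> 0 <= u & u <= v & v <= 1 & f u = f v"
proof (erule leavesE)
 fix a assume a: "a \<in> K" "a < \<pi> a" "a <= u" "u <= rt a" "v = \<phi> a u"
 have "rt a <= \<pi> a" using K_disj a \<pi>(1) by blast
 thus ?thesis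
  using \<phi>_affine[OF a(1,3,4)] f_\<phi>[OF a(1,3,4)] a K[OF a(1)] K[OF \<pi>(1)[OF a(1)]] by auto
next
 assume "u = 0" "v = 1"
 thus ?thesis using f_loop by (simp add: joins_def)
qed auto

text \<open>Leaves of one pair of letters are nested because \<open>\<phi>\<close> is decreasing;
  leaves of different pairs inherit noncrossing from the matching.\<close>

lemma L1_noncrossing:
 assumes "(u, v) \<in> L1" "(u', v') \<in> L1" "u < u'" "u' < v" shows "v' <= v"
 using assms(1)
proof (cases rule: leavesE)
 case (1 a)
 show ?thesis using assms(2)
 proof (cases rule: leavesE)
  case b: (1 b)
  show ?thesis
  proof (cases "a = b")
   case True
   thus ?thesis using \<phi>_mono[OF 1(1) assms(3)] 1 b by simp
  next
   case False
   have ab: "a < b"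
   proof (rule ccontr)
    assume "\<not> a < b"
    hence "b < a" using False by simp
    hence "rt b <= a" using K_disj b(1) 1(1) by blast
    thus False using 1 b assms(3) by linarith
   qed
   have v: "v <= rt (\<pi> a)" "\<pi> a <= v" using \<phi>_affine[OF 1(1,3,4)] 1(5) by auto
   have "b < \<pi> a"
   proof (rule ccontr)
    assume n: "\<not> b < \<pi> a"
    moreover have "b ~= \<pi> a" using b(2) \<pi>(2)[OF 1(1)] ab by auto
    ultimately have "rt (\<pi> a) <= b" using K_disj[OF \<pi>(1)[OF 1(1)] b(1)] by auto
    thus False using v b assms(4) by linarith
   qed
   hence "\<pi> b < \<pi> a" using \<pi>_noncrossing 1(1) b(1) ab by blast
   hence "rt (\<pi> b) <= \<pi> a" using K_disj \<pi>(1) 1(1) b(1) by blast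
   thus ?thesis using \<phi>_affine[OF b(1,3,4)] b(5) v by linarith
  qed
 next
  case 2
  thus ?thesis using assms(3) K[OF 1(1)] 1 by linarith
 qed (use assms in simp)
next
 case 2
 thus ?thesis using L1_bounds[OF assms(2)] by simp
qed (use assms in simp)

lemma closure_L1_approx:
 assumes "z \<in> L" "\<epsilon> > 0"
 obtains u v where "(u, v) \<in> L1" "\<bar>u - fst z\<bar> < \<epsilon>" "\<bar>v - snd z\<bar> < \<epsilon>"
proof -
 obtain w where w: "w \<in> L1" "dist w z < \<epsilon>" using assms unfolding L_def closure_approachable by blast
 thus ?thesis
  using that[of "fst w" "snd w"] dist_fst_le[of w z] dist_snd_le[of w z] by (simp add: dist_real_def)
qed

sublocale lam: lamination EM ed f L
proof
 show cf: "cont_on {0..1} ES.mtopology f" using cont_f by (simp add: E_eq)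
 show b: "0 <= u & u <= v & v <= 1" if "(u, v) \<in> L" for u v
 proof -
  have "closed {z :: real \<times> real. 0 <= fst z & fst z <= snd z & snd z <= 1}"
   by (intro closed_Collect_conj closed_Collect_le continuous_intros)
  moreover have "L1 \<subseteq> {z. 0 <= fst z & fst z <= snd z & snd z <= 1}" using L1_bounds by auto
  ultimately have "L \<subseteq> {z. 0 <= fst z & fst z <= snd z & snd z <= 1}"
   unfolding L_def by (rule closure_minimal[rotated])
  thus ?thesis using that by auto
 qed
 show "closed L" by (simp add: L_def)
 show "(0, 1) \<in> L" "\<And>t. 0 <= t ==> t <= 1 ==> (t, t) \<in> L"
  unfolding L_def using closure_subset[of L1] by (auto simp: L1_def)
 show "f u = f v" if uv: "(u, v) \<in> L" for u v
 proof -
  obtain w where w: "\<And>n. w n \<in> L1" "w \<longlonglongrightarrow> (u, v)" using uv unfolding L_def closure_sequential by blast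
  have wb: "0 <= fst (w n) & fst (w n) <= snd (w n) & snd (w n) <= 1 & f (fst (w n)) = f (snd (w n))" for n
   using L1_bounds[of "fst (w n)" "snd (w n)"] w(1)[of n] by simp
  have b': "u \<in> {0..1}" "v \<in> {0..1}" using b[OF uv] by auto
  have i: "fst (w n) \<in> {0..1}" "snd (w n) \<in> {0..1}" for n using wb[of n] by auto
  have "(\<lambda>n. ed (f (fst (w n))) (f u)) \<longlonglongrightarrow> 0"
   using tendsto_fst[OF w(2)] by (intro ES.continuous_map_eu_tendsto[OF cf b'(1) i(1)]) simp
  moreover have "(\<lambda>n. ed (f (snd (w n))) (f v)) \<longlonglongrightarrow> 0"
   using tendsto_snd[OF w(2)] by (intro ES.continuous_map_eu_tendsto[OF cf b'(2) i(2)]) simp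
  ultimately have lim: "(\<lambda>n. ed (f (fst (w n))) (f u) + ed (f (snd (w n))) (f v)) \<longlonglongrightarrow> 0 + 0"
   by (rule tendsto_add)
  have fEM: "f t \<in> EM" if "t \<in> {0..1}" for t using cf that unfolding ES.continuous_map_eu_metric by blast
  have "ed (f u) (f v) <= ed (f (fst (w n))) (f u) + ed (f (snd (w n))) (f v)" for n
   using ES.triangle[OF fEM[OF b'(1)] fEM[OF i(1)[of n]] fEM[OF b'(2)]] wb[of n] ES.commute[of "f u"] by simp
  hence "ed (f u) (f v) <= 0 + 0" by (intro LIMSEQ_le_const[OF lim]) blast
  thus ?thesis using fEM[OF b'(1)] fEM[OF b'(2)] ES.nonneg[of "f u" "f v"] ES.zero by (metis add.right_neutral order_antisym)
 qed
 \<comment> \<open>A crossing is given by strict inequalities, so it would persist for nearby chords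
   of \<open>L1\<close>.\<close>
 show "v' <= v" if z: "(u, v) \<in> L" "(u', v') \<in> L" "u < u'" "u' < v" for u v u' v'
 proof (rule ccontr)
  assume "\<not> v' <= v"
  define \<epsilon> where "\<epsilon> = min (u' - u) (min (v - u') (v' - v)) / 2"
  have \<epsilon>: "\<epsilon> > 0" "2 * \<epsilon> <= u' - u" "2 * \<epsilon> <= v - u'" "2 * \<epsilon> <= v' - v"
   using z(3,4) \<open>\<not> v' <= v\<close> by (auto simp: \<epsilon>_def)
  obtain a b where ab: "(a, b) \<in> L1" "\<bar>a - u\<bar> < \<epsilon>" "\<bar>b - v\<bar> < \<epsilon>" using closure_L1_approx[OF z(1) \<epsilon>(1)] by auto
  obtain a' b' where ab': "(a', b') \<in> L1" "\<bar>a' - u'\<bar> < \<epsilon>" "\<bar>b' - v'\<bar> < \<epsilon>" using closure_L1_approx[OF z(2) \<epsilon>(1)] by auto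
  have "b' <= b" using \<epsilon> ab ab' by (intro L1_noncrossing[OF ab(1) ab'(1)]) linarith+
  thus False using \<epsilon> ab ab' by linarith
 qed
qed

lemma letter_neq: assumes "b \<in> K" "b < t" "t < rt b" shows "snd (f t) ~= c"
proof
 assume "snd (f t) = c"
 hence "cis ((if snd (lab b) then 1 else -1) * (2 * pi * (t - b) / (rt b - b))) = 1"
  using f_letter[OF assms(1), of t] assms by simp
 hence "cis (2 * pi * ((t - b) / (rt b - b))) = 1"
  using inverse_eq_1_iff[of "cis (2 * pi * (t - b) / (rt b - b))"]
  unfolding cis_inverse by (cases "snd (lab b)") (simp_all only: if_True if_False mult_1_left mult_minus1 times_divide_eq_right minus_divide_left, blast)
 hence Z: "(t - b) / (rt b - b) \<in> \<int>" by (simp only: cis_2pi_eq_1)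
 have "0 < (t - b) / (rt b - b)" "(t - b) / (rt b - b) < 1" using assms by auto
 moreover from this have "\<bar>(t - b) / (rt b - b)\<bar> < 1" by linarith
 ultimately show False using Ints_nonzero_abs_less1[OF Z] by linarith
qed

text \<open>Over the open time interval of a letter, the pairs that are neither trivial nor on its
  leaf form an open set. \<open>L1\<close> misses it, hence so does the closure.\<close>

lemma L_at_letter:
 assumes uv: "(u, v) \<in> L" and b: "b \<in> K" "b < u" "u < rt b"
 shows "v = u \<or> b < \<pi> b & v = \<phi> b u"
proof (rule ccontr)
 assume n: "\<not> ?thesis"
 let ?U = "{z :: real \<times> real. b < fst z & fst z < rt b & snd z ~= fst z & (b < \<pi> b --> snd z ~= \<phi> b (fst z))}"
 have "open ?U"
  unfolding \<phi>_def using K[OF b(1)]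
  by (intro open_Collect_conj open_Collect_imp open_Collect_less open_Collect_neq continuous_intros closed_Collect_const) auto
 moreover have "(u, v) \<in> ?U \<inter> closure L1" using n b uv by (auto simp: L_def)
 ultimately have "?U \<inter> L1 ~= {}" using open_Int_closure_eq_empty by blast
 then obtain z where z: "z \<in> L1" "z \<in> ?U" by blast
 define t w where "t = fst z" and "w = snd z"
 have tw: "(t, w) \<in> L1" "b < t" "t < rt b" "w ~= t" "b < \<pi> b --> w ~= \<phi> b t"
  using z by (simp_all add: t_def w_def)
 from tw(1) show False
 proof (cases rule: leavesE)
  case (1 a)
  have "a = b"
  proof (rule ccontr)
   assume "a ~= b"
   then consider "a < b" | "b < a" by linarith
   thus False
   proof cases
    case ab: 1
    thus False using K_disj[OF 1(1) b(1)] 1 tw by linarith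
   next
    case ab: 2
    thus False using K_disj[OF b(1) 1(1)] 1 tw by linarith
   qed
  qed
  thus False using 1 tw by simp
 qed (use tw K[OF b(1)] in auto)
qed

text \<open>A nontrivial chord starting inside a letter is a leaf, and the parallel leaves starting
  slightly later approach it from below. Together with \<open>Maxi_base\<close> this puts the
  boundary loops of gaps into the copy of X, where they can be filled.\<close>

lemma gap_base: assumes g: "lam.gap e" shows "snd (f (fst e)) = c"
proof (rule ccontr)
 assume n: "snd (f (fst e)) ~= c"
 have e: "e \<in> L" "fst e < snd e" "e \<notin> closure (lam.Sub e)" using g by (auto simp: lam.gap_def)
 have eb: "0 <= fst e" "fst e <= 1" using lam.L_fst[OF e(1)] by auto
 obtain b where b: "b \<in> K" "b < fst e" "fst e < rt b" using snd_f_neq[OF eb n] .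
 have "(fst e, snd e) \<in> L" using e(1) by simp
 from L_at_letter[OF this b] have o: "b < \<pi> b" "snd e = \<phi> b (fst e)" using e(2) by auto
 have "e \<in> closure (lam.Sub e)"
  unfolding closure_sequential
 proof (intro exI[of _ "\<lambda>n. (fst e + (rt b - fst e) / (real n + 1), \<phi> b (fst e + (rt b - fst e) / (real n + 1)))"] conjI allI)
  fix n :: nat
  define t where "t = fst e + (rt b - fst e) / (real n + 1)"
  have "(rt b - fst e) / (real n + 1) <= (rt b - fst e) / 1" using b(3) by (intro divide_left_mono) auto
  hence t: "fst e < t" "t <= rt b" using b(3) by (auto simp: t_def)
  have "(t, \<phi> b t) \<in> L" by (rule leaf_in[OF b(1) o(1)]) (use t b in auto)
  moreover have "\<phi> b t <= snd e" using \<phi>_mono[OF b(1) t(1)] o by simp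
  ultimately have "(t, \<phi> b t) \<in> lam.Sub e" using t by (auto simp: lam.Sub_def lam.encl_def)
  thus "(fst e + (rt b - fst e) / (real n + 1), \<phi> b (fst e + (rt b - fst e) / (real n + 1))) \<in> lam.Sub e"
   by (simp add: t_def)
 next
  have "(\<lambda>n. (rt b - fst e) / (real n + 1)) \<longlonglongrightarrow> 0" by real_asymp
  hence t: "(\<lambda>n. fst e + (rt b - fst e) / (real n + 1)) \<longlonglongrightarrow> fst e + 0" by (intro tendsto_intros)
  moreover have "(\<lambda>n. \<phi> b (fst e + (rt b - fst e) / (real n + 1))) \<longlonglongrightarrow> \<phi> b (fst e + 0)"
   unfolding \<phi>_def using K[OF b(1)] by (intro tendsto_intros t) auto
  ultimately have "(\<lambda>n. (fst e + (rt b - fst e) / (real n + 1), \<phi> b (fst e + (rt b - fst e) / (real n + 1)))) \<longlonglongrightarrow> (fst e, \<phi> b (fst e))"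
   by (intro tendsto_Pair) simp_all
  thus "(\<lambda>n. (fst e + (rt b - fst e) / (real n + 1), \<phi> b (fst e + (rt b - fst e) / (real n + 1)))) \<longlonglongrightarrow> e"
   using o(2) by (metis prod.collapse)
 qed
 thus False using e(3) by blast
qed

text \<open>Otherwise another leaf of the same pair of letters would lie under \<open>e\<close> and
  exceed \<open>m\<close> strictly at both ends.\<close>

lemma Maxi_base: assumes g: "lam.gap e" and m: "m \<in> lam.Maxi e" shows "snd (f (fst m)) = c"
proof (rule ccontr)
 assume n: "snd (f (fst m)) ~= c"
 have e: "e \<in> L" "fst e < snd e" using g by (auto simp: lam.gap_def)
 have mL: "m \<in> L" "lam.encl e (fst m) (snd m)" using lam.Maxi_L[OF m] lam.Sub_L(2) by auto
 have me: "fst e <= fst m" "fst m <= snd m" "snd m <= snd e" using mL lam.L_bounds'[OF mL(1)] by (auto simp: lam.encl_def)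
 obtain b where b: "b \<in> K" "b < fst m" "fst m < rt b"
  using snd_f_neq[OF _ _ n] lam.L_fst[OF mL(1)] by auto
 have fe: "snd (f (fst e)) = c" "snd (f (snd e)) = c" using gap_base[OF g] lam.L_eq'[OF e(1)] by auto
 have eb: "fst e <= b" "rt b <= snd e"
  using letter_neq[OF b(1), of "fst e"] letter_neq[OF b(1), of "snd e"] fe b me by force+
 have mv: "snd m = fst m \<or> b < \<pi> b & snd m = \<phi> b (fst m)" using L_at_letter[OF _ b, of "snd m"] mL by simp
 have "\<exists>a t. a \<in> K & a < \<pi> a & a < t & t < rt a & fst e <= a & t < fst m & snd m < \<phi> a t & \<phi> a t <= snd e"
 proof (cases "b < \<pi> b")
  case True
  define t where "t = (b + fst m) / 2"
  have t: "b < t" "t < fst m" "t < rt b" using b by (auto simp: t_def)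
  have "\<phi> b t > \<phi> b (fst m)" by (rule \<phi>_mono[OF b(1) t(2)])
  moreover have "\<phi> b (fst m) >= fst m" using \<phi>_affine[OF b(1), of "fst m"] b K_disj[OF b(1) \<pi>(1)[OF b(1)] True] by auto
  ultimately have "snd m < \<phi> b t" using mv by auto
  moreover have "\<phi> b t <= snd e"
   using lam.L_nc[OF e(1) leaf_in[OF b(1) True, of t]] t eb b by auto
  ultimately show ?thesis using t b True eb by blast
 next
  case False
  \<comment> \<open>Here the partner \<open>a\<close> precedes \<open>b\<close>, so no leaf starts
    in \<open>b\<close> and \<open>m\<close> is a single point. The leaf starting in
    \<open>a\<close> is chosen to end halfway between this point and the end of letter
    \<open>b\<close>.\<close>
  define a where "a = \<pi> b"
  have a: "a \<in> K" "a < \<pi> a" "\<pi> a = b" using \<pi>(1,2)[OF b(1)] False \<pi>_neq[OF b(1)] by (auto simp: a_def)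
  have sm: "snd m = fst m" using mv False by simp
  have ab: "rt a <= b" using K_disj[OF a(1) b(1)] a by simp
  define r where "r = (rt b - fst m) / (rt b - b)"
  have r: "0 < r" "r < 1" using b by (auto simp: r_def)
  have ra: "rt a - a > 0" using K[OF a(1)] by simp
  define t where "t = a + r / 2 * (rt a - a)"
  have t: "a < t" "t < rt a" using r ra mult_strict_right_mono[of "r/2" 1 "rt a - a"] by (auto simp: t_def)
  have "t - a = r / 2 * (rt a - a)" by (simp add: t_def)
  hence "(t - a) / (rt a - a) = r / 2" using ra by (metis less_irrefl nonzero_mult_div_cancel_right)
  hence \<phi>t: "\<phi> a t = rt b - r / 2 * (rt b - b)" by (simp only: \<phi>_def a(3))
  have rb: "r * (rt b - b) = rt b - fst m" using b by (simp add: r_def)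
  have "fst m < \<phi> a t" "\<phi> a t < rt b" using \<phi>t rb b by (auto simp: field_simps)
  moreover have "fst e <= a"
  proof (rule ccontr)
   assume "\<not> fst e <= a"
   moreover have "snd (f a) = c"
    using f_letter[OF a(1), of a] K[OF a(1)] by simp
   moreover have "\<not> (a < fst e & fst e < rt a)" using letter_neq[OF a(1), of "fst e"] fe by auto
   ultimately have "rt a <= fst e" by linarith
   hence "t < fst e" using t by simp
   moreover have "fst e < \<phi> a t" using me \<open>fst m < \<phi> a t\<close> by simp
   ultimately have "snd e <= \<phi> a t"
    using lam.L_nc[OF leaf_in[OF a(1,2), of t] e(1)] t by simp
   thus False using \<open>\<phi> a t < rt b\<close> eb by linarith
  qed
  ultimately show ?thesis using t a sm ab b eb by (intro exI[of _ a] exI[of _ t]) auto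
 qed
 then obtain a t where at: "a \<in> K" "a < \<pi> a" "a < t" "t < rt a" "fst e <= a" "t < fst m" "snd m < \<phi> a t" "\<phi> a t <= snd e" by blast
 have "(t, \<phi> a t) \<in> L" by (rule leaf_in) (use at in auto)
 moreover have "(t, \<phi> a t) ~= e" using at by auto
 ultimately have "(t, \<phi> a t) \<in> lam.Sub e" using at by (auto simp: lam.Sub_def lam.encl_def)
 thus False using m at unfolding lam.Maxi_def by force
qed

lemma edge_base: assumes "lam.gap e" "fst e <= t" "t <= snd e" shows "snd (lam.edge e t) = c"
 using lam.edgeE[OF assms] Maxi_base[OF assms(1)] by metis

end

section \<open>Fillings of the gaps with control of their size\<close>

lemma simply_connected_null:
 assumes "simply_connected_space T" "joins T x x p"
 shows "path_hom T x x p (\<lambda>_. x)"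
proof -
 have x: "x \<in> topspace T" using joins_in[OF assms(2)] by blast
 hence "carrier (pi1 T x) = {loop_class T x (\<lambda>_. x)}"
  using assms(1) by (simp add: simply_connected_space_def one_pi1)
 hence "loop_class T x p = loop_class T x (\<lambda>_. x)" using loop_class_carrier[OF assms(2)] by blast
 thus ?thesis using loop_class_eq_iff[OF assms(2) joins_const[OF x]] by blast
qed

context earring
begin

lemma null_hom_on_base:
 assumes uv: "u < v" and p: "cont_on {u..v} E p" "\<And>t. t \<in> {u..v} ==> snd (p t) = c"
  and null: "path_hom (subtopology (mtopology_of X) U) (fst (p u)) (fst (p u)) (\<lambda>t. fst (p (u + t * (v - u)))) (\<lambda>_. fst (p u))"
 obtains h where "ES.null_hom_on u v p h" "\<And>z. z \<in> {0..1} \<times> {u..v} ==> fst (h z) \<in> U \<inter> mspace X & snd (h z) = c"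
proof -
 obtain k where k: "cont_on ({0..1::real} \<times> {0..1::real}) (subtopology (mtopology_of X) U) k"
  and k': "\<forall>t\<in>{0..1}. k (0, t) = fst (p (u + t * (v - u))) & k (1, t) = fst (p u) & k (t, 0) = fst (p u) & k (t, 1) = fst (p u)"
  using null unfolding path_hom_iff by blast
 define h where "h = (\<lambda>z. (k (fst z, (snd z - u) / (v - u)), c))"
 have r: "(t - u) / (v - u) \<in> {0..1}" if "t \<in> {u..v}" for t using that uv by auto
 have kU: "k z \<in> U \<inter> mspace X" if "z \<in> {0..1} \<times> {0..1}" for z
  using k that unfolding continuous_map_def by auto
 have "cont_on ({0..1} \<times> {u..v}) (subtopology (mtopology_of X) U) (\<lambda>z. k (fst z, (snd z - u) / (v - u)))"
  using uv r by (intro continuous_map_compose_eu[OF k] continuous_intros) auto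
 hence "cont_on ({0..1} \<times> {u..v}) (mtopology_of X) (\<lambda>z. k (fst z, (snd z - u) / (v - u)))"
  unfolding continuous_map_in_subtopology by blast
 from continuous_map_compose[OF this continuous_base]
 have hc: "cont_on ({0..1} \<times> {u..v}) E h" by (simp add: h_def o_def)
 have pu: "p t = (fst (p t), c)" if "t \<in> {u..v}" for t using p(2)[OF that] by (simp add: prod_eq_iff)
 have 1: "h (0, t) = p t & h (1, t) = p u" if t: "t \<in> {u..v}" for t
 proof -
  have "u + (t - u) / (v - u) * (v - u) = t" using uv by simp
  thus ?thesis using bspec[OF k' r[OF t]] pu[OF t] pu[of u] uv unfolding h_def by simp
 qed
 have 2: "h (s, u) = p u & h (s, v) = p u" if s: "s \<in> {0..1}" for s
 proof -
  have "(u - u) / (v - u) = 0" "(v - u) / (v - u) = 1" using uv by auto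
  thus ?thesis using bspec[OF k' s] pu[of u] uv unfolding h_def by simp
 qed
 have "ES.null_hom_on u v p h" using hc 1 2 unfolding ES.null_hom_on_def E_eq by blast
 moreover have "fst (h z) \<in> U \<inter> mspace X & snd (h z) = c" if z: "z \<in> {0..1} \<times> {u..v}" for z
  using kU[of "(fst z, (snd z - u) / (v - u))"] r[of "snd z"] z by (auto simp: h_def)
 ultimately show ?thesis by (rule that)
qed

end

context matched_loop
begin

definition filling :: "real \<times> real => (real \<times> real => 'a \<times> complex) => bool" where
 "filling e H \<longleftrightarrow>
  cont_on {(x, y). fst e <= x & x <= y & y <= snd e} ES.mtopology H &
  (\<forall>y\<in>{fst e..snd e}. H (fst e, y) = f (fst e) & H (y, snd e) = f (fst e)) &
  (\<forall>x y. fst e <= x & x <= y & y <= snd e & (\<forall>t\<in>{x..y}. lam.edge e t = lam.edge e x) --> H (x, y) = lam.edge e x)"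

definition bounded_by :: "real \<times> real => (real \<times> real => 'a \<times> complex) => real => bool" where
 "bounded_by e H r \<longleftrightarrow> (\<forall>x y. fst e <= x & x <= y & y <= snd e --> ed (f (fst e)) (H (x, y)) <= r)"

lemma filling_small:
 assumes g: "lam.gap e"
  and null: "path_hom (subtopology (mtopology_of X) U) (fst (f (fst e))) (fst (f (fst e)))
   (\<lambda>t. fst (lam.edge e (fst e + t * (snd e - fst e)))) (\<lambda>_. fst (f (fst e)))"
 obtains H where "filling e H"
  "\<And>x y. fst e <= x ==> x <= y ==> y <= snd e ==> fst (H (x, y)) \<in> U \<inter> mspace X & snd (H (x, y)) = c"
proof -
 have e: "fst e < snd e" using g by (simp add: lam.gap_def)
 note ends = lam.edge_ends(1)[OF g]
 have ec: "cont_on {fst e..snd e} E (lam.edge e)" using lam.edge_cont[OF g] by (simp only: E_eq)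
 have sc: "snd (lam.edge e t) = c" if "t \<in> {fst e..snd e}" for t using edge_base[OF g] that by simp
 obtain h where h: "ES.null_hom_on (fst e) (snd e) (lam.edge e) h"
  "\<And>z. z \<in> {0..1} \<times> {fst e..snd e} ==> fst (h z) \<in> U \<inter> mspace X & snd (h z) = c"
  using null_hom_on_base[OF e ec sc] null unfolding ends by blast
 show ?thesis
 proof (rule ES.triangle_filling[OF e h(1) lam.edge_cont[OF g]])
  fix H assume H: "cont_on {(x, y). fst e <= x & x <= y & y <= snd e} ES.mtopology H"
  "\<And>y. fst e <= y ==> y <= snd e ==> H (fst e, y) = lam.edge e (fst e)" 
  "\<And>x. fst e <= x ==> x <= snd e ==> H (x, snd e) = lam.edge e (fst e)"
  "\<And>x y. fst e <= x ==> x <= y ==> y <= snd e ==> (\<And>t. t \<in> {x..y} ==> lam.edge e t = lam.edge e x) ==> H (x, y) = lam.edge e x"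
  "\<And>x y. fst e <= x ==> x <= y ==> y <= snd e ==> H (x, y) \<in> h ` ({0..1} \<times> {fst e..snd e})"
 have "filling e H"
  unfolding filling_def
 proof (intro conjI ballI allI impI)
  show "H (fst e, y) = f (fst e)" "H (y, snd e) = f (fst e)" if "y \<in> {fst e..snd e}" for y
   using H(2,3)[of y] that unfolding ends by simp_all
  show "H (x, y) = lam.edge e x" if "fst e <= x & x <= y & y <= snd e & (\<forall>t\<in>{x..y}. lam.edge e t = lam.edge e x)" for x y
   by (rule H(4)) (use that in blast)+
 qed (rule H(1))
 moreover have "fst (H (x, y)) \<in> U \<inter> mspace X & snd (H (x, y)) = c" if xy: "fst e <= x" "x <= y" "y <= snd e" for x y
  proof -
   obtain w where w: "H (x, y) = h w" "w \<in> {0..1} \<times> {fst e..snd e}" using H(5)[OF xy] by (rule imageE)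
   show ?thesis unfolding w(1) by (rule h(2)[OF w(2)])
  qed
  ultimately show ?thesis by (rule that)
 qed
qed

lemma edge_loop:
 assumes g: "lam.gap e" and V: "\<And>t. t \<in> {fst e..snd e} ==> fst (lam.edge e t) \<in> V"
 shows "joins (subtopology (mtopology_of X) V) (fst (f (fst e))) (fst (f (fst e)))
  (\<lambda>t. fst (lam.edge e (fst e + t * (snd e - fst e))))"
proof -
 have e: "fst e < snd e" using g by (simp add: lam.gap_def)
 note r = segment_in[OF _ less_imp_le[OF e]]
 have ec: "cont_on {fst e..snd e} E (lam.edge e)" using lam.edge_cont[OF g] by (simp only: E_eq)
 have "cont_on {0..1} E (\<lambda>t. lam.edge e (fst e + t * (snd e - fst e)))"
  using r by (intro continuous_map_compose_eu[OF ec] continuous_intros) auto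
 from continuous_map_compose[OF this continuous_fst]
 have "cont_on {0..1} (mtopology_of X) (\<lambda>t. fst (lam.edge e (fst e + t * (snd e - fst e))))"
  by (simp add: o_def)
 moreover have "fst (lam.edge e (fst e + t * (snd e - fst e))) \<in> V" if "t \<in> {0..1}" for t using V[OF r[OF that]] .
 ultimately show ?thesis using lam.edge_ends[OF g]
  by (simp add: joins_def pathin_def continuous_map_in_subtopology image_subset_iff)
qed

lemma filling_exists: assumes g: "lam.gap e" obtains H where "filling e H"
proof -
 have "joins (mtopology_of X) (fst (f (fst e))) (fst (f (fst e)))
  (\<lambda>t. fst (lam.edge e (fst e + t * (snd e - fst e))))"
  using edge_loop[OF g, of UNIV] by simp
 from simply_connected_null[OF sc this]
 show ?thesis using filling_small[OF g, of UNIV] that by simp metis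
qed

lemma filling_diag:
 assumes "filling e H" "fst e <= t" "t <= snd e" shows "H (t, t) = lam.edge e t"
proof -
 have "fst e <= t & t <= t & t <= snd e & (\<forall>u\<in>{t..t}. lam.edge e u = lam.edge e t)" using assms by simp
 thus ?thesis using assms(1) unfolding filling_def by blast
qed

lemma filling_EM:
 assumes "filling e H" "fst e <= x" "x <= y" "y <= snd e" shows "H (x, y) \<in> EM"
proof -
 have "cont_on {(x, y). fst e <= x & x <= y & y <= snd e} ES.mtopology H"
  using assms(1) unfolding filling_def by (rule conjunct1)
 hence "H ` {(x, y). fst e <= x & x <= y & y <= snd e} \<subseteq> topspace ES.mtopology"
  using continuous_map_image_subset_topspace by force
 thus ?thesis using assms(2-) unfolding ES.topspace_mtopology by blast
qed

lemma f_EM: "0 <= t ==> t <= 1 ==> f t \<in> EM"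
 by (rule lam.fM)

text \<open>The filling is taken within a factor 2 of the smallest possible size. Simple
  connectedness shows that fillings exist at all, and a small filling obtained later by other means
  then bounds the size of the chosen one.\<close>

lemma good_filling:
 assumes g: "lam.gap e"
 obtains H where "filling e H" "\<And>H' r. filling e H' ==> bounded_by e H' r ==> bounded_by e H (2 * r)"
proof -
 define R where "R = {r. \<exists>H. filling e H & bounded_by e H r}"
 have e: "e \<in> L" "fst e < snd e" using g by (auto simp: lam.gap_def)
 have feM: "f (fst e) \<in> EM" using lam.L_fst[OF e(1)] by (intro f_EM) auto
 have pos: "0 <= r" if rR: "r \<in> R" for r
 proof -
  obtain H where "bounded_by e H r" using rR unfolding R_def by blast
  hence "ed (f (fst e)) (H (fst e, fst e)) <= r" using e unfolding bounded_by_def by auto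
  thus ?thesis using ES.nonneg order_trans by blast
 qed
 show ?thesis
 proof (cases "R = {}")
  case True
  obtain H where "filling e H" using filling_exists[OF g] .
  moreover have "bounded_by e H (2 * r)" if "filling e H'" "bounded_by e H' r" for H' r using that True unfolding R_def by blast
  ultimately show ?thesis by (rule that)
 next
  case False
  have bdd: "bdd_below R" using pos by (meson bdd_belowI)
  have I: "Inf R >= 0" using pos False by (intro cInf_greatest) auto
  show ?thesis
  proof (cases "Inf R = 0")
   case True
   \<comment> \<open>If the infimum is 0 there is no room for a factor. But then the boundary loop
     is constant, since its points are values of every filling on the diagonal, and all fillings are
     constant.\<close>
   have const: "lam.edge e t = f (fst e)" if t: "fst e <= t" "t <= snd e" for t
   proof -
    have "ed (f (fst e)) (lam.edge e t) <= r" if rR: "r \<in> R" for r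
    proof -
     obtain H where "filling e H" "bounded_by e H r" using rR unfolding R_def by blast
     moreover have "fst e <= t & t <= t & t <= snd e" using t by simp
     ultimately show ?thesis using filling_diag[of e H t] t unfolding bounded_by_def by metis
    qed
    hence "ed (f (fst e)) (lam.edge e t) <= Inf R" using False by (intro cInf_greatest) auto
    hence "ed (f (fst e)) (lam.edge e t) = 0" using True ES.nonneg[of "f (fst e)" "lam.edge e t"] by linarith
    thus ?thesis using ES.zero[OF feM lam.edge_M[OF g t]] by simp
   qed
   obtain H where H: "filling e H" using filling_exists[OF g] .
   have "H (x, y) = f (fst e)" if "fst e <= x" "x <= y" "y <= snd e" for x y
   proof -
    have "\<forall>t\<in>{x..y}. lam.edge e t = lam.edge e x" using const that by simp
    hence "H (x, y) = lam.edge e x" using H that unfolding filling_def by blast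
    thus ?thesis using const that by simp
   qed
   hence b: "bounded_by e H (2 * r)" if "0 <= r" for r
    using that ES.zero[OF feM feM] unfolding bounded_by_def by simp
   show ?thesis
   proof (rule that[OF H])
    show "bounded_by e H (2 * r)" if "filling e H'" "bounded_by e H' r" for H' r
     using that pos b by (auto simp: R_def)
   qed
  next
   case F: False
   hence "Inf R < 2 * Inf R" using I by simp
   then obtain r0 where r0: "r0 \<in> R" "r0 < 2 * Inf R" using cInf_lessD[OF False] by blast
   then obtain H where H: "filling e H" "bounded_by e H r0" by (auto simp: R_def)
   show ?thesis
   proof (rule that[OF H(1)])
    fix H' r assume "filling e H'" "bounded_by e H' r"
    hence "r \<in> R" by (auto simp: R_def)
    hence "r0 <= 2 * r" using cInf_lower[OF _ bdd, of r] r0 by simp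
    thus "bounded_by e H (2 * r)" using H(2) unfolding bounded_by_def by force
   qed
  qed
 qed
qed

definition G :: "real \<times> real => real \<times> real => 'a \<times> complex" where
 "G e = (if lam.gap e then SOME H. filling e H & (\<forall>H' r. filling e H' & bounded_by e H' r --> bounded_by e H (2 * r))
  else (\<lambda>_. f (fst e)))"

lemma G:
 assumes "lam.gap e"
 shows "filling e (G e)" "\<And>H' r. filling e H' ==> bounded_by e H' r ==> bounded_by e (G e) (2 * r)"
proof -
 have "\<exists>H. filling e H & (\<forall>H' r. filling e H' & bounded_by e H' r --> bounded_by e H (2 * r))"
  using good_filling[OF assms] by metis
 from someI_ex[OF this] show "filling e (G e)" "\<And>H' r. filling e H' ==> bounded_by e H' r ==> bounded_by e (G e) (2 * r)"
  using assms unfolding G_def by auto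
qed

text \<open>If \<open>f z\<close> lies off X, gap ends stay away from it by \<open>gap_base\<close>,
  and the claim is vacuous for small \<delta>. At a point of X, local simple connectedness for the
  ball of radius \<epsilon>/8 gives a filling of size at most \<epsilon>/4, so the chosen one has
  size at most \<epsilon>/2; the rest covers the distance from \<open>f z\<close> to the left end of
  the gap.\<close>

lemma G_small:
 assumes z: "0 <= z" "z <= 1" and \<epsilon>: "\<epsilon> > 0"
 shows "\<exists>\<delta>>0. \<forall>e x y. lam.gap e & ed (f (fst e)) (f z) < \<delta> &
   (\<forall>t\<in>{fst e..snd e}. ed (lam.edge e t) (f z) < \<delta>) & fst e <= x & x <= y & y <= snd e --> ed (G e (x, y)) (f z) < \<epsilon>"
proof (cases "snd (f z) = c")
 case False
 have fz: "f z \<in> EM" using f_EM z by blast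
 let ?s = "fst (f z)"
 have s: "?s \<in> D" "snd (f z) \<in> sphere 0 1" using fz False unfolding EM_iff by blast+
 define \<delta> where "\<delta> = mdist C (snd (f z)) c / real (idx ?s)"
 have "mdist C (snd (f z)) c > 0"
 proof -
  have "mdist C (snd (f z)) c ~= 0"
   using Metric_space.zero[OF Metric_space_mspace_mdist[of C]] False s c_sphere by (simp add: mspace_C)
  thus ?thesis using mdist_nonneg[of C] by (metis order_le_less)
 qed
 hence \<delta>: "\<delta> > 0" using idx(3)[OF s(1)] by (simp add: \<delta>_def)
 have no: "\<not> ed (f (fst e)) (f z) < \<delta>" if g: "lam.gap e" for e
 proof
  assume lt: "ed (f (fst e)) (f z) < \<delta>"
  have e: "e \<in> L" using g by (simp add: lam.gap_def)
  have feM: "f (fst e) \<in> EM" using lam.L_fst[OF e(1)] by (intro f_EM) auto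
  have "circ ?s (f (fst e)) = c" using gap_base[OF g] by (simp add: circ_def)
  hence "mdist C (snd (f z)) c <= real (idx ?s) * ed (f z) (f (fst e))"
   using mdist_circ_le[OF s(1) fz feM] by (simp add: circ_def)
  also have "\<dots> < real (idx ?s) * \<delta>" using lt idx(3)[OF s(1)] ES.commute[of "f z"] by simp
  also have "\<dots> = mdist C (snd (f z)) c" using idx(3)[OF s(1)] by (simp add: \<delta>_def)
  finally show False by simp
 qed
 show ?thesis using \<delta> no by blast
next
 case True
 have fz: "f z \<in> EM" using f_EM z by blast
 define x0 where "x0 = fst (f z)"
 have x0: "x0 \<in> mspace X" "f z = (x0, c)" using EM_fst[OF fz] True by (auto simp: x0_def prod_eq_iff)
 define U where "U = XM.mball x0 (\<epsilon> / 8)"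
 have top: "mtopology_of X = XM.mtopology" by (simp add: mtopology_of_def)
 have U: "U \<subseteq> topspace (mtopology_of X)" "x0 \<in> mtopology_of X interior_of U"
  using x0 \<epsilon> XM.openin_mball[of x0 "\<epsilon> / 8"] unfolding top by (auto simp: U_def interior_of_openin)
 obtain V where V: "x0 \<in> mtopology_of X interior_of V"
  "\<And>p. pathin (subtopology (mtopology_of X) V) p ==> p 0 = p 1 ==> null_homotopic_loop (subtopology (mtopology_of X) U) p"
  using lsc U x0(1) unfolding locally_simply_connected_space_def by (metis topspace_mtopology_of)
 have "openin XM.mtopology (XM.mtopology interior_of V)" by simp
 then obtain \<delta>1 where \<delta>1: "\<delta>1 > 0" "XM.mball x0 \<delta>1 \<subseteq> V"
  using V(1) interior_of_subset[of XM.mtopology V] unfolding top XM.openin_mtopology by (meson order_trans)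
 define \<delta> where "\<delta> = min \<delta>1 (\<epsilon> / 8)"
 have \<delta>: "\<delta> > 0" using \<delta>1 \<epsilon> by (simp add: \<delta>_def)
 have "ed (G e (x, y)) (f z) < \<epsilon>" if g: "lam.gap e" and near: "ed (f (fst e)) (f z) < \<delta>"
   "\<forall>t\<in>{fst e..snd e}. ed (lam.edge e t) (f z) < \<delta>" and xy: "fst e <= x" "x <= y" "y <= snd e" for e x y
 proof -
  have e: "e \<in> L" "fst e < snd e" using g by (auto simp: lam.gap_def)
  have feM: "f (fst e) \<in> EM" using lam.L_fst[OF e(1)] by (intro f_EM) auto
  have "fst (lam.edge e t) \<in> V" if t: "t \<in> {fst e..snd e}" for t
  proof -
   have eM: "lam.edge e t \<in> EM" using lam.edge_M[OF g] t by simp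
   have "mdist X x0 (fst (lam.edge e t)) <= ed (f z) (lam.edge e t)"
    using mdist_fst_le[OF fz eM] by (simp add: x0_def)
   also have "\<dots> < \<delta>1" using bspec[OF near(2) t] ES.commute[of "f z"] by (simp add: \<delta>_def)
   finally show ?thesis using \<delta>1(2) x0(1) EM_fst[OF eM] by (auto simp: XM.in_mball subset_iff)
  qed
  from edge_loop[OF g this] have p: "joins (subtopology (mtopology_of X) V) (fst (f (fst e))) (fst (f (fst e)))
   (\<lambda>t. fst (lam.edge e (fst e + t * (snd e - fst e))))" (is "joins _ _ _ ?p") by blast
  have p01: "?p 0 = fst (f (fst e))" "?p 0 = ?p 1" using lam.edge_ends[OF g] by simp_all
  have "null_homotopic_loop (subtopology (mtopology_of X) U) ?p"
   using p p01 by (intro V(2)) (auto simp: joins_def)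
  hence "path_hom (subtopology (mtopology_of X) U) (fst (f (fst e))) (fst (f (fst e))) ?p (\<lambda>_. fst (f (fst e)))"
   unfolding null_homotopic_loop_def loop_homotopy_iff p01(1) .
  then obtain H where H: "filling e H"
   "\<And>x y. fst e <= x ==> x <= y ==> y <= snd e ==> fst (H (x, y)) \<in> U \<inter> mspace X & snd (H (x, y)) = c"
   using filling_small[OF g] by blast
  have "bounded_by e H (\<epsilon> / 4)"
   unfolding bounded_by_def
  proof (intro allI impI)
   fix x y assume xy: "fst e <= x & x <= y & y <= snd e"
   have H': "fst (H (x, y)) \<in> mspace X" "mdist X x0 (fst (H (x, y))) < \<epsilon> / 8" "H (x, y) = (fst (H (x, y)), c)"
    using H(2)[of x y] xy by (auto simp: U_def XM.in_mball prod_eq_iff)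
   have "ed (f z) (H (x, y)) = mdist X x0 (fst (H (x, y)))"
    unfolding x0(2) using ed_base[OF x0(1) H'(1)] H'(3) by metis
   moreover have "ed (f (fst e)) (H (x, y)) <= ed (f (fst e)) (f z) + ed (f z) (H (x, y))"
    using filling_EM[OF H(1)] xy by (intro ES.triangle feM fz) blast
   ultimately show "ed (f (fst e)) (H (x, y)) <= \<epsilon> / 4" using near(1) H'(2) by (simp add: \<delta>_def)
  qed
  from G(2)[OF g H(1) this] have "ed (f (fst e)) (G e (x, y)) <= \<epsilon> / 2" using xy unfolding bounded_by_def by force
  moreover have "ed (G e (x, y)) (f z) <= ed (G e (x, y)) (f (fst e)) + ed (f (fst e)) (f z)"
   using filling_EM[OF G(1)[OF g] xy] by (intro ES.triangle feM fz)
  ultimately show ?thesis using near(1) \<epsilon> ES.commute[of "f (fst e)"] by (simp add: \<delta>_def)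
 qed
 thus ?thesis using \<delta> by blast
qed

theorem null_homotopic: "path_hom E (f 0) (f 0) f (\<lambda>_. f 0)"
proof -
 interpret lamination_filling EM ed f L G
 proof
  fix e assume e: "e \<in> L"
  have feM: "f (fst e) \<in> EM" using lam.L_fst[OF e(1)] by (intro f_EM) auto
  show "cont_on {(x, y). fst e <= x & x <= y & y <= snd e} ES.mtopology (G e)"
  proof (cases "lam.gap e")
   case True
   show ?thesis using G(1)[OF True] unfolding filling_def by (rule conjunct1)
  next
   case False
   hence "G e = (\<lambda>_. f (fst e))" by (simp add: G_def)
   thus ?thesis using feM by simp
  qed
  have ends: "G e (fst e, y) = f (fst e) & G e (y, snd e) = f (fst e)" if "y \<in> {fst e..snd e}" for y
  proof (cases "lam.gap e")
   case True
   have "\<forall>y\<in>{fst e..snd e}. G e (fst e, y) = f (fst e) & G e (y, snd e) = f (fst e)"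
    using G(1)[OF True] unfolding filling_def by (elim conjE)
   thus ?thesis using that by (rule bspec)
  qed (simp add: G_def)
  show "G e (fst e, y) = f (fst e)" if "fst e <= y" "y <= snd e" for y using ends[of y] that by simp
  show "G e (x, snd e) = f (fst e)" if "fst e <= x" "x <= snd e" for x using ends[of x] that by simp
 next
  show "G e (x, y) = lam.edge e x" if "lam.gap e" "fst e <= x" "x <= y" "y <= snd e"
   "\<And>t. t \<in> {x..y} ==> lam.edge e t = lam.edge e x" for e x y
   using G(1)[OF that(1)] that(2-) unfolding filling_def by blast
 qed (rule G_small)
 show ?thesis using null_homotopic by (simp only: E_eq)
qed

end

context earring
begin

theorem null_homotopic_if_words_trivial:
 assumes sc: "simply_connected_space (mtopology_of X)" "locally_simply_connected_space (mtopology_of X)"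
  and f: "joins E (x0, c) (x0, c) f"
  and triv: "\<And>S. finite S ==> S \<subseteq> D ==> word_along S q f 0 1 = 0"
 shows "path_hom E (x0, c) (x0, c) f (\<lambda>_. (x0, c))"
proof -
 obtain f' K rt lab where f': "path_hom E (x0, c) (x0, c) f f'" "std_loop C c X D d f' K rt lab"
  using standard_form[OF f] .
 interpret std_loop C c X D d f' K rt lab by (rule f'(2))
 have 0: "f' 0 = (x0, c)" using path_hom_imp(2)[OF f'(1)] by (simp add: joins_def)
 have "word_along S q f' 0 1 = 0" if S: "finite S" "S \<subseteq> D" for S
 proof -
  interpret coc: cocycle E "circle_cover E S q" "cross_letter S q"
   by (rule cocycle_cross_letter[OF circle_system_E[OF S(2)] S(1)])
  show ?thesis using coc.ctrans_path_hom[OF f'(1)] triv[OF S] by (simp add: word_along_def)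
 qed
 then obtain \<pi> where \<pi>: "ncmatching K lab \<pi>" using matching_exists by blast
 interpret matched_loop C c X D d f' K rt lab \<pi>
  by unfold_locales (use \<pi> 0 sc in auto)
 show ?thesis using path_hom_trans[OF f'(1)] null_homotopic unfolding 0 by blast
qed

end

lemma ctrans_transfer:
 assumes "\<And>s s'. s \<in> {a..b} ==> s' \<in> {a..b} ==> \<kappa>' (f' s) (f' s') = \<kappa> (f s) (f s')"
 shows "ctrans \<kappa>' f' a b = ctrans \<kappa> f a b"
proof -
 have "clift \<kappa>' f' a b g = clift \<kappa> f a b g" for g
  unfolding clift_def using assms by (metis (no_types, lifting))
 thus ?thesis by (simp add: ctrans_def)
qed

section \<open>The embedding into the Hawaiian earring group\<close>

definition earring_circle :: "nat => (real \<times> real) set" where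
 "earring_circle n = {(x, y). (x + 1 / real n)\<^sup>2 + y\<^sup>2 = (1 / real n)\<^sup>2}"

text \<open>The similarity taking circle n to the unit circle and the origin to 1; the other circles
  are sent to 1.\<close>

definition earring_coord :: "nat => real \<times> real => complex" where
 "earring_coord n z = (if z \<in> earring_circle n then Complex (1 + real n * fst z) (real n * snd z) else 1)"

lemma earring_circle_iff:
 assumes "n >= 1"
 shows "z \<in> earring_circle n \<longleftrightarrow> 2 * fst z + real n * ((fst z)\<^sup>2 + (snd z)\<^sup>2) = 0"
proof -
 have n: "real n > 0" using assms by simp
 have "(fst z + 1 / real n)\<^sup>2 + (snd z)\<^sup>2 - (1 / real n)\<^sup>2 = (2 * fst z + real n * ((fst z)\<^sup>2 + (snd z)\<^sup>2)) / real n"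
  using n by (simp add: power2_eq_square field_simps)
 moreover have "z \<in> earring_circle n \<longleftrightarrow> (fst z + 1 / real n)\<^sup>2 + (snd z)\<^sup>2 - (1 / real n)\<^sup>2 = 0"
  by (auto simp: earring_circle_def split: prod.splits)
 ultimately show ?thesis using n by simp
qed

text \<open>On the earring, the points of circle \<open>n\<close> other than the base point form the open set
 \<open>\<bar>2 x + n (x\<^sup>2 + y\<^sup>2)\<bar> < x\<^sup>2 + y\<^sup>2\<close>, since \<open>- 2 x / (x\<^sup>2 + y\<^sup>2)\<close> is the number of the circle through \<open>(x, y)\<close>.\<close>

lemma earring_circle_open:
 assumes "n >= 1" "z \<in> hawaiian_earring"
 shows "\<bar>2 * fst z + real n * ((fst z)\<^sup>2 + (snd z)\<^sup>2)\<bar> < (fst z)\<^sup>2 + (snd z)\<^sup>2 \<longleftrightarrow> z \<in> earring_circle n & z ~= (0, 0)"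
proof -
 obtain m where m: "m >= 1" "z \<in> earring_circle m" using assms(2) by (auto simp: hawaiian_earring_def earring_circle_def)
 define r where "r = (fst z)\<^sup>2 + (snd z)\<^sup>2"
 have r: "r >= 0" "r = 0 \<longleftrightarrow> z = (0, 0)" by (auto simp: r_def sum_power2_eq_zero_iff prod_eq_iff)
 have "2 * fst z + real m * r = 0" using earring_circle_iff[OF m(1)] m(2) by (simp add: r_def)
 hence e: "2 * fst z + real n * r = (real n - real m) * r" by (simp add: algebra_simps)
 have "\<bar>(real n - real m) * r\<bar> < r \<longleftrightarrow> n = m & r ~= 0"
 proof (cases "n = m")
  case True
  thus ?thesis using r by auto
 next
  case False
  hence "1 <= \<bar>real n - real m\<bar>" by linarith
  hence "1 * r <= \<bar>real n - real m\<bar> * r" using r(1) by (rule mult_right_mono)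
  thus ?thesis using r(1) False by (simp add: abs_mult)
 qed
 moreover have "z \<in> earring_circle n & z ~= (0, 0) \<longleftrightarrow> n = m & r ~= 0"
  using earring_circle_iff[OF assms(1), of z, folded r_def] e r(2) by auto
 ultimately show ?thesis unfolding r_def[symmetric] e by simp
qed

lemma earring_circle_unique:
 assumes "n >= 1" "m >= 1" "z \<in> earring_circle n" "z \<in> earring_circle m" "z ~= (0, 0)"
 shows "n = m"
proof -
 have "(fst z)\<^sup>2 + (snd z)\<^sup>2 ~= 0" using assms(5) by (simp add: sum_power2_eq_zero_iff prod_eq_iff)
 moreover have "real n * ((fst z)\<^sup>2 + (snd z)\<^sup>2) = real m * ((fst z)\<^sup>2 + (snd z)\<^sup>2)"
  using earring_circle_iff[OF assms(1), of z] earring_circle_iff[OF assms(2), of z] assms(3,4) by linarith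
 ultimately show ?thesis unfolding mult_cancel_right of_nat_eq_iff by blast
qed

lemma earring_coord_neq_1: "earring_coord n z ~= 1 ==> z \<in> earring_circle n & z ~= (0, 0)"
 by (auto simp: earring_coord_def complex_eq_iff split: if_splits)

text \<open>Two relatively closed pieces are glued: the circle, and the earring without the open set
  of points of that circle other than the origin. They meet only in the origin.\<close>

lemma continuous_earring_coord:
 assumes n: "n >= 1"
 shows "cont_on hawaiian_earring (top_of_set (sphere 0 1)) (earring_coord n)"
proof -
 let ?U = "{z :: real \<times> real. \<bar>2 * fst z + real n * ((fst z)\<^sup>2 + (snd z)\<^sup>2)\<bar> < (fst z)\<^sup>2 + (snd z)\<^sup>2}"
 have U: "open ?U" by (intro open_Collect_less continuous_intros)
 have cl: "closed {z :: real \<times> real. 2 * fst z + real n * ((fst z)\<^sup>2 + (snd z)\<^sup>2) = 0}"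
  by (intro closed_Collect_eq continuous_intros)
 have "earring_circle n = {z. 2 * fst z + real n * ((fst z)\<^sup>2 + (snd z)\<^sup>2) = 0}" using earring_circle_iff[OF n] by blast
 hence cl: "closed (earring_circle n)" using cl by simp
 let ?A = "hawaiian_earring \<inter> earring_circle n" and ?B = "hawaiian_earring - ?U"
 have AB: "hawaiian_earring = ?A \<union> ?B" using earring_circle_open[OF n] by blast
 have "continuous_on (?A \<union> ?B) (\<lambda>z. if z \<in> earring_circle n then Complex (1 + real n * fst z) (real n * snd z) else 1)"
 proof (rule continuous_on_cases_local)
  show "closedin (top_of_set (?A \<union> ?B)) ?A" unfolding AB[symmetric] by (intro closedin_closed_Int cl)
  have "?B = hawaiian_earring \<inter> - ?U" by blast
  thus "closedin (top_of_set (?A \<union> ?B)) ?B" unfolding AB[symmetric]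
   using U closedin_closed_Int[of "- ?U" hawaiian_earring] by (simp add: closed_def)
  show "continuous_on ?A (\<lambda>z. Complex (1 + real n * fst z) (real n * snd z))"
   unfolding Complex_eq by (intro continuous_intros)
  show "Complex (1 + real n * fst z) (real n * snd z) = 1"
   if "z \<in> ?A & z \<notin> earring_circle n \<or> z \<in> ?B & z \<in> earring_circle n" for z
  proof -
   have "z = (0, 0)" using that earring_circle_open[OF n, of z] by blast
   thus ?thesis by (simp add: complex_eq_iff)
  qed
 qed simp
 moreover have "norm (earring_coord n z) = 1" for z
 proof (cases "z \<in> earring_circle n")
  case True
  hence "real n * (2 * fst z + real n * ((fst z)\<^sup>2 + (snd z)\<^sup>2)) = 0" using earring_circle_iff[OF n] by simp
  hence "(1 + real n * fst z)\<^sup>2 + (real n * snd z)\<^sup>2 = 1" by (simp add: power2_eq_square algebra_simps)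
  thus ?thesis using True by (simp add: earring_coord_def cmod_def)
 qed (simp add: earring_coord_def)
 ultimately show ?thesis unfolding AB[symmetric] continuous_map_in_subtopology
  by (auto simp: earring_coord_def[abs_def])
qed

context earring
begin

text \<open>Crushes X to the origin and carries the n-th circle onto the n-th circle of the Hawaiian
  earring.\<close>

definition hw :: "'a \<times> complex => real \<times> real" where
 "hw P = (if fst P \<in> D then ((Re (snd P / c) - 1) / real (idx (fst P)), Im (snd P / c) / real (idx (fst P))) else (0, 0))"

lemma hw_base: "hw (x, c) = (0, 0)"
 by (simp add: hw_def)

lemma hw_circle: assumes "P \<in> EM" "fst P \<in> D" shows "hw P \<in> earring_circle (idx (fst P))"
proof -
 define u where "u = snd P / c"
 have n: "idx (fst P) >= 1" by (rule idx(3)[OF assms(2)])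
 have "norm u = 1" using EM_snd[OF assms(1)] by (simp add: u_def norm_divide)
 hence "(Re u)\<^sup>2 + (Im u)\<^sup>2 = 1" by (metis cmod_power2 one_power2)
 hence "((Re u - 1) / real (idx (fst P)) + 1 / real (idx (fst P)))\<^sup>2 + (Im u / real (idx (fst P)))\<^sup>2 = (1 / real (idx (fst P)))\<^sup>2"
  using n by (simp add: power_divide flip: add_divide_distrib)
 thus ?thesis using assms(2) by (simp add: earring_circle_def hw_def u_def)
qed

lemma hw_in: assumes "P \<in> EM" shows "hw P \<in> hawaiian_earring"
proof (cases "fst P \<in> D")
 case True
 thus ?thesis using hw_circle[OF assms True] idx(3)[OF True] by (auto simp: hawaiian_earring_def earring_circle_def)
next
 case False
 thus ?thesis by (auto simp: hw_def hawaiian_earring_def)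
qed

lemma earring_coord_hw:
 assumes "P \<in> EM" "s \<in> D" shows "earring_coord (idx s) (hw P) = q s P"
proof (cases "fst P = s")
 case True
 hence "hw P \<in> earring_circle (idx s)" using hw_circle[OF assms(1)] assms(2) by blast
 moreover have "idx s >= 1" by (rule idx(3)[OF assms(2)])
 ultimately show ?thesis using True assms by (simp add: earring_coord_def hw_def q_def complex_eq_iff)
next
 case False
 have "earring_coord (idx s) (hw P) = 1"
 proof (rule ccontr)
  assume "earring_coord (idx s) (hw P) ~= 1"
  hence z: "hw P \<in> earring_circle (idx s)" "hw P ~= (0, 0)" using earring_coord_neq_1 by blast+
  hence "fst P \<in> D" unfolding hw_def by argo
  hence "idx (fst P) = idx s"
   using earring_circle_unique[OF _ _ hw_circle[OF assms(1)] z(1,2)] idx(3) assms(2) by blast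
  thus False using idx_inj \<open>fst P \<in> D\<close> assms(2) False by blast
 qed
 thus ?thesis using False by (simp add: q_def)
qed

text \<open>The map is the uniform limit of its finite stages, the circles being of radius \<open>1 / n\<close>.\<close>

lemma continuous_hw: "continuous_map E (top_of_set hawaiian_earring) hw"
proof -
 define g where "g s P = ((Re (q s P) - 1) / real (idx s), Im (q s P) / real (idx s))" for s P
 define S where "S N = {s \<in> D. idx s <= N}" for N
 have finS: "finite (S N)" for N unfolding S_def by (rule finite_idx_le)
 have cg: "continuous_map E euclidean (g s)" if s: "s \<in> D" for s
 proof -
  have "continuous_map E euclidean (q s)" using continuous_q[OF s] by (simp add: continuous_map_in_subtopology)
  from continuous_map_compose[OF this, of euclidean "\<lambda>w. ((Re w - 1) / real (idx s), Im w / real (idx s))"]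
  moreover have "continuous_on UNIV (\<lambda>w. ((Re w - 1) / real (idx s), Im w / real (idx s)))"
   using idx(3)[OF s] by (auto intro!: continuous_intros)
  ultimately show ?thesis by (simp add: g_def[abs_def] o_def)
 qed
 have sum: "(\<Sum>s\<in>S N. g s P) = (if fst P \<in> S N then hw P else 0)" for N P
 proof -
  have "g s P = 0" if "s ~= fst P" for s using that by (simp add: g_def q_def zero_prod_def)
  hence "(\<Sum>s\<in>S N. g s P) = (\<Sum>s\<in>S N. if s = fst P then g s P else 0)" by (intro sum.cong) auto
  also have "\<dots> = (if fst P \<in> S N then g (fst P) P else 0)" using finS by simp
  also have "\<dots> = (if fst P \<in> S N then hw P else 0)" by (auto simp: g_def hw_def q_def S_def)
  finally show ?thesis .
 qed
 have csum: "continuous_map E euclidean (\<lambda>P. \<Sum>s\<in>S N. g s P)" for N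
  by (intro continuous_map_sum finS cg) (simp add: S_def)
 have dist: "dist (\<Sum>s\<in>S N. g s P) (hw P) <= 3 / (real N + 1)" if P: "P \<in> EM" for N P
 proof (cases "fst P \<in> D & fst P \<notin> S N")
  case True
  hence "idx (fst P) >= Suc N" by (auto simp: S_def)
  hence n: "real (idx (fst P)) >= real N + 1" by linarith
  have u: "norm (snd P / c) = 1" using EM_snd[OF P] by (simp add: norm_divide)
  have "norm (hw P) <= norm (fst (hw P)) + norm (snd (hw P))" by (metis norm_Pair_le prod.collapse)
  also have "\<dots> <= 2 / real (idx (fst P)) + 1 / real (idx (fst P))"
  proof (rule add_mono)
   have "\<bar>Re (snd P / c)\<bar> <= 1" using abs_Re_le_cmod[of "snd P / c"] u by simp
   hence "\<bar>Re (snd P / c) - 1\<bar> <= 2" by linarith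
   thus "norm (fst (hw P)) <= 2 / real (idx (fst P))" using True by (simp add: hw_def divide_right_mono)
   have "\<bar>Im (snd P / c)\<bar> <= 1" using abs_Im_le_cmod[of "snd P / c"] u by simp
   thus "norm (snd (hw P)) <= 1 / real (idx (fst P))" using True by (simp add: hw_def divide_right_mono)
  qed
  also have "\<dots> = 3 / real (idx (fst P))" by simp
  also have "\<dots> <= 3 / (real N + 1)" using n by (intro divide_left_mono mult_pos_pos) linarith+
  finally show ?thesis using True by (simp add: sum dist_norm)
 next
  case False
  hence "(\<Sum>s\<in>S N. g s P) = hw P" by (auto simp: sum hw_def zero_prod_def)
  thus ?thesis by simp
 qed
 have "continuous_map E Met_TC.mtopology hw"
 proof (rule Met_TC.continuous_map_uniform_limit)
  show "\<forall>\<^sub>F N in sequentially. continuous_map E Met_TC.mtopology (\<lambda>P. \<Sum>s\<in>S N. g s P)"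
   using csum by simp
  fix \<epsilon> :: real assume "\<epsilon> > 0"
  moreover have "(\<lambda>N. 3 / (real N + 1)) \<longlonglongrightarrow> 0" by real_asymp
  ultimately have "\<forall>\<^sub>F N in sequentially. 3 / (real N + 1) < \<epsilon>" using order_tendstoD(2) by blast
  thus "\<forall>\<^sub>F N in sequentially. \<forall>P\<in>topspace E. hw P \<in> UNIV & dist (\<Sum>s\<in>S N. g s P) (hw P) < \<epsilon>"
  proof eventually_elim
   case (elim N)
   show ?case
   proof (intro ballI conjI UNIV_I)
    fix P assume "P \<in> topspace E"
    hence "P \<in> EM" by (simp only: topspace_E)
    from dist[OF this, of N] elim show "dist (\<Sum>s\<in>S N. g s P) (hw P) < \<epsilon>" by (rule order_le_less_trans)
   qed
  qed
 qed simp
 hence "continuous_map E euclidean hw" by simp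
 thus ?thesis using hw_in unfolding continuous_map_in_subtopology topspace_E by blast
qed

lemma circle_system_hawaiian:
 assumes "S \<subseteq> D" shows "circle_system (top_of_set hawaiian_earring) S (\<lambda>s. earring_coord (idx s))"
 unfolding circle_system_def
proof (intro conjI ballI impI)
 show "cont_on hawaiian_earring (top_of_set (sphere 0 1)) (earring_coord (idx s))" if "s \<in> S" for s
  using continuous_earring_coord idx(3) assms that by blast
 fix z s s' assume s: "s \<in> S" "s' \<in> S" "earring_coord (idx s) z ~= 1 & earring_coord (idx s') z ~= 1"
 hence "idx s = idx s'" using earring_coord_neq_1 earring_circle_unique idx(3) assms by (meson subsetD)
 thus "s = s'" using idx_inj s assms by blast
qed

text \<open>The map intertwines the circle coordinates, so a loop and its image have the same words;
  those of a null homotopic image are trivial.\<close>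

lemma hw_injective:
 assumes sc: "simply_connected_space (mtopology_of X)" "locally_simply_connected_space (mtopology_of X)"
  and f: "joins E (x0, c) (x0, c) f"
  and null: "path_hom (top_of_set hawaiian_earring) (0, 0) (0, 0) (\<lambda>t. hw (f t)) (\<lambda>_. (0, 0))"
 shows "path_hom E (x0, c) (x0, c) f (\<lambda>_. (x0, c))"
proof (rule null_homotopic_if_words_trivial[OF sc f])
 fix S assume S: "finite S" "S \<subseteq> D"
 let ?r = "\<lambda>s. earring_coord (idx s)" and ?H = "top_of_set hawaiian_earring"
 interpret coc: cocycle ?H "circle_cover ?H S ?r" "cross_letter S ?r"
  by (rule cocycle_cross_letter[OF circle_system_hawaiian[OF S(2)] S(1)])
 have fEM: "f t \<in> EM" if "t \<in> {0..1}" for t using joins_topspace[OF f, of t] that unfolding topspace_E by simp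
 have "cross_letter S ?r (hw (f t)) (hw (f t')) = cross_letter S q (f t) (f t')" if t: "t \<in> {0..1}" "t' \<in> {0..1}" for t t'
 proof -
  have "s \<in> S ==> ?r s (hw (f u)) = q s (f u)" if "u \<in> {0..1}" for s u
   using earring_coord_hw[OF fEM[OF that]] S(2) by blast
  hence "crosses S ?r s (hw (f t)) (hw (f t')) = crosses S q s (f t) (f t')" for s
   unfolding crosses_def using t by metis
  moreover have "\<exists>!s. crosses S q s (f t) (f t') ==> (THE s. crosses S q s (f t) (f t')) \<in> S"
   using theI'[of "\<lambda>s. crosses S q s (f t) (f t')"] by (simp add: crosses_def)
  ultimately show ?thesis using \<open>\<And>u s. u \<in> {0..1} ==> s \<in> S ==> ?r s (hw (f u)) = q s (f u)\<close> t
   by (simp add: cross_letter_def Let_def)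
 qed
 hence "word_along S q f 0 1 = word_along S ?r (\<lambda>t. hw (f t)) 0 1"
  unfolding word_along_def by (intro ctrans_transfer[symmetric]) 
 also have "\<dots> = word_along S ?r (\<lambda>_. (0, 0)) 0 1"
  unfolding word_along_def by (rule coc.ctrans_path_hom[OF null])
 also have "\<dots> = 0" unfolding word_along_def by (rule coc.ctrans_const) (auto simp: hawaiian_earring_def)
 finally show "word_along S q f 0 1 = 0" .
qed

lemma path_to_base:
 assumes "P \<in> EM" obtains \<alpha> where "joins E (fst P, c) P \<alpha>" "\<And>t. fst (\<alpha> t) = fst P"
proof -
 obtain \<theta> where \<theta>: "snd P / c = cis \<theta>"
  using EM_snd[OF assms] by (metis complex_norm_eq_1_exp cis_conv_exp mem_sphere_0 norm_c norm_divide div_by_1)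
 have P: "snd P = c * cis \<theta>" using \<theta> by (simp flip: \<theta>)
 show ?thesis
 proof (cases "snd P = c")
  case True
  hence "joins E (fst P, c) P (\<lambda>_. P)"
   using assms joins_const[of P E] unfolding topspace_E by (metis prod.collapse)
  thus ?thesis by (rule that) simp
 next
  case False
  hence D: "fst P \<in> D" using assms unfolding EM_iff by blast
  hence "joins E (fst P, c) P (\<lambda>t. (fst P, c * cis (\<theta> * t)))"
   using path_in_circle[OF D, of "\<lambda>t. \<theta> * t"] by (simp add: continuous_intros flip: P)
  thus ?thesis by (rule that) simp
 qed
qed

theorem embeds_in_hawaiian:
 assumes sc: "simply_connected_space (mtopology_of X)" "locally_simply_connected_space (mtopology_of X)"
  and e: "e \<in> EM"
 shows "\<exists>K. subgroup K (pi1 (top_of_set hawaiian_earring) (0, 0)) &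
   pi1 E e \<cong> (pi1 (top_of_set hawaiian_earring) (0, 0))\<lparr>carrier := K\<rparr>"
proof -
 let ?H = "pi1 (top_of_set hawaiian_earring) (0, 0)"
 define x0 where "x0 = fst e"
 let ?G = "pi1 E (x0, c)"
 have x0: "(x0, c) \<in> topspace E" using EM_fst[OF e] unfolding topspace_E x0_def by blast
 obtain \<alpha> where \<alpha>: "joins E (x0, c) e \<alpha>" using path_to_base[OF e] unfolding x0_def by blast
 obtain k where k: "k \<in> iso (pi1 E e) ?G" using iso_change_base[OF \<alpha>] by blast
 obtain h where h: "h \<in> hom ?G ?H" "\<And>p. joins E (x0, c) (x0, c) p ==> h (loop_class E (x0, c) p) =
   loop_class (top_of_set hawaiian_earring) (0, 0) (\<lambda>t. hw (p t))"
  using hom_induced[OF continuous_hw, of "(x0, c)"] unfolding hw_base by blast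
 have o: "(0, 0) \<in> topspace (top_of_set hawaiian_earring)" by (auto simp: hawaiian_earring_def)
 interpret group_hom ?G ?H h
  using group_pi1[OF x0] group_pi1[OF o] h(1)
  by (simp add: group_hom_def group_hom_axioms_def)
 have "inj_on h (carrier ?G)"
  unfolding inj_on_one_iff
 proof (intro allI impI)
  fix g assume g: "g \<in> carrier ?G" "h g = \<one>\<^bsub>?H\<^esub>"
  obtain p where p: "joins E (x0, c) (x0, c) p" "g = loop_class E (x0, c) p"
   using carrier_pi1E[OF g(1)] .
  have "joins (top_of_set hawaiian_earring) (0, 0) (0, 0) (\<lambda>t. hw (p t))"
   using joins_image[OF continuous_hw p(1)] by (simp only: hw_base)
  hence "path_hom (top_of_set hawaiian_earring) (0, 0) (0, 0) (\<lambda>t. hw (p t)) (\<lambda>_. (0, 0))"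
   using g(2) loop_class_eq_iff[OF _ joins_const[OF o]] unfolding p(2) h(2)[OF p(1)] one_pi1 by blast
  from loop_class_eqI[OF hw_injective[OF sc p(1) this]] show "g = \<one>\<^bsub>?G\<^esub>"
   by (simp only: p(2) one_pi1)
 qed
 hence "h \<in> iso ?G (?H\<lparr>carrier := h ` carrier ?G\<rparr>)"
  using h(1) by (auto simp: iso_def bij_betw_def hom_def)
 with k have "pi1 E e \<cong> ?H\<lparr>carrier := h ` carrier ?G\<rparr>"
  unfolding is_iso_def using iso_set_trans by blast
 thus ?thesis using img_is_subgroup by blast
qed

end

section \<open>Infinite products of null sequences of loops\<close>

definition wprod :: "('g, 'b) monoid_scheme => (nat => 'g) => nat list => 'g" where
 "wprod G g js = foldr (\<lambda>j a. g j \<otimes>\<^bsub>G\<^esub> a) js \<one>\<^bsub>G\<^esub>"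

text \<open>A set of sequences in a group that behaves like the null sequences of loops at a point.\<close>

locale tail_system = group G for G (structure) +
 fixes \<G> :: "(nat => 'a) set"
 assumes ts_carrier: "g \<in> \<G> ==> g j \<in> carrier G"
  and ts_words: "g \<in> \<G> ==> (\<And>i j. j \<in> set (l i) ==> i <= j) ==> (\<lambda>i. wprod G g (l i)) \<in> \<G>"
  and ts_interleave: "g \<in> \<G> ==> h \<in> \<G> ==> (\<lambda>j. if even j then g (j div 2) else h (j div 2)) \<in> \<G>"
  and ts_solve: "g \<in> \<G> ==> \<exists>x\<in>\<G>. \<forall>j. x j = g j \<otimes> x (Suc j) [^] (k j :: nat)"

lemma (in group) wprod_closed: "(\<And>j. g j \<in> carrier G) ==> wprod G g js \<in> carrier G"
 by (induction js) (auto simp: wprod_def)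

lemma (in group_hom) hom_wprod:
 assumes "\<And>j. g j \<in> carrier G" shows "h (wprod G g js) = wprod H (\<lambda>j. h (g j)) js"
proof (induction js)
 case (Cons j js)
 have "wprod G g js \<in> carrier G" by (rule G.wprod_closed[OF assms])
 hence "h (g j \<otimes> wprod G g js) = h (g j) \<otimes>\<^bsub>H\<^esub> h (wprod G g js)" using assms by simp
 thus ?case using Cons by (simp add: wprod_def)
qed (simp add: wprod_def)

text \<open>The conditions are purely algebraic, so an isomorphism carries the null sequences at a
  point of one space to a tail system in the group of the other, where no topological description of
  them is available.\<close>

lemma tail_system_image:
 assumes "tail_system G \<G>" "group H" "\<phi> \<in> hom G H"
 shows "tail_system H ((\<lambda>g j. \<phi> (g j)) ` \<G>)"
proof -
 interpret G: tail_system G \<G> by fact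
 interpret group_hom G H \<phi> using assms G.group_axioms by (simp add: group_hom_def group_hom_axioms_def)
 show ?thesis
 proof (unfold_locales; (elim imageE)?)
  fix g' g j assume "g' = (\<lambda>j. \<phi> (g j))" "g \<in> \<G>"
  thus "g' j \<in> carrier H" using G.ts_carrier by simp
 next
  fix g' g and l :: "nat => nat list"
  assume g: "g' = (\<lambda>j. \<phi> (g j))" "g \<in> \<G>" and l: "\<And>i j. j \<in> set (l i) ==> i <= j"
  have "(\<lambda>i. wprod G g (l i)) \<in> \<G>" by (rule G.ts_words[OF g(2) l])
  moreover have "(\<lambda>i. wprod H g' (l i)) = (\<lambda>i. \<phi> (wprod G g (l i)))"
   using hom_wprod[of g] G.ts_carrier[OF g(2)] g(1) by simp
  ultimately show "(\<lambda>i. wprod H g' (l i)) \<in> (\<lambda>g j. \<phi> (g j)) ` \<G>" by (intro image_eqI[of _ _ "\<lambda>i. wprod G g (l i)"])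
 next
  fix g' g h' h assume g: "g' = (\<lambda>j. \<phi> (g j))" "g \<in> \<G>" "h' = (\<lambda>j. \<phi> (h j))" "h \<in> \<G>"
  have "(\<lambda>j. if even j then g' (j div 2) else h' (j div 2)) = (\<lambda>j. \<phi> (if even j then g (j div 2) else h (j div 2)))"
   using g by auto
  thus "(\<lambda>j. if even j then g' (j div 2) else h' (j div 2)) \<in> (\<lambda>g j. \<phi> (g j)) ` \<G>"
   using G.ts_interleave[OF g(2,4)] by (rule image_eqI)
 next
  fix g' g and k :: "nat => nat" assume g: "g' = (\<lambda>j. \<phi> (g j))" "g \<in> \<G>"
  obtain x where x: "x \<in> \<G>" "\<And>j. x j = g j \<otimes>\<^bsub>G\<^esub> x (Suc j) [^]\<^bsub>G\<^esub> k j" using G.ts_solve[OF g(2), of k] by blast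
  have c: "g j \<in> carrier G" "x j \<in> carrier G" for j using G.ts_carrier g(2) x(1) by blast+
  have eq: "\<phi> (x j) = \<phi> (g j) \<otimes>\<^bsub>H\<^esub> \<phi> (x (Suc j)) [^]\<^bsub>H\<^esub> k j" for j
   by (subst x(2)) (simp add: c hom_nat_pow)
  show "\<exists>x\<in>(\<lambda>g j. \<phi> (g j)) ` \<G>. \<forall>j. x j = g' j \<otimes>\<^bsub>H\<^esub> x (Suc j) [^]\<^bsub>H\<^esub> k j"
   unfolding g(1) by (intro bexI[of _ "\<lambda>j. \<phi> (x j)"] allI eq imageI x(1))
 qed
qed

section \<open>Finite concatenations of loops and recursive systems of null sequences\<close>

definition pcat :: "'a => (real => 'a) list => real => 'a" where
 "pcat P ms = foldr path_concat ms (\<lambda>_. P)"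

lemma pcat_simps [simp]: "pcat P [] = (\<lambda>_. P)" "pcat P (m # ms) = (m @@ pcat P ms)"
 by (simp_all add: pcat_def)

lemma joins_pcat:
 "P \<in> topspace T ==> (\<And>m. m \<in> set ms ==> joins T P P m) ==> joins T P P (pcat P ms)"
proof (induction ms)
 case (Cons m ms)
 have "joins T P P m" "joins T P P (pcat P ms)" using Cons by simp_all
 thus ?case unfolding pcat_simps by (rule joins_concat)
qed (simp add: joins_const)

lemma pcat_values:
 "t \<in> {0..1} ==> pcat P ms t = P \<or> (\<exists>m\<in>set ms. \<exists>s\<in>{0..1}. pcat P ms t = m s)"
proof (induction ms arbitrary: t)
 case (Cons m ms)
 show ?case
 proof (cases "t <= 1/2")
  case True
  hence "pcat P (m # ms) t = m (2 * t)" "2 * t \<in> {0..1}" using Cons.prems by (simp_all add: path_concat_def)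
  thus ?thesis by auto
 next
  case False
  hence "pcat P (m # ms) t = pcat P ms (2 * t - 1)" "2 * t - 1 \<in> {0..1}" using Cons.prems by (simp_all add: path_concat_def)
  thus ?thesis using Cons.IH[of "2 * t - 1"] by auto
 qed
qed simp

text \<open>Which copy the time t falls into, and at which inner time s, does not depend on the loop
  \<open>m\<close>. This allows successive approximations to be compared pointwise.\<close>

lemma pcat_replicate_values:
 "t \<in> {0..1} ==> (\<forall>m. pcat P (replicate k m) t = P) \<or> (\<exists>s\<in>{0..1}. \<forall>m. pcat P (replicate k m) t = m s)"
proof (induction k arbitrary: t)
 case (Suc k)
 show ?case
 proof (cases "t <= 1/2")
  case True
  hence "\<forall>m. pcat P (replicate (Suc k) m) t = m (2 * t)" "2 * t \<in> {0..1}" using Suc.prems by (simp_all add: path_concat_def)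
  thus ?thesis by blast
 next
  case False
  hence "\<And>m. pcat P (replicate (Suc k) m) t = pcat P (replicate k m) (2 * t - 1)" "2 * t - 1 \<in> {0..1}"
   using Suc.prems by (simp_all add: path_concat_def)
  thus ?thesis using Suc.IH[of "2 * t - 1"] by simp
 qed
qed simp

lemma loop_class_pcat:
 assumes P: "P \<in> topspace T" and l: "\<And>j. joins T P P (ls j)"
 shows "loop_class T P (pcat P (map ls js)) = wprod (pi1 T P) (\<lambda>j. loop_class T P (ls j)) js"
proof (induction js)
 case (Cons j js)
 have "joins T P P (pcat P (map ls js))" using l by (intro joins_pcat[OF P]) auto
 thus ?case using Cons by (simp add: wprod_def flip: mult_loop_class[OF l])
qed (simp add: wprod_def one_pi1)

lemma loop_class_pcat_replicate:
 assumes P: "P \<in> topspace T" and m: "joins T P P m"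
 shows "loop_class T P (pcat P (replicate k m)) = loop_class T P m [^]\<^bsub>pi1 T P\<^esub> k"
proof (induction k)
 case (Suc k)
 interpret group "pi1 T P" by (rule group_pi1[OF P])
 have "joins T P P (pcat P (replicate k m))" using m by (intro joins_pcat[OF P]) auto
 hence "loop_class T P (pcat P (replicate (Suc k) m)) = loop_class T P m \<otimes>\<^bsub>pi1 T P\<^esub> loop_class T P (pcat P (replicate k m))"
  by (simp add: mult_loop_class[OF m])
 thus ?case using Suc nat_pow_Suc2[OF loop_class_carrier[OF m]] by simp
qed (simp add: one_pi1)

context Metric_space
begin

definition null_loops :: "'a => (nat => real => 'a) set" where
 "null_loops P = {ls. (\<forall>j. joins mtopology P P (ls j)) & (\<forall>\<epsilon>>0. \<exists>J. \<forall>j\<ge>J. \<forall>t\<in>{0..1}. d P (ls j t) < \<epsilon>)}"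

context
 fixes P :: 'a and ls :: "nat => real => 'a" and k :: "nat => nat"
 assumes PM: "P \<in> M" and ls: "ls \<in> null_loops P"
begin

text \<open>The recursion x_j = l_j x_(j+1)^(k_j) unrolled n times, with the constant loop at
  \<open>P\<close> in place of the remaining unknown.\<close>

primrec approx_sol :: "nat => nat => real => 'a" where
 "approx_sol 0 = (\<lambda>j t. P)"
| "approx_sol (Suc n) = (\<lambda>j. (ls j @@ (pcat P (replicate (k j) (approx_sol n (Suc j))))))"

lemma ls_loop: "joins mtopology P P (ls j)"
 using ls by (simp add: null_loops_def)

lemma approx_sol_loop: "joins mtopology P P (approx_sol n j)"
proof (induction n arbitrary: j)
 case (Suc n)
 have "joins mtopology P P (pcat P (replicate (k j) (approx_sol n (Suc j))))"
  using Suc PM by (intro joins_pcat) auto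
 thus ?case using joins_concat[OF ls_loop] by simp
qed (simp add: joins_const PM)

lemma approx_sol_M: "t \<in> {0..1} ==> approx_sol n j t \<in> M"
 using joins_topspace[OF approx_sol_loop, of t n j] by simp

lemma approx_sol_step:
 assumes "t \<in> {0..1}"
 obtains "\<And>n. approx_sol (Suc n) j t = ls j (2 * t)" "2 * t \<in> {0..1}" "t <= 1/2"
 | "\<not> t <= 1/2" "\<And>m. pcat P (replicate (k j) m) (2 * t - 1) = P" "\<And>n. approx_sol (Suc n) j t = P"
 | s where "\<not> t <= 1/2" "s \<in> {0..1}" "\<And>m. pcat P (replicate (k j) m) (2 * t - 1) = m s" "\<And>n. approx_sol (Suc n) j t = approx_sol n (Suc j) s"
proof (cases "t <= 1/2")
 case True
 thus ?thesis using that(1) assms by (simp add: path_concat_def)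
next
 case False
 hence e: "approx_sol (Suc n) j t = pcat P (replicate (k j) (approx_sol n (Suc j))) (2 * t - 1)" for n
  by (simp add: path_concat_def)
 have "2 * t - 1 \<in> {0..1}" using assms False by simp
 from pcat_replicate_values[OF this, of P "k j"] show ?thesis
 proof (elim disjE bexE)
  assume "\<forall>m. pcat P (replicate (k j) m) (2 * t - 1) = P"
  thus ?thesis using that(2)[OF False] e by simp
 next
  fix s assume "s \<in> {0..1}" "\<forall>m. pcat P (replicate (k j) m) (2 * t - 1) = m s"
  thus ?thesis using that(3)[OF False, of s] e by simp
 qed
qed

lemma approx_sol_stable:
 "t \<in> {0..1} ==> approx_sol n j t ~= P ==> n <= n' ==> approx_sol n' j t = approx_sol n j t"
proof (induction n arbitrary: j t n')
 case (Suc n)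
 obtain m where m: "n' = Suc m" "n <= m" using Suc.prems(3) by (cases n') auto
 show ?case unfolding m(1)
  using Suc.prems(1)
 proof (cases rule: approx_sol_step[where j=j])
  case 1
  show "approx_sol (Suc m) j t = approx_sol (Suc n) j t" unfolding 1(1) ..
 next
  case 2
  show "approx_sol (Suc m) j t = approx_sol (Suc n) j t" unfolding 2(3) ..
 next
  case (3 s)
  have "approx_sol n (Suc j) s ~= P" using Suc.prems(2) unfolding 3(4) .
  from Suc.IH[OF 3(2) this m(2)] show "approx_sol (Suc m) j t = approx_sol (Suc n) j t" unfolding 3(4) .
 qed
qed simp

lemma approx_sol_near:
 "(\<And>m t. j <= m ==> t \<in> {0..1} ==> d P (ls m t) < \<epsilon>) ==> \<epsilon> > 0 ==> t \<in> {0..1} ==> d P (approx_sol n j t) < \<epsilon>"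
proof (induction n arbitrary: j t)
 case (Suc n)
 show ?case
  using Suc.prems(3)
 proof (cases rule: approx_sol_step[where j=j])
  case 1
  show ?thesis unfolding 1(1) using Suc.prems(1) 1(2) by blast
 next
  case 2
  show ?thesis unfolding 2(3) using PM Suc.prems(2) by simp
 next
  case (3 s)
  show ?thesis unfolding 3(4) by (rule Suc.IH[OF Suc.prems(1) Suc.prems(2) 3(2)]) simp
 qed
qed (use PM in simp)

text \<open>Approximations from stage n on differ only inside loops of index at least j + n, which
  are small. This is where uniform convergence comes from.\<close>

lemma approx_sol_Cauchy:
 "(\<And>m t. j + n <= m ==> t \<in> {0..1} ==> d P (ls m t) < \<epsilon>) ==> \<epsilon> > 0 ==> t \<in> {0..1} ==> n <= n' ==>
  d (approx_sol n j t) (approx_sol n' j t) < \<epsilon>"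
proof (induction n arbitrary: j t n')
 case 0
 thus ?case using approx_sol_near[of j \<epsilon> t n'] by simp
next
 case (Suc n)
 obtain m where m: "n' = Suc m" "n <= m" using Suc.prems(4) by (cases n') auto
 have M: "approx_sol (Suc n) j t \<in> M" by (rule approx_sol_M[OF Suc.prems(3)])
 show ?case unfolding m(1)
  using Suc.prems(3)
 proof (cases rule: approx_sol_step[where j=j])
  case 1
  show "d (approx_sol (Suc n) j t) (approx_sol (Suc m) j t) < \<epsilon>" using M Suc.prems(2) unfolding 1(1) by simp
 next
  case 2
  show "d (approx_sol (Suc n) j t) (approx_sol (Suc m) j t) < \<epsilon>" unfolding 2(3) using PM Suc.prems(2) by simp
 next
  case (3 s)
  show "d (approx_sol (Suc n) j t) (approx_sol (Suc m) j t) < \<epsilon>" unfolding 3(4)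
   by (rule Suc.IH[OF Suc.prems(1) Suc.prems(2) 3(2) m(2)]) simp
 qed
qed

text \<open>By \<open>approx_sol_stable\<close> the value at a fixed time no longer changes once it
  has left \<open>P\<close>. The limit is therefore an eventual value, and the recursion holds as an
  equality of functions on [0,1], not only up to homotopy.\<close>

definition sol :: "nat => real => 'a" where
 "sol j t = (if \<exists>n. approx_sol n j t ~= P then approx_sol (LEAST n. approx_sol n j t ~= P) j t else P)"

lemma sol_eventually:
 assumes t: "t \<in> {0..1}" shows "\<exists>n. \<forall>n'\<ge>n. approx_sol n' j t = sol j t"
proof (cases "\<exists>n. approx_sol n j t ~= P")
 case True
 hence "approx_sol (LEAST n. approx_sol n j t ~= P) j t ~= P" by (rule LeastI_ex)
 note stable = approx_sol_stable[OF t this]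
 have sol: "sol j t = approx_sol (LEAST n. approx_sol n j t ~= P) j t" unfolding sol_def by (rule if_P[OF True])
 show ?thesis unfolding sol by (intro exI allI impI) (rule stable)
next
 case False
 hence "sol j t = P" unfolding sol_def by (rule if_not_P)
 thus ?thesis using False by metis
qed

lemma sol_unique: assumes "t \<in> {0..1}" "\<And>n. approx_sol (Suc n) j t = z" shows "sol j t = z"
 using sol_eventually[OF assms(1), of j] assms(2) by (metis le_Suc_eq le_refl)

lemma sol_eq:
 assumes t: "t \<in> {0..1}" shows "(ls j @@ (pcat P (replicate (k j) (sol (Suc j))))) t = sol j t"
 using t
proof (cases rule: approx_sol_step[where j=j])
 case 1
 thus ?thesis using sol_unique[OF t 1(1)] by (simp add: path_concat_def)
next
 case 2
 thus ?thesis using sol_unique[OF t 2(3)] by (simp add: path_concat_def)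
next
 case (3 s)
 obtain n where n: "\<forall>n'\<ge>n. approx_sol n' j t = sol j t" using sol_eventually[OF t] by blast
 obtain n1 where n1: "\<forall>n'\<ge>n1. approx_sol n' (Suc j) s = sol (Suc j) s" using sol_eventually[OF 3(2)] by blast
 have "Suc (max n n1) >= n" by simp
 hence "sol j t = approx_sol (Suc (max n n1)) j t" using n by (metis (no_types))
 also have "\<dots> = sol (Suc j) s" unfolding 3(4) using n1 by simp
 finally show ?thesis using 3(1,3) by (simp add: path_concat_def)
qed

lemma sol_near:
 assumes "\<And>m t. j <= m ==> t \<in> {0..1} ==> d P (ls m t) < \<epsilon>" "\<epsilon> > 0" "t \<in> {0..1}"
 shows "d P (sol j t) < \<epsilon>"
proof -
 obtain n where "\<forall>n'\<ge>n. approx_sol n' j t = sol j t" using sol_eventually[OF assms(3)] by blast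
 hence "sol j t = approx_sol n j t" by simp
 thus ?thesis using approx_sol_near[OF assms] by simp
qed

lemma sol_null: "sol \<in> null_loops P"
 unfolding null_loops_def
proof (intro CollectI conjI allI impI)
 show "\<exists>J. \<forall>j\<ge>J. \<forall>t\<in>{0..1}. d P (sol j t) < \<epsilon>" if \<epsilon>: "\<epsilon> > 0" for \<epsilon>
 proof -
  obtain J where "\<forall>j\<ge>J. \<forall>t\<in>{0..1}. d P (ls j t) < \<epsilon>" using ls \<epsilon> unfolding null_loops_def by blast
  hence "d P (sol j t) < \<epsilon>" if "j >= J" "t \<in> {0..1}" for j t
   using that \<open>\<epsilon> > 0\<close> by (intro sol_near) auto
  thus ?thesis by blast
 qed
 fix j
 have "cont_on {0..1} mtopology (sol j)"
 proof (rule continuous_map_uniform_limit)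
  show "\<forall>\<^sub>F n in sequentially. cont_on {0..1} mtopology (approx_sol n j)"
   using approx_sol_loop by (simp add: joins_def pathin_def)
  fix \<epsilon> :: real assume \<epsilon>: "\<epsilon> > 0"
  obtain J where J: "\<forall>j\<ge>J. \<forall>t\<in>{0..1}. d P (ls j t) < \<epsilon>" using ls \<epsilon> unfolding null_loops_def by blast
  have "sol j t \<in> M & d (approx_sol n j t) (sol j t) < \<epsilon>" if n: "n >= J" and t: "t \<in> {0..1}" for n t
  proof -
   obtain n1 where n1: "\<forall>n'\<ge>n1. approx_sol n' j t = sol j t" using sol_eventually[OF t] by blast
   hence e: "sol j t = approx_sol (max n n1) j t" by simp
   have "d (approx_sol n j t) (approx_sol (max n n1) j t) < \<epsilon>"
    by (rule approx_sol_Cauchy) (use J n t \<epsilon> in auto)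
   thus ?thesis using approx_sol_M[OF t] e by simp
  qed
  thus "\<forall>\<^sub>F n in sequentially. \<forall>t\<in>topspace (top_of_set {0..1}). sol j t \<in> M & d (approx_sol n j t) (sol j t) < \<epsilon>"
   unfolding eventually_sequentially by (intro exI[of _ J]) simp
 qed simp
 moreover have "sol j 0 = P" "sol j 1 = P"
  by (rule sol_unique; use approx_sol_loop[of _ j] in \<open>simp add: joins_def del: approx_sol.simps\<close>)+
 ultimately show "joins mtopology P P (sol j)" by (simp add: joins_def pathin_def)
qed

end

theorem tail_system_null_loops:
 assumes P: "P \<in> M"
 shows "tail_system (pi1 mtopology P) ((\<lambda>ls j. loop_class mtopology P (ls j)) ` null_loops P)"
proof -
 let ?G = "pi1 mtopology P"
 let ?N = "(\<lambda>ls j. loop_class mtopology P (ls j)) ` null_loops P"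
 have Pt: "P \<in> topspace mtopology" using P by simp
 interpret group ?G by (rule group_pi1[OF Pt])
 have loop: "joins mtopology P P (ls j)" if "ls \<in> null_loops P" for ls j using that by (simp add: null_loops_def)
 have near: "\<exists>J. \<forall>j\<ge>J. \<forall>t\<in>{0..1}. d P (ls j t) < \<epsilon>" if "ls \<in> null_loops P" "\<epsilon> > 0" for ls \<epsilon>
  using that unfolding null_loops_def by blast
 show ?thesis
 proof (unfold_locales; (elim imageE)?)
  fix g ls j assume "g = (\<lambda>j. loop_class mtopology P (ls j))" "ls \<in> null_loops P"
  thus "g j \<in> carrier ?G" using loop_class_carrier[OF loop] by simp
 next
  fix g ls and l :: "nat => nat list"
  assume g: "g = (\<lambda>j. loop_class mtopology P (ls j))" "ls \<in> null_loops P" and l: "\<And>i j. j \<in> set (l i) ==> i <= j"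
  have "(\<lambda>i. pcat P (map ls (l i))) \<in> null_loops P"
   unfolding null_loops_def
  proof (intro CollectI conjI allI impI)
   show "joins mtopology P P (pcat P (map ls (l i)))" for i
    using loop[OF g(2)] by (intro joins_pcat[OF Pt]) auto
   fix \<epsilon> :: real assume \<epsilon>: "\<epsilon> > 0"
   obtain J where J: "\<forall>j\<ge>J. \<forall>t\<in>{0..1}. d P (ls j t) < \<epsilon>" using near[OF g(2) \<epsilon>] by blast
   have "d P (pcat P (map ls (l i)) t) < \<epsilon>" if "i >= J" "t \<in> {0..1}" for i t
    using pcat_values[OF that(2), of P "map ls (l i)"]
   proof (elim disjE bexE)
    fix m s assume m: "m \<in> set (map ls (l i))" "s \<in> {0..1}" "pcat P (map ls (l i)) t = m s"
    then obtain j where "j \<in> set (l i)" "m = ls j" by auto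
    thus ?thesis using J m(2,3) l[of j i] that(1) by auto
   qed (use P \<epsilon> in simp)
   thus "\<exists>J. \<forall>i\<ge>J. \<forall>t\<in>{0..1}. d P (pcat P (map ls (l i)) t) < \<epsilon>" by blast
  qed
  moreover have "(\<lambda>i. wprod ?G g (l i)) = (\<lambda>i. loop_class mtopology P (pcat P (map ls (l i))))"
   using loop_class_pcat[OF Pt loop[OF g(2)]] g(1) by simp
  ultimately show "(\<lambda>i. wprod ?G g (l i)) \<in> ?N" by (intro image_eqI[of _ _ "\<lambda>i. pcat P (map ls (l i))"])
 next
  fix g ls h hs assume g: "g = (\<lambda>j. loop_class mtopology P (ls j))" "ls \<in> null_loops P"
   "h = (\<lambda>j. loop_class mtopology P (hs j))" "hs \<in> null_loops P"
  have "(\<lambda>j. if even j then ls (j div 2) else hs (j div 2)) \<in> null_loops P"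
   unfolding null_loops_def
  proof (intro CollectI conjI allI impI)
   show "joins mtopology P P (if even j then ls (j div 2) else hs (j div 2))" for j
    using loop g(2,4) by simp
   fix \<epsilon> :: real assume \<epsilon>: "\<epsilon> > 0"
   obtain J1 J2 where J: "\<forall>j\<ge>J1. \<forall>t\<in>{0..1}. d P (ls j t) < \<epsilon>" "\<forall>j\<ge>J2. \<forall>t\<in>{0..1}. d P (hs j t) < \<epsilon>"
    using near[OF g(2) \<epsilon>] near[OF g(4) \<epsilon>] by blast
   have "j div 2 >= J1 & j div 2 >= J2" if "j >= 2 * max J1 J2" for j using that by auto
   thus "\<exists>J. \<forall>j\<ge>J. \<forall>t\<in>{0..1}. d P ((if even j then ls (j div 2) else hs (j div 2)) t) < \<epsilon>"
    using J by (intro exI[of _ "2 * max J1 J2"]) simp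
  qed
  moreover have "(\<lambda>j. if even j then g (j div 2) else h (j div 2)) =
    (\<lambda>j. loop_class mtopology P (if even j then ls (j div 2) else hs (j div 2)))" unfolding g by (intro ext) simp
  ultimately show "(\<lambda>j. if even j then g (j div 2) else h (j div 2)) \<in> ?N"
   by (intro image_eqI[of _ _ "\<lambda>j. if even j then ls (j div 2) else hs (j div 2)"])
 next
  fix g ls and k :: "nat => nat" assume g: "g = (\<lambda>j. loop_class mtopology P (ls j))" "ls \<in> null_loops P"
  define \<xi> where "\<xi> = sol P ls k"
  have \<xi>: "\<xi> \<in> null_loops P" unfolding \<xi>_def by (rule sol_null[OF P g(2)])
  have eq: "loop_class mtopology P (\<xi> j) = g j \<otimes>\<^bsub>?G\<^esub> loop_class mtopology P (\<xi> (Suc j)) [^]\<^bsub>?G\<^esub> k j" for j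
  proof -
   have p: "joins mtopology P P (pcat P (replicate (k j) (\<xi> (Suc j))))"
    using loop[OF \<xi>] by (intro joins_pcat[OF Pt]) auto
   have "path_hom mtopology P P (ls j @@ (pcat P (replicate (k j) (\<xi> (Suc j))))) (\<xi> j)"
    by (rule path_hom_cong[OF joins_concat[OF loop[OF g(2)] p]]) (use sol_eq[OF P g(2)] in \<open>simp add: \<xi>_def\<close>)
   from loop_class_eqI[OF this] show ?thesis
    using loop_class_pcat_replicate[OF Pt loop[OF \<xi>]] mult_loop_class[OF loop[OF g(2)] p] g(1) by simp
  qed
  show "\<exists>x\<in>?N. \<forall>j. x j = g j \<otimes>\<^bsub>?G\<^esub> x (Suc j) [^]\<^bsub>?G\<^esub> k j"
   by (intro bexI[of _ "\<lambda>j. loop_class mtopology P (\<xi> j)"] allI eq imageI \<xi>)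
 qed
qed

end

section \<open>Words of homotopy classes\<close>

definition alternates :: "'a fg => 'a set => 'a set => bool" where
 "alternates a A B \<longleftrightarrow> a ~= 0 & core_supp a \<inter> A ~= {} & core_supp a \<inter> B ~= {}"

locale based_earring = earring C c X D d for C c and X :: "'a metric" and D d +
 fixes b :: 'a
 assumes sc: "simply_connected_space (mtopology_of X)" and lsc: "locally_simply_connected_space (mtopology_of X)"
  and lpc: "locally_path_connected_space (mtopology_of X)" and dense: "mtopology_of X closure_of D = mspace X"
  and b: "b \<in> mspace X"
begin

abbreviation "G \<equiv> pi1 E (b, c)"

definition \<tau> :: "'a set => (real => 'a \<times> complex) set => 'a fg" where
 "\<tau> S g = word_along S q (SOME p. joins E (b, c) (b, c) p & g = loop_class E (b, c) p) 0 1"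

text \<open>By \<open>null_homotopic_if_words_trivial\<close> and
  \<open>word_along_collapse\<close>, inactivity on \<open>A\<close> means that the class becomes
  trivial when all circles outside \<open>A\<close> are collapsed.\<close>

definition active :: "(real => 'a \<times> complex) set => 'a set => bool" where
 "active g A \<longleftrightarrow> (\<exists>S. finite S & S \<subseteq> D \<inter> A & \<tau> S g ~= 0)"

lemma base_topspace: "x \<in> mspace X ==> (x, c) \<in> topspace E"
 unfolding topspace_E by blast

sublocale G: group G
 by (rule group_pi1[OF base_topspace[OF b]])

lemma loopE:
 assumes "g \<in> carrier G" obtains p where "joins E (b, c) (b, c) p" "g = loop_class E (b, c) p"
 using carrier_pi1E[OF assms] .

lemma path_cont: "joins E P Q p ==> 0 <= s ==> t <= 1 ==> cont_on {s..t} E p"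
 using continuous_map_from_subtopology_mono[of "euclidean" "{0..1}" E p "{s..t}"] by (simp add: joins_def pathin_def)

context
 fixes S assumes S: "finite S" "S \<subseteq> D"
begin

lemma coc_S: "cocycle E (circle_cover E S q) (cross_letter S q)"
 by (rule cocycle_cross_letter[OF circle_system_E[OF S(2)] S(1)])

lemma \<tau>_class:
 assumes "joins E (b, c) (b, c) p" shows "\<tau> S (loop_class E (b, c) p) = word_along S q p 0 1"
proof -
 define p' where "p' = (SOME p'. joins E (b, c) (b, c) p' & loop_class E (b, c) p = loop_class E (b, c) p')"
 have "joins E (b, c) (b, c) p' & loop_class E (b, c) p = loop_class E (b, c) p'"
  unfolding p'_def by (rule someI[of _ p]) (use assms in simp)
 hence "path_hom E (b, c) (b, c) p p'" using loop_class_eq_iff[OF assms] by blast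
 thus ?thesis using cocycle.ctrans_path_hom[OF coc_S] by (simp add: \<tau>_def p'_def word_along_def)
qed

lemma \<tau>_mult: assumes "g \<in> carrier G" "h \<in> carrier G" shows "\<tau> S (g \<otimes>\<^bsub>G\<^esub> h) = \<tau> S g + \<tau> S h"
proof -
 obtain p where p: "joins E (b, c) (b, c) p" "g = loop_class E (b, c) p" using loopE[OF assms(1)] .
 obtain p' where p': "joins E (b, c) (b, c) p'" "h = loop_class E (b, c) p'" using loopE[OF assms(2)] .
 show ?thesis unfolding p(2) p'(2) mult_loop_class[OF p(1) p'(1)] \<tau>_class[OF p(1)] \<tau>_class[OF p'(1)]
  \<tau>_class[OF joins_concat[OF p(1) p'(1)]]
  unfolding word_along_def by (rule cocycle.ctrans_concat[OF coc_S p(1) p'(1)])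
qed

lemma \<tau>_one: "\<tau> S \<one>\<^bsub>G\<^esub> = 0"
 using \<tau>_mult[OF G.one_closed G.one_closed] add_left_cancel[of "\<tau> S \<one>\<^bsub>G\<^esub>" "\<tau> S \<one>\<^bsub>G\<^esub>" 0] by simp

lemma \<tau>_inv: "g \<in> carrier G ==> \<tau> S (inv\<^bsub>G\<^esub> g) = - \<tau> S g"
 using \<tau>_mult[of g "inv\<^bsub>G\<^esub> g"] \<tau>_one by (simp add: minus_unique)

lemma \<tau>_pow: "g \<in> carrier G ==> \<tau> S (g [^]\<^bsub>G\<^esub> (n::nat)) = fg_pow n (\<tau> S g)"
proof (induction n)
 case (Suc n)
 have "g [^]\<^bsub>G\<^esub> Suc n = g \<otimes>\<^bsub>G\<^esub> g [^]\<^bsub>G\<^esub> n" using G.nat_pow_Suc2[OF Suc.prems] .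
 thus ?case using \<tau>_mult[of g "g [^]\<^bsub>G\<^esub> n"] Suc by (simp del: nat_pow_Suc)
qed (simp add: \<tau>_one)

lemma \<tau>_keep: assumes "g \<in> carrier G" shows "fg_keep A (\<tau> S g) = \<tau> (S \<inter> A) g"
 unfolding \<tau>_def
proof (rule word_along_keep[OF circle_system_E[OF S(2)] S(1)])
 define p where "p = (SOME p. joins E (b, c) (b, c) p & g = loop_class E (b, c) p)"
 have "\<exists>p. joins E (b, c) (b, c) p & g = loop_class E (b, c) p" using loopE[OF assms] by metis
 from someI_ex[OF this] show "cont_on {0..1} E (SOME p. joins E (b, c) (b, c) p & g = loop_class E (b, c) p)"
  unfolding p_def[symmetric] by (elim conjE) (rule path_cont, auto)
qed simp

lemma \<tau>_supp: assumes "g \<in> carrier G" shows "fg_supp (\<tau> S g) \<subseteq> S"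
 using \<tau>_keep[OF assms, of S] fg_supp_keep[of S "\<tau> S g"] by simp

end

lemma trivial_if_\<tau>_trivial:
 assumes g: "g \<in> carrier G" and "\<And>S. finite S ==> S \<subseteq> D ==> \<tau> S g = 0"
 shows "g = \<one>\<^bsub>G\<^esub>"
proof -
 obtain p where p: "joins E (b, c) (b, c) p" "g = loop_class E (b, c) p" using loopE[OF g] .
 have "path_hom E (b, c) (b, c) p (\<lambda>_. (b, c))"
  by (rule null_homotopic_if_words_trivial[OF sc lsc p(1)]) (use assms(2) \<tau>_class[OF _ _ p(1)] p(2) in auto)
 from loop_class_eqI[OF this] show ?thesis by (simp only: p(2) one_pi1)
qed

lemma active_mono: "active g A ==> A \<inter> D \<subseteq> B ==> active g B"
 unfolding active_def by (meson Int_subset_iff inf_commute order_trans subset_trans le_inf_iff)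

lemma active_conj:
 assumes "g \<in> carrier G" "h \<in> carrier G" "active g A"
 shows "active (h \<otimes>\<^bsub>G\<^esub> g \<otimes>\<^bsub>G\<^esub> inv\<^bsub>G\<^esub> h) A"
proof -
 obtain S where S: "finite S" "S \<subseteq> D \<inter> A" "\<tau> S g ~= 0" using assms(3) unfolding active_def by blast
 have SD: "S \<subseteq> D" using S by blast
 have "\<tau> S (h \<otimes>\<^bsub>G\<^esub> g \<otimes>\<^bsub>G\<^esub> inv\<^bsub>G\<^esub> h) = \<tau> S h + \<tau> S g - \<tau> S h"
  using assms \<tau>_mult[OF S(1) SD] \<tau>_inv[OF S(1) SD] by simp
 also have "\<dots> ~= 0" using S(3) by (metis add_0_right add_left_cancel diff_add_cancel add_0_left)
 finally show ?thesis using S unfolding active_def by blast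
qed

text \<open>By continuity, the projection of a loop to X over a sufficiently short time interval
  misses one of two sets at positive distance, and then the word has at most one switch. The bound
  comes from the number of pieces and is the same for all finite \<open>S\<close>.\<close>

lemma alternation_bounded:
 assumes g: "g \<in> carrier G" and r: "r > 0"
  and sep: "\<And>x y. x \<in> A ==> y \<in> B ==> x \<in> mspace X ==> y \<in> mspace X ==> r <= mdist X x y"
 shows "\<exists>N. \<forall>S. finite S & S \<subseteq> D --> fg_alt (A \<inter> mspace X) (B \<inter> mspace X) (\<tau> S g) <= N"
proof -
 let ?A = "A \<inter> mspace X" and ?B = "B \<inter> mspace X"
 obtain p where p: "joins E (b, c) (b, c) p" "g = loop_class E (b, c) p" using loopE[OF g] .
 have pX: "fst (p t) \<in> mspace X" if "t \<in> {0..1}" for t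
  using joins_topspace[OF p(1), of t] that EM_fst[of "p t"] unfolding topspace_E by simp
 have AB: "?A \<inter> ?B = {}"
 proof (rule equals0I)
  show False if "z \<in> ?A \<inter> ?B" for z using sep[of z z] mdist_self[of z X] that r by auto
 qed
 define Q where "Q s t \<longleftrightarrow> (\<exists>N::nat. \<forall>S. finite S & S \<subseteq> D --> fg_alt ?A ?B (word_along S q p s t) <= N)" for s t
 have "0 <= (0::real) & 1 <= (1::real) --> Q 0 1"
 proof (rule Bolzano[where P="\<lambda>s t. 0 <= s & t <= 1 --> Q s t"])
  fix x y z :: real
  assume 1: "0 <= x & y <= 1 --> Q x y" "0 <= y & z <= 1 --> Q y z" "x <= y" "y <= z"
  show "0 <= x & z <= 1 --> Q x z"
  proof
   assume xz: "0 <= x & z <= 1"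
   then obtain N1 N2 where N: "\<And>S. finite S & S \<subseteq> D ==> fg_alt ?A ?B (word_along S q p x y) <= N1"
    "\<And>S. finite S & S \<subseteq> D ==> fg_alt ?A ?B (word_along S q p y z) <= N2"
    using 1 unfolding Q_def by auto
   have "fg_alt ?A ?B (word_along S q p x z) <= N1 + 1 + N2" if S: "finite S & S \<subseteq> D" for S
   proof -
    have "word_along S q p x z = word_along S q p x y + word_along S q p y z"
     unfolding word_along_def using S xz 1(3,4)
     by (intro cocycle.ctrans_join[OF coc_S] path_cont[OF p(1)]) auto
    thus ?thesis using fg_alt_add[of ?A ?B "word_along S q p x y" "word_along S q p y z"] N[OF S] by simp
   qed
   thus "Q x z" unfolding Q_def by blast
  qed
 next
  fix x :: real assume x: "0 <= x" "x <= 1"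
  have cf: "cont_on {0..1} XM.mtopology (\<lambda>t. fst (p t))"
   using continuous_map_compose[OF path_cont[OF p(1), of 0 1] continuous_fst] by (simp add: o_def mtopology_of_def)
  obtain \<delta> where \<delta>: "\<delta> > 0" "\<And>w. w \<in> {0..1} ==> dist w x < \<delta> ==> mdist X (fst (p x)) (fst (p w)) < r / 2"
   using cf x r unfolding XM.continuous_map_eu_metric by (metis atLeastAtMost_iff half_gt_zero)
  have "Q u v" if uv: "u <= x" "x <= v" "v - u < \<delta>" "0 <= u" "v <= 1" for u v
  proof -
   have near: "mdist X (fst (p x)) (fst (p w)) < r / 2" if "w \<in> {u..v}" for w
    using \<delta>(2)[of w] that uv by (auto simp: dist_real_def)
   have i: "w \<in> {0..1}" if "w \<in> {u..v}" for w using that uv by auto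
   have "(\<forall>w\<in>{u..v}. fst (p w) \<notin> ?A) \<or> (\<forall>w\<in>{u..v}. fst (p w) \<notin> ?B)"
   proof (rule ccontr)
    assume "\<not> ?thesis"
    then obtain w w' where w: "w \<in> {u..v}" "fst (p w) \<in> A" "w' \<in> {u..v}" "fst (p w') \<in> B" by blast
    have "mdist X (fst (p w)) (fst (p w')) <= mdist X (fst (p w)) (fst (p x)) + mdist X (fst (p x)) (fst (p w'))"
     using pX i w(1,3) x by (intro XM.triangle) auto
    also have "\<dots> < r" using near[OF w(1)] near[OF w(3)] XM.commute[of "fst (p x)" "fst (p w)"] by simp
    finally show False using sep[OF w(2,4) pX pX] i w by force
   qed
   moreover have "fg_alt ?A ?B (word_along S q p u v) <= 1" if S: "finite S & S \<subseteq> D"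
    and av: "(\<forall>w\<in>{u..v}. fst (p w) \<notin> ?A) \<or> (\<forall>w\<in>{u..v}. fst (p w) \<notin> ?B)" for S
   proof (rule fg_alt_le_1[OF AB])
    have *: "fg_supp (word_along S q p u v) \<inter> A' = {}" if "\<forall>w\<in>{u..v}. fst (p w) \<notin> A'" for A'
    proof -
     have "fg_supp (word_along S q p u v) \<subseteq> S - A'"
     proof (rule word_along_avoid[OF circle_system_E])
      show "q s (p t) = 1" if "t \<in> {u..v}" "s \<in> S \<inter> A'" for t s
       using \<open>\<forall>w\<in>{u..v}. fst (p w) \<notin> A'\<close> that by (auto simp: q_def)
     qed (use S uv path_cont[OF p(1)] in auto)
     thus ?thesis by blast
    qed
    show "fg_supp (word_along S q p u v) \<inter> ?A = {} \<or> fg_supp (word_along S q p u v) \<inter> ?B = {}"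
     using av *[of ?A] *[of ?B] by blast
   qed
   ultimately show ?thesis unfolding Q_def by blast
  qed
  thus "\<exists>\<delta>>0. \<forall>u v. u <= x & x <= v & v - u < \<delta> --> 0 <= u & v <= 1 --> Q u v" using \<delta>(1) by blast
 qed simp
 hence "Q 0 1" by simp
 thus ?thesis unfolding Q_def p(2) using \<tau>_class[OF _ _ p(1)] by auto
qed

section \<open>Higman's argument and alternation counts for tail systems\<close>

context
 fixes \<G> assumes ts: "tail_system G \<G>"
begin

interpretation tail_system G \<G> by (rule ts)

text \<open>The word map turns solvability of the recursions in the tail system into solvability in
  a free group, where Higman's argument applies.\<close>

lemma eventually_trivial:
 assumes "g \<in> \<G>" and S: "finite S" "S \<subseteq> D"
 shows "\<exists>J. \<forall>j\<ge>J. \<tau> S (g j) = 0"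
proof (rule higman_eventually_zero)
 fix k :: "nat => nat"
 obtain x where x: "x \<in> \<G>" "\<And>j. x j = g j \<otimes>\<^bsub>G\<^esub> x (Suc j) [^]\<^bsub>G\<^esub> k j" using ts_solve[OF assms(1), of k] by blast
 have "\<tau> S (x j) = \<tau> S (g j) + fg_pow (k j) (\<tau> S (x (Suc j)))" for j
  by (subst x(2)) (simp add: \<tau>_mult[OF S] \<tau>_pow[OF S] ts_carrier[OF assms(1)] ts_carrier[OF x(1)])
 thus "\<exists>x. \<forall>j. x j = \<tau> S (g j) + fg_pow (k j) (x (Suc j))" by (intro exI[of _ "\<lambda>j. \<tau> S (x j)"] allI)
qed

text \<open>An infinite product of powers of members of \<open>g\<close>, each chosen in view of its predecessors. The
 finite sets are chosen so that later factors do not matter for earlier requirements.\<close>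

lemma infinite_product:
 assumes g: "g \<in> \<G>" and inf: "\<And>m. \<exists>j\<ge>m. \<exists>S. finite S & S \<subseteq> D & R j S"
  and step: "\<And>n u j S. u \<in> carrier G ==> finite S ==> S \<subseteq> D ==> R j S ==> \<exists>a. Q n j S (\<tau> S u + fg_pow a (\<tau> S (g j)))"
 obtains y js Ss where "y \<in> carrier G" "strict_mono js" "\<And>n::nat. finite (Ss n) & Ss n \<subseteq> D & R (js n) (Ss n)"
  "\<And>n. Q n (js n) (Ss n) (\<tau> (Ss n) y)"
proof -
 define ok where "ok n z \<longleftrightarrow> (case z of (u, j, S, a) => u \<in> carrier G & finite S & S \<subseteq> D & R j S & Q n j S (\<tau> S u))"
  for n :: nat and z :: "(real => 'a \<times> complex) set \<times> nat \<times> 'a set \<times> nat"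
 \<comment> \<open>The next index is so large that from there on all members of \<open>g\<close> are
   invisible to the finite set chosen before.\<close>
 define nxt where "nxt z z' \<longleftrightarrow> (case (z, z') of ((u, j, S, a), (u', j', S', a')) =>
   j < j' & (\<forall>m\<ge>j'. \<tau> S (g m) = 0) & u' = u \<otimes>\<^bsub>G\<^esub> g j' [^]\<^bsub>G\<^esub> a')"
  for z z' :: "(real => 'a \<times> complex) set \<times> nat \<times> 'a set \<times> nat"
 note gc = ts_carrier[OF g]
 have ext: "\<exists>j'\<ge>m. \<exists>S' a'. ok n (u \<otimes>\<^bsub>G\<^esub> g j' [^]\<^bsub>G\<^esub> a', j', S', a')" if u: "u \<in> carrier G" for n m u
 proof -
  obtain j' S' where j': "j' >= m" "finite S'" "S' \<subseteq> D" "R j' S'" using inf by blast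
  obtain a where "Q n j' S' (\<tau> S' u + fg_pow a (\<tau> S' (g j')))" using step[OF u j'(2-4)] by blast
  hence "ok n (u \<otimes>\<^bsub>G\<^esub> g j' [^]\<^bsub>G\<^esub> a, j', S', a)"
   using j' u gc by (simp add: ok_def \<tau>_mult \<tau>_pow)
  thus ?thesis using j'(1) by blast
 qed
 have "\<exists>z. \<forall>n. ok n (z n) & nxt (z n) (z (Suc n))"
 proof (rule dependent_nat_choice)
  show "\<exists>z. ok 0 z" using ext[OF G.one_closed] by blast
  fix z n assume "ok n z"
  moreover obtain u j S a where z: "z = (u, j, S, a)" by (metis prod.exhaust)
  ultimately have u: "u \<in> carrier G" "finite S" "S \<subseteq> D" by (simp_all add: ok_def)
  obtain J where J: "\<forall>m\<ge>J. \<tau> S (g m) = 0" using eventually_trivial[OF g u(2,3)] by blast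
  obtain j' S' a' where "j' >= max J (Suc j)" "ok (Suc n) (u \<otimes>\<^bsub>G\<^esub> g j' [^]\<^bsub>G\<^esub> a', j', S', a')"
   using ext[OF u(1)] by blast
  thus "\<exists>z'. ok (Suc n) z' & nxt z z'" using J
   by (intro exI[of _ "(u \<otimes>\<^bsub>G\<^esub> g j' [^]\<^bsub>G\<^esub> a', j', S', a')"]) (auto simp: nxt_def z)
 qed
 then obtain z where z: "\<And>n. ok n (z n)" "\<And>n. nxt (z n) (z (Suc n))" by blast
 define us js Ss as where "us = (\<lambda>n. fst (z n))" and "js = (\<lambda>n. fst (snd (z n)))"
  and "Ss = (\<lambda>n. fst (snd (snd (z n))))" and "as = (\<lambda>n. snd (snd (snd (z n))))"
 have us: "us n \<in> carrier G" and Ss: "finite (Ss n)" "Ss n \<subseteq> D" and Rn: "R (js n) (Ss n)" and Qn: "Q n (js n) (Ss n) (\<tau> (Ss n) (us n))" for n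
  using z(1)[of n] by (auto simp: ok_def us_def js_def Ss_def split: prod.splits)
 have js: "js n < js (Suc n)" and kill: "\<And>m. m >= js (Suc n) ==> \<tau> (Ss n) (g m) = 0"
  and us_Suc: "us (Suc n) = us n \<otimes>\<^bsub>G\<^esub> g (js (Suc n)) [^]\<^bsub>G\<^esub> as (Suc n)" for n
  using z(2)[of n] by (auto simp: nxt_def us_def js_def Ss_def as_def split: prod.splits)
 have sm: "strict_mono js" using js by (rule strict_monoI_Suc)
 \<comment> \<open>The chosen powers are words in late members of \<open>g\<close>, so they form a
   sequence of the tail system again. Solving the recursion with all exponents 1 yields their
   infinite product.\<close>
 define h where "h = (\<lambda>n. wprod G g (replicate (as n) (js n)))"
 have h: "h \<in> \<G>" unfolding h_def
  by (rule ts_words[OF g]) (use strict_mono_imp_increasing[OF sm] in auto)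
 have wr: "wprod G g (replicate k j) = g j [^]\<^bsub>G\<^esub> k" for k j
 proof (induction k)
  case (Suc k)
  thus ?case using G.nat_pow_Suc2[OF gc[of j]] by (simp add: wprod_def)
 qed (simp add: wprod_def)
 have h_eq: "h n = g (js n) [^]\<^bsub>G\<^esub> as n" for n unfolding h_def by (rule wr)
 obtain x where x: "x \<in> \<G>" "\<And>j. x j = h j \<otimes>\<^bsub>G\<^esub> x (Suc j) [^]\<^bsub>G\<^esub> (1::nat)" using ts_solve[OF h, of "\<lambda>_. 1"] by blast
 note xc = ts_carrier[OF x(1)] and hc = ts_carrier[OF h]
 have x': "x j = h j \<otimes>\<^bsub>G\<^esub> x (Suc j)" for j using x(2)[of j] xc by simp
 define y where "y = us 0 \<otimes>\<^bsub>G\<^esub> x 1"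
 have y: "y = us n \<otimes>\<^bsub>G\<^esub> x (Suc n)" for n
 proof (induction n)
  case (Suc n)
  have "y = us n \<otimes>\<^bsub>G\<^esub> (h (Suc n) \<otimes>\<^bsub>G\<^esub> x (Suc (Suc n)))" using Suc x'[of "Suc n"] by simp
  also have "\<dots> = us (Suc n) \<otimes>\<^bsub>G\<^esub> x (Suc (Suc n))" using us xc hc[of "Suc n"] by (simp add: us_Suc h_eq G.m_assoc gc)
  finally show ?case .
 qed (simp add: y_def)
 \<comment> \<open>Splitting off further factors, all invisible to \<open>Ss n\<close>, does not
   change the word of the tail, and far out that word vanishes by
   \<open>eventually_trivial\<close>.\<close>
 have tail: "\<tau> (Ss n) (x (Suc n)) = 0" for n
 proof -
  obtain J where J: "\<forall>j\<ge>J. \<tau> (Ss n) (x j) = 0" using eventually_trivial[OF x(1) Ss] by blast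
  have "\<tau> (Ss n) (x (Suc n)) = \<tau> (Ss n) (x (Suc n + m))" for m
  proof (induction m)
   case (Suc m)
   have "js (Suc n) <= js (Suc n + m)" using sm by (simp add: strict_mono_less_eq)
   hence "\<tau> (Ss n) (h (Suc n + m)) = 0"
    unfolding h_eq \<tau>_pow[OF Ss gc] using kill[of n "js (Suc n + m)"] by (metis \<tau>_one[OF Ss] \<tau>_pow[OF Ss G.one_closed] G.nat_pow_one)
   hence "\<tau> (Ss n) (x (Suc n + m)) = \<tau> (Ss n) (x (Suc n + Suc m))"
    by (subst x') (simp add: \<tau>_mult[OF Ss hc xc])
   thus ?case using Suc by simp
  qed simp
  from this[of J] show ?thesis using J by simp
 qed
 show ?thesis
 proof (rule that[of y js Ss])
  show "y \<in> carrier G" using us xc by (simp add: y_def)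
  have "\<tau> (Ss n) y = \<tau> (Ss n) (us n)" for n unfolding y[of n] \<tau>_mult[OF Ss us xc] tail by simp
  thus "Q n (js n) (Ss n) (\<tau> (Ss n) y)" for n using Qn by simp
 qed (use sm Ss Rn in auto)
qed

text \<open>High powers of infinitely many alternating cores would build an infinite product with
  unbounded alternation numbers, while a single loop can pass only boundedly often between separated
  sets.\<close>

lemma no_alternation:
 assumes g: "g \<in> \<G>" and r: "r > 0"
  and sep: "\<And>x y. x \<in> A ==> y \<in> B ==> x \<in> mspace X ==> y \<in> mspace X ==> r <= mdist X x y"
 shows "\<exists>J. \<forall>j S. J <= j --> finite S & S \<subseteq> D --> \<not> alternates (\<tau> S (g j)) (A \<inter> mspace X) (B \<inter> mspace X)"
proof (rule ccontr)
 let ?A = "A \<inter> mspace X" and ?B = "B \<inter> mspace X"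
 define R where "R = (\<lambda>j S. alternates (\<tau> S (g j)) ?A ?B)"
 assume "\<not> ?thesis"
 hence inf: "\<exists>j\<ge>m. \<exists>S. finite S & S \<subseteq> D & R j S" for m unfolding R_def by blast
 have AB: "?A \<inter> ?B = {}"
 proof (rule equals0I)
  show False if "z \<in> ?A \<inter> ?B" for z using sep[of z z] mdist_self[of z X] that r by auto
 qed
 have step: "\<exists>a. n <= fg_alt ?A ?B (\<tau> S u + fg_pow a (\<tau> S (g j)))" if "R j S" for n u j S
 proof -
  \<comment> \<open>Multiplication by the word of the preceding partial product can destroy only as
    many switches as its inverse has, plus one at the junction.\<close>
  define a where "a = n + 1 + fg_alt ?A ?B (- \<tau> S u)"
  have "a <= fg_alt ?A ?B (fg_pow a (\<tau> S (g j)))" using that unfolding R_def alternates_def by (intro fg_alt_pow[OF AB]) (elim conjE, assumption)+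
  also have "fg_pow a (\<tau> S (g j)) = - \<tau> S u + (\<tau> S u + fg_pow a (\<tau> S (g j)))" by (simp add: add.assoc[symmetric])
  finally have "a <= fg_alt ?A ?B (- \<tau> S u) + 1 + fg_alt ?A ?B (\<tau> S u + fg_pow a (\<tau> S (g j)))"
   using fg_alt_add order_trans by blast
  thus ?thesis by (intro exI[of _ a]) (simp add: a_def)
 qed
 show False
 proof (rule infinite_product[where R="R" and Q="\<lambda>n j S w. n <= fg_alt ?A ?B w", OF g inf step])
 fix y js and Ss :: "nat => 'a set"
 assume y: "y \<in> carrier G" "\<And>n. finite (Ss n) & Ss n \<subseteq> D & R (js n) (Ss n)" "\<And>n. n <= fg_alt ?A ?B (\<tau> (Ss n) y)"
 obtain N where "\<And>S. finite S & S \<subseteq> D ==> fg_alt ?A ?B (\<tau> S y) <= N"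
  using alternation_bounded[OF y(1) r sep] by blast
 hence "fg_alt ?A ?B (\<tau> (Ss (Suc N)) y) <= N" using y(2)[of "Suc N"] by blast
 thus False using y(3)[of "Suc N"] by linarith
 qed
qed

text \<open>Unless one factor is already active on both sets, the product of a member active on
  \<open>A\<close> and one active on \<open>B\<close> is. The core of such an element meets both
  sets, so alternation would occur in arbitrarily late words.\<close>

lemma not_active_apart:
 assumes g: "g \<in> \<G>" and r: "r > 0"
  and sep: "\<And>x y. x \<in> A ==> y \<in> B ==> x \<in> mspace X ==> y \<in> mspace X ==> r <= mdist X x y"
  and A: "\<And>m. \<exists>j\<ge>m. active (g j) A" and B: "\<And>m. \<exists>j\<ge>m. active (g j) B"
 shows False
proof -
 note gc = ts_carrier[OF g]
 have "\<exists>l. (\<forall>j\<in>set l. i <= j) & active (wprod G g l) A & active (wprod G g l) B" for i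
 proof -
  obtain j j' where j: "j >= i" "active (g j) A" "j' >= i" "active (g j') B" using A B by meson
  have one: "wprod G g [k] = g k" for k using gc by (simp add: wprod_def)
  have two: "wprod G g [k, k'] = g k \<otimes>\<^bsub>G\<^esub> g k'" for k k' using gc by (simp add: wprod_def)
  show ?thesis
  proof (cases "active (g j) B \<or> active (g j') A")
   case True
   thus ?thesis using j one by (metis empty_iff empty_set insert_iff list.simps(15))
  next
   case False
   obtain S where S: "finite S" "S \<subseteq> D \<inter> A" "\<tau> S (g j) ~= 0" using j(2) unfolding active_def by blast
   obtain S' where S': "finite S'" "S' \<subseteq> D \<inter> B" "\<tau> S' (g j') ~= 0" using j(4) unfolding active_def by blast
   have "\<tau> S (g j') = 0" "\<tau> S' (g j) = 0" using False S S' unfolding active_def by blast+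
   hence "\<tau> S (g j \<otimes>\<^bsub>G\<^esub> g j') ~= 0" "\<tau> S' (g j \<otimes>\<^bsub>G\<^esub> g j') ~= 0"
    using S S' by (simp_all add: \<tau>_mult gc)
   hence "active (wprod G g [j, j']) A" "active (wprod G g [j, j']) B"
    unfolding two active_def using S(1,2) S'(1,2) by blast+
   thus ?thesis using j by (intro exI[of _ "[j, j']"]) simp
  qed
 qed
 then obtain l where l: "\<And>i j. j \<in> set (l i) ==> i <= j" "\<And>i. active (wprod G g (l i)) A" "\<And>i. active (wprod G g (l i)) B" by metis
 have w: "(\<lambda>i. wprod G g (l i)) \<in> \<G>" by (rule ts_words[OF g l(1)])
 obtain J where J': "\<forall>j S. J <= j --> finite S & S \<subseteq> D --> \<not> alternates (\<tau> S (wprod G g (l j))) (A \<inter> mspace X) (B \<inter> mspace X)"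
  using no_alternation[OF w r sep] ..
 note J = J'[rule_format, OF order_refl]
 obtain S where S: "finite S" "S \<subseteq> D \<inter> A" "\<tau> S (wprod G g (l J)) ~= 0" using l(2) unfolding active_def by blast
 obtain S' where S': "finite S'" "S' \<subseteq> D \<inter> B" "\<tau> S' (wprod G g (l J)) ~= 0" using l(3) unfolding active_def by blast
 have U: "finite (S \<union> S')" "S \<union> S' \<subseteq> D" using S S' by auto
 have keep: "fg_keep S (\<tau> (S \<union> S') (wprod G g (l J))) ~= 0" "fg_keep S' (\<tau> (S \<union> S') (wprod G g (l J))) ~= 0"
  unfolding \<tau>_keep[OF U ts_carrier[OF w]] using S(3) S'(3) by (simp_all add: Int_absorb1)
 hence "\<tau> (S \<union> S') (wprod G g (l J)) ~= 0" by auto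
 moreover have "core_supp (\<tau> (S \<union> S') (wprod G g (l J))) \<inter> (A \<inter> mspace X) ~= {}"
  using core_supp_meets[OF keep(1)] S(2) D_sub by blast
 moreover have "core_supp (\<tau> (S \<union> S') (wprod G g (l J))) \<inter> (B \<inter> mspace X) ~= {}"
  using core_supp_meets[OF keep(2)] S'(2) D_sub by blast
 ultimately have "alternates (\<tau> (S \<union> S') (wprod G g (l J))) (A \<inter> mspace X) (B \<inter> mspace X)"
  unfolding alternates_def by (intro conjI)
 thus False using J[OF conjI[OF U]] by contradiction
qed

text \<open>Each nontrivial word contributes a letter of its core to an infinite product. A loop
  representing the product must visit all these circles, and compactness of the time interval makes
  their positions accumulate.\<close>

lemma limit_point_exists:
 assumes g: "g \<in> \<G>" and nt: "\<And>m. \<exists>j\<ge>m. g j ~= \<one>\<^bsub>G\<^esub>"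
 obtains y where "y \<in> mspace X" "\<And>R m. R > 0 ==> \<exists>j\<ge>m. active (g j) {x \<in> mspace X. mdist X y x < R}"
proof -
 note gc = ts_carrier[OF g]
 let ?R = "\<lambda>j S. \<tau> S (g j) ~= 0"
 define s where "s j S = (SOME s. s \<in> core_supp (\<tau> S (g j)))" for j S
 have s: "s j S \<in> core_supp (\<tau> S (g j))" if "?R j S" for j S
 proof -
  have "fg_keep (fg_supp (\<tau> S (g j))) (\<tau> S (g j)) ~= 0" using that by (simp add: fg_keep_id)
  hence "core_supp (\<tau> S (g j)) ~= {}" using core_supp_meets by blast
  thus ?thesis unfolding s_def using some_in_eq by blast
 qed
 have inf: "\<exists>j\<ge>m. \<exists>S. finite S & S \<subseteq> D & ?R j S" for m
  using nt[of m] trivial_if_\<tau>_trivial[OF gc] by metis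
 \<comment> \<open>Exponent 0 or 1 suffices: if the partial product lacks the letter, multiplying by
   a word that contains it cannot lose it.\<close>
 have step: "\<exists>a. s j S \<in> fg_supp (\<tau> S u + fg_pow a (\<tau> S (g j)))" if "?R j S" for u j S
 proof (cases "s j S \<in> fg_supp (\<tau> S u)")
  case True
  thus ?thesis by (intro exI[of _ 0]) simp
 next
  case False
  have "s j S \<in> fg_supp (\<tau> S (g j))" using s[OF that] core_supp_subset[OF that] by blast
  also have "\<tau> S (g j) = - \<tau> S u + (\<tau> S u + fg_pow 1 (\<tau> S (g j)))" by (simp add: add.assoc[symmetric])
  finally show ?thesis using False fg_supp_add[of "- \<tau> S u" "\<tau> S u + fg_pow 1 (\<tau> S (g j))"]
   unfolding fg_supp_uminus by blast
 qed
 show ?thesis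
 proof (rule infinite_product[where R="?R" and Q="\<lambda>n j S w. s j S \<in> fg_supp w", OF g inf step])
 fix y js and Ss :: "nat => 'a set"
 assume y: "y \<in> carrier G" "strict_mono js" "\<And>n. finite (Ss n) & Ss n \<subseteq> D & ?R (js n) (Ss n)"
  "\<And>n. s (js n) (Ss n) \<in> fg_supp (\<tau> (Ss n) y)"
 obtain p where p: "joins E (b, c) (b, c) p" "y = loop_class E (b, c) p" using loopE[OF y(1)] .
 define \<sigma> where "\<sigma> = (\<lambda>n. s (js n) (Ss n))"
 have "\<exists>t\<in>{0..1}. fst (p t) = \<sigma> n" for n
 proof (rule ccontr)
  assume n: "\<not> ?thesis"
  have "fg_supp (word_along (Ss n) q p 0 1) \<subseteq> Ss n - {\<sigma> n}"
   by (rule word_along_avoid[OF circle_system_E _ path_cont[OF p(1)]]) (use y(3)[of n] n in \<open>auto simp: q_def\<close>)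
  thus False using y(3,4)[of n] \<tau>_class[OF _ _ p(1), of "Ss n"] p(2) by (auto simp: \<sigma>_def)
 qed
 then obtain t where t: "\<And>n. t n \<in> {0..1}" "\<And>n. fst (p (t n)) = \<sigma> n" by metis
 obtain t0 k where t0: "t0 \<in> {0..1}" "strict_mono (k :: nat => nat)" "(t \<circ> k) \<longlonglongrightarrow> t0"
  using compact_Icc[of "0::real" 1] t(1) unfolding compact_def by metis
 define y0 where "y0 = fst (p t0)"
 have cf: "cont_on {0..1} XM.mtopology (\<lambda>t. fst (p t))"
  using continuous_map_compose[OF path_cont[OF p(1), of 0 1] continuous_fst] by (simp add: o_def mtopology_of_def)
 have y0: "y0 \<in> mspace X" using cf t0(1) unfolding y0_def XM.continuous_map_eu_metric by blast
 have "(\<lambda>n. mdist X (fst (p ((t \<circ> k) n))) (fst (p t0))) \<longlonglongrightarrow> 0"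
  by (rule XM.continuous_map_eu_tendsto[OF cf t0(1) _ t0(3)]) (simp add: t(1) del: atLeastAtMost_iff)
 hence lim: "(\<lambda>n. mdist X (\<sigma> (k n)) y0) \<longlonglongrightarrow> 0" by (simp only: o_def t(2) y0_def)
 show ?thesis
 proof (rule that[OF y0])
  fix R :: real and m :: nat assume R: "R > 0"
  let ?B = "{x \<in> mspace X. mdist X y0 x < R}"
  \<comment> \<open>A core letter near the limit does not by itself give activity there, since the
    retraction onto the ball might kill the word. But in that case the core also has letters outside
    the ball, and it alternates between the ball of half the radius and the complement.\<close>
  show "\<exists>j\<ge>m. active (g j) ?B"
  proof (rule ccontr)
   assume no: "\<not> ?thesis"
   define A where "A = {x \<in> mspace X. mdist X y0 x < R / 2}"
   have sep: "R / 2 <= mdist X x z" if "x \<in> A" "z \<in> mspace X - ?B" for x z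
    using that XM.triangle[of y0 x z] y0 by (auto simp: A_def)
   obtain J where J': "\<forall>j S. J <= j --> finite S & S \<subseteq> D --> \<not> alternates (\<tau> S (g j)) (A \<inter> mspace X) ((mspace X - ?B) \<inter> mspace X)"
    using no_alternation[OF g half_gt_zero[OF R] sep] ..
   note J = J'[rule_format]
   obtain n0 where n0: "\<forall>n\<ge>n0. mdist X (\<sigma> (k n)) y0 < R / 2"
    using order_tendstoD(2)[OF lim, of "R / 2"] R unfolding eventually_sequentially by auto
   define n where "n = max n0 (max m J)"
   define j S where "j = js (k n)" and "S = Ss (k n)"
   have "n <= k n" "k n <= j" using strict_mono_imp_increasing t0(2) y(2) by (auto simp: j_def)
   hence j: "m <= j" "J <= j" by (auto simp: n_def)
   have S: "finite S" "S \<subseteq> D" "\<tau> S (g j) ~= 0" using y(3)[of "k n"] by (auto simp: j_def S_def)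
   have core: "core_supp (\<tau> S (g j)) \<subseteq> S" using core_supp_subset[OF S(3)] \<tau>_supp[OF S(1,2) gc] by blast
   have "\<sigma> (k n) \<in> core_supp (\<tau> S (g j))" using s[OF S(3)] by (simp add: \<sigma>_def j_def S_def)
   moreover have "\<sigma> (k n) \<in> A" using n0 core calculation S(2) D_sub XM.commute by (auto simp: A_def n_def)
   ultimately have 1: "core_supp (\<tau> S (g j)) \<inter> (A \<inter> mspace X) ~= {}" by (auto simp: A_def)
   have "fg_keep ?B (\<tau> S (g j)) = 0"
   proof (rule ccontr)
    assume "fg_keep ?B (\<tau> S (g j)) ~= 0"
    hence "\<tau> (S \<inter> ?B) (g j) ~= 0" unfolding \<tau>_keep[OF S(1,2) gc] .
    hence "active (g j) ?B" unfolding active_def using S(1,2) by (intro exI[of _ "S \<inter> ?B"]) auto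
    thus False using no j(1) by blast
   qed
   hence "\<not> core_supp (\<tau> S (g j)) \<subseteq> ?B" by (rule core_supp_not_subset[OF S(3)])
   hence "core_supp (\<tau> S (g j)) \<inter> ((mspace X - ?B) \<inter> mspace X) ~= {}" using core S(2) D_sub by blast
   with S(3) 1 have "alternates (\<tau> S (g j)) (A \<inter> mspace X) ((mspace X - ?B) \<inter> mspace X)"
    unfolding alternates_def by (intro conjI)
   thus False using J[OF j(2) conjI[OF S(1,2)]] by contradiction
  qed
 qed
 qed
qed

end

end

section \<open>Small loops and characters\<close>

lemma path_hom_split:
 assumes p: "joins T x y p" and rst: "0 <= r" "r <= s" "s <= t" "t <= 1"
 shows "path_hom T (p r) (p t) (\<lambda>u. p (r + u * (t - r)))
  ((\<lambda>u. p (r + u * (s - r))) @@ (\<lambda>u. p (s + u * (t - s))))"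
proof -
 define \<psi> where "\<psi> u = r + min (2 * u) 1 * (s - r) + max 0 (2 * u - 1) * (t - s)" for u :: real
 have pc: "((\<lambda>u. p (r + u * (s - r))) @@ (\<lambda>u. p (s + u * (t - s)))) u = p (\<psi> u)" if "0 <= u" "u <= 1" for u
 proof (cases "u <= 1/2")
  case True
  hence "min (2 * u) 1 = 2 * u" "max 0 (2 * u - 1) = 0" by (simp_all add: min_def max_def)
  thus ?thesis using True by (simp add: path_concat_def \<psi>_def)
 next
  case False
  hence "min (2 * u) 1 = 1" "max 0 (2 * u - 1) = 2 * u - 1" by (simp_all add: min_def max_def)
  thus ?thesis using False by (simp add: path_concat_def \<psi>_def)
 qed
 have in1: "r + u * (t - r) \<in> {0..1}" if "u \<in> {0..1}" for u
  using segment_in[OF that, of r t] rst by simp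
 have in2: "\<psi> u \<in> {0..1}" if "u \<in> {0..1}" for u
  using segment_in[of "min (2 * u) 1" r s] segment_in[of "max 0 (2 * u - 1)" s t] that rst by (auto simp: \<psi>_def)
 have "path_hom T (p (r + 0 * (t - r))) (p (r + 1 * (t - r))) (\<lambda>u. p (r + u * (t - r))) (\<lambda>u. p (\<psi> u))"
 proof (rule path_hom_reparam[OF p])
  show "continuous_on {0..1} \<psi>" unfolding \<psi>_def by (intro continuous_intros)
  show "continuous_on {0..1} (\<lambda>u. r + u * (t - r))" by (intro continuous_intros)
  show "(\<lambda>u. r + u * (t - r)) ` {0..1} \<subseteq> {0..1}" using in1 by blast
  show "\<psi> ` {0..1} \<subseteq> {0..1}" using in2 by blast
 qed (simp_all add: \<psi>_def)
 hence h: "path_hom T (p r) (p t) (\<lambda>u. p (r + u * (t - r))) (\<lambda>u. p (\<psi> u))" by simp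
 from h path_hom_cong[OF path_hom_imp(2)[OF h] pc[symmetric]] show ?thesis by (rule path_hom_trans)
qed

lemma path_concat_in:
 assumes "\<And>t. t \<in> {0..1} ==> p t \<in> A" "\<And>t. t \<in> {0..1} ==> q t \<in> A" "t \<in> {0..1}"
 shows "(p @@ q) t \<in> A"
 using assms(1)[of "2 * t"] assms(2)[of "2 * t - 1"] assms(3) by (simp add: path_concat_def)

lemma conj_loop_in:
 assumes "\<And>t. t \<in> {0..1} ==> p t \<in> A" "\<And>t. t \<in> {0..1} ==> q t \<in> A" "t \<in> {0..1}"
 shows "conj_loop p q t \<in> A"
 unfolding conj_loop_def
proof (intro path_concat_in assms(3))
 show "rev_path p t \<in> A" if "t \<in> {0..1}" for t using assms(1)[of "1 - t"] that by (simp add: rev_path_def)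
qed (use assms in auto)

context earring
begin

text \<open>The circle metric is only known to induce the usual topology, so small arcs come from
  continuity of the argument and of the exponential, not from a formula for distances.\<close>

lemma small_arc:
 assumes \<eta>: "\<eta> > 0"
 shows "\<exists>\<delta>>0. \<forall>u\<in>sphere 0 1. mdist C u c < \<delta> -->
  (\<exists>\<theta>. u = c * cis \<theta> & (\<forall>t\<in>{0..1}. mdist C (c * cis (t * \<theta>)) c < \<eta>))"
proof -
 interpret CM: Metric_space "mspace C" "mdist C" by simp
 have top: "CM.mtopology = top_of_set (sphere 0 1)" using circle unfolding circle_metric_def mtopology_of_def by blast
 have "cont_on UNIV CM.mtopology (\<lambda>\<theta>. c * cis \<theta>)"
  unfolding top by (auto simp: continuous_map_in_subtopology norm_mult intro!: continuous_intros)
 then obtain \<delta>1 where \<delta>1: "\<delta>1 > 0" "\<And>\<theta>. dist \<theta> 0 < \<delta>1 ==> mdist C (c * cis 0) (c * cis \<theta>) < \<eta>"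
  using \<eta> unfolding CM.continuous_map_eu_metric by (metis UNIV_I)
 have "continuous (at 1) Arg" by (rule continuous_at_Arg) auto
 then obtain \<delta>2 where \<delta>2: "\<delta>2 > 0" "\<And>w. dist w 1 < \<delta>2 ==> \<bar>Arg w\<bar> < \<delta>1"
  unfolding continuous_at_eps_delta using \<delta>1(1) by (force simp: dist_real_def)
 have "openin CM.mtopology (sphere 0 1 \<inter> {u. dist (u / c) 1 < \<delta>2})"
  unfolding top by (intro openin_open_Int open_Collect_less continuous_intros) simp
 moreover have "c \<in> sphere 0 1 \<inter> {u. dist (u / c) 1 < \<delta>2}" using \<delta>2(1) by simp
 ultimately obtain \<delta> where \<delta>: "\<delta> > 0" "CM.mball c \<delta> \<subseteq> sphere 0 1 \<inter> {u. dist (u / c) 1 < \<delta>2}"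
  unfolding CM.openin_mtopology by blast
 show ?thesis
 proof (rule exI[of _ \<delta>], intro conjI ballI impI \<delta>(1))
  fix u assume u: "u \<in> sphere 0 1" "mdist C u c < \<delta>"
  have "u \<in> mspace C" "c \<in> mspace C" using u(1) c_sphere unfolding mspace_C by blast+
  moreover have "mdist C c u < \<delta>" using u(2) CM.commute[of c u] by simp
  ultimately have "u \<in> CM.mball c \<delta>" unfolding CM.in_mball by blast
  hence A: "\<bar>Arg (u / c)\<bar> < \<delta>1" using \<delta>(2) \<delta>2(2) by blast
  show "\<exists>\<theta>. u = c * cis \<theta> & (\<forall>t\<in>{0..1}. mdist C (c * cis (t * \<theta>)) c < \<eta>)"
  proof (intro exI[of _ "Arg (u / c)"] conjI ballI)
   have "u / c ~= 0" "norm (u / c) = 1" using u by (auto simp: norm_divide)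
   thus "u = c * cis (Arg (u / c))" by (simp add: cis_Arg sgn_div_norm)
   fix t :: real assume t: "t \<in> {0..1}"
   have "\<bar>t * Arg (u / c)\<bar> <= \<bar>Arg (u / c)\<bar>" using t by (simp add: abs_mult mult_left_le_one_le)
   thus "mdist C (c * cis (t * Arg (u / c))) c < \<eta>"
    using \<delta>1(2)[of "t * Arg (u / c)"] A by (simp add: CM.commute)
  qed
 qed
qed

end

section \<open>Small connecting paths and characters of the fundamental group\<close>

context based_earring
begin

lemma small_X_path:
 assumes y: "y \<in> mspace X" and \<eta>: "\<eta> > 0"
 shows "\<exists>\<delta>>0. \<forall>x\<in>mspace X. mdist X y x < \<delta> -->
  (\<exists>p. joins (mtopology_of X) y x p & (\<forall>t\<in>{0..1}. mdist X y (p t) < \<eta>))"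
proof -
 have top: "mtopology_of X = XM.mtopology" by (simp add: mtopology_of_def)
 have nb: "neighbourhood_base_at y (path_connectedin XM.mtopology) XM.mtopology"
  using lpc y unfolding locally_path_connected_space_def neighbourhood_base_of_def top by simp
 have W: "openin XM.mtopology (XM.mball y \<eta>) & y \<in> XM.mball y \<eta>" using y \<eta> by simp
 from mp[OF spec[OF nb[unfolded neighbourhood_base_at_def]] W] obtain U V where UV: "openin XM.mtopology U" "path_connectedin XM.mtopology V" "y \<in> U" "U \<subseteq> V" "V \<subseteq> XM.mball y \<eta>"
  by (elim exE conjE)
 obtain \<delta> where \<delta>: "\<delta> > 0" "XM.mball y \<delta> \<subseteq> U" using UV(1,3) unfolding XM.openin_mtopology by blast
 show ?thesis
 proof (rule exI[of _ \<delta>], intro conjI ballI impI \<delta>(1))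
  fix x assume x: "x \<in> mspace X" "mdist X y x < \<delta>"
  hence "x \<in> XM.mball y \<delta>" using y by simp
  hence "x \<in> V" using \<delta>(2) UV(4) by blast
  moreover have "y \<in> V" using UV by blast
  ultimately obtain p where p: "pathin XM.mtopology p" "p \<in> {0..1} \<rightarrow> V" "p 0 = y" "p 1 = x"
   using UV(2) unfolding path_connectedin by blast
  have "\<forall>t\<in>{0..1}. mdist X y (p t) < \<eta>" using p(2) UV(5) by auto
  thus "\<exists>p. joins (mtopology_of X) y x p & (\<forall>t\<in>{0..1}. mdist X y (p t) < \<eta>)"
   using p unfolding joins_def top by blast
 qed
qed

text \<open>Only finitely many circles are large, so the circles near \<open>y\<close> are small, except possibly the one at \<open>y\<close>.\<close>

lemma small_fibres:
 assumes y: "y \<in> mspace X" and \<eta>: "\<eta> > 0"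
 shows "\<exists>\<delta>>0. \<delta> <= \<eta> & (\<forall>P\<in>EM. fst P ~= y & mdist X y (fst P) < \<delta> --> ed P (y, c) < \<eta>)"
proof -
 obtain N where N: "N > 0" "inverse (real N) < \<eta> / 2" using reals_Archimedean2 \<eta> by (metis ex_inverse_of_nat_less half_gt_zero)
 define F where "F = {s \<in> D. idx s <= N} - {y}"
 have "finite F" unfolding F_def using finite_idx_le by blast
 have Fpos: "mdist X y s > 0" if "s \<in> F" for s using that y D_sub by (auto simp: F_def)
 define \<delta> where "\<delta> = Min (insert (\<eta> / 2) (mdist X y ` F))"
 have \<delta>: "\<delta> > 0" using \<open>finite F\<close> Fpos \<eta> by (auto simp: \<delta>_def)
 have "finite (insert (\<eta> / 2) (mdist X y ` F))" using \<open>finite F\<close> by simp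
 note Min_le[OF this, folded \<delta>_def]
 hence \<delta>le: "\<delta> <= \<eta> / 2" "\<And>s. s \<in> F ==> \<delta> <= mdist X y s" by blast+
 show ?thesis
 proof (intro exI[of _ \<delta>] conjI ballI impI \<delta>)
  show "\<delta> <= \<eta>" using \<delta>le \<eta> by simp
  fix P assume P: "P \<in> EM" "fst P ~= y & mdist X y (fst P) < \<delta>"
  have "fibre_dist C D d (fst P) (snd P) c < \<eta> / 2"
  proof (cases "fst P \<in> D")
   case True
   have "fst P \<notin> F" using \<delta>le(2)[of "fst P"] P(2) by linarith
   hence "N < idx (fst P)" using True P(2) by (auto simp: F_def)
   hence "1 / real (idx (fst P)) <= 1 / real N" using N(1) by (intro divide_left_mono) auto
   moreover have "fibre_dist C D d (fst P) (snd P) c <= 1 / real (idx (fst P))"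
    using fibre_dist_le[OF EM_snd[OF P(1)] _ True] c_sphere by blast
   ultimately show ?thesis using N(2) by (simp add: inverse_eq_divide)
  next
   case False
   thus ?thesis using \<eta> by (simp add: fibre_dist_def)
  qed
  moreover have "ed P (y, c) = mdist X (fst P) y + fibre_dist C D d (fst P) (snd P) c + fibre_dist C D d y c c"
   using P(2) by (cases P) (auto simp: earring_dist_def)
  moreover have "fibre_dist C D d y c c = 0" using c_sphere by (simp add: fibre_dist_def mspace_C mdist_self)
  ultimately show "ed P (y, c) < \<eta>" using P(2) \<delta>le(1) XM.commute[of y "fst P"] by linarith
 qed
qed

text \<open>A point over some x different from \<open>y\<close> is reached by a small path in X
  followed by an arc of the circle over x, which is small as a whole. The circle over
  \<open>y\<close> may be large, so there a short arc is used.\<close>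

lemma small_paths:
 assumes y: "y \<in> mspace X" and \<eta>: "\<eta> > 0"
 shows "\<exists>\<delta>>0. \<delta> <= \<eta> & (\<forall>z\<in>EM. ed z (y, c) < \<delta> -->
  (\<exists>\<beta>. joins E (y, c) z \<beta> & (\<forall>t\<in>{0..1}. ed (\<beta> t) (y, c) < \<eta>)))"
proof -
 obtain \<delta>1 where \<delta>1: "\<delta>1 > 0" "\<forall>x\<in>mspace X. mdist X y x < \<delta>1 -->
  (\<exists>p. joins (mtopology_of X) y x p & (\<forall>t\<in>{0..1}. mdist X y (p t) < \<eta>))"
  using small_X_path[OF y \<eta>] by blast
 obtain \<delta>2 where \<delta>2: "\<delta>2 > 0" "\<delta>2 <= \<eta>" "\<forall>P\<in>EM. fst P ~= y & mdist X y (fst P) < \<delta>2 --> ed P (y, c) < \<eta>"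
  using small_fibres[OF y \<eta>] by blast
 obtain \<delta>3 where \<delta>3: "\<delta>3 > 0" "\<forall>u\<in>sphere 0 1. mdist C u c < \<delta>3 -->
  (\<exists>\<theta>. u = c * cis \<theta> & (\<forall>t\<in>{0..1}. mdist C (c * cis (t * \<theta>)) c < \<eta>))"
  using small_arc[OF \<eta>] by blast
 define \<delta> where "\<delta> = min \<delta>1 (min \<delta>2 (if y \<in> D then \<delta>3 / real (idx y) else 1))"
 have \<delta>: "\<delta> > 0" using \<delta>1 \<delta>2 \<delta>3 idx(3)[of y] by (auto simp: \<delta>_def)
 have "\<exists>\<beta>. joins E (y, c) z \<beta> & (\<forall>t\<in>{0..1}. ed (\<beta> t) (y, c) < \<eta>)" if z: "z \<in> EM" "ed z (y, c) < \<delta>" for z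
 proof (cases "fst z = y")
  case True
  hence zy: "z = (y, snd z)" by (metis prod.collapse)
  show ?thesis
  proof (cases "snd z = c")
   case True
   hence "z = (y, c)" using zy by metis
   thus ?thesis using joins_const[OF base_topspace[OF y]] \<eta> ed_base[OF y y] y by (intro exI[of _ "\<lambda>_. z"]) simp
  next
   case False
   hence yD: "y \<in> D" using z(1) True unfolding EM_iff by blast
   have n: "real (idx y) >= 1" using idx(3)[OF yD] by simp
   have "ed (y, snd z) (y, c) = mdist C (snd z) c / real (idx y)" by (rule ed_same[OF yD])
   hence "mdist C (snd z) c / real (idx y) < \<delta>3 / real (idx y)" using z(2) zy yD unfolding \<delta>_def by (metis min_less_iff_conj)
   hence "mdist C (snd z) c < \<delta>3" using n by (simp add: divide_less_cancel)
   then obtain \<theta> where \<theta>: "snd z = c * cis \<theta>" "\<forall>t\<in>{0..1}. mdist C (c * cis (t * \<theta>)) c < \<eta>"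
    using \<delta>3(2) EM_snd[OF z(1)] by blast
   have "joins E (y, c) z (\<lambda>t. (y, c * cis (t * \<theta>)))"
    using path_in_circle[OF yD, of "\<lambda>t. t * \<theta>"] zy \<theta>(1) by (simp add: continuous_intros)
   moreover have "ed (y, c * cis (t * \<theta>)) (y, c) < \<eta>" if "t \<in> {0..1}" for t
   proof -
    have "ed (y, c * cis (t * \<theta>)) (y, c) = mdist C (c * cis (t * \<theta>)) c / real (idx y)" by (rule ed_same[OF yD])
    also have "\<dots> <= mdist C (c * cis (t * \<theta>)) c / 1" using n by (intro divide_left_mono) auto
    also have "\<dots> < \<eta>" using \<theta>(2) that by simp
    finally show ?thesis .
   qed
   ultimately show ?thesis by blast
  qed
 next
  case False
  have x: "fst z \<in> mspace X" by (rule EM_fst[OF z(1)])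
  have "mdist X (fst z) (fst (y, c)) <= ed z (y, c)" by (rule mdist_fst_le[OF z(1) base_in_EM[OF y]])
  hence near: "mdist X y (fst z) < \<delta>1" "mdist X y (fst z) < \<delta>2" using z(2) XM.commute by (auto simp: \<delta>_def)
  obtain p where p: "joins (mtopology_of X) y (fst z) p" "\<forall>t\<in>{0..1}. mdist X y (p t) < \<eta>" using \<delta>1(2) x near(1) by blast
  have p1: "joins E (y, c) (fst z, c) (\<lambda>t. (p t, c))" by (rule joins_image[OF continuous_base p(1)])
  obtain \<alpha> where \<alpha>: "joins E (fst z, c) z \<alpha>" "\<And>t. fst (\<alpha> t) = fst z" using path_to_base[OF z(1)] by blast
  have "((\<lambda>t. (p t, c)) @@ \<alpha>) t \<in> {P. ed P (y, c) < \<eta>}" if "t \<in> {0..1}" for t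
  proof (rule path_concat_in[OF _ _ that])
   fix t :: real assume t: "t \<in> {0..1}"
   have "p t \<in> mspace X" using joins_topspace[OF p(1), of t] t by simp
   thus "(p t, c) \<in> {P. ed P (y, c) < \<eta>}" using ed_base[OF _ y] p(2) t XM.commute[of y] by simp
   have "\<alpha> t \<in> EM" using joins_topspace[OF \<alpha>(1), of t] t unfolding topspace_E by simp
   thus "\<alpha> t \<in> {P. ed P (y, c) < \<eta>}" using \<delta>2(3) near(2) False \<alpha>(2) by simp
  qed
  thus ?thesis using joins_concat[OF p1 \<alpha>(1)] by blast
 qed
 moreover have "\<delta> <= \<eta>" using \<delta>2(2) by (simp add: \<delta>_def)
 ultimately show ?thesis using \<delta> by blast
qed

lemma path_from_base: assumes "z \<in> EM" obtains \<alpha> where "joins E (b, c) z \<alpha>"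
proof -
 have "fst z \<in> mspace X" by (rule EM_fst[OF assms])
 then obtain p where p: "joins (mtopology_of X) b (fst z) p"
  using sc b unfolding simply_connected_space_def path_connected_space_def joins_def topspace_mtopology_of by meson
 obtain \<alpha> where "joins E (fst z, c) z \<alpha>" using path_to_base[OF assms] by blast
 thus ?thesis using joins_concat[OF joins_image[OF continuous_base p]] that by blast
qed

text \<open>A homomorphism defined on \<open>G\<close> extends to a homomorphism on the fundamental groupoid, once a path
 from the base point to every point is chosen.\<close>

context
 fixes \<zeta> :: "(real => 'a \<times> complex) set => 'g::group_add"
 assumes \<zeta>_mult: "\<And>g h. g \<in> carrier G ==> h \<in> carrier G ==> \<zeta> (g \<otimes>\<^bsub>G\<^esub> h) = \<zeta> g + \<zeta> h"
begin

definition spider :: "'a \<times> complex => real => 'a \<times> complex" where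
 "spider z = (SOME \<alpha>. joins E (b, c) z \<alpha>)"

definition \<Theta> :: "(real => 'a \<times> complex) => 'g" where
 "\<Theta> p = \<zeta> (loop_class E (b, c) ((spider (p 0) @@ p) @@ (rev_path (spider (p 1)))))"

lemma spider: "z \<in> topspace E ==> joins E (b, c) z (spider z)"
 unfolding spider_def using path_from_base[of z] someI_ex[of "\<lambda>\<alpha>. joins E (b, c) z \<alpha>"] unfolding topspace_E by blast

lemma \<Theta>_eq: "joins E z w p ==>
  \<Theta> p = \<zeta> (loop_class E (b, c) ((spider z @@ p) @@ rev_path (spider w)))"
 by (simp add: \<Theta>_def joins_def)

lemma spider_loop: assumes "joins E z w p"
 shows "joins E (b, c) (b, c) ((spider z @@ p) @@ rev_path (spider w))"
 using joins_in[OF assms] by (meson joins_concat joins_rev spider assms)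

lemma \<Theta>_hom: assumes "path_hom E z w p p'" shows "\<Theta> p = \<Theta> p'"
proof -
 note p = path_hom_imp[OF assms]
 note zw = joins_in[OF p(1)]
 have "path_hom E (b, c) (b, c) ((spider z @@ p) @@ rev_path (spider w))
   ((spider z @@ p') @@ rev_path (spider w))"
  using zw by (intro path_hom_concat[where y=w] path_hom_concat[where y=z] assms path_hom_refl joins_rev spider) auto
 from loop_class_eqI[OF this] show ?thesis using \<Theta>_eq p by simp
qed

lemma \<Theta>_concat: assumes p: "joins E z w p" and p': "joins E w v p'"
 shows "\<Theta> (p @@ p') = \<Theta> p + \<Theta> p'"
proof -
 note z = spider[OF conjunct1[OF joins_in[OF p]]] and w = spider[OF conjunct1[OF joins_in[OF p']]]
  and v = joins_rev[OF spider[OF conjunct2[OF joins_in[OF p']]]]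
 note pp = joins_concat[OF p p']
 have 1: "path_hom E (b, c) (b, c) ((spider w @@ p') @@ rev_path (spider v))
   (spider w @@ (p' @@ rev_path (spider v)))" by (rule path_hom_assoc[OF w p' v])
 have "path_hom E (b, c) (b, c)
   (((spider z @@ p) @@ rev_path (spider w)) @@ ((spider w @@ p') @@ rev_path (spider v)))
   (((spider z @@ p) @@ rev_path (spider w)) @@ (spider w @@ (p' @@ rev_path (spider v))))"
  by (rule path_hom_concat[OF path_hom_refl[OF spider_loop[OF p]] 1])
 also have "path_hom E (b, c) (b, c) \<dots> ((spider z @@ p) @@ (p' @@ rev_path (spider v)))"
  by (rule path_concat_cancel_middle[OF joins_concat[OF z p] w joins_concat[OF p' v]])
 also have "path_hom E (b, c) (b, c) \<dots> (((spider z @@ p) @@ p') @@ rev_path (spider v))"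
  by (rule path_hom_sym[OF path_hom_assoc[OF joins_concat[OF z p] p' v]])
 also have "path_hom E (b, c) (b, c) \<dots> ((spider z @@ (p @@ p')) @@ rev_path (spider v))"
  by (rule path_hom_concat[OF path_hom_assoc[OF z p p'] path_hom_refl[OF v]])
 finally have "loop_class E (b, c) ((spider z @@ p) @@ rev_path (spider w))
   \<otimes>\<^bsub>G\<^esub> loop_class E (b, c) ((spider w @@ p') @@ rev_path (spider v))
  = loop_class E (b, c) ((spider z @@ (p @@ p')) @@ rev_path (spider v))"
  using mult_loop_class[OF spider_loop[OF p] spider_loop[OF p']] loop_class_eqI by metis
 thus ?thesis
  using \<zeta>_mult[OF loop_class_carrier[OF spider_loop[OF p]] loop_class_carrier[OF spider_loop[OF p']]] \<Theta>_eq[OF p] \<Theta>_eq[OF p'] \<Theta>_eq[OF pp]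
  by simp
qed

lemma \<Theta>_const: assumes "z \<in> topspace E" shows "\<Theta> (\<lambda>_. z) = 0"
proof -
 have c: "joins E z z (\<lambda>_. z)" by (rule joins_const[OF assms])
 have "\<Theta> (\<lambda>_. z) = \<Theta> ((\<lambda>_. z) @@ (\<lambda>_. z))" by (rule \<Theta>_hom[OF path_hom_sym[OF path_hom_unit_left[OF c]]])
 thus ?thesis using \<Theta>_concat[OF c c] add_left_cancel[of "\<Theta> (\<lambda>_. z)" "\<Theta> (\<lambda>_. z)" 0] by simp
qed

text \<open>The path chosen for the base point is arbitrary and need not be constant, which accounts
  for the conjugation by \<open>a\<close>.\<close>

lemma \<Theta>_loop:
 assumes p: "joins E (b, c) (b, c) p"
 obtains a where "\<Theta> p = a + \<zeta> (loop_class E (b, c) p) - a"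
proof -
 have s: "joins E (b, c) (b, c) (spider (b, c))" by (rule spider[OF base_topspace[OF b]])
 note sg = loop_class_carrier[OF s] and pg = loop_class_carrier[OF p]
 have one: "\<zeta> \<one>\<^bsub>G\<^esub> = 0" using \<zeta>_mult[OF G.one_closed G.one_closed] add_left_cancel[of "\<zeta> \<one>\<^bsub>G\<^esub>" "\<zeta> \<one>\<^bsub>G\<^esub>" 0] by simp
 have inv: "\<zeta> (inv\<^bsub>G\<^esub> g) = - \<zeta> g" if "g \<in> carrier G" for g
  using \<zeta>_mult[OF that G.inv_closed[OF that]] one that by (simp add: minus_unique)
 have "loop_class E (b, c) (((spider (b, c)) @@ p) @@ (rev_path (spider (b, c))))
  = loop_class E (b, c) (spider (b, c)) \<otimes>\<^bsub>G\<^esub> loop_class E (b, c) p \<otimes>\<^bsub>G\<^esub> inv\<^bsub>G\<^esub> loop_class E (b, c) (spider (b, c))"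
  by (simp only: mult_loop_class[OF s p] inv_loop_class[OF s] mult_loop_class[OF joins_concat[OF s p] joins_rev[OF s]])
 hence "\<Theta> p = \<zeta> (loop_class E (b, c) (spider (b, c))) + \<zeta> (loop_class E (b, c) p) - \<zeta> (loop_class E (b, c) (spider (b, c)))"
  using \<Theta>_eq[OF p] sg pg inv[OF sg] by (simp add: \<zeta>_mult)
 thus ?thesis by (rule that)
qed

text \<open>Collapsing the circles over the punctured ball turns \<open>g\<close> into a null
  homotopic loop, because \<open>g\<close> is inactive on the others. The collapse changes the loop
  only close to (y, c), by small loops that \<open>\<zeta>\<close> kills. The circle over
  \<open>y\<close> is not collapsed, as it may be large.\<close>

lemma character_trivial:
 assumes y: "y \<in> mspace X" and \<delta>: "\<delta> > 0" "\<delta> <= \<eta>" "\<forall>P\<in>EM. fst P ~= y & mdist X y (fst P) < \<delta> --> ed P (y, c) < \<eta>"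
  and kill: "\<And>z \<alpha> m. joins E (b, c) z \<alpha> ==> joins E z z m ==> (\<And>t. t \<in> {0..1} ==> ed (m t) (y, c) < \<eta>) ==>
   \<zeta> (loop_class E (b, c) (conj_loop \<alpha> m)) = 0"
  and g: "g \<in> carrier G" and inactive: "\<not> active g (- {x. x ~= y & mdist X y x < \<delta> / 2})"
 shows "\<zeta> g = 0"
proof -
 define B where "B = {x. x ~= y & mdist X y x < \<delta> / 2}"
 let ?\<kappa> = "collapse (- B)"
 have \<kappa>E: "?\<kappa> P \<in> topspace E" if "P \<in> topspace E" for P
  using continuous_collapse[of "- B"] that by (auto simp: continuous_map_def)
 have \<kappa>_id: "?\<kappa> P = P" if "fst P \<notin> B" for P using that by (simp add: collapse_def)
 have \<kappa>_base: "?\<kappa> (x, c) = (x, c)" for x by (simp add: collapse_def)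
 have fst_\<kappa>: "fst (?\<kappa> P) = fst P" for P by (simp add: collapse_def)
 \<comment> \<open>Two paths with common ends that stay near (y, c) differ by a small loop, and
   \<open>\<zeta>\<close> kills its conjugates.\<close>
 have local: "\<Theta> p = \<Theta> p'" if p: "joins E z w p" "joins E z w p'"
  and near: "\<And>t. t \<in> {0..1} ==> ed (p t) (y, c) < \<eta>" "\<And>t. t \<in> {0..1} ==> ed (p' t) (y, c) < \<eta>" for z w p p'
 proof -
  note r = joins_rev[OF p(2)]
  have z: "z \<in> topspace E" using joins_in[OF p(1)] by blast
  have "\<Theta> (p @@ rev_path p') = 0"
   unfolding \<Theta>_eq[OF joins_concat[OF p(1) r]] conj_loop_def[symmetric]
  proof (rule kill[OF spider[OF z] joins_concat[OF p(1) r]])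
   fix t :: real assume "t \<in> {0..1}"
   hence "(p @@ rev_path p') t \<in> {P. ed P (y, c) < \<eta>}"
    by (intro path_concat_in) (use near in \<open>auto simp: rev_path_def\<close>)
   thus "ed ((p @@ rev_path p') t) (y, c) < \<eta>" by simp
  qed
  hence "\<Theta> p + \<Theta> (rev_path p') = 0" using \<Theta>_concat[OF p(1) r] by simp
  moreover have "\<Theta> p' + \<Theta> (rev_path p') = 0"
   using \<Theta>_concat[OF p(2) r] \<Theta>_hom[OF path_hom_inv_right[OF p(2)]] \<Theta>_const[OF z] by simp
  ultimately show ?thesis by (metis add_right_cancel)
 qed
 have "\<exists>\<beta>. joins E P (?\<kappa> P) \<beta> & (\<forall>t. fst (\<beta> t) = fst P) & (?\<kappa> P = P --> \<beta> = (\<lambda>_. P))" if P: "P \<in> topspace E" for P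
 proof (cases "?\<kappa> P = P")
  case True
  thus ?thesis using joins_const[OF P] by (intro exI[of _ "\<lambda>_. P"]) simp
 next
  case False
  hence e: "?\<kappa> P = (fst P, c)" by (auto simp: collapse_def prod_eq_iff split: if_splits)
  obtain \<alpha> where \<alpha>: "joins E (fst P, c) P \<alpha>" "\<And>t. fst (\<alpha> t) = fst P" using path_to_base[of P] P unfolding topspace_E by blast
  show ?thesis using joins_rev[OF \<alpha>(1)] \<alpha>(2) False unfolding e by (intro exI[of _ "rev_path \<alpha>"]) (simp add: rev_path_def)
 qed
 then obtain \<beta> where \<beta>: "\<And>P. P \<in> topspace E ==> joins E P (?\<kappa> P) (\<beta> P)" "\<And>P t. P \<in> topspace E ==> fst (\<beta> P t) = fst P"
  "\<And>P. P \<in> topspace E ==> ?\<kappa> P = P ==> \<beta> P = (\<lambda>_. P)" by metis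
 have \<beta>0: "\<Theta> (\<beta> P) = 0" if "P \<in> topspace E" "fst P \<notin> B" for P using \<beta>(3)[OF that(1) \<kappa>_id[OF that(2)]] \<Theta>_const[OF that(1)] by simp
 \<comment> \<open>Over \<open>y\<close> closeness is measured in E, elsewhere in X only: circles
   over nearby points other than \<open>y\<close> lie within \<eta> as a whole. So a good point
   remains good when it is moved along its circle.\<close>
 define good where "good P \<longleftrightarrow> (if fst P = y then ed P (y, c) < \<delta> else mdist X y (fst P) < \<delta>)" for P
 have goodD: "ed P (y, c) < \<eta>" if "good P" "P \<in> topspace E" for P
  using that \<delta>(2,3) unfolding good_def topspace_E by (metis less_le_trans)
 have good_\<beta>: "good (\<beta> P t)" if P: "good P" "P \<in> topspace E" for P t
 proof (cases "fst P = y")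
  case True
  hence "?\<kappa> P = P" by (intro \<kappa>_id) (simp add: B_def)
  thus ?thesis using \<beta>(3)[OF P(2)] P(1) by simp
 next
  case False
  thus ?thesis using P(1) \<beta>(2)[OF P(2)] by (simp add: good_def)
 qed
 have good_\<kappa>: "good (?\<kappa> P)" if P: "good P" for P
 proof (cases "fst P = y")
  case True
  hence "?\<kappa> P = P" by (intro \<kappa>_id) (simp add: B_def)
  thus ?thesis using P by simp
 next
  case False
  thus ?thesis using P fst_\<kappa>[of P] by (simp add: good_def)
 qed
 have na: "\<not> active g (- B)" using inactive unfolding B_def .
  obtain \<gamma> where \<gamma>: "joins E (b, c) (b, c) \<gamma>" "g = loop_class E (b, c) \<gamma>" using loopE[OF g] .
  have \<kappa>\<gamma>: "joins E (b, c) (b, c) (\<lambda>t. ?\<kappa> (\<gamma> t))" using joins_image[OF continuous_collapse[of "- B"] \<gamma>(1)] by (simp only: \<kappa>_base)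
  have \<gamma>E: "\<gamma> t \<in> topspace E" if "t \<in> {0..1}" for t using joins_topspace[OF \<gamma>(1)] that by simp
  have null: "path_hom E (b, c) (b, c) (\<lambda>t. ?\<kappa> (\<gamma> t)) (\<lambda>_. (b, c))"
  proof (rule null_homotopic_if_words_trivial[OF sc lsc \<kappa>\<gamma>])
   fix S assume S: "finite S" "S \<subseteq> D"
   have "word_along (S \<inter> - B) q \<gamma> 0 1 = \<tau> (S \<inter> - B) g" unfolding \<gamma>(2) by (rule \<tau>_class[OF _ _ \<gamma>(1), symmetric]) (use S in auto)
   also have "\<dots> = 0"
   proof (rule ccontr)
    assume "\<tau> (S \<inter> - B) g ~= 0"
    hence "active g (- B)" unfolding active_def using S by (intro exI[of _ "S \<inter> - B"]) auto
    thus False using na by contradiction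
   qed
   finally show "word_along S q (\<lambda>t. ?\<kappa> (\<gamma> t)) 0 1 = 0" by (simp only: word_along_collapse)
  qed
  define F where "F s t = \<Theta> (\<lambda>u. \<gamma> (s + u * (t - s)))" for s t
  define F' where "F' s t = \<Theta> (\<lambda>u. ?\<kappa> (\<gamma> (s + u * (t - s))))" for s t
  \<comment> \<open>A piece of \<gamma> and its collapsed image form a square with the connecting
    paths \<beta> as sides; the equation says that \<Theta> cannot tell the two ways around it
    apart. Squares glue along common sides, so short pieces suffice.\<close>
  define Q where "Q s t \<longleftrightarrow> F s t + \<Theta> (\<beta> (\<gamma> t)) = \<Theta> (\<beta> (\<gamma> s)) + F' s t" for s t
  have piece: "joins E (p s) (p t) (\<lambda>u. p (s + u * (t - s)))" if "joins E (b, c) (b, c) p" "0 <= s" "s <= t" "t <= 1" for p s t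
   using path_hom_imp(1)[OF path_hom_split[OF that(1,2) that(3) order_refl that(4)]] .
  have join: "\<Theta> (\<lambda>u. p (r + u * (t - r))) = \<Theta> (\<lambda>u. p (r + u * (s - r))) + \<Theta> (\<lambda>u. p (s + u * (t - s)))"
   if "joins E (b, c) (b, c) p" "0 <= r" "r <= s" "s <= t" "t <= 1" for p r s t
   using \<Theta>_hom[OF path_hom_split[OF that]] \<Theta>_concat[OF piece[OF that(1,2,3)] piece[OF that(1) _ that(4,5)]] that by simp
  have "0 <= (0::real) & 1 <= (1::real) --> Q 0 1"
  proof (rule Bolzano[where P="\<lambda>s t. 0 <= s & t <= 1 --> Q s t"])
   fix r s t :: real
   assume 1: "0 <= r & s <= 1 --> Q r s" "0 <= s & t <= 1 --> Q s t" "r <= s" "s <= t"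
   show "0 <= r & t <= 1 --> Q r t"
   proof
    assume rt: "0 <= r & t <= 1"
    hence q: "Q r s" "Q s t" using 1 by auto
    have F: "F r t = F r s + F s t" unfolding F_def by (rule join[OF \<gamma>(1)]) (use rt 1(3,4) in auto)
    have F': "F' r t = F' r s + F' s t" unfolding F'_def by (rule join[OF \<kappa>\<gamma>]) (use rt 1(3,4) in auto)
    have "F r t + \<Theta> (\<beta> (\<gamma> t)) = F r s + (\<Theta> (\<beta> (\<gamma> s)) + F' s t)"
     using q(2) unfolding F Q_def add.assoc by simp
    also have "\<dots> = \<Theta> (\<beta> (\<gamma> r)) + F' r t" using q(1) unfolding F' Q_def by (simp only: add.assoc[symmetric])
    finally show "Q r t" by (simp add: Q_def)
   qed
  next
   fix x :: real assume x: "0 <= x" "x <= 1"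
   have gx: "\<gamma> x \<in> EM" using \<gamma>E[of x] x unfolding topspace_E by simp
   have fx: "fst (\<gamma> x) \<in> mspace X" by (rule EM_fst[OF gx])
   \<comment> \<open>Near each point either the collapse changes nothing or all points are good. The
     former holds on the open part of the circle over \<open>y\<close> and at distance \<delta> or
     more; the latter at (y, c) and over other points closer than \<delta>. The radius \<delta>/2 in
     \<open>B\<close> leaves the margin this needs.\<close>
   have "\<exists>\<epsilon>>0. (\<forall>P\<in>EM. ed (\<gamma> x) P < \<epsilon> --> fst P \<notin> B) \<or> (\<forall>P\<in>EM. ed (\<gamma> x) P < \<epsilon> --> good P)"
   proof -
    have le: "mdist X (fst (\<gamma> x)) (fst P) < \<epsilon>" if "P \<in> EM" "ed (\<gamma> x) P < \<epsilon>" for P \<epsilon>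
     using mdist_fst_le[OF gx that(1)] that(2) by linarith
    consider "fst (\<gamma> x) = y" "snd (\<gamma> x) = c" | "fst (\<gamma> x) = y" "snd (\<gamma> x) ~= c"
     | "fst (\<gamma> x) ~= y" "mdist X y (fst (\<gamma> x)) < \<delta>" | "mdist X y (fst (\<gamma> x)) >= \<delta>" by linarith
    thus ?thesis
    proof cases
     case 1
     hence e: "\<gamma> x = (y, c)" by (simp add: prod_eq_iff)
     have "good P" if "P \<in> EM" "ed (\<gamma> x) P < \<delta>" for P
      using that(2) le[OF that] ES.commute[of "(y, c)" P] unfolding e by (simp add: good_def)
     thus ?thesis using \<delta>(1) by blast
    next
     case 2
     hence e: "\<gamma> x = (y, snd (\<gamma> x))" by (metis prod.collapse)
     have yD: "y \<in> D" using gx 2 unfolding EM_iff by blast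
     have pos: "ed (\<gamma> x) (y, c) > 0" using ES.mdist_pos_less[of "\<gamma> x" "(y, c)"] gx base_in_EM[OF y] 2 by (metis snd_conv)
     have "fst P = y" if P: "P \<in> EM" "ed (\<gamma> x) P < ed (\<gamma> x) (y, c)" for P
     proof (rule ccontr)
      assume ne: "fst P ~= y"
      have "ed (\<gamma> x) P = mdist X y (fst P) + fibre_dist C D d y (snd (\<gamma> x)) c + fibre_dist C D d (fst P) (snd P) c"
       using ne by (subst e, cases P) (auto simp: earring_dist_def)
      moreover have "ed (\<gamma> x) (y, c) = fibre_dist C D d y (snd (\<gamma> x)) c" using ed_fibre[OF y] e by metis
      ultimately show False using P(2) fibre_dist_nonneg[of "fst P" "snd P" c] XM.nonneg[of y "fst P"] by linarith
     qed
     hence "\<forall>P\<in>EM. ed (\<gamma> x) P < ed (\<gamma> x) (y, c) --> fst P \<notin> B" by (simp add: B_def)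
     thus ?thesis using pos by blast
    next
     case 3
     have "mdist X y (fst (\<gamma> x)) > 0" using 3(1) y fx by simp
     define \<epsilon> where "\<epsilon> = min (mdist X y (fst (\<gamma> x))) (\<delta> - mdist X y (fst (\<gamma> x)))"
     have "\<epsilon> > 0" using 3 \<open>mdist X y (fst (\<gamma> x)) > 0\<close> by (simp add: \<epsilon>_def)
     moreover have "good P" if P: "P \<in> EM" "ed (\<gamma> x) P < \<epsilon>" for P
     proof -
      have "mdist X (fst (\<gamma> x)) (fst P) < \<epsilon>" by (rule le[OF P])
      moreover have "mdist X y (fst P) <= mdist X y (fst (\<gamma> x)) + mdist X (fst (\<gamma> x)) (fst P)"
       by (rule XM.triangle[OF y fx EM_fst[OF P(1)]])
      moreover have "fst P ~= y"
       using \<open>mdist X (fst (\<gamma> x)) (fst P) < \<epsilon>\<close> XM.commute[of y "fst (\<gamma> x)"] by (auto simp: \<epsilon>_def)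
      ultimately show ?thesis by (simp add: good_def \<epsilon>_def)
     qed
     ultimately show ?thesis by blast
    next
     case 4
     have "fst P \<notin> B" if P: "P \<in> EM" "ed (\<gamma> x) P < \<delta> / 2" for P
      using le[OF P] XM.triangle[OF y EM_fst[OF P(1)] fx] XM.commute[of "fst P"] 4 by (auto simp: B_def)
     thus ?thesis using \<delta>(1) half_gt_zero by blast
    qed
   qed
   then obtain \<epsilon> where \<epsilon>: "\<epsilon> > 0" "(\<forall>P\<in>EM. ed (\<gamma> x) P < \<epsilon> --> fst P \<notin> B) \<or> (\<forall>P\<in>EM. ed (\<gamma> x) P < \<epsilon> --> good P)" by blast
   have c\<gamma>: "cont_on {0..1} ES.mtopology \<gamma>" using path_cont[OF \<gamma>(1), of 0 1] by (simp only: E_eq order_refl)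
   obtain \<delta>' where \<delta>': "\<delta>' > 0" "\<And>w. w \<in> {0..1} ==> dist w x < \<delta>' ==> ed (\<gamma> x) (\<gamma> w) < \<epsilon>"
    using c\<gamma> x \<epsilon>(1) unfolding ES.continuous_map_eu_metric by (metis atLeastAtMost_iff)
   have "Q s t" if st: "s <= x" "x <= t" "t - s < \<delta>'" "0 <= s" "t <= 1" for s t
   proof -
    have st': "s <= t" using st by simp
    have w: "s + u * (t - s) \<in> {0..1}" "dist (s + u * (t - s)) x < \<delta>'" if "u \<in> {0..1}" for u
     using segment_in[OF that st'] st unfolding atLeastAtMost_iff dist_real_def by linarith+
    have ends: "s \<in> {0..1}" "t \<in> {0..1}" using st by auto
    have pE: "\<gamma> (s + u * (t - s)) \<in> EM" "ed (\<gamma> x) (\<gamma> (s + u * (t - s))) < \<epsilon>" if "u \<in> {0..1}" for u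
     using \<gamma>E[OF w(1)[OF that]] \<delta>'(2)[OF w[OF that]] unfolding topspace_E by auto
    have sE: "\<gamma> s \<in> EM" "ed (\<gamma> x) (\<gamma> s) < \<epsilon>" using pE[of 0] by simp_all
    have tE: "\<gamma> t \<in> EM" "ed (\<gamma> x) (\<gamma> t) < \<epsilon>" using pE[of 1] by simp_all
    show ?thesis using \<epsilon>(2)
    proof
     assume nB: "\<forall>P\<in>EM. ed (\<gamma> x) P < \<epsilon> --> fst P \<notin> B"
     have "path_hom E (\<gamma> s) (\<gamma> t) (\<lambda>u. \<gamma> (s + u * (t - s))) (\<lambda>u. ?\<kappa> (\<gamma> (s + u * (t - s))))"
     proof (rule path_hom_cong[OF piece[OF \<gamma>(1) st(4) st' st(5)]])
      fix u :: real assume "0 <= u" "u <= 1"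
      hence "fst (\<gamma> (s + u * (t - s))) \<notin> B" using nB pE[of u] by simp
      from \<kappa>_id[OF this] show "\<gamma> (s + u * (t - s)) = ?\<kappa> (\<gamma> (s + u * (t - s)))" by (rule sym)
     qed
     from \<Theta>_hom[OF this] show ?thesis
      using \<beta>0[OF \<gamma>E[OF ends(1)]] \<beta>0[OF \<gamma>E[OF ends(2)]] nB sE tE by (simp add: Q_def F_def F'_def)
    next
     assume gd: "\<forall>P\<in>EM. ed (\<gamma> x) P < \<epsilon> --> good P"
     note p1 = piece[OF \<gamma>(1) st(4) st' st(5)] and p2 = \<beta>(1)[OF \<gamma>E[OF ends(2)]]
      and p3 = \<beta>(1)[OF \<gamma>E[OF ends(1)]] and p4 = piece[OF \<kappa>\<gamma> st(4) st' st(5)]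
     have "\<Theta> ((\<lambda>u. \<gamma> (s + u * (t - s))) @@ \<beta> (\<gamma> t)) = \<Theta> (\<beta> (\<gamma> s) @@ (\<lambda>u. ?\<kappa> (\<gamma> (s + u * (t - s)))))"
     proof (rule local[OF joins_concat[OF p1 p2] joins_concat[OF p3 p4]])
      fix v :: real assume v: "v \<in> {0..1}"
      have \<beta>n: "ed (\<beta> (\<gamma> w) u) (y, c) < \<eta>" if "w \<in> {0..1}" "good (\<gamma> w)" "u \<in> {0..1}" for w u
       using goodD[OF good_\<beta>[OF that(2) \<gamma>E[OF that(1)]]] joins_topspace[OF \<beta>(1)[OF \<gamma>E[OF that(1)]]] that(3) by simp
      have \<gamma>g: "good (\<gamma> (s + u * (t - s)))" if "u \<in> {0..1}" for u
       using bspec[OF gd pE(1)[OF that]] pE(2)[OF that] by (rule mp)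
      have gs: "good (\<gamma> s)" "good (\<gamma> t)" using bspec[OF gd sE(1)] sE(2) bspec[OF gd tE(1)] tE(2) by (iprover)+
      have "((\<lambda>u. \<gamma> (s + u * (t - s))) @@ \<beta> (\<gamma> t)) v \<in> {P. ed P (y, c) < \<eta>}"
       by (intro path_concat_in[OF _ _ v] CollectI goodD[OF \<gamma>g \<gamma>E[OF w(1)]] \<beta>n[OF ends(2) gs(2)])
      thus "ed (((\<lambda>u. \<gamma> (s + u * (t - s))) @@ \<beta> (\<gamma> t)) v) (y, c) < \<eta>" by simp
      have "(\<beta> (\<gamma> s) @@ (\<lambda>u. ?\<kappa> (\<gamma> (s + u * (t - s))))) v \<in> {P. ed P (y, c) < \<eta>}"
       by (intro path_concat_in[OF _ _ v] CollectI goodD[OF good_\<kappa>[OF \<gamma>g] \<kappa>E[OF \<gamma>E[OF w(1)]]] \<beta>n[OF ends(1) gs(1)])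
      thus "ed ((\<beta> (\<gamma> s) @@ (\<lambda>u. ?\<kappa> (\<gamma> (s + u * (t - s))))) v) (y, c) < \<eta>" by simp
     qed
     thus ?thesis unfolding Q_def F_def F'_def \<Theta>_concat[OF p1 p2] \<Theta>_concat[OF p3 p4] .
    qed
   qed
   thus "\<exists>d>0. \<forall>s t. s <= x & x <= t & t - s < d --> 0 <= s & t <= 1 --> Q s t" using \<delta>'(1) by blast
  qed simp
  moreover have "\<Theta> (\<beta> (b, c)) = 0" using \<beta>(3)[OF base_topspace[OF b] \<kappa>_base] \<Theta>_const[OF base_topspace[OF b]] by simp
  moreover have "\<gamma> 0 = (b, c)" "\<gamma> 1 = (b, c)" using \<gamma>(1) by (auto simp: joins_def)
  ultimately have "\<Theta> \<gamma> = \<Theta> (\<lambda>t. ?\<kappa> (\<gamma> t))" by (simp add: Q_def F_def F'_def)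
  also have "\<dots> = 0" using \<Theta>_hom[OF null] \<Theta>_const[OF base_topspace[OF b]] by simp
  finally have "\<Theta> \<gamma> = 0" .
  moreover obtain a where "\<Theta> \<gamma> = a + \<zeta> g - a" using \<Theta>_loop[OF \<gamma>(1)] unfolding \<gamma>(2) by blast
  ultimately have "a + \<zeta> g = a" by (metis eq_iff_diff_eq_0)
  thus "\<zeta> g = 0" using add_left_cancel[of a "\<zeta> g" 0] by simp
qed

end

end

section \<open>Recovering the space from the group\<close>

lemma (in Metric_space) null_loopsI:
 assumes "\<And>j. joins mtopology P P (ls j)" "\<And>j t. t \<in> {0..1} ==> d P (ls j t) < 2 / real (Suc j)"
 shows "ls \<in> null_loops P"
 unfolding null_loops_def
proof (intro CollectI conjI allI impI assms(1))
 fix \<epsilon> :: real assume \<epsilon>: "\<epsilon> > 0"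
 have "(\<lambda>j. 2 / real (Suc j)) \<longlonglongrightarrow> 0" by real_asymp
 from order_tendstoD(2)[OF this \<epsilon>] obtain J where J: "\<forall>j\<ge>J. 2 / real (Suc j) < \<epsilon>"
  unfolding eventually_sequentially ..
 have "d P (ls j t) < \<epsilon>" if "J <= j" "t \<in> {0..1}" for j t
  by (rule order_less_trans[OF assms(2)[OF that(2)] J[rule_format, OF that(1)]])
 thus "\<exists>J. \<forall>j\<ge>J. \<forall>t\<in>{0..1}. d P (ls j t) < \<epsilon>" by (intro exI[of _ J] allI impI ballI)
qed

section \<open>Null sequences at a point and where they concentrate\<close>

context based_earring
begin

definition sp :: "'a => real => 'a \<times> complex" where
 "sp x = (SOME \<alpha>. joins E (b, c) (x, c) \<alpha>)"

definition N :: "'a => (nat => (real => 'a \<times> complex) set) set" where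
 "N x = (\<lambda>ls j. loop_class E (b, c) (conj_loop (sp x) (ls j))) ` ES.null_loops (x, c)"

text \<open>The circle over the centre does not get small with the ball. Null sequences still leave
  it eventually, since it is a single circle and \<open>eventually_trivial\<close> applies to
  it.\<close>

abbreviation punctured :: "'a => real => 'a set" where
 "punctured y R \<equiv> {x. x ~= y & mdist X y x < R}"

lemma sp: assumes "x \<in> mspace X" shows "joins E (b, c) (x, c) (sp x)"
proof -
 obtain \<alpha> where "joins E (b, c) (x, c) \<alpha>" using path_from_base[OF base_in_EM[OF assms]] .
 thus ?thesis unfolding sp_def by (rule someI[of "joins E (b, c) (x, c)"])
qed

lemma tail_system_N:
 assumes "x \<in> mspace X" shows "tail_system G (N x)"
proof -
 obtain h where h: "h \<in> iso (pi1 E (x, c)) G"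
  "\<And>p. joins E (x, c) (x, c) p ==> h (loop_class E (x, c) p) = loop_class E (b, c) (conj_loop (sp x) p)"
  using iso_change_base[OF sp[OF assms]] by blast
 have "tail_system (pi1 E (x, c)) ((\<lambda>ls j. loop_class E (x, c) (ls j)) ` ES.null_loops (x, c))"
  using ES.tail_system_null_loops[OF base_in_EM[OF assms]] by (simp only: E_eq)
 from tail_system_image[OF this G.is_group]
 have "tail_system G ((\<lambda>g j. h (g j)) ` (\<lambda>ls j. loop_class E (x, c) (ls j)) ` ES.null_loops (x, c))"
  using h(1) by (simp add: iso_def)
 also have "(\<lambda>g j. h (g j)) ` (\<lambda>ls j. loop_class E (x, c) (ls j)) ` ES.null_loops (x, c) = N x"
  unfolding N_def image_image
 proof (rule image_cong)
  fix ls assume "ls \<in> ES.null_loops (x, c)"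
  hence "joins E (x, c) (x, c) (ls j)" for j by (simp add: ES.null_loops_def E_eq)
  thus "(\<lambda>j. h (loop_class E (x, c) (ls j))) = (\<lambda>j. loop_class E (b, c) (conj_loop (sp x) (ls j)))"
   using h(2) by blast
 qed simp
 finally show ?thesis .
qed

text \<open>The limit point of one nontrivial sequence serves for all: a sequence that stayed active
  at a distance from it, interleaved with this one, would contradict
  \<open>not_active_apart\<close>.\<close>

lemma tail_limit:
 assumes ts: "tail_system G \<G>" and g0: "g0 \<in> \<G>" "\<And>j. g0 j ~= \<one>\<^bsub>G\<^esub>"
 obtains y where "y \<in> mspace X"
  "\<And>g R. g \<in> \<G> ==> R > 0 ==> \<exists>J. \<forall>j\<ge>J. \<not> active (g j) (- punctured y R)"
  "\<And>g R m. g \<in> \<G> ==> (\<And>j. g j ~= \<one>\<^bsub>G\<^esub>) ==> R > 0 ==> \<exists>j\<ge>m. active (g j) {x \<in> mspace X. mdist X y x < R}"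
proof -
 interpret tail_system G \<G> by (rule ts)
 obtain y where y: "y \<in> mspace X" "\<And>R m. R > 0 ==> \<exists>j\<ge>m. active (g0 j) {x \<in> mspace X. mdist X y x < R}"
  using limit_point_exists[OF ts g0(1)] g0(2) by blast
 have far: "\<exists>J. \<forall>j\<ge>J. \<not> active (g j) {x. R <= mdist X y x}" if g: "g \<in> \<G>" and R: "R > 0" for g R
 proof (rule ccontr)
  assume "\<not> ?thesis"
  hence inf: "\<exists>j\<ge>m. active (g j) {x. R <= mdist X y x}" for m by blast
  define h where "h = (\<lambda>j. if even j then g (j div 2) else g0 (j div 2))"
  have h: "h \<in> \<G>" unfolding h_def by (rule ts_interleave[OF g g0(1)])
  show False
  proof (rule not_active_apart[OF ts h half_gt_zero[OF R]])
   fix x z assume "x \<in> {x. R <= mdist X y x}" "z \<in> {x \<in> mspace X. mdist X y x < R / 2}" "x \<in> mspace X" "z \<in> mspace X"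
   thus "R / 2 <= mdist X x z" using XM.triangle[OF y(1), of z x] XM.commute[of z x] by simp
  next
   fix m
   obtain j where "j >= m" "active (g j) {x. R <= mdist X y x}" using inf by blast
   thus "\<exists>j\<ge>m. active (h j) {x. R <= mdist X y x}" by (intro exI[of _ "2 * j"]) (simp add: h_def)
   obtain j where "j >= m" "active (g0 j) {x \<in> mspace X. mdist X y x < R / 2}" using y(2)[OF half_gt_zero[OF R]] by blast
   thus "\<exists>j\<ge>m. active (h j) {x \<in> mspace X. mdist X y x < R / 2}" by (intro exI[of _ "2 * j + 1"]) (simp add: h_def)
  qed
 qed
 show ?thesis
 proof (rule that[OF y(1)])
  fix g and R :: real assume g: "g \<in> \<G>" and R: "R > 0"
  note gc = ts_carrier[OF g]
  let ?F = "{x. R <= mdist X y x}"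
  obtain J1 where J1: "\<forall>j\<ge>J1. \<not> active (g j) ?F" using far[OF g R] by blast
  \<comment> \<open>The circle over \<open>y\<close> is one letter, on which the sequence is
    eventually trivial. As it is also inactive far from \<open>y\<close>, a nontrivial word off the
    punctured ball would have a core with letters both at \<open>y\<close> and far away, hence
    alternate.\<close>
  obtain J2 where J2: "\<forall>j\<ge>J2. \<tau> (D \<inter> {y}) (g j) = 0" using eventually_trivial[OF ts g, of "D \<inter> {y}"] by auto
  obtain J3 where J3: "\<forall>j\<ge>J3. \<tau> {} (g j) = 0" using eventually_trivial[OF ts g, of "{}"] by auto
  have "R <= mdist X x z" if "x \<in> {y}" "z \<in> ?F" for x z using that by simp
  then obtain J4 where J4: "\<forall>j S. J4 <= j --> finite S & S \<subseteq> D --> \<not> alternates (\<tau> S (g j)) ({y} \<inter> mspace X) (?F \<inter> mspace X)"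
   using no_alternation[OF ts g R, of "{y}" ?F] by blast
  show "\<exists>J. \<forall>j\<ge>J. \<not> active (g j) (- punctured y R)"
  proof (intro exI[of _ "max (max J1 J2) (max J3 J4)"] allI impI notI)
   fix j assume j: "max (max J1 J2) (max J3 J4) <= j" and act: "active (g j) (- punctured y R)"
   obtain S where S: "finite S" "S \<subseteq> D \<inter> (- punctured y R)" "\<tau> S (g j) ~= 0" using act unfolding active_def by blast
   have SD: "S \<subseteq> D" and S': "S \<subseteq> {y} \<union> ?F" using S(2) by auto
   have core: "core_supp (\<tau> S (g j)) \<subseteq> S" using core_supp_subset[OF S(3)] \<tau>_supp[OF S(1) SD gc] by blast
   have "fg_keep ?F (\<tau> S (g j)) = 0"
   proof (rule ccontr)
    assume "fg_keep ?F (\<tau> S (g j)) ~= 0"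
    hence "active (g j) ?F" unfolding active_def \<tau>_keep[OF S(1) SD gc] using S(1) SD by (intro exI[of _ "S \<inter> ?F"]) auto
    thus False using J1 j by simp
   qed
   hence 1: "\<not> core_supp (\<tau> S (g j)) \<subseteq> ?F" by (rule core_supp_not_subset[OF S(3)])
   have "S \<inter> {y} = {} \<or> S \<inter> {y} = D \<inter> {y}" using SD by blast
   hence "fg_keep {y} (\<tau> S (g j)) = 0"
    unfolding \<tau>_keep[OF S(1) SD gc]
   proof (elim disjE)
    assume e: "S \<inter> {y} = {}"
    show "\<tau> (S \<inter> {y}) (g j) = 0" unfolding e using J3 j by simp
   next
    assume e: "S \<inter> {y} = D \<inter> {y}"
    show "\<tau> (S \<inter> {y}) (g j) = 0" unfolding e using J2[rule_format, of j] j by simp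
   qed
   hence 2: "\<not> core_supp (\<tau> S (g j)) \<subseteq> {y}" by (rule core_supp_not_subset[OF S(3)])
   have "core_supp (\<tau> S (g j)) \<inter> ({y} \<inter> mspace X) ~= {}" using 1 core S' y(1) by blast
   moreover have "core_supp (\<tau> S (g j)) \<inter> (?F \<inter> mspace X) ~= {}" using 2 core S' SD D_sub by blast
   ultimately have "alternates (\<tau> S (g j)) ({y} \<inter> mspace X) (?F \<inter> mspace X)" using S(3) unfolding alternates_def by simp
   thus False using J4 j S(1) SD by simp
  qed
 next
  fix g and R :: real and m assume g: "g \<in> \<G>" "\<And>j. g j ~= \<one>\<^bsub>G\<^esub>" and R: "R > 0"
  obtain y' where y': "y' \<in> mspace X" "\<And>R m. R > 0 ==> \<exists>j\<ge>m. active (g j) {x \<in> mspace X. mdist X y' x < R}"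
   using limit_point_exists[OF ts g(1)] g(2) by blast
  have "y' = y"
  proof (rule ccontr)
   assume "y' ~= y"
   define r where "r = mdist X y y' / 2"
   have r: "r > 0" using \<open>y' ~= y\<close> y(1) y'(1) by (simp add: r_def)
   obtain J where J: "\<forall>j\<ge>J. \<not> active (g j) {x. r <= mdist X y x}" using far[OF g(1) r] by blast
   obtain j where j: "j >= J" "active (g j) {x \<in> mspace X. mdist X y' x < r}" using y'(2)[OF r] by blast
   have "r <= mdist X y x" if "x \<in> mspace X" "mdist X y' x < r" for x
    using XM.triangle[OF y(1) that(1) y'(1)] XM.commute[of x y'] that(2) by (simp add: r_def)
   hence "active (g j) {x. r <= mdist X y x}" by (intro active_mono[OF j(2)]) auto
   thus False using J j(1) by blast
  qed
  thus "\<exists>j\<ge>m. active (g j) {x \<in> mspace X. mdist X y x < R}" using y'(2)[OF R] by simp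
 qed
qed

text \<open>A connected space with two points has no isolated points, and \<open>D\<close> is
  dense.\<close>

lemma near_point:
 assumes x: "x \<in> mspace X" "x' \<in> mspace X" "x' ~= x" and \<delta>: "\<delta> > 0"
 obtains s where "s \<in> D" "s ~= x" "mdist X x s < \<delta>"
proof -
 have top: "mtopology_of X = XM.mtopology" by (simp add: mtopology_of_def)
 have op: "openin XM.mtopology (mspace X - {x})"
  unfolding XM.openin_mtopology
 proof (intro conjI allI impI)
  fix z assume "z \<in> mspace X - {x}"
  hence "mdist X z x > 0" "x \<notin> XM.mball z (mdist X z x)" using x(1) by auto
  thus "\<exists>r>0. XM.mball z r \<subseteq> mspace X - {x}" by (intro exI[of _ "mdist X z x"]) auto
 qed blast
 have conn: "connected_space XM.mtopology" using sc unfolding simply_connected_space_def top by (blast intro: path_connected_imp_connected_space)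
 have "\<not> XM.mball x \<delta> \<subseteq> {x}"
 proof
  assume s: "XM.mball x \<delta> \<subseteq> {x}"
  have "x \<in> XM.mball x \<delta>" using x(1) \<delta> by simp
  hence "openin XM.mtopology {x}" using s XM.openin_mball[of x \<delta>] by (metis subset_singletonD empty_iff)
  moreover have "topspace XM.mtopology \<subseteq> {x} \<union> (mspace X - {x})" "{x} \<inter> (mspace X - {x}) = {}" "{x} ~= {}" "mspace X - {x} ~= {}"
   using x by auto
  ultimately show False using conn op unfolding connected_space_def by blast
 qed
 then obtain z where z: "z \<in> XM.mball x \<delta>" "z ~= x" by blast
 have "z \<in> mtopology_of X closure_of D" using z(1) unfolding dense by simp
 moreover have "openin (mtopology_of X) (XM.mball x \<delta> \<inter> (mspace X - {x}))" unfolding top using op by (intro openin_Int) simp_all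
 ultimately obtain s where "s \<in> D" "s \<in> XM.mball x \<delta> \<inter> (mspace X - {x})"
  using z unfolding in_closure_of by (metis Diff_iff IntI XM.in_mball singletonD)
 thus ?thesis by (intro that) auto
qed

definition circle_loop :: "'a => real => 'a \<times> complex" where
 "circle_loop s t = (s, c * cis (2 * pi * t))"

lemma circle_loop: assumes "s \<in> D" shows "joins E (s, c) (s, c) (circle_loop s)"
 unfolding circle_loop_def[abs_def]
 using path_in_circle[OF assms, of "\<lambda>t. 2 * pi * t"] by (simp add: continuous_intros)

lemma word_circle_loop: assumes "finite S" "S \<subseteq> D" "s \<in> S" shows "word_along S q (circle_loop s) 0 1 = fg_of [(s, True)]"
proof (rule word_along_circle[OF circle_system_E[OF assms(2)] assms(1,3)])
 have "s \<in> D" using assms by blast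
 thus "cont_on {0..1} E (circle_loop s)" using circle_loop by (simp add: joins_def pathin_def)
qed (simp_all add: q_def circle_loop_def)

text \<open>Circles over points of \<open>D\<close> tending to \<open>x\<close> are small; connected
  to \<open>x\<close> by small paths, they form a null sequence. The points are chosen different
  from \<open>x\<close>, because the circle over \<open>x\<close> itself does not shrink.\<close>

lemma active_null_sequence:
 assumes x: "x \<in> mspace X" "x' \<in> mspace X" "x' ~= x"
 obtains g s where "g \<in> N x" "\<And>j. s j \<in> D" "\<And>j. mdist X x (s j) < 1 / real (Suc j)" "\<And>j. \<tau> {s j} (g j) ~= 0"
proof -
 have "\<exists>s m. s \<in> D & mdist X x s < 1 / real (Suc j) & joins E (x, c) (x, c) m &
  (\<forall>t\<in>{0..1}. ed (x, c) (m t) < 2 / real (Suc j)) & \<tau> {s} (loop_class E (b, c) (conj_loop (sp x) m)) ~= 0" for j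
 proof -
  define \<eta> where "\<eta> = 1 / real (Suc j)"
  have \<eta>: "\<eta> > 0" by (simp add: \<eta>_def)
  obtain \<delta>1 where \<delta>1: "\<delta>1 > 0" "\<delta>1 <= \<eta>" "\<forall>z\<in>EM. ed z (x, c) < \<delta>1 -->
   (\<exists>\<beta>. joins E (x, c) z \<beta> & (\<forall>t\<in>{0..1}. ed (\<beta> t) (x, c) < \<eta>))" using small_paths[OF x(1) \<eta>] by blast
  obtain \<delta>2 where \<delta>2: "\<delta>2 > 0" "\<delta>2 <= \<eta>" "\<forall>P\<in>EM. fst P ~= x & mdist X x (fst P) < \<delta>2 --> ed P (x, c) < \<eta>"
   using small_fibres[OF x(1) \<eta>] by blast
  have "min \<delta>1 \<delta>2 > 0" using \<delta>1(1) \<delta>2(1) by simp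
  then obtain s where s: "s \<in> D" "s ~= x" "mdist X x s < min \<delta>1 \<delta>2" using near_point[OF x] by blast
  have sX: "s \<in> mspace X" using s(1) D_sub by blast
  have "ed (s, c) (x, c) < \<delta>1" using ed_base[OF sX x(1)] s(3) XM.commute[of x] by simp
  then obtain \<beta> where \<beta>: "joins E (x, c) (s, c) \<beta>" "\<forall>t\<in>{0..1}. ed (\<beta> t) (x, c) < \<eta>"
   using \<delta>1(3) base_in_EM[OF sX] by blast
  note cl = circle_loop[OF s(1)]
  define m where "m = conj_loop \<beta> (circle_loop s)"
  have m: "joins E (x, c) (x, c) m" unfolding m_def by (rule joins_conj_loop[OF \<beta>(1) cl])
  have "m t \<in> {P. ed P (x, c) < \<eta>}" if "t \<in> {0..1}" for t
   unfolding m_def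
  proof (rule conj_loop_in[OF _ _ that])
   fix t :: real assume t: "t \<in> {0..1}"
   show "\<beta> t \<in> {P. ed P (x, c) < \<eta>}" using \<beta>(2) t by simp
   have "circle_loop s t \<in> EM" using joins_topspace[OF cl, of t] t unfolding topspace_E by simp
   moreover have "fst (circle_loop s t) = s" by (simp add: circle_loop_def)
   ultimately show "circle_loop s t \<in> {P. ed P (x, c) < \<eta>}" using \<delta>2(3) s(2,3) by simp
  qed
  moreover have "\<eta> < 2 / real (Suc j)" by (simp add: \<eta>_def divide_strict_right_mono)
  ultimately have near: "\<forall>t\<in>{0..1}. ed (x, c) (m t) < 2 / real (Suc j)"
   unfolding ES.commute[of "(x, c)"] by (blast intro: order_less_trans)
  have S: "finite {s}" "{s} \<subseteq> D" using s(1) by auto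
  interpret coc: cocycle E "circle_cover E {s} q" "cross_letter {s} q" by (rule coc_S[OF S])
  have conj_neq: "u + v - u ~= 0" if "v ~= 0" for u v :: "'a fg"
   using that by (metis add_0_right add_left_cancel diff_add_cancel add_0_left)
  have "word_along {s} q m 0 1 ~= 0"
   using coc.ctrans_conj_loop[OF \<beta>(1) cl] word_circle_loop[OF S, of s] conj_neq unfolding m_def word_along_def by simp
  hence "word_along {s} q (conj_loop (sp x) m) 0 1 ~= 0"
   using coc.ctrans_conj_loop[OF sp[OF x(1)] m] conj_neq unfolding word_along_def by simp
  hence "\<tau> {s} (loop_class E (b, c) (conj_loop (sp x) m)) ~= 0"
   using \<tau>_class[OF S joins_conj_loop[OF sp[OF x(1)] m]] by simp
  moreover have "mdist X x s < 1 / real (Suc j)" using s(3) \<delta>1(2) by (simp add: \<eta>_def)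
  ultimately show ?thesis using s(1) m near by blast
 qed
 then obtain s ls where s: "\<And>j. s j \<in> D" "\<And>j. mdist X x (s j) < 1 / real (Suc j)" "\<And>j. joins E (x, c) (x, c) (ls j)"
  "\<And>j. \<forall>t\<in>{0..1}. ed (x, c) (ls j t) < 2 / real (Suc j)" "\<And>j. \<tau> {s j} (loop_class E (b, c) (conj_loop (sp x) (ls j))) ~= 0"
  by metis
 have "ls \<in> ES.null_loops (x, c)" by (rule ES.null_loopsI) (use s(3,4) in \<open>auto simp: E_eq[symmetric]\<close>)
 hence "(\<lambda>j. loop_class E (b, c) (conj_loop (sp x) (ls j))) \<in> N x" unfolding N_def by (rule imageI)
 from this s(1,2,5) show ?thesis by (rule that)
qed

lemma commutative_if_singleton:
 assumes "\<And>x. x \<in> mspace X ==> x = b" and g: "g \<in> carrier G" "h \<in> carrier G"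
 shows "g \<otimes>\<^bsub>G\<^esub> h = h \<otimes>\<^bsub>G\<^esub> g"
proof -
 let ?k = "(g \<otimes>\<^bsub>G\<^esub> h) \<otimes>\<^bsub>G\<^esub> inv\<^bsub>G\<^esub> (h \<otimes>\<^bsub>G\<^esub> g)"
 have "?k = \<one>\<^bsub>G\<^esub>"
 proof (rule trivial_if_\<tau>_trivial)
  fix S assume S: "finite S" "S \<subseteq> D"
  hence "S \<subseteq> {b}" using assms(1) D_sub by blast
  hence "fg_supp (\<tau> S g) \<subseteq> {b}" "fg_supp (\<tau> S h) \<subseteq> {b}" using \<tau>_supp[OF S] g by blast+
  hence "\<tau> S g + \<tau> S h = \<tau> S h + \<tau> S g" by (rule fg_single_commute)
  thus "\<tau> S ?k = 0" using g by (simp add: \<tau>_mult[OF S] \<tau>_inv[OF S])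
 qed (use g in simp)
 thus ?thesis using g G.inv_equality[of "g \<otimes>\<^bsub>G\<^esub> h" "inv\<^bsub>G\<^esub> (h \<otimes>\<^bsub>G\<^esub> g)"] by simp
qed

lemma circle_element:
 assumes s: "s \<in> D"
 obtains g where "g \<in> carrier G" "\<And>S. finite S ==> S \<subseteq> D ==> s \<in> S ==> \<tau> S g = fg_of [(s, True)]"
proof -
 have "s \<in> mspace X" using s D_sub by blast
 then obtain p where p: "joins (mtopology_of X) b s p"
  using sc b unfolding simply_connected_space_def path_connected_space_def joins_def topspace_mtopology_of by meson
 have p1: "joins E (b, c) (s, c) (\<lambda>t. (p t, c))" by (rule joins_image[OF continuous_base p])
 note cl = circle_loop[OF s]
 note m = joins_conj_loop[OF p1 cl]
 show ?thesis
 proof (rule that[OF loop_class_carrier[OF m]])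
  fix S assume S: "finite S" "S \<subseteq> D" "s \<in> S"
  have "word_along S q (\<lambda>t. (p t, c)) 0 1 = 0"
   by (rule word_along_trivial[OF circle_system_E[OF S(2)] S(1) path_cont[OF p1]]) simp_all
  thus "\<tau> S (loop_class E (b, c) (conj_loop (\<lambda>t. (p t, c)) (circle_loop s))) = fg_of [(s, True)]"
   using \<tau>_class[OF S(1,2) m] cocycle.ctrans_conj_loop[OF coc_S[OF S(1,2)] p1 cl] word_circle_loop[OF S]
   by (simp add: word_along_def)
 qed
qed

lemma noncommutative:
 assumes "x \<in> mspace X" "x ~= b"
 obtains g h where "g \<in> carrier G" "h \<in> carrier G" "g \<otimes>\<^bsub>G\<^esub> h ~= h \<otimes>\<^bsub>G\<^esub> g"
proof -
 obtain s where s: "s \<in> D" "s ~= b" using near_point[OF b assms zero_less_one] by blast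
 have "mdist X b s > 0" using s D_sub b Metric_space.mdist_pos_less[OF Metric_space_mspace_mdist[of X], of b s] by blast
 then obtain s' where s': "s' \<in> D" "mdist X b s' < mdist X b s" using near_point[OF b assms] by blast
 obtain g where g: "g \<in> carrier G" "\<And>S. finite S ==> S \<subseteq> D ==> s \<in> S ==> \<tau> S g = fg_of [(s, True)]" using circle_element[OF s(1)] by metis
 obtain h where h: "h \<in> carrier G" "\<And>S. finite S ==> S \<subseteq> D ==> s' \<in> S ==> \<tau> S h = fg_of [(s', True)]" using circle_element[OF s'(1)] by metis
 have S: "finite {s, s'}" "{s, s'} \<subseteq> D" using s s' by auto
 have "s ~= s'" using s'(2) by auto
 hence "\<tau> {s, s'} (g \<otimes>\<^bsub>G\<^esub> h) ~= \<tau> {s, s'} (h \<otimes>\<^bsub>G\<^esub> g)"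
  using g(2)[OF S] h(2)[OF S] fg_of_single_noncommute \<tau>_mult[OF S] g(1) h(1) by simp
 thus ?thesis using that[OF g(1) h(1)] by metis
qed

text \<open>Detects one-point spaces, in which no null sequence of nontrivial classes exists and the
  limit construction has nothing to work with.\<close>

lemma comm_group_iff: "comm_group G \<longleftrightarrow> (\<forall>x\<in>mspace X. x = b)"
proof
 show "\<forall>x\<in>mspace X. x = b" if "comm_group G"
  using noncommutative comm_monoid.m_comm[OF comm_group.axioms(1)[OF that]] by metis
 show "comm_group G" if "\<forall>x\<in>mspace X. x = b"
  using commutative_if_singleton that by (intro G.group_comm_groupI) blast
qed

end

section \<open>The map of points induced by an isomorphism\<close>

locale earring_iso = E1: based_earring C c X1 D1 d1 b1 + E2: based_earring C c X2 D2 d2 b2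
 for C c and X1 :: "'b metric" and D1 d1 b1 and X2 :: "'c metric" and D2 d2 b2 +
 fixes \<phi> \<psi>
 assumes \<phi>: "\<phi> \<in> hom E1.G E2.G" and \<psi>: "\<psi> \<in> hom E2.G E1.G"
  and \<psi>\<phi>: "\<And>g. g \<in> carrier E1.G ==> \<psi> (\<phi> g) = g" and \<phi>\<psi>: "\<And>h. h \<in> carrier E2.G ==> \<phi> (\<psi> h) = h"
  and two_points: "\<And>x. \<exists>x'\<in>mspace X1. x' ~= x" "\<And>y. \<exists>y'\<in>mspace X2. y' ~= y"
begin

interpretation \<phi>: group_hom E1.G E2.G \<phi>
 using E1.G.is_group E2.G.is_group \<phi> by (simp add: group_hom_def group_hom_axioms_def)

text \<open>Records only where the images of null sequences at \<open>x\<close> are active, since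
  they are not known to be null sequences themselves. The second clause speaks of sequences without
  trivial terms, as trivial classes are active nowhere.\<close>

definition conv :: "'b => 'c => bool" where
 "conv x y \<longleftrightarrow> y \<in> mspace X2 &
  (\<forall>g\<in>E1.N x. \<forall>R>0. \<exists>J. \<forall>j\<ge>J. \<not> E2.active (\<phi> (g j)) (- E2.punctured y R)) &
  (\<forall>g\<in>E1.N x. (\<forall>j. g j ~= \<one>\<^bsub>E1.G\<^esub>) -->
   (\<forall>R>0. \<forall>m. \<exists>j\<ge>m. E2.active (\<phi> (g j)) {z \<in> mspace X2. mdist X2 y z < R}))"

lemma convD:
 assumes "conv x y"
 shows "y \<in> mspace X2"
  and "\<And>g R. g \<in> E1.N x ==> R > 0 ==> \<exists>J. \<forall>j\<ge>J. \<not> E2.active (\<phi> (g j)) (- E2.punctured y R)"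
  and "\<And>g R m. g \<in> E1.N x ==> \<forall>j. g j ~= \<one>\<^bsub>E1.G\<^esub> ==> R > 0 ==>
   \<exists>j\<ge>m. E2.active (\<phi> (g j)) {z \<in> mspace X2. mdist X2 y z < R}"
proof -
 note c = assms[unfolded conv_def]
 show "y \<in> mspace X2" by (rule conjunct1[OF c])
 show "\<exists>J. \<forall>j\<ge>J. \<not> E2.active (\<phi> (g j)) (- E2.punctured y R)" if "g \<in> E1.N x" "R > 0" for g R
  using bspec[OF conjunct1[OF conjunct2[OF c]] that(1), rule_format, OF that(2)] .
 show "\<exists>j\<ge>m. E2.active (\<phi> (g j)) {z \<in> mspace X2. mdist X2 y z < R}"
  if "g \<in> E1.N x" "\<forall>j. g j ~= \<one>\<^bsub>E1.G\<^esub>" "R > 0" for g R m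
  using mp[OF bspec[OF conjunct2[OF conjunct2[OF c]] that(1)] that(2), rule_format, OF that(3)] .
qed

lemma flip: "earring_iso C c X2 D2 d2 b2 X1 D1 d1 b1 \<psi> \<phi>"
proof (rule earring_iso.intro[OF E2.based_earring_axioms E1.based_earring_axioms])
 show "earring_iso_axioms C c X2 D2 d2 b2 X1 D1 d1 b1 \<psi> \<phi>"
  by (rule earring_iso_axioms.intro) (fact \<psi> \<phi> \<phi>\<psi> \<psi>\<phi> two_points)+
qed

lemma N_carrier: "x \<in> mspace X1 ==> g \<in> E1.N x ==> g j \<in> carrier E1.G"
 using tail_system.ts_carrier[OF E1.tail_system_N] .

lemma conv_exists: assumes x: "x \<in> mspace X1" shows "\<exists>y. conv x y"
proof -
 obtain x' where "x' \<in> mspace X1" "x' ~= x" using two_points(1) by blast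
 then obtain g0 s where g0: "g0 \<in> E1.N x" "\<And>j. s j \<in> D1" "\<And>j. E1.\<tau> {s j} (g0 j) ~= 0" using E1.active_null_sequence[OF x] by metis
 have g0': "g0 j ~= \<one>\<^bsub>E1.G\<^esub>" for j using g0(2,3)[of j] E1.\<tau>_one[of "{s j}"] by auto
 have inj: "\<phi> g ~= \<one>\<^bsub>E2.G\<^esub>" if "g \<in> carrier E1.G" "g ~= \<one>\<^bsub>E1.G\<^esub>" for g
  using that \<psi>\<phi>[OF that(1)] \<psi>\<phi>[OF E1.G.one_closed] \<phi>.hom_one by metis
 note ts = tail_system_image[OF E1.tail_system_N[OF x] E2.G.is_group \<phi>]
 obtain y where y: "y \<in> mspace X2"
  "\<And>g R. g \<in> (\<lambda>g j. \<phi> (g j)) ` E1.N x ==> R > 0 ==> \<exists>J. \<forall>j\<ge>J. \<not> E2.active (g j) (- E2.punctured y R)"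
  "\<And>g R m. g \<in> (\<lambda>g j. \<phi> (g j)) ` E1.N x ==> (\<And>j. g j ~= \<one>\<^bsub>E2.G\<^esub>) ==> R > 0 ==> \<exists>j\<ge>m. E2.active (g j) {x \<in> mspace X2. mdist X2 y x < R}"
  using E2.tail_limit[OF ts imageI[OF g0(1)]] inj[OF N_carrier[OF x g0(1)] g0'] by blast
 have "conv x y"
  unfolding conv_def
 proof (intro conjI ballI allI impI y(1))
  fix g and R :: real assume g: "g \<in> E1.N x" "R > 0"
  show "\<exists>J. \<forall>j\<ge>J. \<not> E2.active (\<phi> (g j)) (- E2.punctured y R)" using y(2)[OF imageI[OF g(1)] g(2)] .
 next
  fix g and R :: real and m assume g: "g \<in> E1.N x" "\<forall>j. g j ~= \<one>\<^bsub>E1.G\<^esub>" "R > 0"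
  show "\<exists>j\<ge>m. E2.active (\<phi> (g j)) {z \<in> mspace X2. mdist X2 y z < R}"
   using y(3)[OF imageI[OF g(1)] _ g(3)] inj[OF N_carrier[OF x g(1)]] g(2) by blast
 qed
 thus ?thesis ..
qed

lemma active_change_path:
 assumes "joins E1.E (b1, c) z \<alpha>" "joins E1.E (b1, c) z \<beta>" "joins E1.E z z m"
  and "E2.active (\<phi> (loop_class E1.E (b1, c) (conj_loop \<alpha> m))) A"
 shows "E2.active (\<phi> (loop_class E1.E (b1, c) (conj_loop \<beta> m))) A"
proof -
 define w where "w = loop_class E1.E (b1, c) (\<beta> @@ rev_path \<alpha>)"
 have w: "w \<in> carrier E1.G" unfolding w_def
  by (rule loop_class_carrier[OF joins_concat[OF assms(2) joins_rev[OF assms(1)]]])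
 have m: "loop_class E1.E (b1, c) (conj_loop \<alpha> m) \<in> carrier E1.G"
  by (rule loop_class_carrier[OF joins_conj_loop[OF assms(1,3)]])
 have "\<phi> (loop_class E1.E (b1, c) (conj_loop \<beta> m)) =
   \<phi> w \<otimes>\<^bsub>E2.G\<^esub> \<phi> (loop_class E1.E (b1, c) (conj_loop \<alpha> m)) \<otimes>\<^bsub>E2.G\<^esub> inv\<^bsub>E2.G\<^esub> \<phi> w"
  unfolding conj_loop_class_conj[OF assms(2,1,3), folded w_def] using w m by simp
 thus ?thesis using E2.active_conj[OF _ _ assms(4)] w m by simp
qed

lemma conj_class: 
 assumes "x \<in> mspace X1" "joins E1.E (x, c) z \<beta>" "joins E1.E z z m"
 shows "loop_class E1.E (b1, c) (conj_loop (E1.sp x) (conj_loop \<beta> m)) =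
  loop_class E1.E (b1, c) (conj_loop (E1.sp x @@ \<beta>) m)"
 by (rule loop_class_eqI[OF path_hom_sym[OF conj_loop_concat[OF E1.sp[OF assms(1)] assms(2,3)]]])

text \<open>The loops are chosen one by one, ever closer to \<open>x\<close>, and together form a null sequence.\<close>

lemma eventually_inactive:
 assumes x: "x \<in> mspace X1" and far: "\<forall>g\<in>E1.N x. \<exists>J. \<forall>j\<ge>J. \<not> E2.active (\<phi> (g j)) A"
 shows "\<exists>\<eta>>0. \<forall>z \<alpha> m. joins E1.E (b1, c) z \<alpha> & joins E1.E z z m & (\<forall>t\<in>{0..1}. E1.ed (m t) (x, c) < \<eta>) -->
  \<not> E2.active (\<phi> (loop_class E1.E (b1, c) (conj_loop \<alpha> m))) A"
proof (rule ccontr)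
 assume n: "\<not> ?thesis"
 have "\<exists>\<mu>. joins E1.E (x, c) (x, c) \<mu> & (\<forall>t\<in>{0..1}. E1.ed (x, c) (\<mu> t) < 2 / real (Suc j)) &
   E2.active (\<phi> (loop_class E1.E (b1, c) (conj_loop (E1.sp x) \<mu>))) A" for j
 proof -
  define \<eta> where "\<eta> = 1 / real (Suc j)"
  have \<eta>: "\<eta> > 0" by (simp add: \<eta>_def)
  obtain \<delta> where \<delta>: "\<delta> > 0" "\<delta> <= \<eta>" "\<forall>z\<in>E1.EM. E1.ed z (x, c) < \<delta> -->
   (\<exists>\<beta>. joins E1.E (x, c) z \<beta> & (\<forall>t\<in>{0..1}. E1.ed (\<beta> t) (x, c) < \<eta>))" using E1.small_paths[OF x \<eta>] by blast
  obtain z \<alpha> m where m: "joins E1.E (b1, c) z \<alpha>" "joins E1.E z z m" "\<forall>t\<in>{0..1}. E1.ed (m t) (x, c) < \<delta>"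
   "E2.active (\<phi> (loop_class E1.E (b1, c) (conj_loop \<alpha> m))) A" using n \<delta>(1) by blast
  have zM: "z \<in> E1.EM" using joins_in[OF m(2)] unfolding E1.topspace_E by blast
  have "m 0 = z" using m(2) by (simp add: joins_def)
  hence "E1.ed z (x, c) < \<delta>" using bspec[OF m(3), of 0] by simp
  then obtain \<beta> where \<beta>: "joins E1.E (x, c) z \<beta>" "\<forall>t\<in>{0..1}. E1.ed (\<beta> t) (x, c) < \<eta>" using \<delta>(3) zM by blast
  have "conj_loop \<beta> m t \<in> {P. E1.ed P (x, c) < \<eta>}" if "t \<in> {0..1}" for t
   by (rule conj_loop_in[OF _ _ that]) (use \<beta>(2) m(3) \<delta>(2) in force)+
  moreover have "\<eta> < 2 / real (Suc j)" by (simp add: \<eta>_def divide_strict_right_mono)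
  ultimately have near: "\<forall>t\<in>{0..1}. E1.ed (x, c) (conj_loop \<beta> m t) < 2 / real (Suc j)"
   unfolding E1.ES.commute[of "(x, c)"] by (blast intro: order_less_trans)
  have "E2.active (\<phi> (loop_class E1.E (b1, c) (conj_loop (E1.sp x) (conj_loop \<beta> m)))) A"
   unfolding conj_class[OF x \<beta>(1) m(2)]
   by (rule active_change_path[OF m(1) joins_concat[OF E1.sp[OF x] \<beta>(1)] m(2,4)])
  thus ?thesis using near joins_conj_loop[OF \<beta>(1) m(2)] by blast
 qed
 then obtain ls where ls: "\<And>j. joins E1.E (x, c) (x, c) (ls j)" "\<And>j. \<forall>t\<in>{0..1}. E1.ed (x, c) (ls j t) < 2 / real (Suc j)"
  "\<And>j. E2.active (\<phi> (loop_class E1.E (b1, c) (conj_loop (E1.sp x) (ls j)))) A" by metis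
 have "ls \<in> E1.ES.null_loops (x, c)" by (rule E1.ES.null_loopsI) (use ls(1,2) in \<open>auto simp: E1.E_eq[symmetric]\<close>)
 hence "(\<lambda>j. loop_class E1.E (b1, c) (conj_loop (E1.sp x) (ls j))) \<in> E1.N x" unfolding E1.N_def by (rule imageI)
 from bspec[OF far this] ls(3) show False by blast
qed

text \<open>Late members of a null sequence at a point near \<open>x\<close> are loops close to
  \<open>x\<close>, so their images are inactive off the punctured ball of radius R/2 at
  \<open>y\<close>. Some of them are active within R/2 of the limit y', so the two balls cannot be
  disjoint.\<close>

lemma conv_continuous:
 assumes x: "x \<in> mspace X1" and xy: "conv x y" and R: "R > 0"
 shows "\<exists>\<delta>>0. \<forall>x' y'. x' \<in> mspace X1 & mdist X1 x x' < \<delta> & conv x' y' --> mdist X2 y y' < R"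
proof -
 have R2: "R / 2 > 0" using R by simp
 have y: "y \<in> mspace X2" by (rule convD(1)[OF xy])
 have far: "\<forall>g\<in>E1.N x. \<exists>J. \<forall>j\<ge>J. \<not> E2.active (\<phi> (g j)) (- E2.punctured y (R / 2))"
  by (intro ballI convD(2)[OF xy _ R2])
 obtain \<eta> where \<eta>: "\<eta> > 0" and \<eta>': "\<forall>z \<alpha> m. joins E1.E (b1, c) z \<alpha> & joins E1.E z z m &
   (\<forall>t\<in>{0..1}. E1.ed (m t) (x, c) < \<eta>) -->
   \<not> E2.active (\<phi> (loop_class E1.E (b1, c) (conj_loop \<alpha> m))) (- E2.punctured y (R / 2))"
  using eventually_inactive[OF x far] by (elim exE conjE)
 have "mdist X2 y y' < R" if x': "x' \<in> mspace X1" "mdist X1 x x' < \<eta> / 2" and c': "conv x' y'" for x' y'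
 proof (rule ccontr)
  assume far: "\<not> mdist X2 y y' < R"
  have y': "y' \<in> mspace X2" by (rule convD(1)[OF c'])
  obtain x'' where "x'' \<in> mspace X1" "x'' ~= x'" using two_points(1) by blast
  then obtain g s where g: "g \<in> E1.N x'" "\<And>j. s j \<in> D1" "\<And>j. E1.\<tau> {s j} (g j) ~= 0" using E1.active_null_sequence[OF x'(1)] by metis
  have "g j ~= \<one>\<^bsub>E1.G\<^esub>" for j using g(2,3)[of j] E1.\<tau>_one[of "{s j}"] by auto
  hence g': "\<forall>j. g j ~= \<one>\<^bsub>E1.G\<^esub>" ..
  obtain ls where ls: "ls \<in> E1.ES.null_loops (x', c)" "g = (\<lambda>j. loop_class E1.E (b1, c) (conj_loop (E1.sp x') (ls j)))"
   using g(1) unfolding E1.N_def by (rule imageE)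
  obtain J where J: "\<forall>j\<ge>J. \<forall>t\<in>{0..1}. E1.ed (x', c) (ls j t) < \<eta> / 2"
   using ls(1) half_gt_zero[OF \<eta>] unfolding E1.ES.null_loops_def by blast
  obtain j where j: "j >= J" "E2.active (\<phi> (g j)) {z \<in> mspace X2. mdist X2 y' z < R / 2}"
   using convD(3)[OF c' g(1) g' R2] by blast
  have loop: "joins E1.E (x', c) (x', c) (ls j)" using ls(1) by (simp add: E1.ES.null_loops_def E1.E_eq)
  have "E2.active (\<phi> (g j)) (- E2.punctured y (R / 2))"
  proof (rule E2.active_mono[OF j(2)])
   show "{z \<in> mspace X2. mdist X2 y' z < R / 2} \<inter> D2 \<subseteq> - E2.punctured y (R / 2)"
   proof
    fix z assume "z \<in> {z \<in> mspace X2. mdist X2 y' z < R / 2} \<inter> D2"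
    thus "z \<in> - E2.punctured y (R / 2)" using E2.XM.triangle[OF y _ y', of z] E2.XM.commute[of z y'] far by auto
   qed
  qed
  moreover have "\<not> E2.active (\<phi> (loop_class E1.E (b1, c) (conj_loop (E1.sp x') (ls j)))) (- E2.punctured y (R / 2))"
  proof (rule mp[OF spec[OF spec[OF spec[OF \<eta>', of "(x', c)"], of "E1.sp x'"], of "ls j"]], intro conjI ballI E1.sp[OF x'(1)] loop)
   fix t :: real assume t: "t \<in> {0..1}"
   have lM: "ls j t \<in> E1.EM" using joins_topspace[OF loop, of t] t unfolding E1.topspace_E by simp
   have "E1.ed (ls j t) (x, c) <= E1.ed (ls j t) (x', c) + E1.ed (x', c) (x, c)"
    by (rule E1.ES.triangle[OF lM E1.base_in_EM[OF x'(1)] E1.base_in_EM[OF x]])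
   moreover have "E1.ed (ls j t) (x', c) < \<eta> / 2" using J j(1) t E1.ES.commute[of "(x', c)"] by simp
   moreover have "E1.ed (x', c) (x, c) < \<eta> / 2" using E1.ed_base[OF x'(1) x] x'(2) E1.XM.commute[of x] by simp
   ultimately show "E1.ed (ls j t) (x, c) < \<eta>" by linarith
  qed
  ultimately show False using ls(2) by simp
 qed
 thus ?thesis using half_gt_zero[OF \<eta>] by blast
qed

text \<open>If null sequences at \<open>y\<close> are sent back to a point away from
  \<open>x\<close>, then \<open>\<psi>\<close> makes small loops at \<open>y\<close> inactive near
  \<open>x\<close>. The character reading one letter near \<open>x\<close> kills these loops and
  thus, by \<open>character_trivial\<close>, the images of a null sequence at \<open>x\<close>,
  although each term of that sequence has such a letter.\<close>

lemma conv_inverse: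
 assumes x: "x \<in> mspace X1" and xy: "conv x y" and x': "x' \<in> mspace X1"
  and yx: "\<And>g R. g \<in> E2.N y ==> R > 0 ==> \<exists>J. \<forall>j\<ge>J. \<not> E1.active (\<psi> (g j)) (- E1.punctured x' R)"
 shows "x' = x"
proof (rule ccontr)
 assume ne: "x' ~= x"
 interpret flip: earring_iso C c X2 D2 d2 b2 X1 D1 d1 b1 \<psi> \<phi>
  by (rule flip)
 have y: "y \<in> mspace X2" by (rule convD(1)[OF xy])
 define r where "r = mdist X1 x x' / 2"
 have r: "r > 0" using ne x x' by (simp add: r_def)
 let ?A = "{z \<in> mspace X1. mdist X1 x z < r}"
 have A: "?A \<inter> D1 \<subseteq> - E1.punctured x' r"
 proof
  fix z assume "z \<in> ?A \<inter> D1"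
  thus "z \<in> - E1.punctured x' r" using E1.XM.triangle[OF x _ x', of z] E1.XM.commute[of z x'] by (auto simp: r_def)
 qed
 have "\<forall>g\<in>E2.N y. \<exists>J. \<forall>j\<ge>J. \<not> E1.active (\<psi> (g j)) ?A"
  using yx[OF _ r] E1.active_mono[OF _ A] by blast
 from flip.eventually_inactive[OF y this]
 obtain \<eta> where \<eta>: "\<eta> > 0" "\<forall>z \<alpha> m. joins E2.E (b2, c) z \<alpha> & joins E2.E z z m &
   (\<forall>t\<in>{0..1}. E2.ed (m t) (y, c) < \<eta>) --> \<not> E1.active (\<psi> (loop_class E2.E (b2, c) (conj_loop \<alpha> m))) ?A"
  by (elim exE conjE)
 obtain \<delta> where \<delta>: "\<delta> > 0" "\<delta> <= \<eta>" "\<forall>P\<in>E2.EM. fst P ~= y & mdist X2 y (fst P) < \<delta> --> E2.ed P (y, c) < \<eta>"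
  using E2.small_fibres[OF y \<eta>(1)] by blast
 obtain g s where g: "g \<in> E1.N x" "\<And>j. s j \<in> D1" "\<And>j. mdist X1 x (s j) < 1 / real (Suc j)" "\<And>j. E1.\<tau> {s j} (g j) ~= 0"
  using E1.active_null_sequence[OF x x' ne] by blast
 note gc = N_carrier[OF x g(1)]
 obtain J where J: "\<forall>j\<ge>J. \<not> E2.active (\<phi> (g j)) (- E2.punctured y (\<delta> / 2))"
  using convD(2)[OF xy g(1) half_gt_zero[OF \<delta>(1)]] ..
 obtain n where n: "1 / real (Suc n) < r" using r nat_approx_posE by blast
 define j where "j = max J n"
 have "1 / real (Suc j) <= 1 / real (Suc n)" by (simp add: j_def frac_le)
 hence sA: "s j \<in> ?A" using g(2,3)[of j] n E1.D_sub by auto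
 have S: "finite {s j}" "{s j} \<subseteq> D1" using g(2) by auto
 \<comment> \<open>The letter is that of the circle over \<open>s j\<close>, on which
   \<open>g j\<close> is nontrivial; \<open>j\<close> is so large that this circle lies near
   \<open>x\<close>.\<close>
 define \<zeta> where "\<zeta> h = E1.\<tau> {s j} (\<psi> h)" for h
 have \<psi>c: "\<psi> h \<in> carrier E1.G" if "h \<in> carrier E2.G" for h using \<psi> that by (auto simp: hom_def)
 have \<zeta>_mult: "\<zeta> (h \<otimes>\<^bsub>E2.G\<^esub> h') = \<zeta> h + \<zeta> h'" if "h \<in> carrier E2.G" "h' \<in> carrier E2.G" for h h'
  unfolding \<zeta>_def using hom_mult[OF \<psi> that] E1.\<tau>_mult[OF S \<psi>c[OF that(1)] \<psi>c[OF that(2)]] by simp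
 have "\<zeta> (\<phi> (g j)) = 0"
 proof (rule E2.character_trivial[OF \<zeta>_mult y \<delta>])
  fix z \<alpha> m assume m: "joins E2.E (b2, c) z \<alpha>" "joins E2.E z z m" "\<And>t. t \<in> {0..1} ==> E2.ed (m t) (y, c) < \<eta>"
  have "\<not> E1.active (\<psi> (loop_class E2.E (b2, c) (conj_loop \<alpha> m))) ?A"
   by (rule mp[OF spec[OF spec[OF spec[OF \<eta>(2), of z], of \<alpha>], of m]]) (intro conjI ballI m)
  moreover have "{s j} \<subseteq> D1 \<inter> ?A" using S(2) sA by blast
  ultimately show "\<zeta> (loop_class E2.E (b2, c) (conj_loop \<alpha> m)) = 0"
   unfolding \<zeta>_def E1.active_def not_ex using spec[of _ "{s j}"] S(1) by blast
 next
  show "\<phi> (g j) \<in> carrier E2.G" using gc by simp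
  show "\<not> E2.active (\<phi> (g j)) (- E2.punctured y (\<delta> / 2))" using J by (simp add: j_def)
 qed
 thus False using g(4)[of j] \<psi>\<phi>[OF gc[of j]] by (simp add: \<zeta>_def)
qed

lemma limit_map:
 obtains f where "continuous_map (mtopology_of X1) (mtopology_of X2) f" "\<And>x. x \<in> mspace X1 ==> conv x (f x)"
proof -
 define f where "f x = (SOME y. conv x y)" for x
 have f: "conv x (f x)" if "x \<in> mspace X1" for x unfolding f_def using conv_exists[OF that] by (rule someI_ex)
 have "continuous_map E1.XM.mtopology E2.XM.mtopology f"
  unfolding E1.XM.metric_continuous_map[OF Metric_space_mspace_mdist]
 proof (intro conjI ballI allI impI)
  show "f ` mspace X1 \<subseteq> mspace X2" using convD(1)[OF f] by blast
  fix a \<epsilon> assume a: "a \<in> mspace X1" and \<epsilon>: "(\<epsilon>::real) > 0"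
  show "\<exists>\<delta>>0. \<forall>x. x \<in> mspace X1 & mdist X1 a x < \<delta> --> mdist X2 (f a) (f x) < \<epsilon>"
   using conv_continuous[OF a f[OF a] \<epsilon>] f by blast
 qed
 hence "continuous_map (mtopology_of X1) (mtopology_of X2) f" by (simp add: mtopology_of_def)
 thus ?thesis using f by (rule that)
qed

theorem homeomorphic: "mtopology_of X1 homeomorphic_space mtopology_of X2"
proof -
 interpret flip: earring_iso C c X2 D2 d2 b2 X1 D1 d1 b1 \<psi> \<phi>
  by (rule flip)
 obtain f where f: "continuous_map (mtopology_of X1) (mtopology_of X2) f" "\<And>x. x \<in> mspace X1 ==> conv x (f x)"
  using limit_map by blast
 obtain f' where f': "continuous_map (mtopology_of X2) (mtopology_of X1) f'" "\<And>y. y \<in> mspace X2 ==> flip.conv y (f' y)"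
  using flip.limit_map by blast
 have fX: "f x \<in> mspace X2" if "x \<in> mspace X1" for x by (rule convD(1)[OF f(2)[OF that]])
 have f'X: "f' y \<in> mspace X1" if "y \<in> mspace X2" for y by (rule flip.convD(1)[OF f'(2)[OF that]])
 have 1: "f' (f x) = x" if x: "x \<in> mspace X1" for x
 proof (rule conv_inverse[OF x f(2)[OF x] f'X[OF fX[OF x]]])
  show "\<exists>J. \<forall>j\<ge>J. \<not> E1.active (\<psi> (g j)) (- E1.punctured (f' (f x)) R)" if "g \<in> E2.N (f x)" "R > 0" for g R
   by (rule flip.convD(2)[OF f'(2)[OF fX[OF x]] that])
 qed
 have 2: "f (f' y) = y" if y: "y \<in> mspace X2" for y
 proof (rule flip.conv_inverse[OF y f'(2)[OF y] fX[OF f'X[OF y]]])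
  show "\<exists>J. \<forall>j\<ge>J. \<not> E2.active (\<phi> (g j)) (- E2.punctured (f (f' y)) R)" if "g \<in> E1.N (f' y)" "R > 0" for g R
   by (rule convD(2)[OF f(2)[OF f'X[OF y]] that])
 qed
 have "homeomorphic_maps (mtopology_of X1) (mtopology_of X2) f f'"
  unfolding homeomorphic_maps_def topspace_mtopology_of using f(1) f'(1) 1 2 by blast
 thus ?thesis unfolding homeomorphic_space_def by blast
qed

end

section \<open>One-point spaces and arbitrary base points\<close>

lemma based_earring_data:
 assumes "circle_metric C" "c \<in> sphere 0 1" "earring_data X D d" "b \<in> mspace X"
 shows "based_earring C c X D d b"
proof -
 have d: "simply_connected_space (mtopology_of X)" "locally_simply_connected_space (mtopology_of X)"
  "locally_path_connected_space (mtopology_of X)" "D \<subseteq> mspace X" "mtopology_of X closure_of D = mspace X" "enumerates d D"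
  using assms(3) unfolding earring_data_def by - (elim conjE, assumption)+
 show ?thesis
  by (intro based_earring.intro earring.intro based_earring_axioms.intro assms d)
qed

theorem homeomorphic_if_iso:
 assumes "based_earring C c X1 D1 d1 b1" "based_earring C c X2 D2 d2 b2"
  and iso: "pi1 (earring_space C c X1 D1 d1) (b1, c) \<cong> pi1 (earring_space C c X2 D2 d2) (b2, c)"
 shows "mtopology_of X1 homeomorphic_space mtopology_of X2"
proof -
 interpret E1: based_earring C c X1 D1 d1 b1 by fact
 interpret E2: based_earring C c X2 D2 d2 b2 by fact
 obtain \<phi> where \<phi>: "\<phi> \<in> iso E1.G E2.G" using iso unfolding is_iso_def by blast
 define \<psi> where "\<psi> = inv_into (carrier E1.G) \<phi>"
 have \<psi>: "\<psi> \<in> iso E2.G E1.G" unfolding \<psi>_def by (rule E1.G.iso_set_sym[OF \<phi>])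
 have bij: "bij_betw \<phi> (carrier E1.G) (carrier E2.G)" using \<phi> by (simp add: iso_def)
 have \<psi>\<phi>: "\<psi> (\<phi> g) = g" if "g \<in> carrier E1.G" for g unfolding \<psi>_def using bij that by (rule bij_betw_inv_into_left)
 have \<phi>\<psi>: "\<phi> (\<psi> h) = h" if "h \<in> carrier E2.G" for h unfolding \<psi>_def using bij that by (rule bij_betw_inv_into_right)
 have h: "\<phi> \<in> hom E1.G E2.G" "\<psi> \<in> hom E2.G E1.G" using \<phi> \<psi> by (auto simp: iso_def)
 show ?thesis
 proof (cases "(\<forall>x\<in>mspace X1. x = b1) \<or> (\<forall>y\<in>mspace X2. y = b2)")
  case True
  \<comment> \<open>Commutativity is preserved by isomorphisms, so if one of the spaces is a point,
    both are.\<close>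
  have c12: "(\<forall>x\<in>mspace X1. x = b1) \<longleftrightarrow> (\<forall>y\<in>mspace X2. y = b2)"
   using comm_group.iso_imp_comm_group[OF _ iso E2.G.is_monoid]
    comm_group.iso_imp_comm_group[OF _ E1.G.iso_sym[OF iso] E1.G.is_monoid]
   unfolding E1.comm_group_iff E2.comm_group_iff by blast
  have "homeomorphic_maps (mtopology_of X1) (mtopology_of X2) (\<lambda>_. b2) (\<lambda>_. b1)"
   unfolding homeomorphic_maps_def
  proof (intro conjI ballI)
   have s: "\<forall>x\<in>mspace X1. x = b1" "\<forall>y\<in>mspace X2. y = b2" using True unfolding c12 by (iprover, iprover)
   show "b1 = x" if "x \<in> topspace (mtopology_of X1)" for x
    using that unfolding topspace_mtopology_of by (rule bspec[OF s(1), THEN sym])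
   show "b2 = y" if "y \<in> topspace (mtopology_of X2)" for y
    using that unfolding topspace_mtopology_of by (rule bspec[OF s(2), THEN sym])
  qed (simp_all add: E1.b E2.b)
  thus ?thesis unfolding homeomorphic_space_def by blast
 next
  case False
  hence n: "\<exists>x\<in>mspace X1. x ~= b1" "\<exists>y\<in>mspace X2. y ~= b2" by blast+
  have "earring_iso_axioms C c X1 D1 d1 b1 X2 D2 d2 b2 \<phi> \<psi>"
  proof (rule earring_iso_axioms.intro)
   show "\<exists>x'\<in>mspace X1. x' ~= x" for x using n(1) E1.b by metis
   show "\<exists>y'\<in>mspace X2. y' ~= y" for y using n(2) E2.b by metis
  qed (fact h \<psi>\<phi> \<phi>\<psi>)+
  from earring_iso.intro[OF assms(1,2) this] show ?thesis by (rule earring_iso.homeomorphic)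
 qed
qed

theorem corollary3p6:
  fixes C :: "complex metric" and c :: complex
    and X :: "'a metric" and D :: "'a set" and d :: "nat \<Rightarrow> 'a" and e :: "'a \<times> complex"
    and X1 :: "'b metric" and D1 :: "'b set" and d1 :: "nat \<Rightarrow> 'b" and e1 :: "'b \<times> complex"
    and X2 :: "'c metric" and D2 :: "'c set" and d2 :: "nat \<Rightarrow> 'c" and e2 :: "'c \<times> complex"
  assumes "circle_metric C" and "c \<in> sphere 0 1"
  shows
    "(earring_data X D d \<and> e \<in> topspace (earring_space C c X D d) \<longrightarrow>
       (\<exists>K. subgroup K (fundamental_group (top_of_set hawaiian_earring) (0, 0)) \<and>
            fundamental_group (earring_space C c X D d) e \<cong>
              (fundamental_group (top_of_set hawaiian_earring) (0, 0))\<lparr>carrier := K\<rparr>)) \<and>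
     (earring_data X1 D1 d1 \<and> e1 \<in> topspace (earring_space C c X1 D1 d1) \<and>
      earring_data X2 D2 d2 \<and> e2 \<in> topspace (earring_space C c X2 D2 d2) \<and>
      \<not> mtopology_of X1 homeomorphic_space mtopology_of X2 \<longrightarrow>
       \<not> fundamental_group (earring_space C c X1 D1 d1) e1 \<cong>
           fundamental_group (earring_space C c X2 D2 d2) e2)"
proof (intro conjI impI notI)
 assume a: "earring_data X D d & e \<in> topspace (earring_space C c X D d)"
 interpret earring C c X D d using a assms by unfold_locales (auto simp: earring_data_def)
 have "e \<in> EM" using a unfolding topspace_E by blast
 thus "\<exists>K. subgroup K (pi1 (top_of_set hawaiian_earring) (0, 0)) &
   pi1 E e \<cong> (pi1 (top_of_set hawaiian_earring) (0, 0))\<lparr>carrier := K\<rparr>"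
  using a embeds_in_hawaiian by (simp add: earring_data_def)
next
 assume a: "earring_data X1 D1 d1 & e1 \<in> topspace (earring_space C c X1 D1 d1) &
   earring_data X2 D2 d2 & e2 \<in> topspace (earring_space C c X2 D2 d2) &
   \<not> mtopology_of X1 homeomorphic_space mtopology_of X2"
  and iso: "pi1 (earring_space C c X1 D1 d1) e1 \<cong> pi1 (earring_space C c X2 D2 d2) e2"
 interpret E1: earring C c X1 D1 d1 using a assms by unfold_locales (auto simp: earring_data_def)
 interpret E2: earring C c X2 D2 d2 using a assms by unfold_locales (auto simp: earring_data_def)
 have e: "e1 \<in> E1.EM" "e2 \<in> E2.EM" using a unfolding E1.topspace_E E2.topspace_E by blast+
 \<comment> \<open>A base point off X is moved along its circle into X, which changes the group only
   by an isomorphism.\<close>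
 obtain \<alpha>1 where \<alpha>1: "joins E1.E (fst e1, c) e1 \<alpha>1" using E1.path_to_base[OF e(1)] by blast
 obtain \<alpha>2 where \<alpha>2: "joins E2.E (fst e2, c) e2 \<alpha>2" using E2.path_to_base[OF e(2)] by blast
 have b: "fst e1 \<in> mspace X1" "fst e2 \<in> mspace X2" using E1.EM_fst[OF e(1)] E2.EM_fst[OF e(2)] .
 obtain h1 where h1: "h1 \<in> iso (pi1 E1.E e1) (pi1 E1.E (fst e1, c))"
  using iso_change_base[OF \<alpha>1] by metis
 obtain h2 where h2: "h2 \<in> iso (pi1 E2.E e2) (pi1 E2.E (fst e2, c))"
  using iso_change_base[OF \<alpha>2] by metis
 have "group (pi1 E1.E e1)" using a by (intro group_pi1) (elim conjE)
 from group.iso_sym[OF this is_isoI[OF h1]]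
 have iso': "pi1 E1.E (fst e1, c) \<cong> pi1 E2.E (fst e2, c)"
  using iso is_isoI[OF h2] by (blast intro: iso_trans)
 have be: "based_earring C c X1 D1 d1 (fst e1)" "based_earring C c X2 D2 d2 (fst e2)"
  using a by (auto intro!: based_earring_data assms b)
 have "mtopology_of X1 homeomorphic_space mtopology_of X2" by (rule homeomorphic_if_iso[OF be iso'])
 thus False using a by blast
qed

end
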